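(* Assume $1<p<N$, $p+m-3>0$, and that $g\in C([0,+\infty))\cap C^1((0,+\infty))$, $g(0)=0$, $g(s)>0$ for $s>0$, satisfies, for given $0<\alpha_1\le\alpha_2<p$, $$\alpha_1\frac{g(s)}{s}\le g'(s)\le\alpha_2\frac{g(s)}{s},\qquad s>0.$$ Let $\hat r$ and $\rho$ be the specific functions associated with $g$, $N$, $p$ as in the context, and let $v\ge0$ be a strong solution to $$\rho(|x|)\,\frac{\partial v}{\partial t}=\operatorname{div}\big(v^{m-1}|\nabla v|^{p-2}\nabla v\big),\qquad x\in\mathbb R^N,\ t>0,$$ such that $v(x,0)$ is compactly supported, bounded and $v(x,0)\ge\varepsilon>0$ for $|x|\le\ell$, $\ell>0$. Then there exist constants $t_0>1$ and $C_*,r_0,\varGamma>0$ such that $\widetilde u(\hat r(|x|),t)$, with $\widetilde u(r,t)$ the radial function defined in the context, is a subsolution to this equation, and $$v(x,t)\ge\widetilde u(\hat r(|x|),t),\qquad (x,t)\in S_\infty=\mathbb R^N\times(0,+\infty).$$ Moreover $$\operatorname{supp}v(t)\supset B_{\tilde R(t)}(0),\qquad t>t_0,$$ for a positive function $\tilde R$ with $\log\tilde R(t)\sim\log t$. The constants involved depend on the parameters appearing in the assumptions (i.e. on $N,p,m,\alpha_1,\alpha_2$ and $g$) and on $v(x,0)$.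
   Context: The notation $F_1(t)\sim F_2(t)$ means that there exist constants $C_1,C_2,\bar t>0$ such that $C_1\le F_2(t)/F_1(t)\le C_2$ for all $t\ge\bar t$ (with $F_1,F_2$ positive there). The functions $\hat r$ and $\rho$. Let $f(r)=e^{g(r)}$. $\hat r$ is the increasing solution of $$\hat r_s(s)=\Big(f(\hat r(s))\,\frac{\hat r(s)^{N-1}}{s^{N-1}}\Big)^{\frac1{p-1}},\qquad \hat r(1)=r_*,$$ where $r_*>0$ (depending only on $N,p,g$) is chosen so that $\hat r$ is defined over the whole $(0,+\infty)$ with $\hat r(s)\to0$ as $s\to0+$ and $\hat r(s)\to+\infty$ as $s\to+\infty$; $\hat r$ extends to a $C^1([0,+\infty))$ function with $\hat r(0)=0$, $\hat r_s(0)=1$. The density is $\rho(s)=\hat r_s(s)^p$, a positive continuous function on $[0,+\infty)$ with $\rho(0)=1$. Barrier function. $G(r)=\int_0^r\frac{g(s)}{s}\,ds$ for $r\ge0$; $G^{(-1)}$ is the inverse function of $G$; $J(r)=\frac{r^p}{G(r)}$ for $r>0$; $\tau=\varGamma\log(t+t_0)$ for $t\ge0$; $E(\tau)=J(G^{(-1)}(\tau))=\frac{G^{(-1)}(\tau)^p}{\tau}$ for $\tau>0$; and $$I(r)=\nu_0\Big(\frac{r^p}{G(r_0)}\Big)^{\frac1{p-1}}+(1-\nu_0)J(r_0)^{\frac1{p-1}}.$$ With $[\cdot]_+$ the positive part, $$\widetilde u(r,t)=\frac{C_*}{(t+t_0)^{\frac1{p+m-3}}}\Big[E(\tau)^{\frac1{p-1}}-J(r)^{\frac1{p-1}}\Big]_+^{\frac{p-1}{p+m-3}},\quad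 r\ge r_0,$$ $$\widetilde u(r,t)=\frac{C_*}{(t+t_0)^{\frac1{p+m-3}}}\Big[E(\tau)^{\frac1{p-1}}-I(r)\Big]_+^{\frac{p-1}{p+m-3}},\quad r<r_0.$$ The constant $\nu_0\in(0,1)$ is selected so that $\widetilde u$ and $\widetilde u_r$ are continuous also at $r=r_0$, namely $\nu_0=1-\frac{r_0G'(r_0)}{p\,G(r_0)}$. Solutions. $L^1_\rho(\mathbb R^N)$ is the $L^1$ space with respect to the measure $\rho(|x|)\,dx$, and $L^1_{\rho,\mathrm{loc}}$ its local version. A function $v\ge0$ is a weak solution if $v\in C([0,+\infty);L^1_\rho(\mathbb R^N))\cap L^\infty(\mathbb R^N\times(\bar t,+\infty))$ for all $\bar t>0$, $\nabla v^{\frac{p+m-2}{p-1}}\in L^p_{\mathrm{loc}}(S_\infty)$, and for all $\eta\in C_0^\infty(S_\infty)$ $$\int_0^{+\infty}\!\!\int_{\mathbb R^N}\{-\rho(|x|)\,v\,\eta_t+v^{m-1}|\nabla v|^{p-2}\nabla v\cdot\nabla\eta\}\,dx\,dt=0.$$ It is a strong solution if moreover $v_t\in L^\infty_{\mathrm{loc}}((0,+\infty);L^1_{\rho,\mathrm{loc}}(\mathbb R^N))$. Supersolutions [subsolutions] are defined similarly, requiring for all $\eta\ge0$ the inequality sign $\ge$ [$\le$] in place of equality. The initial value $v(\cdot,0)$ is taken in the sense of $C([0,+\infty);L^1_\rho(\mathbb R^N))$. *)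

theory Defs
  imports "HOL-Analysis.Analysis"
begin

(* \<open>R^N\<close> is a type 'a :: euclidean_space with N = DIM('a); space-time points are pairs (x, t).
   Functions v :: 'a \<Rightarrow> real \<Rightarrow> real are only meaningful for t \<ge> 0. *)

section \<open>The change of radial variable and the density\<close>

text \<open>The requirement at infinity singles out one solution of the equation (hence the value
  \<open>r\<^sub>* = rhat 1\<close>); that \<open>rhat\<close> is \<open>C\<^sup>1\<close> up to \<open>0\<close> with \<open>rhat_s(0) = 1\<close> is then a consequence.\<close>

definition radial_change :: "nat \<Rightarrow> real \<Rightarrow> (real \<Rightarrow> real) \<Rightarrow> (real \<Rightarrow> real) \<Rightarrow> bool" where
  "radial_change N p g rhat \<longleftrightarrow>
     rhat 0 = 0 \<and> strict_mono_on {0..} rhat \<and>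
     (\<forall>s>0. rhat s > 0 \<and>
        (rhat has_real_derivative
          (exp (g (rhat s)) * (rhat s ^ (N - 1) / s ^ (N - 1))) powr (1 / (p - 1))) (at s)) \<and>
     (rhat \<longlongrightarrow> 0) (at_right 0) \<and>
     filterlim rhat at_top at_top"

text \<open>The derivative is one-sided at \<open>s = 0\<close>.\<close>

definition rho :: "real \<Rightarrow> (real \<Rightarrow> real) \<Rightarrow> real \<Rightarrow> real" where
  "rho p rhat s = vector_derivative rhat (at s within {0..}) powr p"

section \<open>The barrier\<close>

definition G :: "(real \<Rightarrow> real) \<Rightarrow> real \<Rightarrow> real" where
  "G g r = integral {0..r} (\<lambda>s. g s / s)"

definition G_inv :: "(real \<Rightarrow> real) \<Rightarrow> real \<Rightarrow> real" where
  "G_inv g = the_inv_into {0..} (G g)"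

definition J :: "real \<Rightarrow> (real \<Rightarrow> real) \<Rightarrow> real \<Rightarrow> real" where
  "J p g r = r powr p / G g r"

definition E :: "real \<Rightarrow> (real \<Rightarrow> real) \<Rightarrow> real \<Rightarrow> real" where
  "E p g \<tau> = J p g (G_inv g \<tau>)"

definition nu0 :: "real \<Rightarrow> (real \<Rightarrow> real) \<Rightarrow> real \<Rightarrow> real" where
  "nu0 p g r0 = 1 - r0 * deriv (G g) r0 / (p * G g r0)"

definition I_fun :: "real \<Rightarrow> (real \<Rightarrow> real) \<Rightarrow> real \<Rightarrow> real \<Rightarrow> real" where
  "I_fun p g r0 r =
     nu0 p g r0 * (r powr p / G g r0) powr (1 / (p - 1))
     + (1 - nu0 p g r0) * J p g r0 powr (1 / (p - 1))"

definition u_tilde ::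
  "real \<Rightarrow> real \<Rightarrow> (real \<Rightarrow> real) \<Rightarrow> real \<Rightarrow> real \<Rightarrow> real \<Rightarrow> real \<Rightarrow> real \<Rightarrow> real \<Rightarrow> real" where
  "u_tilde p m g Cs t0 r0 \<Gamma> r t =
     (let \<tau> = \<Gamma> * ln (t + t0) in
      Cs / (t + t0) powr (1 / (p + m - 3)) *
      (max 0 (E p g \<tau> powr (1 / (p - 1))
              - (if r \<ge> r0 then J p g r powr (1 / (p - 1)) else I_fun p g r0 r)))
        powr ((p - 1) / (p + m - 3)))"

section \<open>Test functions and weak derivatives\<close>

definition S_infty :: "('a::euclidean_space \<times> real) set" where
  "S_infty = UNIV \<times> {0<..}"

primrec Ck :: "nat \<Rightarrow> ('b::euclidean_space \<Rightarrow> real) \<Rightarrow> bool" where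
  "Ck 0 f \<longleftrightarrow> continuous_on UNIV f"
| "Ck (Suc k) f \<longleftrightarrow>
     f differentiable_on UNIV \<and> (\<forall>b\<in>Basis. Ck k (\<lambda>z. frechet_derivative f (at z) b))"

text \<open>Test functions are extended by \<open>0\<close> to all of \<open>R\<^sup>N \<times> R\<close>.\<close>

definition test_fun :: "('a::euclidean_space \<times> real \<Rightarrow> real) \<Rightarrow> bool" where
  "test_fun \<eta> \<longleftrightarrow> (\<forall>k. Ck k \<eta>) \<and>
     compact (closure {z. \<eta> z \<noteq> 0}) \<and> closure {z. \<eta> z \<noteq> 0} \<subseteq> S_infty"

definition dt :: "('a::euclidean_space \<times> real \<Rightarrow> real) \<Rightarrow> 'a \<times> real \<Rightarrow> real" where
  "dt \<eta> z = frechet_derivative \<eta> (at z) (0, 1)"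

definition grad_x :: "('a::euclidean_space \<times> real \<Rightarrow> real) \<Rightarrow> 'a \<times> real \<Rightarrow> 'a" where
  "grad_x \<eta> z = (\<Sum>b\<in>Basis. frechet_derivative \<eta> (at z) (b, 0) *\<^sub>R b)"

definition locally_integrable ::
  "('a::euclidean_space \<times> real \<Rightarrow> 'b::{banach, second_countable_topology}) \<Rightarrow> bool" where
  "locally_integrable w \<longleftrightarrow> (\<forall>K. compact K \<and> K \<subseteq> S_infty \<longrightarrow> set_integrable lborel K w)"

definition weak_grad_x ::
  "('a::euclidean_space \<times> real \<Rightarrow> real) \<Rightarrow> ('a \<times> real \<Rightarrow> 'a) \<Rightarrow> bool" where
  "weak_grad_x w D \<longleftrightarrow> locally_integrable w \<and> locally_integrable D \<and>
     (\<forall>\<phi>. test_fun \<phi> \<longrightarrow>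
        (LINT z:S_infty|lborel. w z *\<^sub>R grad_x \<phi> z) = - (LINT z:S_infty|lborel. \<phi> z *\<^sub>R D z))"

definition weak_dt ::
  "('a::euclidean_space \<times> real \<Rightarrow> real) \<Rightarrow> ('a \<times> real \<Rightarrow> real) \<Rightarrow> bool" where
  "weak_dt w d \<longleftrightarrow> locally_integrable w \<and> locally_integrable d \<and>
     (\<forall>\<phi>. test_fun \<phi> \<longrightarrow>
        (LINT z:S_infty|lborel. w z * dt \<phi> z) = - (LINT z:S_infty|lborel. d z * \<phi> z))"

section \<open>Solutions\<close>

definition rho_measure :: "(real \<Rightarrow> real) \<Rightarrow> 'a::euclidean_space measure" where
  "rho_measure \<rho> = density lborel (\<lambda>x. ennreal (\<rho> (norm x)))"

definition continuous_L1 :: "(real \<Rightarrow> real) \<Rightarrow> ('a::euclidean_space \<Rightarrow> real \<Rightarrow> real) \<Rightarrow> bool" where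
  "continuous_L1 \<rho> v \<longleftrightarrow>
     (\<forall>t\<ge>0. integrable (rho_measure \<rho>) (\<lambda>x. v x t)) \<and>
     (\<forall>t\<ge>0. ((\<lambda>s. LINT x|rho_measure \<rho>. \<bar>v x s - v x t\<bar>) \<longlongrightarrow> 0) (at t within {0..}))"

definition bounded_after :: "('a::euclidean_space \<Rightarrow> real \<Rightarrow> real) \<Rightarrow> bool" where
  "bounded_after v \<longleftrightarrow>
     (\<forall>T>0. \<exists>M. AE z in lborel. snd z > T \<longrightarrow> \<bar>v (fst z) (snd z)\<bar> \<le> M)"

definition sigma :: "real \<Rightarrow> real \<Rightarrow> real" where
  "sigma p m = (p + m - 2) / (p - 1)"

text \<open>\<open>D\<close> is the weak gradient of \<open>v\<^sup>\<sigma>\<close>, \<open>\<sigma> = (p+m-2)/(p-1)\<close>. The regularity demanded of a weak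
  solution concerns this gradient only.\<close>

definition energy_class ::
  "(real \<Rightarrow> real) \<Rightarrow> real \<Rightarrow> real \<Rightarrow> ('a::euclidean_space \<Rightarrow> real \<Rightarrow> real) \<Rightarrow> ('a \<times> real \<Rightarrow> 'a) \<Rightarrow> bool"
where
  "energy_class \<rho> p m v D \<longleftrightarrow>
     (\<forall>t\<ge>0. AE x in lborel. 0 \<le> v x t) \<and>
     set_borel_measurable lborel S_infty (\<lambda>(x, t). v x t) \<and>
     set_borel_measurable lborel S_infty D \<and>
     continuous_L1 \<rho> v \<and> bounded_after v \<and>
     weak_grad_x (\<lambda>(x, t). v x t powr sigma p m) D \<and>
     locally_integrable (\<lambda>z. norm (D z) powr p)"

text \<open>Where \<open>v > 0\<close> the gradient of \<open>v\<close> is read off from \<open>\<nabla>v\<^sup>\<sigma> = \<sigma> v\<^bsup>\<sigma>-1\<^esup> \<nabla>v\<close>; where \<open>v = 0\<close>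
  (where \<open>\<nabla>v\<^sup>\<sigma> = 0\<close> almost everywhere) the value below is \<open>0\<close>, because \<open>0 powr a = 0\<close>.
  The resulting flux equals \<open>\<sigma>\<^bsup>1-p\<^esup> |\<nabla>v\<^sup>\<sigma>|\<^bsup>p-2\<^esup> \<nabla>v\<^sup>\<sigma>\<close> almost everywhere.\<close>

definition grad_v ::
  "real \<Rightarrow> real \<Rightarrow> ('a::euclidean_space \<Rightarrow> real \<Rightarrow> real) \<Rightarrow> ('a \<times> real \<Rightarrow> 'a) \<Rightarrow> 'a \<times> real \<Rightarrow> 'a" where
  "grad_v p m v D z = (v (fst z) (snd z) powr (1 - sigma p m) / sigma p m) *\<^sub>R D z"

definition flux ::
  "real \<Rightarrow> real \<Rightarrow> ('a::euclidean_space \<Rightarrow> real \<Rightarrow> real) \<Rightarrow> ('a \<times> real \<Rightarrow> 'a) \<Rightarrow> 'a \<times> real \<Rightarrow> 'a" where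
  "flux p m v D z =
     (v (fst z) (snd z) powr (m - 1) * norm (grad_v p m v D z) powr (p - 2)) *\<^sub>R grad_v p m v D z"

definition weak_form ::
  "(real \<Rightarrow> real) \<Rightarrow> real \<Rightarrow> real \<Rightarrow> ('a::euclidean_space \<Rightarrow> real \<Rightarrow> real) \<Rightarrow> ('a \<times> real \<Rightarrow> 'a)
     \<Rightarrow> ('a \<times> real \<Rightarrow> real) \<Rightarrow> real" where
  "weak_form \<rho> p m v D \<eta> =
     (LINT z:S_infty|lborel.
        - \<rho> (norm (fst z)) * v (fst z) (snd z) * dt \<eta> z + flux p m v D z \<bullet> grad_x \<eta> z)"

definition weak_solution ::
  "(real \<Rightarrow> real) \<Rightarrow> real \<Rightarrow> real \<Rightarrow> ('a::euclidean_space \<Rightarrow> real \<Rightarrow> real) \<Rightarrow> bool" where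
  "weak_solution \<rho> p m v \<longleftrightarrow>
     (\<exists>D. energy_class \<rho> p m v D \<and> (\<forall>\<eta>. test_fun \<eta> \<longrightarrow> weak_form \<rho> p m v D \<eta> = 0))"

definition weak_subsolution ::
  "(real \<Rightarrow> real) \<Rightarrow> real \<Rightarrow> real \<Rightarrow> ('a::euclidean_space \<Rightarrow> real \<Rightarrow> real) \<Rightarrow> bool" where
  "weak_subsolution \<rho> p m v \<longleftrightarrow>
     (\<exists>D. energy_class \<rho> p m v D \<and>
        (\<forall>\<eta>. test_fun \<eta> \<and> (\<forall>z. 0 \<le> \<eta> z) \<longrightarrow> weak_form \<rho> p m v D \<eta> \<le> 0))"

definition strong_solution ::
  "(real \<Rightarrow> real) \<Rightarrow> real \<Rightarrow> real \<Rightarrow> ('a::euclidean_space \<Rightarrow> real \<Rightarrow> real) \<Rightarrow> bool" where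
  "strong_solution \<rho> p m v \<longleftrightarrow> weak_solution \<rho> p m v \<and>
     (\<exists>vt. set_borel_measurable lborel S_infty vt \<and> weak_dt (\<lambda>(x, t). v x t) vt \<and>
        (\<forall>a b K. 0 < a \<and> a \<le> b \<and> compact K \<longrightarrow>
           (\<exists>M. AE t in lborel. t \<in> {a..b} \<longrightarrow>
              set_integrable (rho_measure \<rho>) K (\<lambda>x. vt (x, t)) \<and>
              (LINT x:K|rho_measure \<rho>. \<bar>vt (x, t)\<bar>) \<le> M)))"

section \<open>Support and comparability\<close>

text \<open>The support of an element of \<open>L\<^sup>1\<close>, insensitive to null sets.\<close>

definition ess_support :: "('a::euclidean_space \<Rightarrow> real) \<Rightarrow> 'a set" where
  "ess_support w = {x. \<forall>e>0. \<not> (AE y in lborel. y \<in> ball x e \<longrightarrow> w y = 0)}"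

definition comparable :: "(real \<Rightarrow> real) \<Rightarrow> (real \<Rightarrow> real) \<Rightarrow> bool" where
  "comparable F1 F2 \<longleftrightarrow>
     (\<exists>C1>0. \<exists>C2>0. \<exists>T>0. \<forall>t\<ge>T.
        0 < F1 t \<and> 0 < F2 t \<and> C1 \<le> F2 t / F1 t \<and> F2 t / F1 t \<le> C2)"

end

theory Submission
 imports Defs
begin

text \<open>Put \<open>Z = E^(1/(p-1)) - J^(1/(p-1))\<close>, with \<open>I\<close> in place of \<open>J^(1/(p-1))\<close> near the origin. In the variable
 \<open>s = |x|\<close> the \<open>p\<close>-Laplacian of \<open>J^(1/(p-1))\<close> is \<open>\<rho>\<close> times a bounded function, and its gradient to the
 power \<open>p\<close> is \<open>\<rho>\<close> times the \<open>p\<close>-th power of the \<open>r\<close>-derivative. Where \<open>J^(1/(p-1))\<close> is at most half of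
 \<open>E^(1/(p-1))\<close>, the term of order \<open>Z\<close> dominates the time derivative of \<open>E\<close> for large \<open>t0\<close>; elsewhere the
 gradient term dominates it. Since \<open>Z^q\<close> need not be differentiable at the free boundary, the
 inequality is integrated for \<open>Z^2 (Z + e)^(q-2)\<close> and passed to the limit \<open>e \<rightarrow> 0\<close>.

 The comparison is an \<open>L^1\<close> contraction: the difference of the two weak inequalities is tested with
 \<open>S(j (u^\<sigma> - v^\<sigma>))\<close>, \<open>S\<close> a smooth step and \<open>u^\<sigma> - v^\<sigma>\<close> mollified; the fluxes are monotone functions
 of \<open>\<nabla>u^\<sigma>\<close>, \<open>\<nabla>v^\<sigma>\<close>, and existence of the time derivatives lets \<open>j \<rightarrow> \<infinity>\<close>.

 The support estimate follows from \<open>g(rhat s) \<le> (N - p) (ln s - ln (rhat s))\<close>, which bounds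
 \<open>G(rhat(t^c))\<close> by less than \<open>\<Gamma> ln t\<close> for small \<open>c\<close> and large \<open>t\<close>.\<close>

text \<open>The weak forms accept only smooth compactly supported test functions, \<open>v\<close>
  enters only through \<open>v^\<sigma>\<close> with a weak gradient in \<open>L^p_loc\<close>, and
  for \<open>q = (p-1)/(p+m-3) < 1\<close> the time derivative of the barrier is singular at the
  free boundary. For the barrier, the replacement \<open>Psi q e\<close> of \<open>Z^q\<close>
  satisfies \<open>Z * Psi' <= max q 2 * Psi\<close> for every \<open>e\<close>, so a pointwise
  inequality proved with \<open>max q 2\<close> in place of \<open>q\<close> already holds before
  the limit. For the comparison, the barrier has bounded support in \<open>x\<close> on bounded time
  intervals, so a cut-off can be spatially constant wherever the barrier is positive and leaves no
  error at infinity. The constants are fixed in this order: \<open>R0 = rhat l\<close> puts the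
  initial front at \<open>|x| = l\<close>; \<open>r0\<close> makes the root of \<open>J\<close> at
  \<open>r0\<close> at most half its value at \<open>R0\<close>, so that the modified inner profile
  never meets the region near the front; \<open>Cs\<close> is small for the divergence term and for
  the initial bound \<open>\<epsilon>\<close>; then \<open>t0\<close> is large, and
  \<open>\<Gamma> = G(R0) / ln t0\<close>.\<close>

abbreviation (input) lborel_integral (binder "LI " [60] 60) where
 "lborel_integral f == integral\<^sup>L lborel f"
abbreviation (input) S_integral (binder "LIS " [60] 60) where
 "S_integral f == set_lebesgue_integral lborel S_infty f"
abbreviation (input) S_integrable where
 "S_integrable f == integrable lborel (\<lambda>z. indicator S_infty z *\<^sub>R f z)"
abbreviation (input) seq_limit (infix "---->" 60) where
 "X ----> L == X \<longlonglongrightarrow> L"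
abbreviation (input) scale (infixr "*." 75) where "c *. x == c *\<^sub>R x"
abbreviation (input) "meas == borel_measurable borel"

lemmas continuous_measurable = borel_measurable_continuous_onI
lemmas integrable_dominated = Bochner_Integration.integrable_bound
lemmas dominated_conv = Bochner_Integration.integral_dominated_convergence

section \<open>Smooth functions\<close>

definition smooth :: "('b::euclidean_space => real) => bool" where
 "smooth f \<longleftrightarrow> (\<forall>k. Ck k f)"

abbreviation pd :: "'b::euclidean_space => ('b => real) => 'b => real" where
 "pd b f == (%z. frechet_derivative f (at z) b)"

lemma smooth_differentiable: "smooth f ==> f differentiable (at z)"
 using Ck.simps(2)[of 0 f] by (auto simp: smooth_def differentiable_on_def simp del: Ck.simps)

lemma smooth_has_derivative: "smooth f ==> (f has_derivative frechet_derivative f (at z)) (at z)"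
 using smooth_differentiable frechet_derivative_works by blast

lemma smooth_pd: "smooth f ==> b \<in> Basis ==> smooth (pd b f)"
 unfolding smooth_def using Ck.simps(2) by blast

lemma smooth_continuous: "smooth f ==> continuous_on UNIV f"
 unfolding smooth_def using Ck.simps(1) by blast

lemma smooth_measurable: "smooth f ==> f \<in> meas"
 by (simp add: continuous_measurable smooth_continuous)

lemma Ck_down: "Ck (Suc k) f ==> Ck k f"
proof (induction k arbitrary: f)
 case 0
 then show ?case by (auto intro: differentiable_imp_continuous_on)
next
 case (Suc k)
 then show ?case by (meson Ck.simps(2))
qed

text \<open>The recursion in \<open>Ck\<close> is phrased with \<open>frechet_derivative\<close>.
  This form accepts any explicit derivative, which is how the closure properties below are
  obtained.\<close>

lemma Ck_cong_pd:
 assumes "!!z. (f has_derivative f' z) (at z)" "!!b. b \<in> Basis ==> Ck k (%z. f' z b)"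
 shows "Ck (Suc k) f"
proof -
 have "frechet_derivative f (at z) = f' z" for z
  using assms(1) frechet_derivative_at by metis
 then show ?thesis
  using assms by (auto simp: differentiable_on_def intro: differentiable_at_withinI differentiableI)
qed

lemma Ck_add: "Ck k f ==> Ck k g ==> Ck k (%z. f z + g z)"
proof (induction k arbitrary: f g)
 case 0
 then show ?case by (auto intro: continuous_on_add)
next
 case (Suc k)
 show ?case
 proof (rule Ck_cong_pd)
  fix z show "((%z. f z + g z) has_derivative (%h. frechet_derivative f (at z) h + frechet_derivative g (at z) h)) (at z)"
   using Suc.prems by (auto intro!: has_derivative_add simp: frechet_derivative_works[symmetric] differentiable_on_def)
 qed (use Suc in auto)
qed

lemma Ck_mult: "Ck k f ==> Ck k g ==> Ck k (%z. f z * g z)"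
proof (induction k arbitrary: f g)
 case 0
 then show ?case by (auto intro: continuous_on_mult)
next
 case (Suc k)
 have d: "Ck k f" "Ck k g" using Suc.prems Ck_down by blast+
 show ?case
 proof (rule Ck_cong_pd)
  fix z show "((%z. f z * g z) has_derivative (%h. f z * frechet_derivative g (at z) h + frechet_derivative f (at z) h * g z)) (at z)"
   using Suc.prems by (auto intro!: has_derivative_mult simp: frechet_derivative_works[symmetric] differentiable_on_def)
 qed (use Suc d in "auto intro!: Ck_add")
qed

lemma Ck_const: "Ck k (%z. c)"
 by (induction k arbitrary: c) (auto simp: frechet_derivative_const)

lemma smooth_const: "smooth (%z. c)" by (simp add: smooth_def Ck_const)
lemma smooth_add: "smooth f ==> smooth g ==> smooth (%z. f z + g z)" by (simp add: smooth_def Ck_add)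
lemma smooth_mult: "smooth f ==> smooth g ==> smooth (%z. f z * g z)" by (simp add: smooth_def Ck_mult)
lemma smooth_diff: "smooth f ==> smooth g ==> smooth (%z. f z - g z)"
 using smooth_add[of f "%z. -1 * g z"] smooth_mult[OF smooth_const, of g "-1"] by simp

lemma smooth_linear:
 assumes "bounded_linear f" shows "smooth f"
proof -
 have "Ck k f" for k
 proof (cases k)
  case 0
  then show ?thesis using assms by (auto intro: linear_continuous_on)
 next
  case (Suc k')
  show ?thesis unfolding Suc
   by (rule Ck_cong_pd[of f "%z. f"]) (simp_all only: bounded_linear_imp_has_derivative[OF assms] Ck_const)
 qed
 then show ?thesis by (simp add: smooth_def)
qed

lemma Ck_sum: "finite A ==> (!!i. i \<in> A ==> Ck k (f i)) ==> Ck k (%z. \<Sum>i\<in>A. f i z)"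
 by (induction A rule: finite_induct) (auto intro: Ck_const Ck_add)

text \<open>The induction generalises \<open>h\<close>, because by the chain rule its partial
  derivatives reappear composed with the same \<open>f\<close>.\<close>

lemma Ck_compose:
 fixes f :: "'b::euclidean_space => 'c::euclidean_space"
 assumes "!!i. i \<in> Basis ==> Ck k (%z. f z \<bullet> i)" "Ck k h"
 shows "Ck k (%z. h (f z))"
 using assms
proof (induction k arbitrary: h)
 case 0
 have "continuous_on UNIV f"
  by (rule continuous_on_componentwise[THEN iffD2]) (use 0 in auto)
 then show ?case using 0 by (auto intro: continuous_on_compose2)
next
 case (Suc k)
 have d: "!!i. i \<in> Basis ==> Ck k (%z. f z \<bullet> i)" using Suc.prems Ck_down by blast
 define f' where "f' z v = (\<Sum>i\<in>Basis. frechet_derivative (%z. f z \<bullet> i) (at z) v *. i)" for z v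
 have f': "(f has_derivative f' z) (at z)" for z
 proof -
  have "((%z. f z \<bullet> i) has_derivative (%v. f' z v \<bullet> i)) (at z)" if "i \<in> Basis" for i
   using Suc.prems(1)[OF that] that
   by (simp add: f'_def inner_sum_left_Basis frechet_derivative_works[symmetric] differentiable_on_def)
  then show ?thesis using has_derivative_componentwise_within[of f "f' z" z UNIV] by auto
 qed
 show ?case
 proof (rule Ck_cong_pd)
  fix z
  have "(h has_derivative frechet_derivative h (at (f z))) (at (f z))"
   using Suc.prems by (auto simp: frechet_derivative_works[symmetric] differentiable_on_def)
  from has_derivative_compose[OF f' this]
  have "((%z. h (f z)) has_derivative (%v. frechet_derivative h (at (f z)) (f' z v))) (at z)" .
  moreover have "frechet_derivative h (at (f z)) (f' z v)
    = (\<Sum>i\<in>Basis. frechet_derivative (%z. f z \<bullet> i) (at z) v * frechet_derivative h (at (f z)) i)" for v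
  proof -
   have "linear (frechet_derivative h (at (f z)))"
    using \<open>(h has_derivative frechet_derivative h (at (f z))) (at (f z))\<close> has_derivative_linear by blast
   then show ?thesis by (simp add: f'_def linear_sum linear_cmul)
  qed
  ultimately show "((%z. h (f z)) has_derivative (%v. (\<Sum>i\<in>Basis. frechet_derivative (%z. f z \<bullet> i) (at z) v * frechet_derivative h (at (f z)) i))) (at z)"
   by simp
 next
  fix b :: 'b assume b: "b \<in> Basis"
  show "Ck k (%z. \<Sum>i\<in>Basis. frechet_derivative (%z. f z \<bullet> i) (at z) b * frechet_derivative h (at (f z)) i)"
   using Suc.prems b by (auto intro!: Ck_sum Ck_mult Suc.IH d)
 qed
qed

lemma smooth_compose:
 fixes f :: "'b::euclidean_space => 'c::euclidean_space"
 assumes "!!i. i \<in> Basis ==> smooth (%z. f z \<bullet> i)" "smooth h"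
 shows "smooth (%z. h (f z))"
 using assms Ck_compose unfolding smooth_def by blast

lemma smooth_compose_real: "smooth (f::'b::euclidean_space => real) ==> smooth h ==> smooth (%z. h (f z))"
 by (rule smooth_compose) auto

lemma smooth_norm_sq: "smooth (%z::'b::euclidean_space. (norm z)\<^sup>2)"
proof -
 have "(norm z)\<^sup>2 = (\<Sum>i\<in>Basis. (z \<bullet> i) * (z \<bullet> i))" for z :: 'b
  by (simp add: power2_norm_eq_inner euclidean_inner[of z z])
 then show ?thesis
  using smooth_linear[OF bounded_linear_inner_left] unfolding smooth_def by (auto intro!: Ck_sum Ck_mult)
qed

text \<open>Differentiation stays inside the class \<open>P\<close>, so no formula for the higher
  derivatives is needed. For \<open>psi\<close> the class consists of polynomials in
  \<open>1 / s\<close> times \<open>exp (- 1 / s)\<close>, extended by 0.\<close>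

lemma smooth_real_coinduct:
 fixes P :: "(real => real) => bool"
 assumes "!!f. P f ==> \<exists>f'. P f' \<and> (\<forall>x. (f has_real_derivative f' x) (at x))" "P f"
 shows "smooth f"
proof -
 have "P f ==> Ck k f" for k f
 proof (induction k arbitrary: f)
  case 0
  then obtain f' where "\<forall>x. (f has_real_derivative f' x) (at x)" using assms(1) by blast
  then show ?case by (metis Ck.simps(1) DERIV_isCont continuous_at_imp_continuous_on)
 next
  case (Suc k)
  then obtain f' where f': "P f'" "\<forall>x. (f has_real_derivative f' x) (at x)" using assms(1) by blast
  show ?case
   by (rule Ck_cong_pd[where f' = "%x h. f' x * h"])
     (use f' Suc.IH[OF f'(1)] in "auto simp: has_field_derivative_def mult_commute_abs")
 qed
 then show ?thesis using assms(2) by (auto simp: smooth_def)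
qed

lemma smooth_real_antideriv:
 assumes "smooth f'" "!!x::real. (f has_real_derivative f' x) (at x)"
 shows "smooth f"
proof -
 have "Ck (Suc k) f" for k
  by (rule Ck_cong_pd[where f' = "%x h. f' x * h"])
    (use assms in "auto simp: has_field_derivative_def mult_commute_abs smooth_def")
 then show ?thesis unfolding smooth_def using Ck_down by blast
qed

subsection \<open>A bump function and a smooth step\<close>

definition psi :: "real => real" where "psi s = (if s <= 0 then 0 else exp (- 1 / s))"

lemma psi_decay: "((%s. (1 / s) ^ n * exp (- 1 / s)) \<longlongrightarrow> 0) (at_right (0::real))"
proof -
 have "((%x::real. x ^ n / exp x) \<longlongrightarrow> 0) at_top" by (rule tendsto_power_div_exp_0)
 then have "((%s::real. (inverse s) ^ n / exp (inverse s)) \<longlongrightarrow> 0) (at_right 0)"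
  using filterlim_compose filterlim_inverse_at_top_right by blast
 then show ?thesis by (simp add: exp_minus field_simps)
qed

lemma smooth_psi: "smooth psi"
proof -
 define P where "P f \<longleftrightarrow> (\<exists>q :: real poly. f = (%s. if s <= 0 then 0 else poly q (1 / s) * exp (- 1 / s)))" for f :: "real => real"
 have lim: "((%s. poly q (1 / s) * exp (- 1 / s)) \<longlongrightarrow> 0) (at_right (0::real))" for q :: "real poly"
 proof -
  have "((%s. \<Sum>i\<le>degree q. coeff q i * ((1 / s) ^ i * exp (- 1 / s))) \<longlongrightarrow> (\<Sum>i\<le>degree q. coeff q i * 0)) (at_right (0::real))"
   by (intro tendsto_intros psi_decay)
  then show ?thesis by (simp add: poly_altdef sum_distrib_right mult.assoc)
 qed
 show ?thesis
 proof (rule smooth_real_coinduct[of P])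
  have "psi = (%s. if s <= 0 then 0 else poly 1 (1 / s) * exp (- 1 / s))" by (auto simp: psi_def)
  then show "P psi" by (auto simp: P_def)
 next
  fix f assume "P f"
  then obtain q where q: "f = (%s. if s <= 0 then 0 else poly q (1 / s) * exp (- 1 / s))" by (auto simp: P_def)
  \<comment> \<open>Differentiating \<open>q (1/s) * exp (-1/s)\<close> brings out the factor
    \<open>1/s^2\<close> and leaves \<open>q - pderiv q\<close>.\<close>
  define q' where "q' = [:0,0,1:] * (q - pderiv q)"
  define f' where "f' = (%s::real. if s <= 0 then 0 else poly q' (1 / s) * exp (- 1 / s))"
  have "(f has_real_derivative f' x) (at x)" for x
  proof -
   consider "x < 0" | "x > 0" | "x = 0" by linarith
   then show ?thesis
   proof cases
    case 1
    have "((%_. 0) has_real_derivative 0) (at x)" by simp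
    moreover have "eventually (%y. f y = 0) (nhds x)"
     using eventually_nhds_in_open[of "{..<0}" x] 1 by (auto elim!: eventually_mono simp: q)
    ultimately show ?thesis using 1 by (simp add: f'_def DERIV_cong_ev)
   next
    case 2
    have "((%s. poly q (1 / s) * exp (- 1 / s)) has_real_derivative poly q' (1 / x) * exp (- 1 / x)) (at x)"
     using 2 by (auto intro!: derivative_eq_intros simp: q'_def field_simps power2_eq_square)
    moreover have "eventually (%y. f y = poly q (1 / y) * exp (- 1 / y)) (nhds x)"
     using eventually_nhds_in_open[of "{0<..}" x] 2 by (auto elim!: eventually_mono simp: q)
    ultimately show ?thesis using 2 by (simp add: f'_def DERIV_cong_ev)
   next
    case 3
    \<comment> \<open>The right difference quotient at 0 is once more a polynomial in
      \<open>1/s\<close> times the exponential, with one extra factor \<open>1/s\<close>, so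
      \<open>lim\<close> applies to it.\<close>
    have "((%y. (f y - f 0) / (y - 0)) \<longlongrightarrow> 0) (at_right 0)"
    proof (rule Lim_transform_eventually[OF lim[of "[:0,1:] * q"]])
     show "\<forall>\<^sub>F s in at_right 0. poly ([:0, 1:] * q) (1 / s) * exp (- 1 / s) = (f s - f 0) / (s - 0)"
      by (auto simp: q eventually_at_right_less eventually_at_filter)
    qed
    moreover have "((%y. (f y - f 0) / (y - 0)) \<longlongrightarrow> 0) (at_left 0)"
    proof (rule Lim_transform_eventually[OF tendsto_const])
     show "\<forall>\<^sub>F s in at_left 0. 0 = (f s - f 0) / (s - 0)"
      by (auto simp: q eventually_at_filter)
    qed
    ultimately show ?thesis
     using 3 by (simp add: f'_def has_field_derivative_iff filterlim_at_split)
   qed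
  qed
  moreover have "P f'" by (auto simp: P_def f'_def)
  ultimately show "\<exists>f'. P f' \<and> (\<forall>x. (f has_real_derivative f' x) (at x))" by blast
 qed
qed

lemma psi_nonneg: "psi s >= 0" and psi_pos: "s > 0 ==> psi s > 0" and psi_zero: "s <= 0 ==> psi s = 0"
 by (auto simp: psi_def)

text \<open>The step is the normalised primitive of the bump \<open>psi s * psi (1 - s)\<close>. It
  yields cut-offs in space and time and, with its argument multiplied by a large number, smooth
  approximations of the indicator of a positivity set.\<close>

lemma smooth_step_exists:
 obtains S S' :: "real => real" where
  "smooth S" "smooth S'" "!!x. (S has_real_derivative S' x) (at x)" "!!x. S' x >= 0"
  "!!x. x <= 0 ==> S x = 0" "!!x. x >= 1 ==> S x = 1"
  "!!x. 0 <= S x" "!!x. S x <= 1" "!!x. x <= 0 \<or> x >= 1 ==> S' x = 0"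
proof -
 define b where "b s = psi s * psi (1 - s)" for s
 have sb: "smooth b" unfolding b_def
  by (intro smooth_mult smooth_psi smooth_compose_real[OF _ smooth_psi] smooth_diff smooth_const
    smooth_linear[OF bounded_linear_ident])
 have bc: "continuous_on A b" for A using smooth_continuous[OF sb] continuous_on_subset by blast
 have b0: "b s = 0" if "s <= 0 \<or> s >= 1" for s using that by (auto simp: b_def psi_def)
 have bn: "b s >= 0" for s by (simp add: b_def psi_nonneg)
 \<comment> \<open>Integrating from -1 keeps 0 in the interior of the range where the fundamental
   theorem gives a two-sided derivative.\<close>
 define B where "B x = integral {-1..x} b" for x
 have B': "(B has_real_derivative b x) (at x)" if "x > -1" for x
 proof -
  have "(B has_real_derivative b x) (at x within {-1..x+1})"
   unfolding B_def by (rule integral_has_real_derivative) (use bc that in auto)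
  then show ?thesis
   using that at_within_interior[of x "{-1..x+1}"] by (simp)
 qed
 have Bneg: "B x = 0" if "x <= 0" for x
 proof -
  have "integral {-1..x} b = integral {-1..x} (%_. 0)" by (rule integral_cong) (use that b0 in auto)
  then show ?thesis by (simp add: B_def)
 qed
 have B'2: "(B has_real_derivative b x) (at x)" for x
 proof (cases "x > -1")
  case False
  have "((%_. 0) has_real_derivative 0) (at x)" by simp
  moreover have "eventually (%y. B y = 0) (nhds x)"
   using eventually_nhds_in_open[of "{..<0}" x] False by (auto elim!: eventually_mono simp: Bneg)
  ultimately show ?thesis using False by (simp add: b0 DERIV_cong_ev)
 qed (use B' in auto)
 have Bmono: "B x <= B y" if "x <= y" for x y
  by (rule DERIV_nonneg_imp_nondecreasing[OF that]) (use B'2 bn in blast)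
 have Bconst: "B x = B 1" if "x >= 1" for x
 proof (cases "x = 1")
  case False
  then have "1 < x" using that by auto
  then obtain z where "1 < z" "z < x" "B x - B 1 = (x - 1) * b z"
   using MVT2[of 1 x B b] B'2 by blast
  then show ?thesis by (simp add: b0)
 qed auto
 have B1: "B 1 > 0"
 proof -
  obtain z where z: "0 < z" "z < 1" "B 1 - B 0 = (1 - 0) * b z"
   using MVT2[of 0 1 B b] B'2 by auto
  then show ?thesis by (simp add: Bneg b_def psi_pos)
 qed
 show ?thesis
 proof (rule that[of "%x. (1 / B 1) * B x" "%x. (1 / B 1) * b x"])
  show s': "smooth (%x. 1 / B 1 * b x)" by (intro smooth_mult smooth_const sb)
  show d: "((%x. 1 / B 1 * B x) has_real_derivative 1 / B 1 * b x) (at x)" for x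
   by (rule DERIV_cmult[OF B'2])
  show "smooth (%x. 1 / B 1 * B x)" by (rule smooth_real_antideriv[OF s' d])
  show "0 <= 1 / B 1 * b x" for x using B1 bn by simp
  show "x <= 0 ==> 1 / B 1 * B x = 0" for x by (simp add: Bneg)
  show "1 <= x ==> 1 / B 1 * B x = 1" for x using B1 Bconst[of x] by (metis divide_self_if less_irrefl times_divide_eq_left mult_1)
  show "0 <= 1 / B 1 * B x" for x
   using Bmono[of 0 x] Bneg[of x] Bneg[of 0] B1 by (cases "x <= 0") auto
  show "1 / B 1 * B x <= 1" for x
   using Bmono[of x 1] Bconst[of x] B1 by (cases "x <= 1") (auto simp: divide_le_eq)
  show "x <= 0 \<or> x >= 1 ==> 1 / B 1 * b x = 0" for x using b0 by simp
 qed
qed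

section \<open>Convolution\<close>

definition csupp :: "real => ('b::euclidean_space => real) => bool" where
 "csupp \<delta> k \<longleftrightarrow> smooth k \<and> (\<forall>y. norm y > \<delta> --> k y = 0)"

text \<open>Vector values are allowed so that a function and its weak gradient are mollified by one
  and the same operation.\<close>

definition conv :: "('b::euclidean_space => real) => ('b => 'c::euclidean_space) => 'b => 'c" where
 "conv k f z = (LI y. k (z - y) *. f y)"

lemma frechet_derivative_zero_open:
 assumes "open U" "z \<in> U" "!!y. y \<in> U ==> f y = 0"
 shows "frechet_derivative f (at z) = (%h. 0)"
proof -
 have "(f has_derivative (%h. 0)) (at z)"
  by (rule has_derivative_transform_within_open[of "%_. 0" "%_. 0" z UNIV U]) (use assms in auto)
 then show ?thesis using frechet_derivative_at by metis
qed

lemma csupp_smooth: "csupp \<delta> k ==> smooth k" by (simp add: csupp_def)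

lemma csupp_pd: "csupp \<delta> k ==> b \<in> Basis ==> csupp \<delta> (pd b k)"
 unfolding csupp_def
proof safe
 fix y :: 'a assume k: "smooth k" "\<forall>y. norm y > \<delta> --> k y = 0" and y: "norm y > \<delta>"
 have "open {y::'a. norm y > \<delta>}" by (simp add: open_Collect_less continuous_on_norm continuous_on_id)
 from frechet_derivative_zero_open[OF this, of y k] k y show "pd b k y = 0" by auto
qed (rule smooth_pd)

lemma csupp_bounded: assumes "csupp \<delta> k" obtains M where "M >= 0" "!!y. \<bar>k y\<bar> <= M"
proof -
 have "continuous_on (cball 0 \<delta>) k" using assms smooth_continuous continuous_on_subset by (metis csupp_def subset_UNIV)
 then have "bounded (k ` cball 0 \<delta>)" by (simp add: compact_continuous_image compact_imp_bounded)
 then obtain M where M: "\<forall>y\<in>cball 0 \<delta>. \<bar>k y\<bar> <= M" by (auto simp: bounded_iff)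
 have "\<bar>k y\<bar> <= max M 0" for y
  using bspec[OF M, of y] assms by (cases "norm y <= \<delta>") (auto simp: csupp_def)
 then show ?thesis using that[of "max M 0"] by auto
qed

lemma csupp_uc:
 assumes "csupp \<delta> k" "e > 0"
 obtains d where "d > 0" "!!x y. dist x y < d ==> \<bar>k x - k y\<bar> < e"
proof -
 have "continuous_on (cball 0 (\<delta>+1)) k" using assms smooth_continuous continuous_on_subset by (metis csupp_def subset_UNIV)
 then have "uniformly_continuous_on (cball 0 (\<delta>+1)) k" by (simp add: compact_uniformly_continuous)
 then obtain d where d: "d > 0" "!!x y. x \<in> cball 0 (\<delta>+1) ==> y \<in> cball 0 (\<delta>+1) ==> dist y x < d ==> dist (k y) (k x) < e"
  using \<open>e > 0\<close> unfolding uniformly_continuous_on_def by metis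
 show ?thesis
 proof (rule that[of "min d 1"])
  \<comment> \<open>Two points at distance below 1 either both lie in the ball of radius
    \<open>\<delta> + 1\<close>, where \<open>k\<close> is uniformly continuous, or both lie outside
    the support of \<open>k\<close>.\<close>
  fix x y :: 'a assume xy: "dist x y < min d 1"
  show "\<bar>k x - k y\<bar> < e"
  proof (cases "norm x <= \<delta> + 1 \<and> norm y <= \<delta> + 1")
   case True
   then show ?thesis using d(2)[of y x] xy by (auto simp: dist_real_def)
  next
   case False
   have "norm x - norm y <= dist x y" "norm y - norm x <= dist x y"
    by (metis dist_norm norm_triangle_ineq2) (metis dist_norm norm_triangle_ineq2 norm_minus_commute)
   then have "norm x > \<delta>" "norm y > \<delta>" using False xy by auto
   then show ?thesis using assms by (auto simp: csupp_def)
  qed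
 qed (use d in auto)
qed

lemma csupp_measurable: "csupp \<delta> k ==> k \<in> meas"
 by (simp add: csupp_def smooth_measurable)

lemma conv_integrable:
 fixes f :: "'b::euclidean_space => 'c::euclidean_space"
 assumes "csupp \<delta> k" "integrable lborel f"
 shows "integrable lborel (%y. k (z - y) *. f y)"
proof -
 obtain M where M: "M >= 0" "!!y. \<bar>k y\<bar> <= M" using csupp_bounded[OF assms(1)] by blast
 note [measurable] = csupp_measurable[OF assms(1)] borel_measurable_integrable[OF assms(2)]
 show ?thesis
  by (rule integrable_dominated[where f = "%y. M *. f y"])
    (use assms M in "auto intro!: mult_mono")
qed

lemma conv_continuous:
 fixes f :: "'b::euclidean_space => 'c::euclidean_space"
 assumes "csupp \<delta> k" "integrable lborel f"
 shows "continuous_on UNIV (conv k f)"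
proof (rule continuous_on_iff[THEN iffD2], intro ballI allI impI)
 fix z :: 'b and e :: real assume e: "e > 0"
 define F where "F = (LI y. norm (f y))"
 have F: "F >= 0" by (simp add: F_def)
 obtain d where d: "d > 0" "!!x y. dist x y < d ==> \<bar>k x - k y\<bar> < e / (F + 1)"
  using csupp_uc[OF assms(1), of "e / (F + 1)"] e F by auto
 show "\<exists>d>0. \<forall>z'\<in>UNIV. dist z' z < d --> dist (conv k f z') (conv k f z) < e"
 proof (intro exI[of _ d] conjI ballI impI d)
  fix z' assume z': "dist z' z < d"
  have "norm (conv k f z' - conv k f z) = norm (LI y. (k (z' - y) - k (z - y)) *. f y)"
   unfolding conv_def using conv_integrable[OF assms]
   by (subst Bochner_Integration.integral_diff[symmetric]) (auto simp: scaleR_diff_left)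
  also have "... <= (LI y. (e / (F + 1)) * norm (f y))"
  proof (rule Bochner_Integration.integral_norm_bound_integral)
   show "integrable lborel (%y. (k (z' - y) - k (z - y)) *. f y)"
    using conv_integrable[OF assms] by (auto simp: scaleR_diff_left)
   show "norm ((k (z' - y) - k (z - y)) *. f y) <= e / (F + 1) * norm (f y)" for y
    using d(2)[of "z' - y" "z - y"] z' by (auto intro!: mult_right_mono simp: dist_norm less_imp_le simp del: times_divide_eq_left)
  qed (rule integrable_mult_right[OF integrable_norm[OF assms(2)]])
  also have "... = e * (F / (F + 1))" by (simp add: F_def)
  also have "... < e * 1" using e F by (intro mult_strict_left_mono) auto
  finally show "dist (conv k f z') (conv k f z) < e" by (simp add: dist_norm)
 qed
qed

lemma linear_pd_sum:
 assumes "smooth (k :: 'b::euclidean_space => real)"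
 shows "frechet_derivative k (at x) h = (\<Sum>b\<in>Basis. (h \<bullet> b) * pd b k x)"
proof -
 have l: "linear (frechet_derivative k (at x))"
  using smooth_has_derivative[OF assms] has_derivative_linear by blast
 have "frechet_derivative k (at x) h = frechet_derivative k (at x) (\<Sum>b\<in>Basis. (h \<bullet> b) *. b)"
  by (simp add: euclidean_representation)
 also have "... = (\<Sum>b\<in>Basis. (h \<bullet> b) * pd b k x)" using l by (simp add: linear_sum linear_cmul)
 finally show ?thesis .
qed

text \<open>Uniformity in \<open>x\<close> is what permits differentiation under the integral in
  \<open>conv\<close>. It follows from the mean value theorem on the segment from \<open>x\<close>
  to \<open>x + h\<close> and from uniform continuity of the compactly supported partial
  derivatives.\<close>

lemma csupp_derivative_uniform:
 fixes k :: "'b::euclidean_space => real"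
 assumes "csupp \<delta> k" "e > 0"
 obtains d where "d > 0" "!!x h. norm h < d ==> \<bar>k (x + h) - k x - frechet_derivative k (at x) h\<bar> <= e * norm h"
proof -
 define n where "n = real DIM('b)"
 have n: "n > 0" by (simp add: n_def)
 have "\<exists>d>0. \<forall>x y. dist x y < d --> \<bar>pd b k x - pd b k y\<bar> < e / n" if "b \<in> Basis" for b
  using csupp_uc[OF csupp_pd[OF assms(1) that], of "e / n"] assms(2) n by (metis divide_pos_pos)
 then obtain D where D: "!!b. b \<in> Basis ==> D b > 0"
  "!!b x y. b \<in> Basis ==> dist x y < D b ==> \<bar>pd b k x - pd b k y\<bar> < e / n" by metis
 define d where "d = Min (D ` Basis)"
 have d: "d > 0" "!!b. b \<in> Basis ==> d <= D b" using D(1) by (auto simp: d_def)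
 note lin = linear_pd_sum[OF csupp_smooth[OF assms(1)]]
 show ?thesis
 proof (rule that[OF d(1)])
  fix x h :: 'b assume h: "norm h < d"
  define g where "g t = k (x + t *. h)" for t
  have g': "(g has_real_derivative frechet_derivative k (at (x + t *. h)) h) (at t)" for t
  proof -
   have "((%t. x + t *. h) has_derivative (%s. s *. h)) (at t)" by (auto intro!: derivative_eq_intros)
   from has_derivative_compose[OF this smooth_has_derivative[OF csupp_smooth[OF assms(1)]]]
   have "(g has_derivative (%s. frechet_derivative k (at (x + t *. h)) (s *. h))) (at t)"
    unfolding g_def .
   moreover have "frechet_derivative k (at (x + t *. h)) (s *. h) = frechet_derivative k (at (x + t *. h)) h * s" for s
    using linear_cmul[OF has_derivative_linear[OF smooth_has_derivative[OF csupp_smooth[OF assms(1)]]]] by (simp add: mult.commute)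
   ultimately show ?thesis by (simp add: has_field_derivative_def)
  qed
  obtain t where t: "0 < t" "t < 1" "g 1 - g 0 = (1 - 0) * frechet_derivative k (at (x + t *. h)) h"
   using MVT2[of 0 1 g "%t. frechet_derivative k (at (x + t *. h)) h"] g' by auto
  have "\<bar>k (x + h) - k x - frechet_derivative k (at x) h\<bar>
    = \<bar>\<Sum>b\<in>Basis. (h \<bullet> b) * (pd b k (x + t *. h) - pd b k x)\<bar>"
   using t(3) by (simp add: g_def lin[of _ h] right_diff_distrib sum_subtractf)
  also have "... <= (\<Sum>b\<in>Basis. \<bar>(h \<bullet> b) * (pd b k (x + t *. h) - pd b k x)\<bar>)" by (rule sum_abs)
  also have "... <= (\<Sum>b\<in>(Basis::'b set). norm h * (e / n))"
  proof (rule sum_mono)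
   fix b :: 'b assume b: "b \<in> Basis"
   have "norm (t *. h) <= norm h" using t by (simp add: mult_left_le_one_le)
   then have "dist (x + t *. h) x < D b" using h d(2)[OF b] by (simp add: dist_norm)
   from D(2)[OF b this] Basis_le_norm[OF b, of h]
   show "\<bar>(h \<bullet> b) * (pd b k (x + t *. h) - pd b k x)\<bar> <= norm h * (e / n)"
    unfolding abs_mult by (intro mult_mono) auto
  qed
  also have "... = e * norm h" using n by (simp add: n_def)
  finally show "\<bar>k (x + h) - k x - frechet_derivative k (at x) h\<bar> <= e * norm h" .
 qed
qed

lemma conv_has_derivative:
 fixes f :: "'b::euclidean_space => real"
 assumes k: "csupp \<delta> k" and f: "integrable lborel f"
 shows "(conv k f has_derivative (%h. \<Sum>b\<in>Basis. (h \<bullet> b) * conv (pd b k) f z)) (at z)"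
proof -
 have lin: "(\<Sum>b\<in>Basis. (h \<bullet> b) * conv (pd b k) f z) = (LI y. frechet_derivative k (at (z - y)) h * f y)" for h
 proof -
  have "(LI y. frechet_derivative k (at (z - y)) h * f y)
    = (LI y. (\<Sum>b\<in>Basis. (h \<bullet> b) * (pd b k (z - y) * f y)))"
   by (subst linear_pd_sum[OF csupp_smooth[OF k]]) (simp add: sum_distrib_right mult.assoc)
  also have "... = (\<Sum>b\<in>Basis. LI y. (h \<bullet> b) * (pd b k (z - y) * f y))"
   by (rule Bochner_Integration.integral_sum) (use conv_integrable[OF csupp_pd[OF k] f, of _ z] in auto)
  finally show ?thesis by (simp add: conv_def)
 qed
 have int: "integrable lborel (%y. frechet_derivative k (at (z - y)) h * f y)" for h
 proof -
  have "integrable lborel (%y. \<Sum>b\<in>Basis. (h \<bullet> b) * (pd b k (z - y) * f y))"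
   by (rule Bochner_Integration.integrable_sum) (use conv_integrable[OF csupp_pd[OF k] f, of _ z] in auto)
  then show ?thesis by (subst linear_pd_sum[OF csupp_smooth[OF k]]) (simp add: sum_distrib_right mult.assoc)
 qed
 define F where "F = (LI y. norm (f y))"
 have F: "F >= 0" by (simp add: F_def)
 show ?thesis unfolding has_derivative_at_alt
 proof (intro conjI allI impI)
  show "bounded_linear (%h. \<Sum>b\<in>Basis. h \<bullet> b * conv (pd b k) f z)"
   by (intro bounded_linear_sum bounded_linear_mult_const bounded_linear_inner_left)
  fix e :: real assume e: "e > 0"
  obtain d where d: "d > 0" "!!x h. norm h < d ==> \<bar>k (x + h) - k x - frechet_derivative k (at x) h\<bar> <= e / (F + 1) * norm h"
   using csupp_derivative_uniform[OF k, of "e / (F + 1)"] e F by auto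
  show "\<exists>d>0. \<forall>y. norm (y - z) < d --> norm (conv k f y - conv k f z - (\<Sum>b\<in>Basis. (y - z) \<bullet> b * conv (pd b k) f z)) <= e * norm (y - z)"
  proof (intro exI[of _ d] conjI allI impI d(1))
   fix y assume y: "norm (y - z) < d"
   define h where "h = y - z"
   have "norm (conv k f y - conv k f z - (\<Sum>b\<in>Basis. (y - z) \<bullet> b * conv (pd b k) f z))
    = norm (LI x. (k ((z - x) + h) - k (z - x) - frechet_derivative k (at (z - x)) h) * f x)"
    unfolding lin h_def[symmetric] unfolding conv_def
    using conv_integrable[OF k f, of z] conv_integrable[OF k f, of y] int[of h]
    by (simp add: left_diff_distrib h_def algebra_simps)
   also have "... <= (LI x. (e / (F + 1) * norm h) * norm (f x))"
   proof (rule Bochner_Integration.integral_norm_bound_integral)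
    show "integrable lborel (%x. (k ((z - x) + h) - k (z - x) - frechet_derivative k (at (z - x)) h) * f x)"
     using conv_integrable[OF k f, of z] conv_integrable[OF k f, of y] int[of h]
     by (simp add: left_diff_distrib h_def algebra_simps)
    show "norm ((k (z - x + h) - k (z - x) - pd h k (z - x)) * f x) <= e / (F + 1) * norm h * norm (f x)" for x
     using d(2)[of h "z - x"] y unfolding h_def[symmetric] norm_mult by (intro mult_right_mono) auto
   qed (rule integrable_mult_right[OF integrable_norm[OF f]])
   also have "... = e * norm h * (F / (F + 1))" by (simp add: F_def)
   also have "... <= e * norm h * 1" using e F by (intro mult_left_mono) auto
   finally show "norm (conv k f y - conv k f z - (\<Sum>b\<in>Basis. (y - z) \<bullet> b * conv (pd b k) f z)) <= e * norm (y - z)"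
    by (simp add: h_def)
  qed
 qed
qed

lemma pd_conv:
 fixes f :: "'b::euclidean_space => real"
 assumes "csupp \<delta> k" "integrable lborel f" "b \<in> Basis"
 shows "pd b (conv k f) z = conv (pd b k) f z"
proof -
 have "frechet_derivative (conv k f) (at z) = (%h. \<Sum>b\<in>Basis. (h \<bullet> b) * conv (pd b k) f z)"
  by (rule frechet_derivative_at[OF conv_has_derivative[OF assms(1,2)], symmetric])
 then show ?thesis using assms(3) by (simp add: inner_Basis if_distrib[where f = "%x. x * _"] cong: if_cong)
qed

lemma conv_smooth:
 fixes f :: "'b::euclidean_space => real"
 assumes "csupp \<delta> k" and f: "integrable lborel f"
 shows "smooth (conv k f)"
proof -
 have "csupp \<delta> k ==> Ck n (conv k f)" for n k
 proof (induction n arbitrary: k)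
  case 0
  then show ?case using conv_continuous f by auto
 next
  case (Suc n)
  show ?case
  proof (rule Ck_cong_pd[OF conv_has_derivative[OF Suc.prems f]])
   fix b :: 'b assume b: "b \<in> Basis"
   show "Ck n (%z. \<Sum>b'\<in>Basis. b \<bullet> b' * conv (pd b' k) f z)"
    by (intro Ck_sum Ck_mult Ck_const Suc.IH csupp_pd[OF Suc.prems]) auto
  qed
 qed
 then show ?thesis using assms by (simp add: smooth_def)
qed

subsection \<open>Mollifiers\<close>

text \<open>Evenness is included so that \<open>conv k f x\<close> becomes the average of the
  translates \<open>f (x + h)\<close> with weight \<open>k h\<close>, the form in which moduli of
  translation give its distance from \<open>f\<close>.\<close>

definition mollifier :: "real => ('b::euclidean_space => real) => bool" where
 "mollifier \<delta> k \<longleftrightarrow> csupp \<delta> k \<and> (\<forall>y. k y >= 0) \<and> (\<forall>y. k (- y) = k y) \<and> integrable lborel k \<and> (LI y. k y) = 1"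

lemma csupp_integrable:
 assumes "csupp \<delta> (k :: 'b::euclidean_space => real)" shows "integrable lborel k"
proof -
 obtain M where M: "M >= 0" "!!y. \<bar>k y\<bar> <= M" using csupp_bounded[OF assms(1)] by blast
 note [measurable] = csupp_measurable[OF assms(1)]
 have "integrable lborel (%y. indicator (cball (0::'b) \<delta>) y *. M)"
  using emeasure_lborel_cball_finite[of "0::'b" \<delta>] by (intro integrable_scaleR_left integrable_real_indicator) auto
 then show ?thesis
 proof (rule integrable_dominated, measurable, intro AE_I2)
  show "norm (k y) <= norm (indicator (cball (0::'b) \<delta>) y *. M)" for y
   using M(1) M(2)[of y] assms by (cases "norm y <= \<delta>") (auto simp: csupp_def)
 qed
qed

lemma mollifier_exists:
 assumes "\<delta> > 0" obtains k :: "'b::euclidean_space => real" where "mollifier \<delta> k"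
proof -
 define k0 where "k0 y = psi (\<delta>\<^sup>2 + (-1) * (norm y)\<^sup>2)" for y :: 'b
 have s: "smooth k0" unfolding k0_def
  by (intro smooth_compose_real[OF _ smooth_psi] smooth_add smooth_mult smooth_const smooth_norm_sq)
 have c: "csupp \<delta> k0"
  using s assms by (auto simp: csupp_def k0_def intro!: psi_zero power_mono)
 have pos: "k0 y > 0" if "norm y < \<delta>" for y using that assms by (auto simp: k0_def intro!: psi_pos power_strict_mono)
 have nn: "k0 y >= 0" for y by (simp add: k0_def psi_nonneg)
 have sym: "k0 (- y) = k0 y" for y by (simp add: k0_def)
 have i: "integrable lborel k0" by (rule csupp_integrable[OF c])
 have "(LI y. k0 y) ~= 0"
 proof
  assume "(LI y. k0 y) = 0"
  then have "AE y in lborel. k0 y = 0" using integral_nonneg_eq_0_iff_AE[OF i] nn by auto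
  then have "AE y in lborel. y \<notin> ball (0::'b) \<delta>" by eventually_elim (use pos in force)
  then have "emeasure lborel (ball (0::'b) \<delta>) = 0" by (subst (asm) AE_iff_null) (auto simp: null_sets_def ball_def)
  then have "ball (0::'b) \<delta> \<in> null_sets lborel" by auto
  then show False using open_not_negligible[of "ball (0::'b) \<delta>"] assms
   by (simp add: negligible_iff_null_sets null_sets_completionI)
 qed
 then have I: "(LI y. k0 y) > 0" using nn by (simp add: less_le Bochner_Integration.integral_nonneg)
 define k where "k y = 1 / (LI y. k0 y) * k0 y" for y
 have "smooth k" unfolding k_def by (intro smooth_mult smooth_const s)
 moreover have "integrable lborel k" using i by (simp add: k_def[abs_def])
 ultimately have "mollifier \<delta> k"
  using c i I nn sym by (auto simp: mollifier_def csupp_def k_def)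
 then show ?thesis using that by blast
qed

lemma lborel_shift:
 fixes f :: "'b::euclidean_space => 'c::{banach,second_countable_topology}"
 assumes [measurable]: "f \<in> meas"
 shows "integrable lborel (%x. f (x + h)) \<longleftrightarrow> integrable lborel f" (is ?c1) "(LI x. f (x + h)) = (LI x. f x)"
proof -
 have "integrable (distr lborel borel ((+) h)) f \<longleftrightarrow> integrable lborel (%x. f (h + x))"
  by (rule integrable_distr_eq) auto
 then show ?c1 by (simp add: lborel_distr_plus add.commute)
 have "(LINT x|distr lborel borel ((+) h). f x) = (LI x. f (h + x))"
  by (rule integral_distr) auto
 then show "(LI x. f (x + h)) = (LI x. f x)" by (simp add: lborel_distr_plus add.commute)
qed

section \<open>Continuity of translations in L^1 and L^p\<close>

lemma borel_approx_compact_open: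
 fixes A :: "'b::euclidean_space set"
 assumes A: "A \<in> sets borel" "emeasure lborel A < \<infinity>" and e: "(e::real) > 0"
 obtains K U where "compact K" "open U" "K \<subseteq> A" "A \<subseteq> U" "emeasure lborel (U - K) < e"
proof -
 obtain U where U: "open U" "A \<subseteq> U" "emeasure lborel (U - A) < ennreal (e/3)"
  using outer_regular_lborel[of A "e/3"] A e by auto
 obtain V where V: "open V" "- A \<subseteq> V" "emeasure lborel (V - (- A)) < ennreal (e/3)"
  using outer_regular_lborel[of "- A" "e/3"] A e by auto
 have [measurable]: "A \<in> sets borel" "U \<in> sets borel" "V \<in> sets borel" using A U V by auto
 have "(%n. emeasure lborel (A - cball 0 (real n))) ----> emeasure lborel (\<Inter>n. A - cball 0 (real n))"
 proof (rule Lim_emeasure_decseq)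
  show "decseq (%n. A - cball 0 (real n))" by (force simp: decseq_def)
  show "emeasure lborel (A - cball 0 (real n)) ~= \<infinity>" for n
  proof -
   have "emeasure lborel (A - cball 0 (real n)) <= emeasure lborel A" by (rule emeasure_mono) auto
   then show ?thesis using A(2) by (auto simp: top_unique)
  qed
 qed auto
 moreover have "(\<Inter>n. A - cball 0 (real n)) = {}"
 proof -
  have "x \<in> cball 0 (real (nat \<lceil>norm x\<rceil>))" for x :: 'b by (simp add: real_nat_ceiling_ge)
  then show ?thesis by blast
 qed
 ultimately have "(%n. emeasure lborel (A - cball 0 (real n))) ----> 0" by (simp only: emeasure_empty)
 then have "eventually (%n. emeasure lborel (A - cball 0 (real n)) < ennreal (e/3)) sequentially"
  using e by (intro order_tendstoD(2)[of _ 0]) auto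
 then obtain n where n: "emeasure lborel (A - cball 0 (real n)) < ennreal (e/3)"
  using eventually_happens by force
 \<comment> \<open>The complement of an open set containing \<open>- A\<close> is a closed subset of
   \<open>A\<close>; the ball, which loses little of \<open>A\<close>, makes it compact.\<close>
 define K where "K = (- V) \<inter> cball 0 (real n)"
 show ?thesis
 proof (rule that[of K U])
  show "compact K" unfolding K_def using V(1) by (intro closed_Int_compact) auto
  show "K \<subseteq> A" using V(2) by (auto simp: K_def)
  have "emeasure lborel (U - K) <= emeasure lborel ((U - A) \<union> ((V - (- A)) \<union> (A - cball 0 (real n))))"
   by (rule emeasure_mono) (auto simp: K_def)
  also have "... <= emeasure lborel (U - A) + (emeasure lborel (V - (- A)) + emeasure lborel (A - cball 0 (real n)))"
   by (intro order_trans[OF emeasure_subadditive] add_left_mono) auto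
  also have "... < ennreal (e/3) + (ennreal (e/3) + ennreal (e/3))"
   by (intro add_strict_mono U V n)
  also have "... = ennreal e" using e by (simp flip: ennreal_plus)
  finally show "emeasure lborel (U - K) < e" .
 qed (use U in auto)
qed

text \<open>The claim passes from indicators to sums and dominated limits. For an indicator of
  \<open>A\<close> with \<open>K\<close> compact inside and \<open>U\<close> open outside, a shift
  shorter than the distance from \<open>K\<close> to the complement of \<open>U\<close> changes the
  indicator only at points where \<open>x\<close> or \<open>x + h\<close> lies in
  \<open>U - K\<close>, a set of small measure.\<close>

lemma L1_translation:
 fixes f :: "'b::euclidean_space => 'c::euclidean_space"
 assumes "integrable lborel f" "e > 0"
 shows "\<exists>d>0. \<forall>h. norm h < d --> (LI x. norm (f (x + h) - f x)) < e"
 using assms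
proof (induction arbitrary: e rule: integrable_induct)
 case (base A c)
 define n where "n = norm c + 1"
 have n: "n > 0" "norm c < n" by (auto simp: n_def add_nonneg_pos)
 define e' where "e' = e / (2 * n)"
 have e': "e' > 0" using base n by (auto simp: e'_def)
 have Ab: "A \<in> sets borel" using base by simp
 obtain K U where KU: "compact K" "open U" "K \<subseteq> A" "A \<subseteq> U" "emeasure lborel (U - K) < ennreal e'"
  using borel_approx_compact_open[OF Ab _ e'] base by blast
 obtain d where d: "d > 0" "!!x y. x \<in> K ==> y \<in> - U ==> d <= dist x y"
  using separate_compact_closed[of K "- U"] KU by blast
 have [measurable]: "A \<in> sets borel" "U \<in> sets borel" "K \<in> sets borel" using base KU by (auto simp: borel_compact)
 have fin: "emeasure lborel (U - K) < \<infinity>" unfolding infinity_ennreal_def using KU(5) ennreal_less_top less_trans by blast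
 define \<phi> where "\<phi> x = (indicator (U - K) x :: real)" for x
 have i\<phi>: "integrable lborel \<phi>" unfolding \<phi>_def using fin by (intro integrable_real_indicator) auto
 have i\<phi>h: "integrable lborel (%x. \<phi> (x + h))" for h
  using i\<phi> lborel_shift(1)[of \<phi> h] by (simp add: \<phi>_def)
 have s\<phi>: "(LI x. \<phi> (x + h)) = (LI x. \<phi> x)" for h
  by (rule lborel_shift(2)) (simp add: \<phi>_def[abs_def])
 have iA: "integrable lborel (%x. indicat_real A x *. c)"
  using base by (intro integrable_scaleR_left integrable_real_indicator) auto
 have iAh: "integrable lborel (%x. indicat_real A (x + h) *. c)" for h
  using iA lborel_shift(1)[of "%x. indicat_real A x *. c" h] by simp
 have I\<phi>: "(LI x. \<phi> x) < e'"
 proof -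
  have "(LI x. \<phi> x) = measure lborel (U - K)" by (simp add: \<phi>_def)
  also have "... < e'" using KU(5) fin e' by (simp add: emeasure_eq_ennreal_measure ennreal_less_iff)
  finally show ?thesis .
 qed
 show ?case
 proof (intro exI[of _ d] conjI allI impI d(1))
  fix h :: 'b assume h: "norm h < d"
  have key: "norm (indicator A (x + h) *. c - indicator A x *. c) <= (\<phi> (x + h) + \<phi> x) * norm c" for x
  proof -
   have "x + h \<in> U" if "x \<in> K" using d(2)[OF that, of "x + h"] h by (auto simp: dist_norm)
   moreover have "x \<in> U" if "x + h \<in> K" using d(2)[OF that, of "x"] h by (auto simp: dist_norm)
   ultimately show ?thesis using KU(3,4) by (auto simp: \<phi>_def indicator_def)
  qed
  have "(LI x. norm (indicator A (x + h) *. c - indicator A x *. c)) <= (LI x. (\<phi> (x + h) + \<phi> x) * norm c)"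
   by (rule integral_mono) (use key iA iAh i\<phi> i\<phi>h in auto)
  also have "... = ((LI x. \<phi> x) + (LI x. \<phi> x)) * norm c"
   using i\<phi> i\<phi>h s\<phi> by simp
  also have "... <= (e' + e') * norm c" using I\<phi> by (intro mult_right_mono) auto
  also have "... < (e' + e') * n" using e' n by (intro mult_strict_left_mono) auto
  also have "... = e" using n by (simp add: e'_def field_simps)
  finally show "(LI x. norm (indicator A (x + h) *. c - indicator A x *. c)) < e" .
 qed
next
 case (add f g)
 obtain d1 where d1: "d1 > 0" "!!h. norm h < d1 ==> (LI x. norm (f (x + h) - f x)) < e/2"
  using add(3)[of "e/2"] add.prems by auto
 obtain d2 where d2: "d2 > 0" "!!h. norm h < d2 ==> (LI x. norm (g (x + h) - g x)) < e/2"
  using add(4)[of "e/2"] add.prems by auto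
 note [measurable] = borel_measurable_integrable[OF add(1)] borel_measurable_integrable[OF add(2)]
 have i: "integrable lborel (%x. f (x + h))" "integrable lborel (%x. g (x + h))" for h
  using add lborel_shift(1)[of f h] lborel_shift(1)[of g h] by auto
 show ?case
 proof (intro exI[of _ "min d1 d2"] conjI allI impI)
  fix h :: 'b assume h: "norm h < min d1 d2"
  have "(LI x. norm (f (x + h) + g (x + h) - (f x + g x)))
    <= (LI x. norm (f (x + h) - f x) + norm (g (x + h) - g x))"
   by (rule integral_mono) (use i add in "auto intro!: norm_diff_triangle_ineq")
  also have "... = (LI x. norm (f (x + h) - f x)) + (LI x. norm (g (x + h) - g x))"
   by (rule Bochner_Integration.integral_add) (use i add in auto)
  also have "... < e" using d1(2)[of h] d2(2)[of h] h by auto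
  finally show "(LI x. norm (f (x + h) + g (x + h) - (f x + g x))) < e" .
 qed (use d1 d2 in auto)
next
 case (lim f s)
 note [measurable] = borel_measurable_integrable[OF lim.hyps(4)] borel_measurable_integrable[OF lim.hyps(1)]
 have "(%i. LI x. norm (s i x - f x)) ----> (LINT x|(lborel::'b measure). 0)"
 proof (rule integral_dominated_convergence[where w = "%x. 3 * norm (f x)"])
  show "AE x in lborel. (%i. norm (s i x - f x)) ----> 0"
   using lim.hyps(2) by (auto intro!: tendsto_norm_zero LIM_zero)
  show "AE x in lborel. norm (norm (s i x - f x)) <= 3 * norm (f x)" for i
  proof (intro AE_I2)
   show "norm (norm (s i x - f x)) <= 3 * norm (f x)" for x
    using lim.hyps(3)[of x i] norm_triangle_ineq4[of "s i x" "f x"] by simp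
  qed
 qed (use lim.hyps in auto)
 then have "eventually (%i. (LI x. norm (s i x - f x)) < e/3) sequentially"
  using lim.prems by (intro order_tendstoD(2)[of _ 0]) auto
 then obtain i where i: "(LI x. norm (s i x - f x)) < e/3" using eventually_happens by force
 obtain d where d: "d > 0" "!!h. norm h < d ==> (LI x. norm (s i (x + h) - s i x)) < e/3"
  using lim.IH[of "e/3" i] lim.prems by auto
 show ?case
 proof (intro exI[of _ d] conjI allI impI d(1))
  fix h :: 'b assume h: "norm h < d"
  have ii: "integrable lborel (%x. f (x + h))" "integrable lborel (%x. s i (x + h))"
   using lim lborel_shift(1)[of f h] lborel_shift(1)[of "s i" h] by auto
  have "(LI x. norm (f (x + h) - f x))
    <= (LI x. norm (s i (x + h) - f (x + h)) + (norm (s i (x + h) - s i x) + norm (s i x - f x)))"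
  proof (rule integral_mono)
   show "norm (f (x + h) - f x) <= norm (s i (x + h) - f (x + h)) + (norm (s i (x + h) - s i x) + norm (s i x - f x))" for x
    by norm
  qed (use ii lim in auto)
  also have "... = (LI x. norm (s i (x + h) - f (x + h))) + ((LI x. norm (s i (x + h) - s i x)) + (LI x. norm (s i x - f x)))"
   using ii lim by simp
  also have "(LI x. norm (s i (x + h) - f (x + h))) = (LI x. norm (s i x - f x))"
   using lborel_shift(2)[of "%x. norm (s i x - f x)" h] by simp
  finally show "(LI x. norm (f (x + h) - f x)) < e" using i d(2)[OF h] by simp
 qed
qed

subsection \<open>Convergence of mollifications in Lp\<close>

lemma powr_add_le:
 fixes a b p :: real assumes "0 <= a" "0 <= b" "0 <= p"
 shows "(a + b) powr p <= 2 powr p * (a powr p + b powr p)"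
proof -
 have "(a + b) powr p <= (2 * max a b) powr p" using assms by (intro powr_mono2) auto
 also have "... = 2 powr p * (max a b) powr p" using assms by (simp add: powr_mult)
 also have "... <= 2 powr p * (a powr p + b powr p)" by (intro mult_left_mono) (auto simp: max_def)
 finally show ?thesis .
qed

text \<open>Convexity in tangent form, with the endpoint 0 included. Integrated against a
  probability density it gives Jensen's inequality, which is its purpose in
  \<open>conv_Lp\<close>.\<close>

lemma powr_above_tangent:
 fixes a y p :: real assumes "0 <= a" "0 <= y" "1 <= p"
 shows "a powr p + p * a powr (p - 1) * (y - a) <= y powr p"
proof (cases "a = 0 \<or> y = 0")
 case True
 have "a powr p = a * a powr (p - 1)" using assms by (cases "a = 0") (auto simp: powr_mult_base)
 moreover have "a powr p <= p * a powr p" using mult_right_mono[of 1 p "a powr p"] assms by simp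
 ultimately show ?thesis using True assms by (auto simp: algebra_simps)
next
 case False
 then have pos: "a > 0" "y > 0" using assms by auto
 have "y powr p - a powr p >= (p * a powr (p - 1)) * (y - a)"
  by (rule convex_on_imp_above_tangent[OF powr_convex[OF assms(3)], where c = a])
    (use pos in "auto intro!: derivative_eq_intros simp: interior_open")
 then show ?thesis by simp
qed

lemma Lp_shift_bound:
 fixes f :: "'b::euclidean_space => 'c::euclidean_space"
 assumes "0 <= p"
 shows "norm (f (x + h) - f x) powr p <= 2 powr p * (norm (f (x + h)) powr p + norm (f x) powr p)"
proof -
 have "norm (f (x + h) - f x) powr p <= (norm (f (x + h)) + norm (f x)) powr p"
  by (rule powr_mono2[OF assms norm_ge_zero norm_triangle_ineq4])
 also have "... <= 2 powr p * (norm (f (x + h)) powr p + norm (f x) powr p)"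
  by (rule powr_add_le[OF norm_ge_zero norm_ge_zero assms])
 finally show ?thesis .
qed

lemma integrable_Lp_shift:
 fixes f :: "'b::euclidean_space => 'c::euclidean_space"
 assumes [measurable]: "f \<in> meas" and p: "0 <= p" "integrable lborel (%x. norm (f x) powr p)"
 shows "integrable lborel (%x. norm (f (x + h) - f x) powr p)"
proof (rule integrable_dominated)
 show "integrable lborel (%x. 2 powr p * (norm (f (x + h)) powr p + norm (f x) powr p))"
  using p lborel_shift(1)[of "%x. norm (f x) powr p" h] by simp
 show "AE x in lborel. norm (norm (f (x + h) - f x) powr p) <= norm (2 powr p * (norm (f (x + h)) powr p + norm (f x) powr p))"
  using Lp_shift_bound[OF p(1), of f] by (intro AE_I2) (simp add: powr_ge_zero abs_of_nonneg del: norm_powr_real_powr)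
qed simp

text \<open>Truncation at a high level \<open>M\<close> splits \<open>f\<close> into a bounded part
  and a part small in \<open>L^p\<close>. Differences of the bounded part are at most
  \<open>2 M\<close>, so their \<open>p\<close>-th power is at most
  \<open>(2 M) powr (p - 1)\<close> times their norm and the \<open>L^1\<close> result
  applies.\<close>

lemma Lp_translation:
 fixes f :: "'b::euclidean_space => 'c::euclidean_space"
 assumes f: "integrable lborel f" "integrable lborel (%x. norm (f x) powr p)" and p: "1 <= p" and e: "e > 0"
 shows "\<exists>d>0. \<forall>h. norm h < d --> (LI x. norm (f (x + h) - f x) powr p) < e"
proof -
 have [measurable]: "f \<in> meas" using borel_measurable_integrable[OF f(1)] by simp
 define T where "T M x = (if norm (f x) <= M then f x else 0)" for M x
 have [measurable]: "T M \<in> meas" for M unfolding T_def[abs_def] by measurable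
 have "(%n. LI x. norm (f x - T (real n) x) powr p) ----> (LINT x|(lborel::'b measure). 0)"
 proof (rule dominated_conv[where w = "%x. norm (f x) powr p"])
  show "AE x in lborel. (%n. norm (f x - T (real n) x) powr p) ----> 0"
  proof (intro AE_I2)
   fix x
   have "eventually (%n. norm (f x) <= real n) sequentially"
    using eventually_ge_at_top[of "nat \<lceil>norm (f x)\<rceil>"] by eventually_elim linarith
   then have "eventually (%n. norm (f x - T (real n) x) powr p = 0) sequentially"
    by eventually_elim (simp add: T_def)
   then show "(%n. norm (f x - T (real n) x) powr p) ----> 0" by (rule tendsto_eventually)
  qed
  show "AE x in lborel. norm (norm (f x - T (real n) x) powr p) <= norm (f x) powr p" for n
   by (intro AE_I2) (auto simp: T_def)
 qed (use f in auto)
 then have "eventually (%n. (LI x. norm (f x - T (real n) x) powr p) < e / (4 * (2 powr p * 2 powr p))) sequentially"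
  using e by (intro order_tendstoD(2)[of _ 0]) auto
 then have "eventually (%n. (LI x. norm (f x - T (real n) x) powr p) < e / (4 * (2 powr p * 2 powr p)) \<and> n >= 1) sequentially"
  using eventually_ge_at_top[of 1] by eventually_elim auto
 then obtain n where n: "(LI x. norm (f x - T (real n) x) powr p) < e / (4 * (2 powr p * 2 powr p))" "n >= 1"
  using eventually_happens by force
 define M where "M = real n"
 define F where "F = T M"
 define g where "g x = f x - F x" for x
 define c where "c = (2 * M) powr (p - 1)"
 have M: "M >= 1" using n by (simp add: M_def)
 have c: "c > 0" using M by (simp add: c_def)
 have [measurable]: "F \<in> meas" "g \<in> meas" by (simp_all add: F_def g_def[abs_def])
 have iF: "integrable lborel F"
  by (rule integrable_dominated[OF f(1)]) (auto simp: F_def T_def)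
 have Fb: "norm (F x) <= M" for x using M by (auto simp: F_def T_def)
 have ig: "integrable lborel (%x. norm (g x) powr p)"
  by (rule integrable_dominated[OF f(2)]) (auto simp: g_def F_def T_def)
 have gI: "(LI x. norm (g x) powr p) < e / (4 * (2 powr p * 2 powr p))" using n(1) by (simp add: g_def F_def M_def)
 obtain d where d: "d > 0" "!!h. norm h < d ==> (LI x. norm (F (x + h) - F x)) < e / (2 * (2 powr p * c))"
  using L1_translation[OF iF, of "e / (2 * (2 powr p * c))"] e c by auto
 show ?thesis
 proof (intro exI[of _ d] conjI allI impI d(1))
  fix h :: 'b assume h: "norm h < d"
  have igs: "integrable lborel (%x. norm (g (x + h)) powr p)" using ig lborel_shift(1)[of "%x. norm (g x) powr p" h] by simp
  have iFs: "integrable lborel (%x. F (x + h))" using iF lborel_shift(1)[of F h] by simp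
  have "(LI x. norm (f (x + h) - f x) powr p)
   <= (LI x. 2 powr p * c * norm (F (x + h) - F x) + 2 powr p * 2 powr p * (norm (g (x + h)) powr p + norm (g x) powr p))"
  proof (rule integral_mono)
   fix x
   have "norm (f (x + h) - f x) powr p <= (norm (F (x + h) - F x) + norm (g (x + h) - g x)) powr p"
    using p unfolding g_def by (intro powr_mono2) norm+
   also have "... <= 2 powr p * (norm (F (x + h) - F x) powr p + norm (g (x + h) - g x) powr p)"
    using p by (intro powr_add_le) auto
   also have "norm (F (x + h) - F x) powr p <= c * norm (F (x + h) - F x)"
   proof -
    have "norm (F (x + h) - F x) <= 2 * M" using Fb[of "x + h"] Fb[of x] norm_triangle_ineq4[of "F (x + h)" "F x"] by simp
    then have "norm (F (x + h) - F x) powr (p - 1) <= c" unfolding c_def using p by (intro powr_mono2) auto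
    then have "norm (F (x + h) - F x) * norm (F (x + h) - F x) powr (p - 1) <= norm (F (x + h) - F x) * c"
     by (rule mult_left_mono) auto
    then show ?thesis by (simp add: powr_mult_base mult.commute)
   qed
   also have "norm (g (x + h) - g x) powr p <= 2 powr p * (norm (g (x + h)) powr p + norm (g x) powr p)"
    using p by (intro Lp_shift_bound) auto
   finally show "norm (f (x + h) - f x) powr p <= 2 powr p * c * norm (F (x + h) - F x) + 2 powr p * 2 powr p * (norm (g (x + h)) powr p + norm (g x) powr p)"
    by (simp add: algebra_simps)
  qed (use integrable_Lp_shift[of f p h] f p iF ig igs iFs in auto)
  also have "... = 2 powr p * c * (LI x. norm (F (x + h) - F x)) + 2 powr p * 2 powr p * ((LI x. norm (g (x + h)) powr p) + (LI x. norm (g x) powr p))"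
   using iF ig igs iFs by simp
  also have "(LI x. norm (g (x + h)) powr p) = (LI x. norm (g x) powr p)"
   using lborel_shift(2)[of "%x. norm (g x) powr p" h] by simp
  also have "2 powr p * c * (LI x. norm (F (x + h) - F x)) < 2 powr p * c * (e / (2 * (2 powr p * c)))"
   using d(2)[OF h] c by (intro mult_strict_left_mono) auto
  also have "... = e / 2" using c by simp
  also have "2 powr p * 2 powr p * ((LI x. norm (g x) powr p) + (LI x. norm (g x) powr p))
    <= 2 powr p * 2 powr p * (e / (4 * (2 powr p * 2 powr p)) + e / (4 * (2 powr p * 2 powr p)))"
   using gI by (intro mult_left_mono) auto
  also have "... = e / 2" by (simp add: field_simps)
  finally show "(LI x. norm (f (x + h) - f x) powr p) < e" by simp
 qed
qed

lemma conv_alt: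
 fixes f :: "'b::euclidean_space => 'c::euclidean_space"
 assumes k: "mollifier \<delta> k" and f: "integrable lborel f"
 shows "integrable lborel (%h. k h *. f (x + h))" (is ?c1) "conv k f x = (LI h. k h *. f (x + h))"
proof -
 have kc: "csupp \<delta> k" and ks: "!!y. k (- y) = k y" using k by (auto simp: mollifier_def)
 note [measurable] = csupp_measurable[OF kc] borel_measurable_integrable[OF f]
 show ?c1
  using conv_integrable[OF kc f, of x] lborel_shift(1)[of "%y. k (x - y) *. f y" x] by (simp add: ks add.commute)
 show "conv k f x = (LI h. k h *. f (x + h))"
  using lborel_shift(2)[of "%y. k (x - y) *. f y" x] by (simp add: ks add.commute conv_def)
qed

text \<open>By Jensen's inequality for the weight \<open>k\<close> and Tonelli's theorem, the
  \<open>L^p\<close> distance between \<open>f\<close> and its mollification is controlled by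
  translations of length at most \<open>\<delta>\<close>.\<close>

lemma conv_Lp:
 fixes f :: "'b::euclidean_space => 'c::euclidean_space"
 assumes f: "integrable lborel f" "integrable lborel (%x. norm (f x) powr p)" and p: "1 <= p" and e: "e >= 0"
  and k: "mollifier \<delta> k"
  and small: "!!h. norm h <= \<delta> ==> (LI x. norm (f (x + h) - f x) powr p) <= e"
 shows "integrable lborel (%x. norm (conv k f x - f x) powr p)" (is ?c1) "(LI x. norm (conv k f x - f x) powr p) <= e" (is ?c2)
proof -
 have kc: "csupp \<delta> k" and kn: "!!y. k y >= 0" and ki: "integrable lborel k" and k1: "(LI y. k y) = 1"
  using k by (auto simp: mollifier_def)
 have [measurable]: "k \<in> meas" "f \<in> meas"
  using csupp_measurable[OF kc] borel_measurable_integrable[OF f(1)] by auto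
 have [measurable]: "conv k f \<in> meas"
  using conv_continuous[OF kc f(1)] by (rule continuous_measurable)
 have pw: "ennreal (norm (conv k f x - f x) powr p) <= (\<integral>\<^sup>+h. ennreal (k h * norm (f (x + h) - f x) powr p) \<partial>lborel)" for x
 proof -
  have i1: "integrable lborel (%h. k h *. (f (x + h) - f x))"
   using conv_alt(1)[OF k f(1), of x] ki by (simp add: scaleR_diff_right)
  then have i1n: "integrable lborel (%h. k h * norm (f (x + h) - f x))"
   using integrable_norm[OF i1] kn by simp
  have "integrable lborel (%h. k h * norm (f (x + h)) powr p)"
   using conv_alt(1)[OF k f(2), of x] by simp
  then have "integrable lborel (%h. 2 powr p * (k h * norm (f (x + h)) powr p + k h * norm (f x) powr p))"
   using ki by simp
  then have i2: "integrable lborel (%h. k h * norm (f (x + h) - f x) powr p)"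
  proof (rule integrable_dominated, measurable, intro AE_I2)
   fix h
   have "k h * norm (f (x + h) - f x) powr p <= k h * (2 powr p * (norm (f (x + h)) powr p + norm (f x) powr p))"
    using p kn by (intro mult_left_mono Lp_shift_bound) auto
   then show "norm (k h * norm (f (x + h) - f x) powr p) <= norm (2 powr p * (k h * norm (f (x + h)) powr p + k h * norm (f x) powr p))"
    using kn by (simp add: abs_mult powr_ge_zero algebra_simps)
  qed
  define A where "A = (LI h. k h * norm (f (x + h) - f x))"
  have A: "A >= 0" unfolding A_def using kn by (simp add: Bochner_Integration.integral_nonneg)
  have "conv k f x - f x = (LI h. k h *. (f (x + h) - f x))"
   using conv_alt[OF k f(1), of x] ki k1 by (simp add: scaleR_diff_right)
  then have "norm (conv k f x - f x) <= A"
   unfolding A_def using integral_norm_bound[of lborel "%h. k h *. (f (x + h) - f x)"] kn by simp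
  then have "norm (conv k f x - f x) powr p <= A powr p" using p by (intro powr_mono2) auto
  \<comment> \<open>The tangent inequality at the mean \<open>A\<close> is integrated against
    \<open>k\<close>; its linear term integrates to zero because \<open>k\<close> has mass 1 and
    \<open>A\<close> is the \<open>k\<close>-mean.\<close>
  also have "... = (LI h. A powr p * k h + p * A powr (p - 1) * (k h * norm (f (x + h) - f x) - A * k h))"
   using ki i1n k1 by (simp add: A_def)
  also have "... <= (LI h. k h * norm (f (x + h) - f x) powr p)"
  proof (rule integral_mono)
   fix h
   have "k h * (A powr p + p * A powr (p - 1) * (norm (f (x + h) - f x) - A)) <= k h * norm (f (x + h) - f x) powr p"
    using A p kn by (intro mult_left_mono powr_above_tangent) auto
   then show "A powr p * k h + p * A powr (p - 1) * (k h * norm (f (x + h) - f x) - A * k h) <= k h * norm (f (x + h) - f x) powr p"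
    by (simp add: algebra_simps)
  qed (use i1n ki i2 in auto)
  finally have "ennreal (norm (conv k f x - f x) powr p) <= ennreal (LI h. k h * norm (f (x + h) - f x) powr p)"
   by (rule ennreal_leI)
  also have "... = (\<integral>\<^sup>+h. ennreal (k h * norm (f (x + h) - f x) powr p) \<partial>lborel)"
   using i2 kn by (intro nn_integral_eq_integral[symmetric]) auto
  finally show ?thesis .
 qed
 have "(\<integral>\<^sup>+x. ennreal (norm (conv k f x - f x) powr p) \<partial>lborel)
   <= (\<integral>\<^sup>+x. (\<integral>\<^sup>+h. ennreal (k h * norm (f (x + h) - f x) powr p) \<partial>lborel) \<partial>lborel)"
  by (intro nn_integral_mono pw)
 also have "... = (\<integral>\<^sup>+h. (\<integral>\<^sup>+x. ennreal (k h * norm (f (x + h) - f x) powr p) \<partial>lborel) \<partial>lborel)"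
  by (rule lborel_pair.Fubini') measurable
 also have "... <= (\<integral>\<^sup>+h. ennreal (k h) * ennreal e \<partial>lborel)"
 proof (rule nn_integral_mono)
  fix h :: 'b
  show "(\<integral>\<^sup>+x. ennreal (k h * norm (f (x + h) - f x) powr p) \<partial>lborel) <= ennreal (k h) * ennreal e"
  proof (cases "norm h <= \<delta>")
   case True
   have "(\<integral>\<^sup>+x. ennreal (k h * norm (f (x + h) - f x) powr p) \<partial>lborel) = ennreal (k h) * (\<integral>\<^sup>+x. ennreal (norm (f (x + h) - f x) powr p) \<partial>lborel)"
    using kn by (simp add: ennreal_mult nn_integral_cmult)
   also have "(\<integral>\<^sup>+x. ennreal (norm (f (x + h) - f x) powr p) \<partial>lborel) = ennreal (LI x. norm (f (x + h) - f x) powr p)"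
    using f p by (intro nn_integral_eq_integral integrable_Lp_shift) auto
   also have "... <= ennreal e" using small[OF True] by (rule ennreal_leI)
   finally show ?thesis by (simp add: mult_left_mono)
  next
   case False
   then have "k h = 0" using kc by (auto simp: csupp_def)
   then show ?thesis by simp
  qed
 qed
 also have "... = (\<integral>\<^sup>+h. ennreal (k h) \<partial>lborel) * ennreal e" by (rule nn_integral_multc) simp
 also have "(\<integral>\<^sup>+h. ennreal (k h) \<partial>lborel) = ennreal 1" using ki kn k1 by (subst nn_integral_eq_integral) auto
 finally have le: "(\<integral>\<^sup>+x. ennreal (norm (conv k f x - f x) powr p) \<partial>lborel) <= ennreal e" by simp
 show ?c2
  by (rule integral_real_bounded[OF e le])
 show ?c1
  by (rule integrableI_bounded) (use le in "auto simp: le_less_trans[OF _ ennreal_less_top]")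
qed

lemma conv_Lp_tendsto:
 fixes f :: "'b::euclidean_space => 'c::euclidean_space"
 assumes f: "integrable lborel f" "integrable lborel (%x. norm (f x) powr p)" and p: "1 <= p"
  and k: "!!n. mollifier (\<delta> n) (k n)" and \<delta>: "\<delta> ----> 0"
 shows "(%n. LI x. norm (conv (k n) f x - f x) powr p) ----> 0"
proof (rule order_tendstoI)
 fix e :: real assume e: "0 < e"
 obtain d where d: "d > 0" "!!h. norm h < d ==> (LI x. norm (f (x + h) - f x) powr p) < e / 2"
  using Lp_translation[OF f p, of "e/2"] e by auto
 have "eventually (%n. \<delta> n < d) sequentially" using \<delta> d(1) by (rule order_tendstoD(2))
 then show "eventually (%n. (LI x. norm (conv (k n) f x - f x) powr p) < e) sequentially"
 proof eventually_elim
  case (elim n)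
  have "(LI x. norm (conv (k n) f x - f x) powr p) <= e / 2"
  proof (rule conv_Lp(2)[OF f p _ k])
   fix h :: 'b assume "norm h <= \<delta> n"
   then have "norm h < d" using elim by simp
   then show "(LI x. norm (f (x + h) - f x) powr p) <= e / 2" using d(2) less_imp_le by blast
  qed (use e in simp)
  then show ?case using e by simp
 qed
next
 fix a :: real assume "a < 0"
 have "0 <= (LI x. norm (conv (k n) f x - f x) powr p)" for n
  by (intro Bochner_Integration.integral_nonneg) auto
 then show "eventually (%n. a < (LI x. norm (conv (k n) f x - f x) powr p)) sequentially"
  using \<open>a < 0\<close> by (intro always_eventually allI) (meson less_le_trans)
qed

section \<open>Test functions and integration by parts\<close>

text \<open>Difference quotients of an integrable function have integral zero by translation
  invariance. Compact support and the Lipschitz bound along \<open>b\<close> dominate them, so the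
  limit, which is \<open>h'\<close> almost everywhere, has integral zero as well.\<close>

lemma directional_integral_zero:
 fixes h h' :: "'b::euclidean_space => real"
 assumes [measurable]: "h \<in> meas" "h' \<in> meas"
  and \<tau>: "\<tau> > 0" and supp: "!!z. norm z > r ==> h z = 0" and bnd: "!!z. \<bar>h z\<bar> <= K"
  and lip: "!!z t. 0 <= t ==> t <= \<tau> ==> \<bar>h (z + t *. b) - h z\<bar> <= K * t"
  and der: "AE z in lborel. ((%t. h (z + t *. b)) has_real_derivative h' z) (at 0)"
 shows "integrable lborel h' \<and> (LI z. h' z) = 0"
proof (intro conjI)
 have K: "K >= 0" using bnd[of undefined] by (meson abs_ge_zero order_trans)
 define s where "s n = \<tau> / real (Suc n)" for n
 have s: "s n > 0" "s n <= \<tau>" for n using \<tau> by (auto simp: s_def field_simps)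
 have s0: "s ----> 0" unfolding s_def using LIMSEQ_Suc[OF lim_const_over_n[of \<tau>]] by simp
 define q where "q n z = (h (z + s n *. b) - h z) / s n" for n z
 define w where "w z = K * indicator (cball (0::'b) (r + \<tau> * norm b)) z" for z
 have iw: "integrable lborel w" unfolding w_def
  using emeasure_lborel_cball_finite[of "0::'b"] by (intro integrable_mult_right integrable_real_indicator) auto
 have [measurable]: "q n \<in> meas" for n unfolding q_def[abs_def] by measurable
 have ih: "integrable lborel h"
 proof (rule integrable_dominated[OF iw], measurable, intro AE_I2)
  fix z :: 'b show "norm (h z) <= norm (w z)"
   using bnd[of z] supp[of z] K \<tau> by (cases "norm z <= r") (auto simp: w_def indicator_def add_increasing2)
 qed
 have "(LI z. h (z + c) - h z) = 0" for c
  using ih lborel_shift[of h c] by simp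
 then have qint: "(LI z. q n z) = 0" for n
  unfolding q_def by (simp only: integral_divide_zero div_0)
 have conv: "AE z in lborel. (%n. q n z) ----> h' z"
  using der
 proof eventually_elim
  case (elim z)
  then have "((%y. (h (z + y *. b) - h z) / y) \<longlongrightarrow> h' z) (at 0)" by (simp add: has_field_derivative_iff)
  moreover have "filterlim s (at 0) sequentially"
   using s0 s(1) by (auto simp: filterlim_at less_imp_neq[symmetric])
  ultimately show ?case unfolding q_def using filterlim_compose by blast
 qed
 have bound: "AE z in lborel. norm (q n z) <= w z" for n
 proof (intro AE_I2)
  fix z :: 'b
  show "norm (q n z) <= w z"
  proof (cases "norm z <= r + \<tau> * norm b")
   case True
   have "\<bar>q n z\<bar> <= K" using lip[of "s n" z] s[of n] by (simp add: q_def divide_le_eq)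
   then show ?thesis using True by (simp add: w_def)
  next
   case False
   have "norm (s n *. b) <= \<tau> * norm b" using s[of n] by (simp add: mult_right_mono)
   then have "norm z - \<tau> * norm b <= norm (z + s n *. b)" using norm_diff_ineq[of z "s n *. b"] by linarith
   then have "h (z + s n *. b) = 0" using False by (intro supp) simp
   moreover have "h z = 0" using False \<tau> by (intro supp) (smt (verit) mult_nonneg_nonneg norm_ge_zero)
   ultimately show ?thesis using K by (simp add: q_def w_def)
  qed
 qed
 show "integrable lborel h'"
  by (rule integrable_dominated_convergence[OF _ _ iw conv bound]) auto
 have "(%n. LI z. q n z) ----> (LI z. h' z)"
  by (rule dominated_conv[OF _ _ iw conv bound]) auto
 then show "(LI z. h' z) = 0" by (simp add: qint LIMSEQ_const_iff)
qed

text \<open>Closed cylinders stand in for general compact subsets of \<open>S_infty\<close>: by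
  \<open>compact_in_Bx\<close> each such set lies in one with \<open>0 < t1\<close>.\<close>

definition Bx :: "real => real => real => ('a::euclidean_space \<times> real) set" where
 "Bx r t1 t2 = cball 0 r \<times> {t1..t2}"

lemma mem_Bx: "z \<in> Bx r t1 t2 \<longleftrightarrow> norm (fst z) <= r \<and> t1 <= snd z \<and> snd z <= t2"
 by (cases z) (auto simp: Bx_def)

lemma compact_Bx: "compact (Bx r t1 t2)" by (simp add: Bx_def compact_Times)

lemma Bx_S: "0 < t1 ==> Bx r t1 t2 \<subseteq> S_infty" by (auto simp: Bx_def S_infty_def)

lemma mem_S: "z \<in> S_infty \<longleftrightarrow> snd z > 0" by (cases z) (auto simp: S_infty_def)

lemma Bx_sets [measurable]: "Bx r t1 t2 \<in> sets borel"
 using borel_compact[OF compact_Bx] .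

lemma open_S: "open S_infty" by (auto simp: S_infty_def intro!: open_Times)

lemma S_sets [measurable]: "S_infty \<in> sets borel" by (rule borel_open[OF open_S])

lemma norm_fst': "norm (fst z) <= norm z" and norm_snd': "norm (snd z) <= norm z"
 using norm_fst_le[of "fst z" "snd z"] norm_snd_le[of "snd z" "fst z"] by simp_all

lemma norm_Bx: "z \<in> Bx r t1 t2 ==> 0 <= t1 ==> norm z <= r + t2"
 using norm_Pair_le[of "fst z" "snd z"] by (auto simp: mem_Bx)

lemma compact_in_Bx:
 assumes "compact C" "C \<subseteq> S_infty"
 obtains r t1 t2 where "r > 0" "0 < t1" "t1 < t2" "C \<subseteq> Bx r t1 t2"
proof (cases "C = {}")
 case True
 then show ?thesis using that[of 1 1 2] by auto
next
 case False
 have "\<exists>x\<in>C. \<forall>y\<in>C. snd x <= snd y"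
  by (rule continuous_attains_inf[OF assms(1) False]) (intro continuous_intros)
 then obtain z0 where z0: "z0 \<in> C" "!!z. z \<in> C ==> snd z0 <= snd z" by blast
 obtain M where M: "M > 0" "!!z. z \<in> C ==> norm z <= M"
  using compact_imp_bounded[OF assms(1)] bounded_pos by blast
 have "C \<subseteq> Bx M (snd z0) (max M (snd z0) + 1)"
 proof
  fix z assume z: "z \<in> C"
  have "norm (fst z) <= norm z" "\<bar>snd z\<bar> <= norm z"
   using norm_fst'[of z] norm_snd'[of z] by auto
  then show "z \<in> Bx M (snd z0) (max M (snd z0) + 1)" using M(2)[OF z] z0(2)[OF z] by (auto simp: mem_Bx)
 qed
 then show ?thesis using that[of M "snd z0" "max M (snd z0) + 1"] M z0(1) assms(2) by (force simp: mem_S)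
qed

lemma test_fun_smooth: "test_fun \<eta> ==> smooth \<eta>" by (simp add: test_fun_def smooth_def)

lemma test_funI:
 assumes "smooth \<eta>" "0 < t1" "!!z. \<eta> z ~= 0 ==> z \<in> Bx r t1 t2"
 shows "test_fun \<eta>"
proof -
 have cl: "closure {z. \<eta> z ~= 0} \<subseteq> Bx r t1 t2"
  using assms(3) compact_imp_closed[OF compact_Bx] by (intro closure_minimal) auto
 moreover have "compact (closure {z. \<eta> z ~= 0})"
  using compact_Int_closed[OF compact_Bx closed_closure] cl by (metis inf.absorb2)
 ultimately show ?thesis using assms(1) subset_trans[OF cl Bx_S[OF assms(2)]] by (simp add: test_fun_def smooth_def)
qed

lemma test_fun_supp:
 assumes "test_fun \<eta>"
 obtains r t1 t2 where "r > 0" "0 < t1" "t1 < t2" "!!z. z \<notin> Bx r t1 t2 ==> \<eta> z = 0"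
proof -
 obtain r t1 t2 where b: "r > 0" "0 < t1" "t1 < t2" and c: "closure {z. \<eta> z ~= 0} \<subseteq> Bx r t1 t2"
  using compact_in_Bx assms unfolding test_fun_def by metis
 have "\<eta> z = 0" if "z \<notin> Bx r t1 t2" for z
  using subsetD[OF c, of z] subsetD[OF closure_subset[of "{z. \<eta> z ~= 0}"], of z] that by auto
 then show ?thesis by (rule that[OF b])
qed

lemma pd_zero_off_Bx:
 assumes "!!z. z \<notin> Bx r t1 t2 ==> \<eta> z = 0" "z \<notin> Bx r t1 t2"
 shows "frechet_derivative \<eta> (at z) = (%h. 0)"
proof -
 have "open (- Bx r t1 t2)" using compact_imp_closed[OF compact_Bx] by auto
 from frechet_derivative_zero_open[OF this, of z \<eta>] show ?thesis using assms by simp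
qed

lemma test_fun_pd:
 fixes \<eta> :: "'a::euclidean_space \<times> real => real"
 assumes "test_fun \<eta>" "b \<in> Basis" shows "test_fun (pd b \<eta>)"
proof -
 obtain r t1 t2 where s: "0 < t1" "!!z. z \<notin> Bx r t1 t2 ==> \<eta> z = 0" using test_fun_supp[OF assms(1)] by metis
 show ?thesis
 proof (rule test_funI[OF smooth_pd[OF test_fun_smooth[OF assms(1)] assms(2)] s(1), of r t2])
  show "z \<in> Bx r t1 t2" if "pd b \<eta> z ~= 0" for z
  proof (rule ccontr)
   assume "z \<notin> Bx r t1 t2"
   from pd_zero_off_Bx[OF s(2) this] that show False by simp
  qed
 qed
qed

lemma test_fun_csupp:
 fixes \<eta> :: "'a::euclidean_space \<times> real => real"
 assumes "test_fun \<eta>" obtains \<delta> where "csupp \<delta> \<eta>"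
proof -
 obtain r t1 t2 where s: "0 < t1" "!!z. z \<notin> Bx r t1 t2 ==> \<eta> z = 0" using test_fun_supp[OF assms(1)] by metis
 have "\<eta> z = 0" if "norm z > r + t2" for z
  using s(1) s(2)[of z] norm_Bx[of z r t1 t2] that by (cases "z \<in> Bx r t1 t2") auto
 then have "csupp (r + t2) \<eta>" unfolding csupp_def using test_fun_smooth[OF assms] by simp
 then show ?thesis using that by blast
qed

lemma test_fun_bounded:
 fixes \<eta> :: "'a::euclidean_space \<times> real => real"
 assumes "test_fun \<eta>" obtains M where "M >= 0" "!!z. \<bar>\<eta> z\<bar> <= M"
 using test_fun_csupp[OF assms] csupp_bounded by metis

lemma smooth_line_derivative:
 assumes "smooth \<eta>"
 shows "((%t. \<eta> (z + t *. b)) has_real_derivative pd b \<eta> (z + t *. b)) (at t)"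
proof -
 have "((%t. z + t *. b) has_derivative (%s. s *. b)) (at t)" by (auto intro!: derivative_eq_intros)
 from has_derivative_compose[OF this smooth_has_derivative[OF assms]]
 have d: "((%t. \<eta> (z + t *. b)) has_derivative (%s. frechet_derivative \<eta> (at (z + t *. b)) (s *. b))) (at t)" .
 have "frechet_derivative \<eta> (at (z + t *. b)) (s *. b) = pd b \<eta> (z + t *. b) * s" for s
  using linear_cmul[OF has_derivative_linear[OF smooth_has_derivative[OF assms]]] by (simp add: mult.commute)
 then show ?thesis using d by (simp add: has_field_derivative_def)
qed

lemma smooth_lipschitz:
 assumes "smooth \<eta>" "!!z. \<bar>pd b \<eta> z\<bar> <= M"
 shows "\<bar>\<eta> (z + t *. b) - \<eta> z\<bar> <= M * \<bar>t\<bar>"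
proof -
 have "norm ((%t. \<eta> (z + t *. b)) t - (%t. \<eta> (z + t *. b)) 0) <= M * norm (t - 0)"
  by (rule field_differentiable_bound[where S = UNIV and f' = "%t. pd b \<eta> (z + t *. b)"])
    (use assms smooth_line_derivative[OF assms(1)] in auto)
 then show ?thesis by simp
qed

text \<open>Local boundedness together with Lipschitz continuity along the single direction
  \<open>b\<close>. Restricting to one direction admits a coefficient such as the density, a bounded
  function of \<open>x\<close> that is constant along the time axis.\<close>

definition LD :: "'a::euclidean_space \<times> real => ('a \<times> real => real) => bool" where
 "LD b a \<longleftrightarrow> (\<forall>r t1 t2. 0 < t1 --> (\<exists>L. \<forall>z\<in>Bx r t1 t2. \<bar>a z\<bar> <= L \<and>
   (\<forall>t. z + t *. b \<in> Bx r t1 t2 --> \<bar>a (z + t *. b) - a z\<bar> <= L * \<bar>t\<bar>)))"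

lemma LD_E:
 assumes "LD b a" "0 < t1"
 obtains L where "L >= 0" "!!z. z \<in> Bx r t1 t2 ==> \<bar>a z\<bar> <= L"
  "!!z t. z \<in> Bx r t1 t2 ==> z + t *. b \<in> Bx r t1 t2 ==> \<bar>a (z + t *. b) - a z\<bar> <= L * \<bar>t\<bar>"
proof -
 obtain L where L: "\<forall>z\<in>Bx r t1 t2. \<bar>a z\<bar> <= L \<and>
   (\<forall>t. z + t *. b \<in> Bx r t1 t2 --> \<bar>a (z + t *. b) - a z\<bar> <= L * \<bar>t\<bar>)"
  using assms unfolding LD_def by metis
 show ?thesis
 proof (rule that[of "max L 0"])
  fix z t assume zt: "z \<in> Bx r t1 t2" "z + t *. b \<in> Bx r t1 t2"
  then have "\<bar>a (z + t *. b) - a z\<bar> <= L * \<bar>t\<bar>" using L by blast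
  also have "... <= max L 0 * \<bar>t\<bar>" by (intro mult_right_mono) auto
  finally show "\<bar>a (z + t *. b) - a z\<bar> <= max L 0 * \<bar>t\<bar>" .
 qed (use L in "auto simp: le_max_iff_disj")
qed

lemma LD_mult: assumes "LD b a" "LD b c" shows "LD b (%z. a z * c z)"
 unfolding LD_def
proof (intro allI impI)
 fix r t1 t2 :: real assume t1: "0 < t1"
 let ?B = "Bx r t1 t2 :: ('a \<times> real) set"
 obtain L where L: "L >= 0" "!!z. z \<in> ?B ==> \<bar>a z\<bar> <= L"
  "!!z t. z \<in> ?B ==> z + t *. b \<in> ?B ==> \<bar>a (z + t *. b) - a z\<bar> <= L * \<bar>t\<bar>" using LD_E[OF assms(1) t1] by metis
 obtain M where M: "M >= 0" "!!z. z \<in> ?B ==> \<bar>c z\<bar> <= M"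
  "!!z t. z \<in> ?B ==> z + t *. b \<in> ?B ==> \<bar>c (z + t *. b) - c z\<bar> <= M * \<bar>t\<bar>" using LD_E[OF assms(2) t1] by metis
 show "\<exists>N. \<forall>z\<in>?B. \<bar>a z * c z\<bar> <= N \<and> (\<forall>t. z + t *. b \<in> ?B --> \<bar>a (z + t *. b) * c (z + t *. b) - a z * c z\<bar> <= N * \<bar>t\<bar>)"
 proof (intro exI[of _ "2 * (L * M)"] ballI conjI allI impI)
  fix z assume z: "z \<in> ?B"
  have "\<bar>a z * c z\<bar> <= L * M" unfolding abs_mult using L M z by (intro mult_mono) auto
  then show "\<bar>a z * c z\<bar> <= 2 * (L * M)" using L(1) M(1) by (smt (verit) mult_nonneg_nonneg)
  fix t assume zt: "z + t *. b \<in> ?B"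
  have "a (z + t *. b) * c (z + t *. b) - a z * c z
    = a (z + t *. b) * (c (z + t *. b) - c z) + (a (z + t *. b) - a z) * c z" by (simp add: algebra_simps)
  also have "\<bar>...\<bar> <= L * (M * \<bar>t\<bar>) + (L * \<bar>t\<bar>) * M"
   by (rule order_trans[OF abs_triangle_ineq], unfold abs_mult, intro add_mono mult_mono)
     (use L M z zt in auto)
  finally show "\<bar>a (z + t *. b) * c (z + t *. b) - a z * c z\<bar> <= 2 * (L * M) * \<bar>t\<bar>" by (simp add: algebra_simps)
 qed
qed

lemma LD_compose:
 assumes a: "LD b a" and lip: "!!R. \<exists>L. \<forall>x y. \<bar>x\<bar> <= R --> \<bar>y\<bar> <= R --> \<bar>\<Phi> x - \<Phi> y\<bar> <= L * \<bar>x - y\<bar>"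
 shows "LD b (%z. \<Phi> (a z))"
 unfolding LD_def
proof (intro allI impI)
 fix r t1 t2 :: real assume t1: "0 < t1"
 let ?B = "Bx r t1 t2 :: ('a \<times> real) set"
 obtain L where L: "L >= 0" "!!z. z \<in> ?B ==> \<bar>a z\<bar> <= L"
  "!!z t. z \<in> ?B ==> z + t *. b \<in> ?B ==> \<bar>a (z + t *. b) - a z\<bar> <= L * \<bar>t\<bar>" using LD_E[OF a t1] by metis
 obtain M0 where M0: "!!x y. \<bar>x\<bar> <= L ==> \<bar>y\<bar> <= L ==> \<bar>\<Phi> x - \<Phi> y\<bar> <= M0 * \<bar>x - y\<bar>" using lip by blast
 define M where "M = max M0 0"
 have M: "\<bar>\<Phi> x - \<Phi> y\<bar> <= M * \<bar>x - y\<bar>" if "\<bar>x\<bar> <= L" "\<bar>y\<bar> <= L" for x y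
  by (rule order_trans[OF M0[OF that]]) (auto simp: M_def intro!: mult_right_mono)
 show "\<exists>N. \<forall>z\<in>?B. \<bar>\<Phi> (a z)\<bar> <= N \<and> (\<forall>t. z + t *. b \<in> ?B --> \<bar>\<Phi> (a (z + t *. b)) - \<Phi> (a z)\<bar> <= N * \<bar>t\<bar>)"
 proof (intro exI[of _ "\<bar>\<Phi> 0\<bar> + M * L"] ballI conjI allI impI)
  fix z assume z: "z \<in> ?B"
  have "\<bar>\<Phi> (a z) - \<Phi> 0\<bar> <= M * \<bar>a z - 0\<bar>" using L(1) L(2)[OF z] by (intro M) auto
  also have "... <= M * L" using L(2)[OF z] by (intro mult_left_mono) (auto simp: M_def)
  finally show "\<bar>\<Phi> (a z)\<bar> <= \<bar>\<Phi> 0\<bar> + M * L" by linarith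
  fix t assume zt: "z + t *. b \<in> ?B"
  have "\<bar>\<Phi> (a (z + t *. b)) - \<Phi> (a z)\<bar> <= M * \<bar>a (z + t *. b) - a z\<bar>" using L z zt by (intro M) auto
  also have "... <= M * (L * \<bar>t\<bar>)" using L(3)[OF z zt] by (intro mult_left_mono) (auto simp: M_def)
  also have "... <= (\<bar>\<Phi> 0\<bar> + M * L) * \<bar>t\<bar>" by (simp add: algebra_simps)
  finally show "\<bar>\<Phi> (a (z + t *. b)) - \<Phi> (a z)\<bar> <= (\<bar>\<Phi> 0\<bar> + M * L) * \<bar>t\<bar>" .
 qed
qed

text \<open>The product of \<open>a\<close> with the test function is compactly supported and
  Lipschitz along \<open>b\<close>, so the integral of its directional derivative vanishes. The
  derivative of \<open>a\<close> is asked only almost everywhere because the flux of the barrier may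
  fail to be differentiable at the origin and on one sphere.\<close>

lemma integration_by_parts_test:
 fixes a a' :: "'a::euclidean_space \<times> real => real"
 assumes b: "b \<in> Basis" and a: "LD b a"
  and ma: "(%z. indicator S_infty z * a z) \<in> meas"
  and ma': "(%z. indicator S_infty z * a' z) \<in> meas"
  and der: "AE z in lborel. z \<in> S_infty --> ((%t. a (z + t *. b)) has_real_derivative a' z) (at 0)"
  and \<eta>: "test_fun \<eta>"
 shows "S_integrable (%z. a z * pd b \<eta> z)" (is ?c1)
  "S_integrable (%z. a' z * \<eta> z)"
  "(LIS z. a z * pd b \<eta> z) = - (LIS z. a' z * \<eta> z)" (is ?c2)
proof -
 obtain r t1 t2 where s: "0 < r" "0 < t1" "t1 < t2" "!!z. z \<notin> Bx r t1 t2 ==> \<eta> z = 0" using test_fun_supp[OF \<eta>] by metis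
 have sm: "smooth \<eta>" "smooth (pd b \<eta>)" using test_fun_smooth[OF \<eta>] smooth_pd b by auto
 note [measurable] = smooth_measurable[OF sm(1)] smooth_measurable[OF sm(2)] ma ma'
 have p0: "pd b \<eta> z = 0" if "z \<notin> Bx r t1 t2" for z using pd_zero_off_Bx[OF s(4) that] by simp
 have b1: "norm b = 1" using b by simp
 let ?B = "Bx (r + 1) (t1 / 2) (t2 + 1) :: ('a \<times> real) set"
 \<comment> \<open>A step of length at most \<open>\<tau>\<close> from the support of
   \<open>\<eta>\<close> stays in the larger cylinder \<open>?B\<close>, where \<open>a\<close> has
   one bound and one Lipschitz constant.\<close>
 define \<tau> where "\<tau> = min 1 (t1 / 2)"
 have \<tau>: "\<tau> > 0" "\<tau> <= 1" "\<tau> <= t1 / 2" using s by (auto simp: \<tau>_def)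
 have near: "z' \<in> ?B" if "z \<in> Bx r t1 t2" "norm (z' - z) <= \<tau>" for z z' :: "'a \<times> real"
 proof -
  have "norm (fst z' - fst z) <= \<tau>" "\<bar>snd z' - snd z\<bar> <= \<tau>"
   using that(2) norm_fst'[of "z' - z"] norm_snd'[of "z' - z"] by auto
  moreover have "norm (fst z') <= norm (fst z) + norm (fst z' - fst z)" by norm
  ultimately show ?thesis using that(1) \<tau> s by (auto simp: mem_Bx)
 qed
 obtain L where L: "L >= 0" "!!z. z \<in> ?B ==> \<bar>a z\<bar> <= L"
  "!!z t. z \<in> ?B ==> z + t *. b \<in> ?B ==> \<bar>a (z + t *. b) - a z\<bar> <= L * \<bar>t\<bar>"
  using LD_E[OF a, of "t1/2" "r + 1" "t2 + 1"] s by (metis half_gt_zero)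
 obtain M where M: "M >= 0" "!!z. \<bar>\<eta> z\<bar> <= M" using test_fun_bounded[OF \<eta>] by metis
 obtain M' where M': "M' >= 0" "!!z. \<bar>pd b \<eta> z\<bar> <= M'" using test_fun_bounded[OF test_fun_pd[OF \<eta> b]] by metis
 have sub: "Bx r t1 t2 \<subseteq> ?B" "?B \<subseteq> S_infty" using s by (auto simp: mem_Bx mem_S)
 define h where "h z = indicator S_infty z * a z * \<eta> z" for z
 define h' where "h' z = indicator S_infty z * a z * pd b \<eta> z + indicator S_infty z * a' z * \<eta> z" for z
 define K where "K = L * M + L * M'"
 have K: "L * M <= K" "K >= 0" using L M M' by (auto simp: K_def)
 have z: "h z = 0" if "z \<notin> Bx r t1 t2" for z using s(4)[OF that] by (simp add: h_def)
 have "integrable lborel h' \<and> (LI z. h' z) = 0"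
 proof (rule directional_integral_zero[of h h' \<tau> "r + t2" K b])
  show "h \<in> meas" "h' \<in> meas" unfolding h_def[abs_def] h'_def[abs_def] by measurable
  show "\<tau> > 0" by fact
  show "h z = 0" if "norm z > r + t2" for z
   using that norm_Bx[of z r t1 t2] s z by (metis less_imp_le not_le)
  show "\<bar>h z\<bar> <= K" for z
  proof (cases "z \<in> Bx r t1 t2")
   case True
   have "\<bar>h z\<bar> = \<bar>a z\<bar> * \<bar>\<eta> z\<bar>" using True sub by (auto simp: h_def abs_mult)
   also have "... <= L * M" using L(1) L(2)[of z] M(1) M(2)[of z] True sub by (intro mult_mono) auto
   finally show ?thesis using K by simp
  qed (use z K in simp)
  show "\<bar>h (z + t *. b) - h z\<bar> <= K * t" if t: "0 <= t" "t <= \<tau>" for z t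
  proof (cases "z \<in> Bx r t1 t2 \<or> z + t *. b \<in> Bx r t1 t2")
   case True
   have B: "z \<in> ?B" "z + t *. b \<in> ?B"
    using True near[of z "z + t *. b"] near[of "z + t *. b" z] t b1 sub by auto
   have "h (z + t *. b) - h z = a (z + t *. b) * (\<eta> (z + t *. b) - \<eta> z) + (a (z + t *. b) - a z) * \<eta> z"
    using subsetD[OF sub(2) B(1)] subsetD[OF sub(2) B(2)] by (simp add: h_def algebra_simps)
   also have "\<bar>...\<bar> <= L * (M' * \<bar>t\<bar>) + (L * \<bar>t\<bar>) * M"
    by (rule order_trans[OF abs_triangle_ineq], unfold abs_mult, intro add_mono mult_mono)
      (use L M M' B smooth_lipschitz[OF sm(1) M'(2)] in auto)
   also have "... = K * t" using t by (simp add: K_def algebra_simps)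
   finally show ?thesis .
  qed (use z t K in auto)
  show "AE z in lborel. ((%t. h (z + t *. b)) has_real_derivative h' z) (at 0)"
   using der
  proof eventually_elim
   case (elim z)
   show ?case
   proof (cases "z \<in> S_infty")
    case True
    have "((%t. a (z + t *. b) * \<eta> (z + t *. b)) has_real_derivative (a' z * \<eta> (z + 0 *. b) + pd b \<eta> (z + 0 *. b) * a (z + 0 *. b))) (at 0)"
     by (rule DERIV_mult[OF _ smooth_line_derivative[OF sm(1)]]) (use elim True in auto)
    moreover have "eventually (%t. h (z + t *. b) = a (z + t *. b) * \<eta> (z + t *. b)) (nhds 0)"
    proof -
     have "open ((%t. z + t *. b) -` S_infty)"
      by (intro continuous_open_vimage open_S continuous_intros)
     then have "eventually (%t. t \<in> (%t. z + t *. b) -` S_infty) (nhds 0)"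
      using True by (intro eventually_nhds_in_open) auto
     then show ?thesis by eventually_elim (simp add: h_def)
    qed
    ultimately show ?thesis using True by (simp add: DERIV_cong_ev h'_def algebra_simps)
   next
    case False
    have "z \<in> - Bx r t1 t2" using False sub by auto
    have "open ((%t. z + t *. b) -` (- Bx r t1 t2))"
     using compact_imp_closed[OF compact_Bx] by (intro continuous_open_vimage continuous_intros) auto
    then have "eventually (%t. t \<in> (%t. z + t *. b) -` (- Bx r t1 t2)) (nhds 0)"
     using \<open>z \<in> - Bx r t1 t2\<close> by (intro eventually_nhds_in_open) auto
    then have ev: "eventually (%t. h (z + t *. b) = 0) (nhds 0)" by eventually_elim (simp add: z)
    have "((%t. 0) has_real_derivative 0) (at (0::real))" by simp
    then show ?thesis using ev False by (simp add: DERIV_cong_ev h'_def)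
   qed
  qed
 qed
 then have r1: "integrable lborel h'" "(LI z. h' z) = 0" by auto
 have i1: "integrable lborel (%z. indicator S_infty z * a z * pd b \<eta> z)"
 proof (rule integrable_dominated[where f = "%z. (L * M') * indicator (Bx r t1 t2) z"])
  show "integrable lborel (%z::'a\<times>real. (L * M') * indicator (Bx r t1 t2) z)"
   using emeasure_compact_finite[OF compact_Bx] by (intro integrable_mult_right integrable_real_indicator) auto
  show "AE z in lborel. norm (indicator S_infty z * a z * pd b \<eta> z) <= norm (L * M' * indicator (Bx r t1 t2) z)"
  proof (intro AE_I2)
   fix z :: "'a \<times> real"
   show "norm (indicator S_infty z * a z * pd b \<eta> z) <= norm (L * M' * indicator (Bx r t1 t2) z)"
   proof (cases "z \<in> Bx r t1 t2")
    case True
    have "\<bar>a z\<bar> * \<bar>pd b \<eta> z\<bar> <= L * M'" using L(1) L(2)[of z] M'(1) M'(2)[of z] True sub by (intro mult_mono) auto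
    then show ?thesis using True sub L M' by (auto simp: abs_mult indicator_def)
   qed (simp add: p0)
  qed
 qed measurable
 have i2: "integrable lborel (%z. indicator S_infty z * a' z * \<eta> z)"
  using Bochner_Integration.integrable_diff[OF r1(1) i1] by (simp add: h'_def)
 show ?c1
  "S_integrable (%z. a' z * \<eta> z)"
  using i1 i2 by (simp_all add: mult.assoc)
 have "(LI z. indicator S_infty z * a z * pd b \<eta> z) + (LI z. indicator S_infty z * a' z * \<eta> z) = 0"
  using r1(2) i1 i2 by (simp add: h'_def)
 then show ?c2
  by (simp add: set_lebesgue_integral_def mult.assoc)
qed

section \<open>Weak derivatives and mollification\<close>

lemma loc_int_Bx:
 assumes "locally_integrable w" "0 < t1"
 shows "integrable lborel (%z. indicator (Bx r t1 t2) z *. w z)"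
 by (rule assms(1)[unfolded locally_integrable_def set_integrable_def, rule_format, OF conjI[OF compact_Bx Bx_S[OF assms(2)]]])

lemma loc_int_times:
 fixes w :: "'a::euclidean_space \<times> real => 'c::euclidean_space"
 assumes w: "locally_integrable w" and [measurable]: "c \<in> meas"
  and M: "!!z. \<bar>c z\<bar> <= M" and supp: "!!z. z \<notin> Bx r t1 t2 ==> c z = 0" and t1: "0 < t1"
 shows "S_integrable (%z. c z *. w z)"
proof -
 let ?B = "Bx r t1 t2 :: ('a \<times> real) set"
 have i: "integrable lborel (%z. indicator ?B z *. w z)" by (rule loc_int_Bx[OF w t1])
 have M0: "M >= 0" using M[of undefined] by (meson abs_ge_zero order_trans)
 have [measurable]: "(%z. indicator ?B z *. w z) \<in> meas" using borel_measurable_integrable[OF i] by simp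
 have eq: "indicator S_infty z *. (c z *. w z) = c z *. (indicator ?B z *. w z)" for z
  using supp[of z] subsetD[OF Bx_S[OF t1], of z r t2] by (cases "z \<in> ?B") auto
 show ?thesis unfolding eq
 proof (rule integrable_dominated[where f = "%z. M *. (indicator ?B z *. w z)"])
  show "integrable lborel (%z. M *. (indicator ?B z *. w z))" by (rule integrable_scaleR_right) (rule i)
  show "AE z in lborel. norm (c z *. (indicator ?B z *. w z)) <= norm (M *. (indicator ?B z *. w z))"
   unfolding norm_scaleR using M M0 by (intro AE_I2 mult_right_mono) auto
 qed measurable
qed

lemma loc_int_test:
 fixes w :: "'a::euclidean_space \<times> real => 'c::euclidean_space"
 assumes "locally_integrable w" "test_fun \<phi>"
 shows "S_integrable (%z. \<phi> z *. w z)"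
proof -
 obtain r t1 t2 where s: "r > 0" "0 < t1" "t1 < t2" "!!z. z \<notin> Bx r t1 t2 ==> \<phi> z = 0"
  using test_fun_supp[OF assms(2)] by metis
 obtain M where M: "M >= 0" "!!z. \<bar>\<phi> z\<bar> <= M" using test_fun_bounded[OF assms(2)] by metis
 show ?thesis
  by (rule loc_int_times[OF assms(1) smooth_measurable[OF test_fun_smooth[OF assms(2)]] M(2) s(4) s(2)])
qed

text \<open>One directional notion serves both the time derivative, with direction
  \<open>(0, 1)\<close>, and each component of the spatial gradient, with direction
  \<open>(b, 0)\<close>.\<close>

definition weak_dir :: "'a::euclidean_space \<times> real => ('a \<times> real => real) => ('a \<times> real => real) => bool" where
 "weak_dir b w d \<longleftrightarrow> locally_integrable w \<and> locally_integrable d \<and>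
   (\<forall>\<phi>. test_fun \<phi> --> (LIS z. w z * pd b \<phi> z) = - (LIS z. d z * \<phi> z))"

lemma weak_dt_dir: "weak_dt w d \<longleftrightarrow> weak_dir (0, 1) w d"
 by (simp add: weak_dt_def weak_dir_def dt_def)

lemma grad_x_inner: "b \<in> Basis ==> grad_x \<phi> z \<bullet> b = pd (b, 0) \<phi> z"
 by (simp add: grad_x_def)

lemma Basis_x: "b \<in> Basis ==> (b, 0::real) \<in> Basis" by (auto simp: Basis_prod_def)
lemma Basis_t: "(0::'a::euclidean_space, 1::real) \<in> Basis" by (auto simp: Basis_prod_def)

lemma locally_integrable_inner:
 fixes D :: "'a::euclidean_space \<times> real => 'c::euclidean_space"
 shows "locally_integrable D ==> locally_integrable (%z. D z \<bullet> b)"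
 unfolding locally_integrable_def set_integrable_def
proof (intro allI impI)
 fix K :: "('a \<times> real) set"
 assume *: "\<forall>K. compact K \<and> K \<subseteq> S_infty --> integrable lborel (%x. indicat_real K x *. D x)" "compact K \<and> K \<subseteq> S_infty"
 then have "integrable lborel (%x. (indicat_real K x *. D x) \<bullet> b)" by (intro integrable_inner_left) auto
 then show "integrable lborel (%x. indicat_real K x *. (D x \<bullet> b))" by simp
qed

lemma weak_grad_dir:
 fixes D :: "'a::euclidean_space \<times> real => 'a"
 assumes w: "weak_grad_x w D" and b: "b \<in> Basis"
 shows "weak_dir (b, 0) w (%z. D z \<bullet> b)"
 unfolding weak_dir_def
proof (intro conjI allI impI)
 show "locally_integrable w" "locally_integrable (%z. D z \<bullet> b)"
  using w locally_integrable_inner by (auto simp: weak_grad_x_def)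
 fix \<phi> :: "'a \<times> real => real" assume \<phi>: "test_fun \<phi>"
 have i1: "S_integrable (%z. w z *. grad_x \<phi> z)"
 proof -
  have "integrable lborel (%z. \<Sum>b\<in>Basis. (indicator S_infty z *. (pd (b, 0) \<phi> z *. w z)) *. b)"
   using w by (intro Bochner_Integration.integrable_sum integrable_scaleR_left loc_int_test test_fun_pd[OF \<phi>] Basis_x) (auto simp: weak_grad_x_def)
  then show ?thesis by (simp add: grad_x_def scaleR_sum_right mult_ac)
 qed
 have i2: "S_integrable (%z. \<phi> z *. D z)"
  using w by (intro loc_int_test \<phi>) (auto simp: weak_grad_x_def)
 have "(LI z. indicator S_infty z *. (w z *. grad_x \<phi> z)) = - (LI z. indicator S_infty z *. (\<phi> z *. D z))"
  using w \<phi> by (simp add: weak_grad_x_def set_lebesgue_integral_def)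
 then have "(LI z. indicator S_infty z *. (w z *. grad_x \<phi> z)) \<bullet> b = - (LI z. indicator S_infty z *. (\<phi> z *. D z)) \<bullet> b"
  by simp
 then show "(LIS z. w z * pd (b, 0) \<phi> z) = - (LIS z. D z \<bullet> b * \<phi> z)"
  using i1 i2 by (simp add: integral_inner_left[symmetric] grad_x_inner[OF b] set_lebesgue_integral_def mult_ac)
qed

text \<open>If the \<open>\<delta>\<close>-ball about \<open>z\<close> stays in the cylinder, then
  \<open>y\<close> mapped to \<open>k (z - y)\<close> is itself a test function. Its derivative has
  the opposite sign to that of \<open>k\<close>, which cancels the sign in the weak definition. The
  indicators only make \<open>w\<close> and \<open>d\<close> globally integrable.\<close>

lemma pd_conv_weak:
 fixes w d :: "'a::euclidean_space \<times> real => real"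
 assumes w: "weak_dir b w d" and b: "b \<in> Basis" and k: "mollifier \<delta> k"
  and sub: "cball z \<delta> \<subseteq> Bx R s1 s2" and s1: "0 < s1"
 shows "pd b (conv k (%y. indicator (Bx R s1 s2) y *. w y)) z = conv k (%y. indicator (Bx R s1 s2) y *. d y) z"
proof -
 let ?K = "Bx R s1 s2 :: ('a \<times> real) set"
 have kc: "csupp \<delta> k" and ks: "smooth k" using k by (auto simp: mollifier_def csupp_def)
 define \<phi> where "\<phi> y = k (z - y)" for y
 have "smooth (%y. (z - y) \<bullet> i)" for i
  unfolding inner_diff_left by (intro smooth_diff smooth_const smooth_linear bounded_linear_inner_left)
 then have s\<phi>: "smooth \<phi>" unfolding \<phi>_def using smooth_compose[of "%y. z - y" k] ks by blast
 have off: "y \<in> ?K" if "norm (z - y) <= \<delta>" for y using subsetD[OF sub, of y] that by (simp add: dist_norm)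
 have kz: "k (z - y) = 0" "pd b k (z - y) = 0" if "\<not> norm (z - y) <= \<delta>" for y
  using kc csupp_pd[OF kc b] that by (simp_all add: csupp_def del: split_paired_All)
 have t\<phi>: "test_fun \<phi>"
 proof (rule test_funI[OF s\<phi> s1])
  show "y \<in> ?K" if "\<phi> y ~= 0" for y
   using that kz(1)[of y] off[of y] by (cases "norm (z - y) <= \<delta>") (auto simp: \<phi>_def)
 qed
 have p\<phi>: "pd b \<phi> y = - pd b k (z - y)" for y
 proof -
  have "((%y. z - y) has_derivative (%h. - h)) (at y)" by (auto intro!: derivative_eq_intros)
  from has_derivative_compose[OF this smooth_has_derivative[OF ks]]
  have "(\<phi> has_derivative (%h. frechet_derivative k (at (z - y)) (- h))) (at y)" unfolding \<phi>_def .
  then have "frechet_derivative \<phi> (at y) = (%h. frechet_derivative k (at (z - y)) (- h))"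
   by (rule frechet_derivative_at[symmetric])
  then show ?thesis using linear_neg[OF has_derivative_linear[OF smooth_has_derivative[OF ks]]] by simp
 qed
 have KS: "?K \<subseteq> S_infty" by (rule Bx_S[OF s1])
 have "pd b (conv k (%y. indicator ?K y *. w y)) z = conv (pd b k) (%y. indicator ?K y *. w y) z"
  using w s1 by (intro pd_conv[OF kc _ b] loc_int_Bx) (auto simp: weak_dir_def)
 also have "... = (LI y. - (indicator S_infty y *. (w y * pd b \<phi> y)))"
  unfolding conv_def
 proof (rule Bochner_Integration.integral_cong[OF refl])
  fix y
  show "pd b k (z - y) *. (indicator ?K y *. w y) = - (indicator S_infty y *. (w y * pd b \<phi> y))"
   using off[of y] kz(2)[of y] subsetD[OF KS, of y]
   by (cases "norm (z - y) <= \<delta>") (auto simp: p\<phi>)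
 qed
 also have "... = - (LINT y:S_infty|lborel. w y * pd b \<phi> y)" by (simp add: set_lebesgue_integral_def)
 also have "... = (LINT y:S_infty|lborel. d y * \<phi> y)" using w t\<phi> by (simp add: weak_dir_def)
 also have "... = conv k (%y. indicator ?K y *. d y) z"
  unfolding conv_def set_lebesgue_integral_def
 proof (rule Bochner_Integration.integral_cong[OF refl])
  fix y
  show "indicator S_infty y *. (d y * \<phi> y) = k (z - y) *. (indicator ?K y *. d y)"
   using off[of y] kz(1)[of y] subsetD[OF KS, of y]
   by (cases "norm (z - y) <= \<delta>") (auto simp: \<phi>_def)
 qed
 finally show ?thesis .
qed

lemma grad_x_conv_weak:
 fixes D :: "'a::euclidean_space \<times> real => 'a"
 assumes w: "weak_grad_x w D" and k: "mollifier \<delta> k"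
  and sub: "cball z \<delta> \<subseteq> Bx R s1 s2" and s1: "0 < s1"
 shows "grad_x (conv k (%y. indicator (Bx R s1 s2) y *. w y)) z = conv k (%y. indicator (Bx R s1 s2) y *. D y) z"
proof (rule euclidean_eqI)
 fix b :: 'a assume b: "b \<in> Basis"
 have kc: "csupp \<delta> k" using k by (auto simp: mollifier_def)
 have iD: "integrable lborel (%y. indicator (Bx R s1 s2) y *. D y)" using w s1 by (intro loc_int_Bx) (auto simp: weak_grad_x_def)
 have "grad_x (conv k (%y. indicator (Bx R s1 s2) y *. w y)) z \<bullet> b = conv k (%y. indicator (Bx R s1 s2) y *. (D y \<bullet> b)) z"
  unfolding grad_x_inner[OF b] by (rule pd_conv_weak[OF weak_grad_dir[OF w b] Basis_x[OF b] k sub s1])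
 also have "... = conv k (%y. indicator (Bx R s1 s2) y *. D y) z \<bullet> b"
  unfolding conv_def using conv_integrable[OF kc iD, of z] by (subst integral_inner_left[symmetric]) (auto simp: mult.assoc)
 finally show "grad_x (conv k (%y. indicator (Bx R s1 s2) y *. w y)) z \<bullet> b = conv k (%y. indicator (Bx R s1 s2) y *. D y) z \<bullet> b" .
qed

lemma mollifier_seq:
 fixes r t1 t2 :: real assumes "0 < t1"
 obtains k :: "nat => 'a::euclidean_space \<times> real => real" and \<delta> :: "nat => real"
 where "!!n. mollifier (\<delta> n) (k n)" "\<delta> ----> 0"
  "!!n (z :: 'a \<times> real). z \<in> Bx r t1 t2 ==> cball z (\<delta> n) \<subseteq> Bx (r + 1) (t1 / 2) (t2 + 1)"
proof -
 define c where "c = min 1 (t1 / 2)"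
 have c: "c > 0" "c <= 1" "c <= t1 / 2" using assms by (auto simp: c_def)
 define \<delta> where "\<delta> n = c / real (Suc n)" for n
 have \<delta>: "\<delta> n > 0" "\<delta> n <= c" for n using c by (auto simp: \<delta>_def field_simps)
 have "\<exists>k :: 'a \<times> real => real. mollifier (\<delta> n) k" for n using mollifier_exists[OF \<delta>(1)] by blast
 then obtain k where k: "!!n. mollifier (\<delta> n) (k n :: 'a \<times> real => real)" by metis
 have lim: "\<delta> ----> 0" unfolding \<delta>_def using LIMSEQ_Suc[OF lim_const_over_n[of c]] by simp
 have cb: "cball z (\<delta> n) \<subseteq> Bx (r + 1) (t1 / 2) (t2 + 1)" if z: "z \<in> Bx r t1 t2" for n and z :: "'a \<times> real"
 proof
  fix y assume "y \<in> cball z (\<delta> n)"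
  then have "norm (y - z) <= c" using \<delta>(2)[of n] by (simp add: dist_norm norm_minus_commute)
  then have *: "norm (fst y - fst z) <= c" "\<bar>snd y - snd z\<bar> <= c"
   using norm_fst'[of "y - z"] norm_snd'[of "y - z"] by auto
  moreover have "norm (fst y) <= norm (fst z) + norm (fst y - fst z)" by norm
  ultimately show "y \<in> Bx (r + 1) (t1 / 2) (t2 + 1)" using z c by (auto simp: mem_Bx)
 qed
 show ?thesis by (rule that[OF k lim cb])
qed

section \<open>Young and Hoelder estimates, almost everywhere convergence of mollifications\<close>

lemma young_scaled:
 fixes a b p q c :: real
 assumes "1 < p" "q = p / (p - 1)" "0 <= a" "0 <= b" "0 < c"
 shows "a * b <= c powr q * a powr q + c powr (- p) * b powr p"
proof -
 have q: "q > 1" "1 / q + 1 / p = 1" unfolding assms(2) using assms(1) by (simp_all add: field_simps)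
 have "a * b = (c * a) * (b / c)" using assms by simp
 also have "... <= (c * a) powr q / q + (b / c) powr p / p"
  by (rule Youngs_inequality) (use assms q in auto)
 also have "... <= (c * a) powr q + (b / c) powr p"
  using assms(1) q by (intro add_mono) (auto simp: divide_le_eq mult_le_cancel_left1)
 also have "... = c powr q * a powr q + c powr (- p) * b powr p"
  using assms by (simp add: powr_mult powr_divide powr_minus field_simps)
 finally show ?thesis .
qed

lemma holder_integrable:
 fixes f g :: "'b => real"
 assumes p: "1 < p" "q = p / (p - 1)" and [measurable]: "f \<in> borel_measurable M" "g \<in> borel_measurable M"
  and pos: "!!x. 0 <= f x" "!!x. 0 <= g x"
  and g: "integrable M (%x. g x powr q)" and f: "integrable M (%x. f x powr p)"
 shows "integrable M (%x. g x * f x)"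
proof (rule integrable_dominated[where f = "%x. g x powr q + f x powr p"])
 show "AE x in M. norm (g x * f x) <= norm (g x powr q + f x powr p)"
  using young_scaled[OF p, of "g _" "f _" 1] pos by (intro AE_I2) (simp add: abs_mult)
qed (use f g in auto)

lemma holder_tendsto_zero:
 fixes f :: "nat => 'b => real"
 assumes p: "1 < p" "q = p / (p - 1)" and [measurable]: "!!n. f n \<in> borel_measurable M" "g \<in> borel_measurable M"
  and pos: "!!n x. 0 <= f n x" "!!x. 0 <= g x"
  and g: "integrable M (%x. g x powr q)" and f: "!!n. integrable M (%x. f n x powr p)"
  and lim: "(%n. LINT x|M. f n x powr p) ----> 0"
 shows "(%n. LINT x|M. g x * f n x) ----> 0"
proof (rule order_tendstoI)
 fix e :: real assume e: "0 < e"
 define A where "A = (LINT x|M. g x powr q)"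
 have A: "A >= 0" by (simp add: A_def)
 have q: "q > 0" using p by simp
 \<comment> \<open>This scale makes the term with the fixed factor \<open>g\<close> at most
   \<open>e / 2\<close> for every \<open>n\<close>, while the other term tends to 0. The summand 1
   covers the case \<open>A = 0\<close>.\<close>
 define c where "c = (e / (2 * (A + 1))) powr (1 / q)"
 have l: "c > 0" using e A by (simp add: c_def)
 have lq: "c powr q = e / (2 * (A + 1))" using e A q by (simp add: c_def powr_powr)
 have "((%n. c powr (- p) * (LINT x|M. f n x powr p)) ----> c powr (- p) * 0)" by (intro tendsto_intros lim)
 then have "eventually (%n. c powr (- p) * (LINT x|M. f n x powr p) < e / 2) sequentially"
  using e by (intro order_tendstoD(2)) auto
 then show "eventually (%n. (LINT x|M. g x * f n x) < e) sequentially"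
 proof eventually_elim
  case (elim n)
  have "(LINT x|M. g x * f n x) <= (LINT x|M. c powr q * g x powr q + c powr (- p) * f n x powr p)"
  proof (rule integral_mono)
   show "integrable M (%x. g x * f n x)" by (rule holder_integrable[OF p _ _ _ _ g f]) (use pos in auto)
   show "g x * f n x <= c powr q * g x powr q + c powr (- p) * f n x powr p" for x
    by (rule young_scaled[OF p pos(2) pos(1) l])
  qed (use f g in auto)
  also have "... = c powr q * A + c powr (- p) * (LINT x|M. f n x powr p)" using f g by (simp add: A_def)
  also have "... < c powr q * A + e / 2" using elim by simp
  also have "c powr q * A <= e / 2" using e A unfolding lq by (simp add: field_simps)
  finally show ?case by simp
 qed
next
 fix a :: real assume "a < 0"
 have "0 <= (LINT x|M. g x * f n x)" for n using pos by (intro Bochner_Integration.integral_nonneg) auto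
 then show "eventually (%n. a < (LINT x|M. g x * f n x)) sequentially"
  using \<open>a < 0\<close> by (intro always_eventually allI) (meson less_le_trans)
qed

lemma conv_Lp_integrable:
 fixes f :: "'b::euclidean_space => 'c::euclidean_space"
 assumes f: "integrable lborel f" "integrable lborel (%x. norm (f x) powr p)" and p: "1 <= p" and k: "mollifier \<delta> k"
 shows "integrable lborel (%x. norm (conv k f x - f x) powr p)"
proof -
 have [measurable]: "f \<in> meas" using borel_measurable_integrable[OF f(1)] by simp
 define e where "e = 2 powr p * (2 * (LI x. norm (f x) powr p))"
 have e: "e >= 0" by (simp add: e_def)
 show ?thesis
 proof (rule conv_Lp(1)[OF f p e k])
  fix h
  have i: "integrable lborel (%x. norm (f (x + h)) powr p)" using f(2) lborel_shift(1)[of "%x. norm (f x) powr p" h] by simp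
  have "(LI x. norm (f (x + h) - f x) powr p) <= (LI x. 2 powr p * (norm (f (x + h)) powr p + norm (f x) powr p))"
   by (rule integral_mono) (use integrable_Lp_shift[of f p h] f p i Lp_shift_bound[of p f _ h] in auto)
  also have "... = e"
   using f(2) i lborel_shift(2)[of "%x. norm (f x) powr p" h] by (simp add: e_def)
  finally show "(LI x. norm (f (x + h) - f x) powr p) <= e" .
 qed
qed

lemma conv_L1_tendsto:
 fixes f :: "'b::euclidean_space => 'c::euclidean_space"
 assumes f: "integrable lborel f" and k: "!!n. mollifier (\<delta> n) (k n)" and \<delta>: "\<delta> ----> 0"
 shows "integrable lborel (%x. conv (k n) f x - f x)" (is ?c1) "(%n. LI x. norm (conv (k n) f x - f x)) ----> 0" (is ?c2)
proof -
 have f1: "integrable lborel (%x. norm (f x) powr 1)" using f by simp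
 have [measurable]: "conv (k n) f \<in> meas"
  using conv_continuous[of "\<delta> n" "k n" f] k[of n] f by (auto simp: mollifier_def intro!: continuous_measurable)
 have [measurable]: "f \<in> meas" using borel_measurable_integrable[OF f] by simp
 have "integrable lborel (%x. norm (conv (k n) f x - f x))"
  using conv_Lp_integrable[OF f f1 order_refl k[of n]] by simp
 then show ?c1 by (subst (asm) integrable_norm_iff) auto
 show ?c2
  using conv_Lp_tendsto[OF f f1 order_refl k \<delta>] by simp
qed

lemma conv_AE_subseq:
 fixes f :: "'b::euclidean_space => 'c::euclidean_space"
 assumes f: "integrable lborel f" and k: "!!n. mollifier (\<delta> n) (k n)" and \<delta>: "\<delta> ----> 0"
 obtains s :: "nat => nat" where "strict_mono s" "AE z in lborel. (%n. conv (k (s n)) f z) ----> f z"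
proof -
 obtain s where s: "strict_mono s" "AE z in lborel. (%n. conv (k (s n)) f z - f z) ----> 0"
  using tendsto_L1_AE_subseq[OF conv_L1_tendsto[OF assms]] by blast
 have "AE z in lborel. (%n. conv (k (s n)) f z) ----> f z"
  using s(2) by eventually_elim (rule LIM_zero_cancel)
 then show ?thesis by (rule that[OF s(1)])
qed

text \<open>The assumption says that the zero function has weak time derivative \<open>e\<close>.
  Hence mollifications of \<open>e\<close> are derivatives of mollifications of zero and vanish, and
  along a subsequence they converge to \<open>e\<close> almost everywhere.\<close>

lemma fundamental_lemma:
 fixes e :: "'a::euclidean_space \<times> real => real"
 assumes e: "locally_integrable e" and zero: "!!\<phi>. test_fun \<phi> ==> (LIS z. e z * \<phi> z) = 0"
 shows "AE z in lborel. z \<in> S_infty --> e z = 0"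
proof -
 have w: "weak_dir (0, 1) (%_. 0) e" using e zero
  by (simp add: weak_dir_def locally_integrable_def set_integrable_def)
 have box: "AE z in lborel. z \<in> Bx r t1 t2 --> e z = 0" if t1: "0 < t1" for r t1 t2
 proof -
  obtain k :: "nat => 'a \<times> real => real" and \<delta> :: "nat => real" where k: "!!n. mollifier (\<delta> n) (k n)" "\<delta> ----> 0"
   "!!n (z :: 'a \<times> real). z \<in> Bx r t1 t2 ==> cball z (\<delta> n) \<subseteq> Bx (r + 1) (t1 / 2) (t2 + 1)"
   using mollifier_seq[OF t1] by metis
  have t1': "0 < t1 / 2" using t1 by simp
  define f where "f y = indicator (Bx (r + 1) (t1 / 2) (t2 + 1)) y *. e y" for y
  have f: "integrable lborel f" unfolding f_def by (rule loc_int_Bx[OF e t1'])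
  obtain s where s: "strict_mono s" "AE z in lborel. (%n. conv (k (s n)) f z) ----> f z"
   by (rule conv_AE_subseq[OF f k(1,2)])
  have c0: "conv (k n) f z = 0" if "z \<in> Bx r t1 t2" for n z
  proof -
   have "conv (k n) (%y. indicator (Bx (r + 1) (t1 / 2) (t2 + 1)) y *. (0::real)) = (%_. 0)"
    by (rule ext) (simp add: conv_def)
   then show ?thesis
    using pd_conv_weak[OF w Basis_t k(1)[of n] k(3)[OF that, of n] t1'] unfolding f_def by (simp only: frechet_derivative_const)
  qed
  have sub: "z \<in> Bx (r + 1) (t1 / 2) (t2 + 1)" if "z \<in> Bx r t1 t2" for z :: "'a \<times> real" using that t1 by (auto simp: mem_Bx)
  show ?thesis using s(2)
  proof eventually_elim
   case (elim z)
   show ?case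
   proof
    assume z: "z \<in> Bx r t1 t2"
    have "(%n::nat. 0::real) ----> f z" using elim c0[OF z] by simp
    then have "f z = 0" by (simp add: LIMSEQ_const_iff)
    then show "e z = 0" using sub[OF z] by (simp add: f_def)
   qed
  qed
 qed
 have "AE z in lborel. \<forall>n::nat. z \<in> Bx (real n) (1 / real (Suc n)) (real n) --> e z = 0"
  unfolding AE_all_countable using box by simp
 then show ?thesis
 proof eventually_elim
  case (elim z)
  show ?case
  proof
   assume z: "z \<in> S_infty"
   then have pos: "snd z > 0" by (simp add: mem_S)
   obtain n1 n2 n3 where n: "norm (fst z) <= real n1" "snd z <= real n2" "1 / snd z <= real n3"
    using real_arch_simple by metis
   define n where "n = n1 + n2 + n3"
   have "1 / snd z <= real (Suc n)" using n(3) by (simp add: n_def)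
   then have "1 / real (Suc n) <= snd z" using pos by (simp add: field_simps)
   then have "z \<in> Bx (real n) (1 / real (Suc n)) (real n)" using n by (auto simp: mem_Bx n_def)
   then show "e z = 0" using elim by blast
  qed
 qed
qed

section \<open>Chain rules for weak derivatives\<close>

lemma grad_x_measurable: "smooth \<theta> ==> grad_x \<theta> \<in> meas"
 unfolding grad_x_def[abs_def]
 by (intro borel_measurable_sum borel_measurable_scaleR smooth_measurable smooth_pd Basis_x) auto

lemma grad_x_bounded:
 fixes \<theta> :: "'a::euclidean_space \<times> real => real"
 assumes "test_fun \<theta>" obtains M where "M >= 0" "!!z. norm (grad_x \<theta> z) <= M"
proof -
 have "\<exists>M. \<forall>z. \<bar>pd (b, 0) \<theta> z\<bar> <= M" if "b \<in> Basis" for b :: 'a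
  using test_fun_bounded[OF test_fun_pd[OF assms Basis_x[OF that]]] by metis
 then obtain M where M: "!!b z. b \<in> (Basis :: 'a set) ==> \<bar>pd (b, 0) \<theta> z\<bar> <= M b" by metis
 have le: "norm (grad_x \<theta> z) <= (\<Sum>b\<in>(Basis::'a set). M b)" for z
  unfolding grad_x_def by (rule order_trans[OF norm_sum], rule sum_mono) (simp add: M)
 have "0 <= (\<Sum>b\<in>(Basis::'a set). M b)" using order_trans[OF norm_ge_zero le[of undefined]] .
 then show ?thesis by (rule that) (rule le)
qed

lemma grad_x_zero:
 assumes "!!z. z \<notin> Bx r t1 t2 ==> \<theta> z = 0" "z \<notin> Bx r t1 t2"
 shows "grad_x \<theta> z = 0"
 using pd_zero_off_Bx[OF assms] by (simp add: grad_x_def)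

lemma pd_mult_compose:
 assumes \<theta>: "smooth \<theta>" and c: "smooth c" and H: "(H has_real_derivative H') (at (c z))"
 shows "pd b (%z. \<theta> z * H (c z)) z = H (c z) * pd b \<theta> z + \<theta> z * H' * pd b c z"
proof -
 have "(H has_derivative (%x. H' * x)) (at (c z))" using H by (simp add: has_field_derivative_def)
 from has_derivative_mult[OF smooth_has_derivative[OF \<theta>] has_derivative_compose[OF smooth_has_derivative[OF c] this]]
 have "((%z. \<theta> z * H (c z)) has_derivative (%h. \<theta> z * (H' * frechet_derivative c (at z) h) + frechet_derivative \<theta> (at z) h * H (c z))) (at z)" .
 then have "frechet_derivative (%z. \<theta> z * H (c z)) (at z) = (%h. \<theta> z * (H' * frechet_derivative c (at z) h) + frechet_derivative \<theta> (at z) h * H (c z))"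
  by (rule frechet_derivative_at[symmetric])
 then show ?thesis by (simp add: algebra_simps)
qed

lemma grad_x_mult_compose:
 assumes \<theta>: "smooth \<theta>" and c: "smooth c" and H: "(H has_real_derivative H') (at (c z))"
 shows "grad_x (%z. \<theta> z * H (c z)) z = H (c z) *. grad_x \<theta> z + (\<theta> z * H') *. grad_x c z"
 unfolding grad_x_def pd_mult_compose[OF assms]
 by (simp add: scaleR_add_left sum.distrib scaleR_sum_right)

lemma integral_tendsto_L1:
 fixes T :: "nat => 'b::euclidean_space => real"
 assumes "!!n. integrable M (T n)" "integrable M T0" "!!n. integrable M (e n)"
  and le: "!!n x. \<bar>T n x - T0 x\<bar> <= C * e n x" and lim: "(%n. LINT x|M. e n x) ----> 0"
 shows "(%n. LINT x|M. T n x) ----> (LINT x|M. T0 x)"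
proof (rule LIM_zero_cancel, rule Lim_null_comparison)
 show "eventually (%n. norm ((LINT x|M. T n x) - (LINT x|M. T0 x)) <= C * (LINT x|M. e n x)) sequentially"
 proof (intro always_eventually allI)
  fix n
  have "norm ((LINT x|M. T n x) - (LINT x|M. T0 x)) = norm (LINT x|M. T n x - T0 x)" using assms(1,2) by simp
  also have "... <= (LINT x|M. C * e n x)"
   by (rule Bochner_Integration.integral_norm_bound_integral[of M "%x. T n x - T0 x" "%x. C * e n x"]) (use assms in auto)
  finally show "norm ((LINT x|M. T n x) - (LINT x|M. T0 x)) <= C * (LINT x|M. e n x)" by simp
 qed
 show "(%n. C * (LINT x|M. e n x)) ----> 0" using tendsto_mult_left[OF lim, of C] by simp
qed

text \<open>The function \<open>\<theta> H(w)\<close> wanted in the comparison is not smooth, so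
  \<open>w\<close> is replaced by mollifications \<open>c n\<close>. Near the support of
  \<open>\<theta>\<close> their gradients are mollifications of \<open>D\<close> and converge in
  \<open>L^p\<close>; as \<open>H'\<close> is bounded, Hoelder's inequality against a field
  \<open>F\<close> in \<open>L^q\<close> gives the limit. The sequence is chosen before
  \<open>F\<close>, and its pointwise limit is recorded for the time term.\<close>

lemma weak_chain:
 fixes w :: "'a::euclidean_space \<times> real => real" and D :: "'a \<times> real => 'a"
 assumes w: "weak_grad_x w D" and p: "1 < p" "q = p / (p - 1)" and Dp: "locally_integrable (%z. norm (D z) powr p)"
  and H: "smooth H" "!!x. (H has_real_derivative H' x) (at x)" "continuous_on UNIV H'" "!!x. \<bar>H x\<bar> <= MH" "!!x. \<bar>H' x\<bar> <= MH'"
  and \<theta>: "test_fun \<theta>"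
 shows "\<exists>c. (\<forall>n. test_fun (%z. \<theta> z * H (c n z))) \<and>
  (AE z in lborel. z \<in> S_infty --> (%n. \<theta> z * H (c n z)) ----> \<theta> z * H (w z)) \<and>
  (\<forall>F. set_borel_measurable lborel S_infty F --> locally_integrable F --> locally_integrable (%z. norm (F z) powr q) -->
   S_integrable (%z. F z \<bullet> (H (w z) *. grad_x \<theta> z + (\<theta> z * H' (w z)) *. D z)) \<and>
   (\<forall>n::nat. S_integrable (%z. F z \<bullet> grad_x (%z. \<theta> z * H (c n z)) z)) \<and>
   (%n. LIS z. F z \<bullet> grad_x (%z. \<theta> z * H (c n z)) z) ---->
    (LIS z. F z \<bullet> (H (w z) *. grad_x \<theta> z + (\<theta> z * H' (w z)) *. D z)))"
proof -
 obtain r t1 t2 where s: "0 < r" "0 < t1" "t1 < t2" "!!z. z \<notin> Bx r t1 t2 ==> \<theta> z = 0" using test_fun_supp[OF \<theta>] by metis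
 let ?B = "Bx r t1 t2 :: ('a \<times> real) set"
 let ?K = "Bx (r + 1) (t1 / 2) (t2 + 1) :: ('a \<times> real) set"
 have t1': "0 < t1 / 2" using s by simp
 have BK: "z \<in> ?K" if "z \<in> ?B" for z using that s by (auto simp: mem_Bx)
 have KS: "z \<in> S_infty" if "z \<in> ?K" for z using that Bx_S[OF t1'] by blast
 obtain k0 :: "nat => 'a \<times> real => real" and \<delta>0 :: "nat => real" where k0: "!!n. mollifier (\<delta>0 n) (k0 n)" "\<delta>0 ----> 0"
  "!!n (z :: 'a \<times> real). z \<in> ?B ==> cball z (\<delta>0 n) \<subseteq> ?K"
  using mollifier_seq[OF s(2)] by metis
 define wK where "wK y = indicator ?K y *. w y" for y
 define DK where "DK y = indicator ?K y *. D y" for y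
 have iw: "integrable lborel wK" unfolding wK_def by (rule loc_int_Bx[OF _ t1']) (use w in "simp add: weak_grad_x_def")
 have iD: "integrable lborel DK" unfolding DK_def by (rule loc_int_Bx[OF _ t1']) (use w in "simp add: weak_grad_x_def")
 have "norm (DK z) powr p = indicator ?K z *. norm (D z) powr p" for z by (simp add: DK_def indicator_def)
 then have iDp: "integrable lborel (%z. norm (DK z) powr p)" using loc_int_Bx[OF Dp t1'] by simp
 obtain \<sigma> where \<sigma>: "strict_mono \<sigma>" "AE z in lborel. (%n. conv (k0 (\<sigma> n)) wK z) ----> wK z"
  by (rule conv_AE_subseq[OF iw k0(1,2)])
 define k where "k n = k0 (\<sigma> n)" for n
 define \<delta> where "\<delta> n = \<delta>0 (\<sigma> n)" for n :: nat
 have k: "mollifier (\<delta> n) (k n)" for n by (simp add: k_def \<delta>_def k0(1))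
 have \<delta>: "\<delta> ----> 0" using LIMSEQ_subseq_LIMSEQ[OF k0(2) \<sigma>(1)] by (simp add: \<delta>_def[abs_def] o_def)
 have ksub: "cball z (\<delta> n) \<subseteq> ?K" if "z \<in> ?B" for n z using k0(3)[OF that] by (simp add: \<delta>_def)
 have kc: "csupp (\<delta> n) (k n)" for n using k[of n] by (simp add: mollifier_def)
 define c where "c n = conv (k n) wK" for n
 have cAE: "AE z in lborel. (%n. c n z) ----> wK z" using \<sigma>(2) by (simp add: c_def k_def)
 have cs: "smooth (c n)" for n unfolding c_def by (rule conv_smooth[OF kc iw])
 define \<eta> where "\<eta> n z = \<theta> z * H (c n z)" for n z
 have \<theta>s: "smooth \<theta>" by (rule test_fun_smooth[OF \<theta>])
 have \<eta>t: "test_fun (\<eta> n)" for n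
 proof (rule test_funI[of "\<eta> n" t1 r t2])
  show "smooth (\<eta> n)" unfolding \<eta>_def[abs_def] by (rule smooth_mult[OF \<theta>s smooth_compose_real[OF cs H(1)]])
  show "z \<in> ?B" if "\<eta> n z ~= 0" for z using that s(4)[of z] by (auto simp: \<eta>_def)
 qed (rule s(2))
 define Dn where "Dn n = conv (k n) DK" for n
 have grad: "grad_x (\<eta> n) z = H (c n z) *. grad_x \<theta> z + (\<theta> z * H' (c n z)) *. Dn n z" for n z
 proof (cases "z \<in> ?B")
  case True
  have "grad_x (c n) z = Dn n z"
   unfolding c_def Dn_def wK_def DK_def by (rule grad_x_conv_weak[OF w k ksub[OF True] t1'])
  then show ?thesis using grad_x_mult_compose[OF \<theta>s cs H(2)] by (simp add: \<eta>_def[abs_def])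
 next
  case False
  have "\<eta> n z = 0" if "z \<notin> ?B" for z using s(4)[OF that] by (simp add: \<eta>_def)
  then show ?thesis using grad_x_zero[of r t1 t2 "\<eta> n" z] grad_x_zero[OF s(4) False] False s(4)[OF False] by auto
 qed
 have \<eta>AE: "AE z in lborel. z \<in> S_infty --> (%n. \<eta> n z) ----> \<theta> z * H (w z)"
  using cAE
 proof eventually_elim
  case (elim z)
  show ?case
  proof (cases "z \<in> ?B")
   case True
   then have "(%n. c n z) ----> w z" using elim BK by (simp add: wK_def)
   from tendsto_mult_left[OF isCont_tendsto_compose[OF DERIV_isCont[OF H(2)] this]]
   show ?thesis unfolding \<eta>_def by simp
  next
   case False then show ?thesis by (simp add: \<eta>_def s(4))
  qed
 qed
 obtain M\<theta> where M\<theta>: "M\<theta> >= 0" "!!z. \<bar>\<theta> z\<bar> <= M\<theta>" using test_fun_bounded[OF \<theta>] by metis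
 obtain Mg where Mg: "Mg >= 0" "!!z. norm (grad_x \<theta> z) <= Mg" using grad_x_bounded[OF \<theta>] by metis
 have MH: "MH >= 0" using H(4)[of 0] by linarith
 have MH': "MH' >= 0" using H(5)[of 0] by linarith
 have [measurable]: "H \<in> meas" "H' \<in> meas" "!!n. c n \<in> meas"
   "grad_x \<theta> \<in> meas" "\<theta> \<in> meas" "DK \<in> meas" "wK \<in> meas"
   "!!n. Dn n \<in> meas"
  using smooth_measurable[OF H(1)] continuous_measurable[OF H(3)] smooth_measurable[OF cs] grad_x_measurable[OF \<theta>s]
   smooth_measurable[OF \<theta>s] borel_measurable_integrable[OF iD] borel_measurable_integrable[OF iw]
   continuous_measurable[OF conv_continuous[OF kc iD]] by (auto simp: Dn_def)
 have main: "S_integrable (%z. F z \<bullet> (H (w z) *. grad_x \<theta> z + (\<theta> z * H' (w z)) *. D z)) \<and>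
   (\<forall>n::nat. S_integrable (%z. F z \<bullet> grad_x (\<eta> n) z)) \<and>
   (%n. LIS z. F z \<bullet> grad_x (\<eta> n) z) ---->
    (LIS z. F z \<bullet> (H (w z) *. grad_x \<theta> z + (\<theta> z * H' (w z)) *. D z))"
  if F: "set_borel_measurable lborel S_infty F" "locally_integrable F" "locally_integrable (%z. norm (F z) powr q)" for F :: "'a \<times> real => 'a"
 proof -
  define FB where "FB z = indicator ?B z *. F z" for z
  have iF: "integrable lborel FB" unfolding FB_def by (rule loc_int_Bx[OF F(2) s(2)])
  have "norm (FB z) powr q = indicator ?B z *. norm (F z) powr q" for z by (simp add: FB_def indicator_def)
  then have iFq: "integrable lborel (%z. norm (FB z) powr q)" using loc_int_Bx[OF F(3) s(2)] by simp
  have [measurable]: "FB \<in> meas" using borel_measurable_integrable[OF iF] by simp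
  define f where "f n z = norm (Dn n z - DK z)" for n z
  have [measurable]: "f n \<in> meas" for n unfolding f_def[abs_def] by measurable
  have ifp: "integrable lborel (%z. f n z powr p)" for n
   unfolding f_def Dn_def using p by (intro conv_Lp_integrable[OF iD iDp _ k]) simp
  have fp0: "(%n. LI z. f n z powr p) ----> 0"
   unfolding f_def Dn_def using p by (intro conv_Lp_tendsto[OF iD iDp _ k \<delta>]) simp
  have iGf: "integrable lborel (%z. norm (FB z) * f n z)" for n
   by (rule holder_integrable[OF p _ _ _ _ iFq ifp]) (auto simp: f_def)
  have Gf0: "(%n. LI z. norm (FB z) * f n z) ----> 0"
   by (rule holder_tendsto_zero[OF p _ _ _ _ iFq ifp fp0]) (auto simp: f_def)
  have iGD: "integrable lborel (%z. norm (FB z) * norm (DK z))"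
   by (rule holder_integrable[OF p _ _ _ _ iFq iDp]) auto
  define W where "W z = MH * Mg * norm (FB z) + M\<theta> * MH' * (norm (FB z) * norm (DK z))" for z
  have iW: "integrable lborel W" unfolding W_def using iF iGD by auto
  define T where "T y z = H (y z) * (FB z \<bullet> grad_x \<theta> z) + \<theta> z * H' (y z) * (FB z \<bullet> DK z)" for y z
  have TW: "\<bar>T y z\<bar> <= W z" for y z
  proof -
   have "\<bar>FB z \<bullet> grad_x \<theta> z\<bar> <= norm (FB z) * Mg"
    by (rule order_trans[OF Cauchy_Schwarz_ineq2 mult_left_mono[OF Mg(2) norm_ge_zero]])
   then have "\<bar>H (y z) * (FB z \<bullet> grad_x \<theta> z)\<bar> <= MH * (norm (FB z) * Mg)"
    unfolding abs_mult using H(4) MH by (intro mult_mono) auto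
   moreover have "\<bar>\<theta> z * H' (y z) * (FB z \<bullet> DK z)\<bar> <= M\<theta> * MH' * (norm (FB z) * norm (DK z))"
    unfolding abs_mult using H(5) MH' M\<theta> Cauchy_Schwarz_ineq2[of "FB z" "DK z"]
    by (intro mult_mono) auto
   ultimately show ?thesis unfolding T_def W_def using abs_triangle_ineq[of "H (y z) * (FB z \<bullet> grad_x \<theta> z)" "\<theta> z * H' (y z) * (FB z \<bullet> DK z)"]
    by (simp add: mult_ac)
  qed
  have mT: "(%z. T (c n) z) \<in> borel_measurable lborel" for n unfolding T_def by measurable
  have mTw: "(%z. T wK z) \<in> borel_measurable lborel" unfolding T_def by measurable
  have iTn: "integrable lborel (%z. T (c n) z)" for n
   by (rule integrable_dominated[OF iW mT]) (intro AE_I2, simp only: real_norm_def order_trans[OF TW abs_ge_self])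
  have iTw: "integrable lborel (%z. T wK z)"
   by (rule integrable_dominated[OF iW mTw]) (intro AE_I2, simp only: real_norm_def order_trans[OF TW abs_ge_self])
  have limT: "(%n. LI z. T (c n) z) ----> (LI z. T wK z)"
  proof (rule dominated_conv[OF mTw mT iW])
   show "AE z in lborel. (%n. T (c n) z) ----> T wK z" using cAE
   proof eventually_elim
    case (elim z)
    have "isCont H' (wK z)" using H(3) by (simp add: continuous_on_eq_continuous_at)
    then have "(%n. H' (c n z)) ----> H' (wK z)" using elim by (rule isCont_tendsto_compose)
    moreover have "(%n. H (c n z)) ----> H (wK z)" using DERIV_isCont[OF H(2)] elim by (rule isCont_tendsto_compose)
    ultimately show ?case unfolding T_def by (intro tendsto_intros)
   qed
   show "AE z in lborel. norm (T (c n) z) <= W z" for n using TW by (intro AE_I2) simp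
  qed
  have Tw: "indicator S_infty z *. (F z \<bullet> (H (w z) *. grad_x \<theta> z + (\<theta> z * H' (w z)) *. D z)) = T wK z" for z
  proof (cases "z \<in> ?B")
   case True
   then show ?thesis using BK[OF True] KS[OF BK[OF True]]
    by (simp add: T_def FB_def wK_def DK_def inner_add_right)
  next
   case False
   then show ?thesis using grad_x_zero[OF s(4) False] s(4)[OF False] by (simp add: T_def FB_def)
  qed
  define R where "R n z = indicator S_infty z *. (F z \<bullet> grad_x (\<eta> n) z)" for n z
  \<comment> \<open>The mollified gradient is split into \<open>DK\<close>, for which dominated
    convergence applies, and the error \<open>Dn n - DK\<close>, which is small in
    \<open>L^p\<close> and is paired with \<open>FB\<close> by Hoelder's inequality.\<close>
  have Req: "R n z = T (c n) z + \<theta> z * H' (c n z) * (FB z \<bullet> (Dn n z - DK z))" for n z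
  proof (cases "z \<in> ?B")
   case True
   then show ?thesis using BK[OF True] KS[OF BK[OF True]]
    by (simp add: R_def T_def FB_def grad inner_add_right inner_diff_right algebra_simps)
  next
   case False
   then show ?thesis using grad_x_zero[OF s(4) False] s(4)[OF False] by (simp add: R_def T_def FB_def grad)
  qed
  have Rle: "\<bar>\<theta> z * H' (c n z) * (FB z \<bullet> (Dn n z - DK z))\<bar> <= (M\<theta> * MH') * (norm (FB z) * f n z)" for n z
   unfolding abs_mult f_def using H(5) MH' M\<theta> Cauchy_Schwarz_ineq2[of "FB z" "Dn n z - DK z"]
   by (intro mult_mono) auto
  have iR2: "integrable lborel (%z. \<theta> z * H' (c n z) * (FB z \<bullet> (Dn n z - DK z)))" for n
   by (rule integrable_dominated[OF integrable_mult_right[OF iGf[of n], of "M\<theta> * MH'"]])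
     (measurable, intro AE_I2, simp only: real_norm_def order_trans[OF Rle abs_ge_self])
  have iR: "integrable lborel (R n)" for n unfolding Req[abs_def] using iTn iR2 by simp
  have lim2: "(%n. LI z. \<theta> z * H' (c n z) * (FB z \<bullet> (Dn n z - DK z))) ----> (LINT z|(lborel::('a\<times>real) measure). 0)"
   by (rule integral_tendsto_L1[OF iR2 _ iGf _ Gf0, where C = "M\<theta> * MH'"]) (use Rle in auto)
  have "(%n. LI z. R n z) ----> (LI z. T wK z)"
   using tendsto_add[OF limT lim2] iTn iR2 by (simp add: Req)
  then show ?thesis
   using iR iTw unfolding set_lebesgue_integral_def Tw R_def[symmetric] by (simp add: R_def[abs_def])
 qed
 show ?thesis
  by (rule exI[of _ c]) (use \<eta>t \<eta>AE main in \<open>simp add: \<eta>_def[abs_def]\<close>)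
qed

lemma LD_smooth:
 fixes f :: "'a::euclidean_space \<times> real => real"
 assumes f: "smooth f" and b: "b \<in> Basis"
 shows "LD b f"
 unfolding LD_def
proof (intro allI impI)
 fix r t1 t2 :: real assume t1: "0 < t1"
 let ?B = "Bx r t1 t2 :: ('a \<times> real) set"
 have bd: "\<exists>M. \<forall>z\<in>?B. \<bar>g z\<bar> <= M" if g: "smooth g" for g :: "'a \<times> real => real"
 proof -
  have "continuous_on ?B g" using smooth_continuous[OF g] continuous_on_subset by blast
  then have "bounded (g ` ?B)" using compact_Bx by (intro compact_imp_bounded compact_continuous_image)
  then show ?thesis by (auto simp: bounded_iff)
 qed
 obtain M0 where M0: "\<forall>z\<in>?B. \<bar>f z\<bar> <= M0" using bd[OF f] by blast
 obtain M1 where M1: "\<forall>z\<in>?B. \<bar>pd b f z\<bar> <= M1" using bd[OF smooth_pd[OF f b]] by blast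
 define L where "L = max M0 M1"
 have cvx: "z + s *. b \<in> ?B" if z: "z \<in> ?B" and zt: "z + t *. b \<in> ?B" and s: "s \<in> closed_segment 0 t" for z s t
 proof -
  obtain v where l: "0 <= v" "v <= 1" "s = v * t" using s by (auto simp: closed_segment_def)
  have "convex ?B" by (simp add: Bx_def convex_Times)
  from convexD[OF this z zt, of "1 - v" v] l show ?thesis by (simp add: algebra_simps)
 qed
 show "\<exists>L. \<forall>z\<in>?B. \<bar>f z\<bar> <= L \<and> (\<forall>t. z + t *. b \<in> ?B --> \<bar>f (z + t *. b) - f z\<bar> <= L * \<bar>t\<bar>)"
 proof (intro exI[of _ L] ballI conjI allI impI)
  fix z assume z: "z \<in> ?B"
  show "\<bar>f z\<bar> <= L" using bspec[OF M0 z] by (simp add: L_def)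
  fix t assume zt: "z + t *. b \<in> ?B"
  have "norm ((%t. f (z + t *. b)) t - (%t. f (z + t *. b)) 0) <= L * norm (t - 0)"
  proof (rule field_differentiable_bound[where S = "closed_segment 0 t" and f' = "%t. pd b f (z + t *. b)"])
   show "((%t. f (z + t *. b)) has_real_derivative pd b f (z + s *. b)) (at s within closed_segment 0 t)" for s
    by (rule has_field_derivative_at_within[OF smooth_line_derivative[OF f]])
   show "norm (pd b f (z + s *. b)) <= L" if "s \<in> closed_segment 0 t" for s
    using bspec[OF M1 cvx[OF z zt that]] by (simp add: L_def)
  qed auto
  then show "\<bar>f (z + t *. b) - f z\<bar> <= L * \<bar>t\<bar>" by simp
 qed
qed

lemma LD_space:
 assumes "!!x. \<bar>g x\<bar> <= (R::real)" shows "LD (0, 1) (%z. g (fst z))"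
proof -
 have R: "R >= 0" using assms[of undefined] by linarith
 show ?thesis unfolding LD_def using assms R by (intro allI impI exI[of _ R]) auto
qed

lemma LD_const: "LD b (%_. c)"
 unfolding LD_def by (intro allI impI exI[of _ "\<bar>c\<bar>"]) auto

lemma locally_integrable_const:
 "locally_integrable (%_ :: 'a::euclidean_space \<times> real. c :: 'c::{banach, second_countable_topology})"
 unfolding locally_integrable_def set_integrable_def
proof (intro allI impI integrable_scaleR_left integrable_real_indicator)
 fix K :: "('a \<times> real) set" assume K: "compact K \<and> K \<subseteq> S_infty"
 show "K \<in> sets lborel" using K borel_compact by auto
 show "emeasure lborel K < \<infinity>" using K emeasure_compact_finite by blast
qed

text \<open>The derivative \<open>d\<close> is only locally integrable, so boundedness of
  \<open>\<Phi>'\<close> replaces Hoelder's inequality: \<open>\<Phi>' (c n) * d\<close> converges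
  by domination, and the error from \<open>dn n - d\<close> vanishes in \<open>L^1\<close>. The
  weight \<open>gx\<close>, constant along \<open>b\<close>, later carries the density when
  \<open>b\<close> is the time direction.\<close>

lemma weak_dir_chain:
 fixes w d gx :: "'a::euclidean_space \<times> real => real"
 assumes wd: "weak_dir b w d" and b: "b \<in> Basis"
  and \<Phi>: "!!x. (\<Phi> has_real_derivative \<Phi>' x) (at x)" "continuous_on UNIV \<Phi>'" "!!x. \<bar>\<Phi>' x\<bar> <= M"
  and [measurable]: "gx \<in> meas" and gxb: "!!z. \<bar>gx z\<bar> <= R"
  and inv: "!!z t. gx (z + t *. b) = gx z" and \<theta>: "test_fun \<theta>"
 shows "S_integrable (%z. gx z * \<Phi> (w z) * pd b \<theta> z)" (is ?c1)
  "S_integrable (%z. gx z * (\<Phi>' (w z) * d z) * \<theta> z)"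
  "(LIS z. gx z * \<Phi> (w z) * pd b \<theta> z) = - (LIS z. gx z * (\<Phi>' (w z) * d z) * \<theta> z)" (is ?c2)
proof -
 obtain r t1 t2 where s: "0 < r" "0 < t1" "t1 < t2" "!!z. z \<notin> Bx r t1 t2 ==> \<theta> z = 0" using test_fun_supp[OF \<theta>] by metis
 let ?B = "Bx r t1 t2 :: ('a \<times> real) set"
 let ?K = "Bx (r + 1) (t1 / 2) (t2 + 1) :: ('a \<times> real) set"
 have t1': "0 < t1 / 2" using s by simp
 have BK: "z \<in> ?K" if "z \<in> ?B" for z using that s by (auto simp: mem_Bx)
 have KS: "z \<in> S_infty" if "z \<in> ?K" for z using that Bx_S[OF t1'] by blast
 have wl: "locally_integrable w" "locally_integrable d" using wd by (auto simp: weak_dir_def)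
 obtain k0 :: "nat => 'a \<times> real => real" and \<delta>0 :: "nat => real" where k0: "!!n. mollifier (\<delta>0 n) (k0 n)" "\<delta>0 ----> 0"
  "!!n (z :: 'a \<times> real). z \<in> ?B ==> cball z (\<delta>0 n) \<subseteq> ?K"
  using mollifier_seq[OF s(2)] by metis
 define wK where "wK y = indicator ?K y *. w y" for y
 define dK where "dK y = indicator ?K y *. d y" for y
 have iw: "integrable lborel wK" unfolding wK_def by (rule loc_int_Bx[OF wl(1) t1'])
 have id: "integrable lborel dK" unfolding dK_def by (rule loc_int_Bx[OF wl(2) t1'])
 obtain \<sigma> where \<sigma>: "strict_mono \<sigma>" "AE z in lborel. (%n. conv (k0 (\<sigma> n)) wK z) ----> wK z"
  by (rule conv_AE_subseq[OF iw k0(1,2)])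
 define k where "k n = k0 (\<sigma> n)" for n
 define \<delta> where "\<delta> n = \<delta>0 (\<sigma> n)" for n :: nat
 have k: "mollifier (\<delta> n) (k n)" for n by (simp add: k_def \<delta>_def k0(1))
 have \<delta>: "\<delta> ----> 0" using LIMSEQ_subseq_LIMSEQ[OF k0(2) \<sigma>(1)] by (simp add: \<delta>_def[abs_def] o_def)
 have ksub: "cball z (\<delta> n) \<subseteq> ?K" if "z \<in> ?B" for n z using k0(3)[OF that] by (simp add: \<delta>_def)
 have kc: "csupp (\<delta> n) (k n)" for n using k[of n] by (simp add: mollifier_def)
 define c where "c n = conv (k n) wK" for n
 define dn where "dn n = conv (k n) dK" for n
 have cAE: "AE z in lborel. (%n. c n z) ----> wK z" using \<sigma>(2) by (simp add: c_def k_def)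
 have cs: "smooth (c n)" for n unfolding c_def by (rule conv_smooth[OF kc iw])
 have cd: "pd b (c n) z = dn n z" if "z \<in> ?B" for n z
  unfolding c_def dn_def wK_def dK_def by (rule pd_conv_weak[OF wd b k ksub[OF that] t1'])
 have \<theta>s: "smooth \<theta>" by (rule test_fun_smooth[OF \<theta>])
 have dts: "smooth (pd b \<theta>)" by (rule smooth_pd[OF \<theta>s b])
 have \<Phi>c: "continuous_on UNIV \<Phi>" using \<Phi>(1) DERIV_isCont continuous_at_imp_continuous_on by blast
 have [measurable]: "\<Phi> \<in> meas" "\<Phi>' \<in> meas" "!!n. c n \<in> meas"
   "!!n. dn n \<in> meas" "wK \<in> meas" "dK \<in> meas" "\<theta> \<in> meas" "pd b \<theta> \<in> meas"
  using continuous_measurable[OF \<Phi>c] continuous_measurable[OF \<Phi>(2)] smooth_measurable[OF cs]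
   continuous_measurable[OF conv_continuous[OF kc id]] borel_measurable_integrable[OF iw] borel_measurable_integrable[OF id]
   smooth_measurable[OF \<theta>s] smooth_measurable[OF dts] by (auto simp: dn_def)
 obtain M\<theta> where M\<theta>: "M\<theta> >= 0" "!!z. \<bar>\<theta> z\<bar> <= M\<theta>" using test_fun_bounded[OF \<theta>] by metis
 obtain Md where Md: "Md >= 0" "!!z. \<bar>pd b \<theta> z\<bar> <= Md" using test_fun_bounded[OF test_fun_pd[OF \<theta> b]] by metis
 have M: "M >= 0" using \<Phi>(3)[of 0] by linarith
 have R: "R >= 0" using gxb[of 0] by linarith
 have \<Phi>L: "\<bar>\<Phi> x - \<Phi> y\<bar> <= M * \<bar>x - y\<bar>" for x y
 proof -
  have "norm (\<Phi> x - \<Phi> y) <= M * norm (x - y)"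
   by (rule field_differentiable_bound[where S = UNIV and f' = \<Phi>']) (use \<Phi> in auto)
  then show ?thesis by simp
 qed
 have off: "\<theta> z = 0" "pd b \<theta> z = 0" if "z \<notin> ?B" for z
  using s(4)[OF that] pd_zero_off_Bx[OF s(4) that] by simp_all
 define B1 where "B1 z = indicat_real ?B z" for z :: "'a \<times> real"
 have B1i: "integrable lborel B1" unfolding B1_def using emeasure_compact_finite[OF compact_Bx] by (intro integrable_real_indicator) auto
 define P where "P y z = gx z * \<Phi> (y z) * pd b \<theta> z" for y z
 define Q where "Q y z = gx z * (\<Phi>' (y z) * dK z) * \<theta> z" for y z
 define e where "e n z = \<bar>c n z - wK z\<bar> + \<bar>dn n z - dK z\<bar>" for n z
 have ie1: "integrable lborel (%z. c n z - wK z)" "integrable lborel (%z. dn n z - dK z)" for n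
  unfolding c_def dn_def using conv_L1_tendsto(1)[OF iw k \<delta>] conv_L1_tendsto(1)[OF id k \<delta>] by auto
 have ie: "integrable lborel (e n)" for n unfolding e_def using ie1 by auto
 have e0: "(%n. LI z. e n z) ----> 0"
  using tendsto_add[OF conv_L1_tendsto(2)[OF iw k \<delta>] conv_L1_tendsto(2)[OF id k \<delta>]] ie1 by (simp add: e_def c_def dn_def)
 have PB: "\<bar>P y z\<bar> <= R * Md * (\<bar>\<Phi> 0\<bar> * B1 z + M * \<bar>y z\<bar>)" for y z
 proof (cases "z \<in> ?B")
  case True
  have "\<bar>\<Phi> (y z)\<bar> <= \<bar>\<Phi> 0\<bar> + M * \<bar>y z\<bar>" using \<Phi>L[of "y z" 0] by simp
  then have "\<bar>gx z\<bar> * \<bar>\<Phi> (y z)\<bar> * \<bar>pd b \<theta> z\<bar> <= R * (\<bar>\<Phi> 0\<bar> + M * \<bar>y z\<bar>) * Md"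
   using gxb Md R M by (intro mult_mono) auto
  then show ?thesis using True by (simp add: P_def abs_mult B1_def mult_ac)
 qed (use off M R Md in "simp add: P_def B1_def")
 have mP: "P wK \<in> meas" "P (c n) \<in> meas" for n
  unfolding P_def[abs_def] by measurable
 have iP: "integrable lborel (P wK)"
  by (rule integrable_dominated[where f = "%z. R * Md * (\<bar>\<Phi> 0\<bar> * B1 z + M * \<bar>wK z\<bar>)"])
    (use B1i iw in simp, simp add: mP, intro AE_I2, simp only: real_norm_def order_trans[OF PB abs_ge_self])
 have icn: "integrable lborel (c n)" for n using Bochner_Integration.integrable_add[OF ie1(1)[of n] iw] by simp
 have iPn: "integrable lborel (P (c n))" for n
  by (rule integrable_dominated[where f = "%z. R * Md * (\<bar>\<Phi> 0\<bar> * B1 z + M * \<bar>c n z\<bar>)"])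
    (use B1i icn in simp, simp add: mP, intro AE_I2, simp only: real_norm_def order_trans[OF PB abs_ge_self])
 have Pdiff: "\<bar>P (c n) z - P wK z\<bar> <= (R * Md * M) * e n z" for n z
 proof -
  have "\<bar>gx z\<bar> * \<bar>\<Phi> (c n z) - \<Phi> (wK z)\<bar> * \<bar>pd b \<theta> z\<bar> <= R * (M * e n z) * Md"
  proof (intro mult_mono)
   show "\<bar>\<Phi> (c n z) - \<Phi> (wK z)\<bar> <= M * e n z"
    by (rule order_trans[OF \<Phi>L mult_left_mono[OF _ M]]) (simp add: e_def)
  qed (use gxb Md R M in "auto simp: e_def")
  then show ?thesis unfolding P_def by (simp add: abs_mult[symmetric] algebra_simps)
 qed
 have limP: "(%n. LI z. P (c n) z) ----> (LI z. P wK z)"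
  by (rule integral_tendsto_L1[OF iPn iP ie Pdiff e0])
 have QB: "\<bar>Q y z\<bar> <= (R * M * M\<theta>) * \<bar>dK z\<bar>" for y z
 proof -
  have "\<bar>gx z\<bar> * (\<bar>\<Phi>' (y z)\<bar> * \<bar>dK z\<bar>) * \<bar>\<theta> z\<bar> <= R * (M * \<bar>dK z\<bar>) * M\<theta>"
   using gxb \<Phi>(3) M\<theta> R M by (intro mult_mono) auto
  then show ?thesis by (simp add: Q_def abs_mult mult_ac)
 qed
 have iQB: "integrable lborel (%z. (R * M * M\<theta>) * \<bar>dK z\<bar>)" using id by simp
 have mQ: "Q wK \<in> borel_measurable lborel" "Q (c n) \<in> borel_measurable lborel" for n unfolding Q_def[abs_def] by measurable
 have iQ: "integrable lborel (Q wK)"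
  by (rule integrable_dominated[OF iQB mQ(1)]) (intro AE_I2, simp only: real_norm_def order_trans[OF QB abs_ge_self])
 have iQn: "integrable lborel (Q (c n))" for n
  by (rule integrable_dominated[OF iQB mQ(2)]) (intro AE_I2, simp only: real_norm_def order_trans[OF QB abs_ge_self])
 have limQ: "(%n. LI z. Q (c n) z) ----> (LI z. Q wK z)"
 proof (rule dominated_conv[OF mQ(1) mQ(2) iQB])
  show "AE z in lborel. (%n. Q (c n) z) ----> Q wK z" using cAE
  proof eventually_elim
   case (elim z)
   have "isCont \<Phi>' (wK z)" using \<Phi>(2) by (simp add: continuous_on_eq_continuous_at)
   then have "(%n. \<Phi>' (c n z)) ----> \<Phi>' (wK z)" using elim by (rule isCont_tendsto_compose)
   then show ?case unfolding Q_def by (intro tendsto_intros)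
  qed
  show "AE z in lborel. norm (Q (c n) z) <= (R * M * M\<theta>) * \<bar>dK z\<bar>" for n using QB by (intro AE_I2) simp
 qed
 define E where "E n z = gx z * \<Phi>' (c n z) * (dn n z - dK z) * \<theta> z" for n z
 have Ee: "\<bar>E n z - 0\<bar> <= (R * M * M\<theta>) * e n z" for n z
 proof -
  have "\<bar>gx z\<bar> * \<bar>\<Phi>' (c n z)\<bar> * \<bar>dn n z - dK z\<bar> * \<bar>\<theta> z\<bar> <= R * M * e n z * M\<theta>"
   using gxb \<Phi>(3) M\<theta> R M by (intro mult_mono) (auto simp: e_def)
  then show ?thesis by (simp add: E_def abs_mult mult_ac)
 qed
 have mE: "E n \<in> meas" for n unfolding E_def[abs_def] by measurable
 have iE: "integrable lborel (E n)" for n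
  by (rule integrable_dominated[OF integrable_mult_right[OF ie[of n], of "R * M * M\<theta>"]])
    (simp add: mE, intro AE_I2, simp only: real_norm_def order_trans[OF Ee[unfolded diff_0_right] abs_ge_self])
 have limE: "(%n. LI z. E n z) ----> (LINT z|(lborel::('a\<times>real) measure). 0)"
  by (rule integral_tendsto_L1[OF iE _ ie Ee e0]) simp
 have id_n: "(LI z. P (c n) z) = - (LI z. Q (c n) z + E n z)" for n
 proof -
  define a where "a z = gx z * \<Phi> (c n z)" for z
  define a' where "a' z = gx z * (\<Phi>' (c n z) * pd b (c n) z)" for z
  have LDg: "LD b gx" unfolding LD_def by (intro allI impI exI[of _ R] ballI conjI) (use R in "simp_all add: gxb inv")
  have LDa: "LD b a" unfolding a_def[abs_def]
  proof (rule LD_mult[OF LDg LD_compose[OF LD_smooth[OF cs b]]])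
   show "\<exists>L. \<forall>x y. \<bar>x\<bar> <= Ra --> \<bar>y\<bar> <= Ra --> \<bar>\<Phi> x - \<Phi> y\<bar> <= L * \<bar>x - y\<bar>" for Ra
    by (rule exI[of _ M]) (simp add: \<Phi>L)
  qed
  have der: "((%t. a (z + t *. b)) has_real_derivative a' z) (at 0)" for z
  proof -
   have "((%t. \<Phi> (c n (z + t *. b))) has_real_derivative \<Phi>' (c n (z + 0 *. b)) * pd b (c n) (z + 0 *. b)) (at 0)"
    by (rule DERIV_chain2[OF \<Phi>(1) smooth_line_derivative[OF cs]])
   from DERIV_cmult[OF this, of "gx z"] show ?thesis by (simp add: a_def a'_def inv)
  qed
  have mm: "pd b (c n) \<in> meas" by (rule smooth_measurable[OF smooth_pd[OF cs b]])
  note [measurable] = mm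
  have ma: "(%z. indicator S_infty z * a z) \<in> meas" "(%z. indicator S_infty z * a' z) \<in> meas"
   unfolding a_def a'_def by measurable
  have ib: "(LIS z. a z * pd b \<theta> z) = - (LIS z. a' z * \<theta> z)"
   by (rule integration_by_parts_test(3)[OF b LDa _ _ _ \<theta>])
     (use der ma in auto)
  have "indicator S_infty z *. (a z * pd b \<theta> z) = P (c n) z" for z
   using off[of z] KS[OF BK, of z] by (cases "z \<in> ?B") (auto simp: P_def a_def)
  moreover have "indicator S_infty z *. (a' z * \<theta> z) = Q (c n) z + E n z" for z
   using off[of z] KS[OF BK, of z] cd[of z n] by (cases "z \<in> ?B") (auto simp: Q_def E_def a'_def algebra_simps)
  ultimately show ?thesis using ib by (simp add: set_lebesgue_integral_def)
 qed
 have "(%n. LI z. P (c n) z) ----> - ((LI z. Q wK z) + (LINT z|(lborel::('a\<times>real) measure). 0))"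
  unfolding id_n using tendsto_minus[OF tendsto_add[OF limQ limE]] iQn iE by simp
 then have fin: "(LI z. P wK z) = - (LI z. Q wK z)"
  using LIMSEQ_unique[OF limP] by simp
 have PP: "indicator S_infty z *. (gx z * \<Phi> (w z) * pd b \<theta> z) = P wK z" for z
  using off[of z] KS[OF BK, of z] BK[of z] by (cases "z \<in> ?B") (auto simp: P_def wK_def)
 have QQ: "indicator S_infty z *. (gx z * (\<Phi>' (w z) * d z) * \<theta> z) = Q wK z" for z
  using off[of z] KS[OF BK, of z] BK[of z] by (cases "z \<in> ?B") (auto simp: Q_def wK_def dK_def)
 show ?c1
  "S_integrable (%z. gx z * (\<Phi>' (w z) * d z) * \<theta> z)"
  unfolding PP QQ using iP iQ by simp_all
 show ?c2
  unfolding set_lebesgue_integral_def PP QQ by (rule fin)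
qed

lemma weak_time_chain:
 fixes w d :: "'a::euclidean_space \<times> real => real" and g :: "'a => real"
 assumes w: "weak_dt w d" and \<Phi>: "!!x. (\<Phi> has_real_derivative \<Phi>' x) (at x)" "continuous_on UNIV \<Phi>'" "!!x. \<bar>\<Phi>' x\<bar> <= M"
  and gm: "g \<in> meas" and g: "!!x. \<bar>g x\<bar> <= R" and \<theta>: "test_fun \<theta>"
 shows "S_integrable (%z. g (fst z) * \<Phi> (w z) * dt \<theta> z)" (is ?c1)
  "S_integrable (%z. g (fst z) * (\<Phi>' (w z) * d z) * \<theta> z)"
  "(LIS z. g (fst z) * \<Phi> (w z) * dt \<theta> z) = - (LIS z. g (fst z) * (\<Phi>' (w z) * d z) * \<theta> z)" (is ?c2)
proof -
 have "(%z :: 'a \<times> real. g (fst z)) \<in> meas"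
  by (rule measurable_compose[OF _ gm]) (intro continuous_measurable continuous_on_fst continuous_on_id)
 note I = weak_dir_chain[OF w[unfolded weak_dt_dir] Basis_t \<Phi> this _ _ \<theta>, of R]
 show ?c1
  "S_integrable (%z. g (fst z) * (\<Phi>' (w z) * d z) * \<theta> z)"
  ?c2
  unfolding dt_def by (rule I; simp add: g)+
qed

text \<open>Stampacchia's lemma. The functions \<open>arctan (n x) / n\<close> tend to 0 uniformly
  while their derivatives tend boundedly to the indicator of \<open>{0}\<close>. In the limit of the
  chain rule the part of \<open>D\<close> on \<open>{w = 0}\<close> is orthogonal to every test
  function.\<close>

lemma weak_grad_zero:
 fixes w :: "'a::euclidean_space \<times> real => real" and D :: "'a \<times> real => 'a"
 assumes w: "weak_grad_x w D"
 shows "AE z in lborel. z \<in> S_infty --> w z = 0 --> D z = 0"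
proof -
 have Dl: "locally_integrable D" and wl: "locally_integrable w" using w by (auto simp: weak_grad_x_def)
 have bb: "AE z in lborel. z \<in> S_infty --> (if w z = 0 then D z \<bullet> b else 0) = 0" if b: "b \<in> Basis" for b
 proof (rule fundamental_lemma)
  show "locally_integrable (%z. if w z = 0 then D z \<bullet> b else 0)"
   unfolding locally_integrable_def set_integrable_def
  proof (intro allI impI)
   fix K :: "('a \<times> real) set" assume K: "compact K \<and> K \<subseteq> S_infty"
   have i: "integrable lborel (%z. indicator K z *. (D z \<bullet> b))" "integrable lborel (%z. indicator K z *. w z)"
    using K locally_integrable_inner[OF Dl, of b] wl by (auto simp: locally_integrable_def set_integrable_def)
   define fD where "fD z = indicat_real K z *. (D z \<bullet> b)" for z
   define fw where "fw z = indicat_real K z *. w z" for z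
   have i: "integrable lborel fD" "integrable lborel fw" using i by (simp_all add: fD_def[abs_def] fw_def[abs_def])
   note [measurable] = borel_measurable_integrable[OF i(1)] borel_measurable_integrable[OF i(2)]
   have eq: "indicator K z *. (if w z = 0 then D z \<bullet> b else 0) = (if fw z = 0 then fD z else 0)" for z
    by (simp add: indicator_def fw_def fD_def)
   show "integrable lborel (%z. indicator K z *. (if w z = 0 then D z \<bullet> b else 0))"
    unfolding eq by (rule integrable_dominated[OF i(1)]) auto
  qed
 next
  fix \<phi> :: "'a \<times> real => real" assume \<phi>: "test_fun \<phi>"
  define n where "n j = real (Suc j)" for j
  define H where "H j x = arctan (n j * x) / n j" for j x
  define H' where "H' j x = inverse (1 + (n j * x)\<^sup>2)" for j x
  have n: "0 < n j" for j by (simp add: n_def)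
  have Hd: "(H j has_real_derivative H' j x) (at x)" for j x unfolding H_def[abs_def] H'_def
   using n[of j] by (auto intro!: derivative_eq_intros)
  have pos: "0 < 1 + (n j * x)\<^sup>2" for j x by (simp add: add_pos_nonneg)
  have Hc: "continuous_on UNIV (H' j)" for j unfolding H'_def[abs_def]
   by (intro continuous_intros) (use pos[of j] in "auto simp: less_imp_neq[symmetric]")
  have H'1: "0 <= H' j x" "H' j x <= 1" "\<bar>H' j x\<bar> <= 1" for j x using pos[of j x] by (simp_all add: H'_def inverse_le_1_iff)
  have H1: "\<bar>H j x\<bar> <= 2 / n j" for j x
  proof -
   have "\<bar>arctan (n j * x)\<bar> <= 2" using arctan_bounded[of "n j * x"] pi_less_4 by linarith
   then show ?thesis using n[of j] by (simp add: H_def divide_right_mono)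
  qed
  have nl: "(%j. C / n j) ----> 0" for C using LIMSEQ_Suc[OF lim_const_over_n[of C]] by (simp add: n_def)
  note I = weak_dir_chain[OF weak_grad_dir[OF w b] Basis_x[OF b] Hd Hc H'1(3) _ _ _ \<phi>, of "%_. 1" 1, simplified]
  define T where "T = (%j z. indicator S_infty z * (H' j (w z) * (D z \<bullet> b) * \<phi> z))"
  define T0 where "T0 = (%z. indicator S_infty z * ((if w z = 0 then D z \<bullet> b else 0) * \<phi> z))"
  have ig: "S_integrable (%z. pd (b,0) \<phi> z *. (1::real))"
   by (rule loc_int_test[OF locally_integrable_const test_fun_pd[OF \<phi> Basis_x[OF b]]])
  have iD: "S_integrable (%z. \<phi> z *. (D z \<bullet> b))"
   by (intro loc_int_test \<phi> locally_integrable_inner Dl)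
  have lim: "(%j. T j z) ----> T0 z" for z
   unfolding T_def T0_def
  proof (intro tendsto_mult tendsto_const)
   have "(%j. H' j (w z) * (D z \<bullet> b)) ----> (if w z = 0 then 1 else 0) * (D z \<bullet> b)"
   proof (intro tendsto_mult tendsto_const)
    show "(%j. H' j (w z)) ----> (if w z = 0 then 1 else 0)"
    proof (cases "w z = 0")
     case False
     have "(%j. H' j (w z)) ----> 0"
     proof (rule Lim_null_comparison[OF _ nl[of "1 / \<bar>w z\<bar>"]], intro always_eventually allI)
      fix j
      have "n j * \<bar>w z\<bar> <= 1 + (n j * w z)\<^sup>2"
       using zero_le_power2[of "1 / 2 - n j * \<bar>w z\<bar>"] by (simp add: power2_eq_square algebra_simps)
      then show "norm (H' j (w z)) <= 1 / \<bar>w z\<bar> / n j"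
       using pos[of j "w z"] n[of j] False by (simp add: H'_def divide_simps mult.commute)
     qed
     then show ?thesis using False by simp
    qed (simp add: H'_def)
   qed
   then show "(%j. H' j (w z) * (D z \<bullet> b)) ----> (if w z = 0 then D z \<bullet> b else 0)" by (cases "w z = 0") auto
  qed
  have mT: "T j \<in> borel_measurable lborel" for j using borel_measurable_integrable[OF I(2)] by (simp add: T_def)
  have "(%j. LI z. T j z) ----> (LI z. T0 z)"
  proof (rule dominated_conv[OF _ mT integrable_norm[OF iD]])
   show "T0 \<in> borel_measurable lborel" by (rule borel_measurable_LIMSEQ_metric[OF mT lim])
   show "AE z in lborel. norm (T j z) <= norm (indicator S_infty z *. (\<phi> z *. (D z \<bullet> b)))" for j
   proof (rule AE_I2)
    fix z
    have "\<bar>H' j (w z)\<bar> * \<bar>(D z \<bullet> b) * \<phi> z\<bar> <= 1 * \<bar>(D z \<bullet> b) * \<phi> z\<bar>" by (intro mult_right_mono H'1) simp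
    then show "norm (T j z) <= norm (indicator S_infty z *. (\<phi> z *. (D z \<bullet> b)))"
     by (cases "z \<in> S_infty") (simp_all add: T_def abs_mult mult_ac)
   qed
  qed (simp add: lim)
  moreover have "(%j. LI z. T j z) ----> 0"
  proof (rule Lim_null_comparison[OF _ nl])
   let ?C = "LI z. 2 * norm (indicator S_infty z *. (pd (b,0) \<phi> z *. (1::real)))"
   show "eventually (%j. norm (LI z. T j z) <= ?C / n j) sequentially"
   proof (intro always_eventually allI)
    fix j
    have "norm (LI z. T j z) = norm (LI z. indicator S_infty z * (H j (w z) * pd (b, 0) \<phi> z))"
     using I(3)[of j] by (simp add: set_lebesgue_integral_def T_def)
    also have "... <= (LI z. 2 * norm (indicator S_infty z *. (pd (b,0) \<phi> z *. (1::real))) / n j)"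
    proof (rule Bochner_Integration.integral_norm_bound_integral[OF I(1)])
     show "integrable lborel (%z. 2 * norm (indicator S_infty z *. (pd (b,0) \<phi> z *. (1::real))) / n j)"
      by (intro Bochner_Integration.integrable_divide integrable_mult_right integrable_norm ig)
     fix z
     show "norm (indicator S_infty z * (H j (w z) * pd (b, 0) \<phi> z)) <= 2 * norm (indicator S_infty z *. (pd (b,0) \<phi> z *. (1::real))) / n j"
      using mult_right_mono[OF H1[of j "w z"], of "\<bar>pd (b,0) \<phi> z\<bar>"] by (cases "z \<in> S_infty") (simp_all add: abs_mult)
    qed
    finally show "norm (LI z. T j z) <= ?C / n j" by simp
   qed
  qed
  ultimately have "(LI z. T0 z) = 0" by (rule LIMSEQ_unique)
  then show "(LIS z. (if w z = 0 then D z \<bullet> b else 0) * \<phi> z) = 0" by (simp add: set_lebesgue_integral_def T0_def)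
 qed
 have "AE z in lborel. \<forall>b\<in>Basis. z \<in> S_infty --> (if w z = 0 then D z \<bullet> b else 0) = 0"
  using bb by (intro AE_finite_allI) auto
 then show ?thesis
 proof eventually_elim
  case (elim z)
  show ?case
  proof (intro impI)
   assume z: "z \<in> S_infty" "w z = 0"
   show "D z = 0" by (rule euclidean_eqI) (use elim z in auto)
  qed
 qed
qed

section \<open>Strong subsolutions and comparison\<close>

text \<open>The flux expressed through \<open>\<xi>\<close>, the gradient of
  \<open>v^\<sigma>\<close>. It contains no \<open>v\<close>, and this makes it a monotone function
  of a single vector.\<close>

definition pflux :: "real => real => 'a::euclidean_space => 'a" where
 "pflux s p \<xi> = (s powr (1 - p) * norm \<xi> powr (p - 2)) *. \<xi>"

lemma sigma_pos: "1 < p ==> p + m - 3 > 0 ==> sigma p m > 0"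
 by (simp add: sigma_def)

lemma flux_eq_pflux:
 assumes p: "1 < p" "p + m - 3 > 0" and v: "0 <= v (fst z) (snd z)" "v (fst z) (snd z) = 0 ==> D z = 0"
 shows "flux p m v D z = pflux (sigma p m) p (D z)"
proof -
 define s where "s = sigma p m"
 define V where "V = v (fst z) (snd z)"
 define n where "n = norm (D z)"
 have s: "s > 0" unfolding s_def by (rule sigma_pos[OF p])
 show ?thesis
 proof (cases "V = 0 \<or> n = 0")
  case True
  then have "D z = 0" using v(2) by (auto simp: V_def n_def)
  then show ?thesis by (simp add: flux_def grad_v_def pflux_def)
 next
  case False
  then have V: "V > 0" and n: "n > 0" using v(1) by (auto simp: V_def n_def)
  have "s * (p - 1) = p + m - 2" using p by (simp add: s_def sigma_def)
  \<comment> \<open>The choice of \<open>\<sigma>\<close> makes the total power of \<open>v\<close>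
    in the flux equal to zero.\<close>
  then have e: "m - 1 + ((1 - s) * (p - 2) + (1 - s)) = 0" by (simp add: algebra_simps)
  have a1: "(V powr (1 - s) / s * n) powr (p - 2) = V powr ((1 - s) * (p - 2)) * (1 / s powr (p - 2)) * n powr (p - 2)"
   using V n s by (simp add: powr_mult powr_divide powr_powr)
  have "V powr (m - 1) * (V powr (1 - s) / s * n) powr (p - 2) * (V powr (1 - s) / s)
   = (V powr (m - 1) * (V powr ((1 - s) * (p - 2)) * V powr (1 - s))) * (1 / (s * s powr (p - 2))) * n powr (p - 2)"
   by (subst a1) (simp add: mult_ac)
  also have "V powr (m - 1) * (V powr ((1 - s) * (p - 2)) * V powr (1 - s)) = 1"
   using V by (simp only: powr_add[symmetric] e powr_zero_eq_one) simp
  also have "1 / (s * s powr (p - 2)) = s powr (1 - p)"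
   using s powr_mult_base[of s "p - 2"] powr_minus_divide[of s "p - 1"] by simp
  finally have key: "V powr (m - 1) * (V powr (1 - s) / s * n) powr (p - 2) * (V powr (1 - s) / s) = s powr (1 - p) * n powr (p - 2)" by simp
  have "flux p m v D z = (V powr (m - 1) * (V powr (1 - s) / s * n) powr (p - 2) * (V powr (1 - s) / s)) *. D z"
   using s V by (simp add: flux_def grad_v_def V_def[symmetric] s_def[symmetric] n_def abs_of_pos mult.assoc)
  then show ?thesis unfolding key by (simp add: pflux_def s_def n_def)
 qed
qed

lemma norm_pflux:
 assumes "0 < s" "1 < p" shows "norm (pflux s p \<xi>) = s powr (1 - p) * norm \<xi> powr (p - 1)"
proof (cases "\<xi> = 0")
 case False
 have "norm \<xi> powr (p - 2) * norm \<xi> = norm \<xi> powr (p - 1)"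
  using False powr_mult_base[of "norm \<xi>" "p - 2"] by (simp add: mult.commute)
 then show ?thesis by (simp add: pflux_def mult.assoc)
qed (simp add: pflux_def)

text \<open>Cauchy-Schwarz reduces the claim to the scalar product of
  \<open>x^(p-1) - y^(p-1)\<close> with \<open>x - y\<close>, where both factors have the same sign.
  The argument is the same for \<open>p\<close> below and above 2.\<close>

lemma pflux_mono:
 assumes s: "0 < s" and p: "1 < p" shows "0 <= (pflux s p a - pflux s p b) \<bullet> (a - b)"
proof -
 define x y where "x = norm a" and "y = norm b"
 have xy: "x >= 0" "y >= 0" by (auto simp: x_def y_def)
 have px: "x powr (p - 2) * x = x powr (p - 1)" if "x >= 0" for x :: real
  using that powr_mult_base[of x "p - 2"] by (cases "x = 0") (auto simp: mult.commute)
 have "(norm a powr (p - 2) *. a - norm b powr (p - 2) *. b) \<bullet> (a - b)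
   = x powr (p - 2) * x * x + y powr (p - 2) * y * y - (x powr (p - 2) + y powr (p - 2)) * (a \<bullet> b)"
  by (simp add: x_def y_def inner_diff_left inner_diff_right inner_commute power2_norm_eq_inner[symmetric] power2_eq_square algebra_simps)
 also have "... >= x powr (p - 2) * x * x + y powr (p - 2) * y * y - (x powr (p - 2) + y powr (p - 2)) * (x * y)"
 proof -
  have "a \<bullet> b <= x * y" unfolding x_def y_def by (rule norm_cauchy_schwarz)
  then show ?thesis by (intro diff_left_mono mult_left_mono) auto
 qed
 also have "x powr (p - 2) * x * x + y powr (p - 2) * y * y - (x powr (p - 2) + y powr (p - 2)) * (x * y)
   = (x powr (p - 2) * x - y powr (p - 2) * y) * (x - y)" by (simp add: algebra_simps)
 also have "... = (x powr (p - 1) - y powr (p - 1)) * (x - y)" using px xy by simp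
 also have "... >= 0"
 proof (cases "x <= y")
  case True
  then have "x powr (p - 1) <= y powr (p - 1)" using xy p by (intro powr_mono2) auto
  then show ?thesis using True by (intro mult_nonpos_nonpos) auto
 next
  case False
  then have "y powr (p - 1) <= x powr (p - 1)" using xy p by (intro powr_mono2) auto
  then show ?thesis using False by (intro mult_nonneg_nonneg) auto
 qed
 finally have nn: "0 <= (norm a powr (p - 2) *. a - norm b powr (p - 2) *. b) \<bullet> (a - b)" by simp
 have "pflux s p a - pflux s p b = s powr (1 - p) *. (norm a powr (p - 2) *. a - norm b powr (p - 2) *. b)"
  by (simp add: pflux_def scaleR_diff_right)
 then show ?thesis using nn by simp
qed

lemma loc_int_bound:
 fixes F :: "'a::euclidean_space \<times> real => 'c::euclidean_space"
 assumes F: "set_borel_measurable lborel S_infty F" and g: "locally_integrable g" and le: "!!z. z \<in> S_infty ==> norm (F z) <= (g z :: real)"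
 shows "locally_integrable F"
 unfolding locally_integrable_def set_integrable_def
proof (intro allI impI)
 fix K :: "('a \<times> real) set" assume K: "compact K \<and> K \<subseteq> S_infty"
 have i: "integrable lborel (%z. indicator K z *. g z)" using g K by (auto simp: locally_integrable_def set_integrable_def)
 have [measurable]: "K \<in> sets borel" using K borel_compact by blast
 have [measurable]: "(%z. indicator S_infty z *. F z) \<in> meas" using F by (simp add: set_borel_measurable_def)
 have eq: "indicator K z *. F z = indicator K z *. (indicator S_infty z *. F z)" for z
  using K by (auto simp: indicator_def)
 show "integrable lborel (%z. indicator K z *. F z)"
 proof (rule integrable_dominated[OF i])
  show "(%z. indicator K z *. F z) \<in> borel_measurable lborel" unfolding eq by measurable
  show "AE z in lborel. norm (indicator K z *. F z) <= norm (indicator K z *. g z)"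
  proof (intro AE_I2)
   fix z show "norm (indicator K z *. F z) <= norm (indicator K z *. g z)"
    using le[of z] K by (cases "z \<in> K") auto
  qed
 qed
qed

lemma loc_int_add: "locally_integrable f ==> locally_integrable g ==> locally_integrable (%z. f z + g z)"
 unfolding locally_integrable_def by (auto intro: set_integral_add(1))

lemma loc_int_diff: "locally_integrable f ==> locally_integrable g ==> locally_integrable (%z. f z - g z)"
 unfolding locally_integrable_def by (auto intro: set_integral_diff(1))

lemma loc_int_cmult: "locally_integrable f ==> locally_integrable (%z. c * f z :: real)"
 unfolding locally_integrable_def by (auto intro: set_integrable_mult_right)

text \<open>A gradient in \<open>L^p\<close> gives a flux in \<open>L^q\<close> for the conjugate
  exponent, because \<open>(p - 1) q = p\<close>.\<close>

lemma pflux_class: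
 fixes D :: "'a::euclidean_space \<times> real => 'a"
 assumes s: "0 < s" and p: "1 < p" "q = p / (p - 1)" and D: "set_borel_measurable lborel S_infty D" "locally_integrable (%z. norm (D z) powr p)"
 shows "set_borel_measurable lborel S_infty (%z. pflux s p (D z))" (is ?c1) "locally_integrable (%z. pflux s p (D z))" (is ?c2)
  "locally_integrable (%z. norm (pflux s p (D z)) powr q)" (is ?c3)
proof -
 define D' where "D' z = indicator S_infty z *. D z" for z
 have [measurable]: "D' \<in> meas" using D(1) by (simp add: set_borel_measurable_def D'_def[abs_def])
 have eq: "indicator S_infty z *. pflux s p (D z) = pflux s p (D' z)" for z by (auto simp: D'_def indicator_def pflux_def)
 show m: ?c1
  unfolding set_borel_measurable_def eq unfolding pflux_def by measurable
 show ?c2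
 proof (rule loc_int_bound[OF m])
  show "locally_integrable (%z. s powr (1 - p) * (1 + norm (D z) powr p))"
   by (intro loc_int_cmult loc_int_add D(2) locally_integrable_const)
  show "norm (pflux s p (D z)) <= s powr (1 - p) * (1 + norm (D z) powr p)" for z
  proof -
   have "norm (D z) powr (p - 1) <= 1 + norm (D z) powr p"
   proof (cases "norm (D z) <= 1")
    case True
    then have "norm (D z) powr (p - 1) <= 1" using p by (intro powr_le1) auto
    then show ?thesis by (simp add: add_increasing2)
   next
    case False
    then have "norm (D z) powr (p - 1) <= norm (D z) powr p" by (intro powr_mono) auto
    then show ?thesis by simp
   qed
   then show ?thesis unfolding norm_pflux[OF s p(1)] by (intro mult_left_mono) auto
  qed
 qed
 have "norm (pflux s p (D z)) powr q = s powr ((1 - p) * q) * norm (D z) powr p" for z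
  using p s unfolding norm_pflux[OF s p(1)] by (simp add: powr_mult powr_powr)
 then show ?c3 using loc_int_cmult[OF D(2)] by simp
qed

text \<open>\<open>energy_class\<close> prescribes the sign of \<open>v\<close> separately at each
  time. Fubini turns slicewise validity into validity almost everywhere in space-time, with the
  order of the variables exchanged to match the product measure.\<close>

lemma AE_S_slices:
 fixes P :: "'a::euclidean_space \<times> real => bool"
 assumes m: "{z. P z} \<in> sets borel" and sl: "!!t. 0 < t ==> AE x in lborel. P (x, t)"
 shows "AE z in lborel. z \<in> S_infty --> P z"
proof -
 define Q where "Q z \<longleftrightarrow> z \<in> S_infty --> P z" for z
 have mQ: "{z. Q z} \<in> sets borel"
 proof -
  have "{z. Q z} = (- S_infty) \<union> {z. P z}" by (auto simp: Q_def)
  then show ?thesis using m by auto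
 qed
 have mQ': "{z \<in> space (lborel \<Otimes>\<^sub>M lborel). Q z} \<in> sets (lborel \<Otimes>\<^sub>M lborel)"
  unfolding lborel_prod using mQ by simp
 have "AE t in lborel. AE x in lborel. Q (x, t)"
 proof (rule AE_I2)
  fix t :: real
  show "AE x in lborel. Q (x, t)"
  proof (cases "0 < t")
   case True
   from sl[OF this] show ?thesis by eventually_elim (simp add: Q_def)
  qed (simp add: Q_def mem_S)
 qed
 then have "AE x in lborel. AE t in lborel. Q (x, t)"
  using lborel_pair.AE_commute[of "%x t. Q (x, t)"] mQ' by simp
 from lborel_pair.AE_pair_measure[OF mQ' this] show ?thesis unfolding lborel_prod Q_def .
qed

lemma energy_nonneg:
 assumes "energy_class \<rho> p m v D" shows "AE z in lborel. z \<in> S_infty --> 0 <= v (fst z) (snd z)"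
proof -
 have mv: "(%z. indicator S_infty z * v (fst z) (snd z)) \<in> meas"
  using assms by (simp add: energy_class_def set_borel_measurable_def split_beta)
 have "AE z in lborel. z \<in> S_infty --> 0 <= indicator S_infty z * v (fst z) (snd z)"
 proof (rule AE_S_slices)
  note [measurable] = mv
  have "{z \<in> space borel. 0 <= indicator S_infty z * v (fst z) (snd z)} \<in> sets borel" by measurable
  then show "{z. 0 <= indicator S_infty z * v (fst z) (snd z)} \<in> sets borel" by simp
  fix t :: real assume t: "0 < t"
  have "AE x in lborel. 0 <= v x t" using assms t by (simp add: energy_class_def)
  then show "AE x in lborel. 0 <= indicator S_infty (x, t) * v (fst (x, t)) (snd (x, t))"
   by eventually_elim simp
 qed
 then show ?thesis by eventually_elim simp
qed

text \<open>By \<open>weak_grad_zero\<close> the gradient \<open>D\<close> vanishes almost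
  everywhere on \<open>{v = 0}\<close>; elsewhere the powers of \<open>v\<close> cancel. So the
  convention \<open>0 powr a = 0\<close> in \<open>flux\<close> gives the intended value.\<close>

lemma grad_v_zero_set:
 assumes e: "energy_class \<rho> p m v D" and p: "1 < p" "p + m - 3 > 0"
 shows "AE z in lborel. z \<in> S_infty --> flux p m v D z = pflux (sigma p m) p (D z)"
proof -
 have "AE z in lborel. z \<in> S_infty --> (case z of (x, t) => v x t powr sigma p m) = 0 --> D z = 0"
  using e by (intro weak_grad_zero) (auto simp: energy_class_def)
 then show ?thesis using energy_nonneg[OF e]
 proof eventually_elim
  case (elim z)
  then show ?case by (auto intro!: flux_eq_pflux[OF p] simp: split_beta)
 qed
qed

text \<open>With the time derivative moved onto the solution, only values of \<open>\<eta>\<close>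
  occur in the time term. This matters because the test functions of the comparison converge
  pointwise, with no control of their time derivatives.\<close>

lemma weak_form_strong:
 fixes v :: "'a::euclidean_space => real => real"
 assumes e: "energy_class \<rho> p m v D" and p: "1 < p" "p + m - 3 > 0" and vt: "weak_dt (%(x, t). v x t) vt"
  and \<rho>m [measurable]: "(%x::'a. \<rho> (norm x)) \<in> meas" and \<rho>b: "!!x::'a. \<bar>\<rho> (norm x)\<bar> <= R"
  and \<eta>: "test_fun \<eta>"
 shows "S_integrable (%z. \<rho> (norm (fst z)) * vt z * \<eta> z)" (is ?c1)
  "S_integrable (%z. pflux (sigma p m) p (D z) \<bullet> grad_x \<eta> z)"
  "weak_form \<rho> p m v D \<eta> = (LIS z. \<rho> (norm (fst z)) * vt z * \<eta> z) + (LIS z. pflux (sigma p m) p (D z) \<bullet> grad_x \<eta> z)" (is ?c2)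
proof -
 define s where "s = sigma p m"
 have s: "s > 0" unfolding s_def by (rule sigma_pos[OF p])
 define F where "F z = pflux s p (D z)" for z
 define V where "V z = indicator S_infty z * v (fst z) (snd z)" for z
 define D' where "D' z = indicator S_infty z *. D z" for z
 have F: "set_borel_measurable lborel S_infty F" "locally_integrable F"
  unfolding F_def using e by (auto intro!: pflux_class[OF s p(1) refl] simp: energy_class_def)
 have [measurable]: "V \<in> meas" "D' \<in> meas"
  using e by (simp_all add: energy_class_def set_borel_measurable_def split_beta V_def[abs_def] D'_def[abs_def])
 have \<eta>s: "smooth \<eta>" by (rule test_fun_smooth[OF \<eta>])
 have [measurable]: "\<eta> \<in> meas" "grad_x \<eta> \<in> meas" "dt \<eta> \<in> meas"
  using smooth_measurable[OF \<eta>s] grad_x_measurable[OF \<eta>s] smooth_measurable[OF smooth_pd[OF \<eta>s Basis_t]] by (auto simp: dt_def[abs_def])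
 define rx where "rx z = \<rho> (norm (fst z))" for z :: "'a \<times> real"
 have "fst \<in> borel_measurable (borel :: ('a \<times> real) measure)"
  by (intro continuous_measurable continuous_on_fst continuous_on_id)
 from measurable_compose[OF this \<rho>m] have [measurable]: "rx \<in> meas" by (simp add: rx_def[abs_def])
 note tc = weak_time_chain[where \<Phi> = "%x. x" and \<Phi>' = "%_. 1" and M = 1 and g = "%x. \<rho> (norm x)" and R = R, OF vt _ _ _ \<rho>m \<rho>b \<eta>]
 have i1: "S_integrable (%z. rx z * v (fst z) (snd z) * dt \<eta> z)"
  using tc(1) by (simp add: split_beta rx_def)
 have i2: "S_integrable (%z. rx z * vt z * \<eta> z)"
  using tc(2) by (simp add: split_beta rx_def)
 have eq3: "(LIS z. rx z * v (fst z) (snd z) * dt \<eta> z) = - (LIS z. rx z * vt z * \<eta> z)"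
  using tc(3) by (simp add: split_beta rx_def)
 have i4: "S_integrable (%z. F z \<bullet> grad_x \<eta> z)"
 proof -
  have "integrable lborel (%z. \<Sum>b\<in>Basis. indicator S_infty z *. (pd (b, 0) \<eta> z *. (F z \<bullet> b)))"
   by (intro Bochner_Integration.integrable_sum loc_int_test test_fun_pd[OF \<eta>] Basis_x locally_integrable_inner F)
  then show ?thesis by (simp add: grad_x_def inner_sum_right scaleR_sum_right sum_distrib_left)
 qed
 show ?c1
  "S_integrable (%z. pflux (sigma p m) p (D z) \<bullet> grad_x \<eta> z)"
  using i2 i4 by (simp_all add: rx_def F_def s_def)
 have "(LI z. indicator S_infty z *. (- rx z * v (fst z) (snd z) * dt \<eta> z + flux p m v D z \<bullet> grad_x \<eta> z))
   = (LI z. - (indicator S_infty z *. (rx z * v (fst z) (snd z) * dt \<eta> z)) + indicator S_infty z *. (F z \<bullet> grad_x \<eta> z))"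
 proof (rule Bochner_Integration.integral_cong_AE)
  have "indicator S_infty z *. (- rx z * v (fst z) (snd z) * dt \<eta> z + flux p m v D z \<bullet> grad_x \<eta> z)
   = - rx z * V z * dt \<eta> z + ((V z powr (m - 1) * norm ((V z powr (1 - s) / s) *. D' z) powr (p - 2)) *. ((V z powr (1 - s) / s) *. D' z)) \<bullet> grad_x \<eta> z" for z
   by (auto simp: V_def D'_def flux_def grad_v_def s_def indicator_def)
  then show "(%z. indicator S_infty z *. (- rx z * v (fst z) (snd z) * dt \<eta> z + flux p m v D z \<bullet> grad_x \<eta> z)) \<in> borel_measurable lborel"
   by simp
  show "(%z. - (indicator S_infty z *. (rx z * v (fst z) (snd z) * dt \<eta> z)) + indicator S_infty z *. (F z \<bullet> grad_x \<eta> z)) \<in> borel_measurable lborel"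
   using i1 i4 by (intro borel_measurable_add borel_measurable_uminus borel_measurable_integrable)
  show "AE z in lborel. indicator S_infty z *. (- rx z * v (fst z) (snd z) * dt \<eta> z + flux p m v D z \<bullet> grad_x \<eta> z)
   = - (indicator S_infty z *. (rx z * v (fst z) (snd z) * dt \<eta> z)) + indicator S_infty z *. (F z \<bullet> grad_x \<eta> z)"
   using grad_v_zero_set[OF e p]
  proof eventually_elim
   case (elim z)
   show ?case using elim by (cases "z \<in> S_infty") (auto simp: F_def s_def)
  qed
 qed
 also have "... = - (LI z. indicator S_infty z *. (rx z * v (fst z) (snd z) * dt \<eta> z)) + (LI z. indicator S_infty z *. (F z \<bullet> grad_x \<eta> z))"
  using i1 i4 by simp
 finally show ?c2
  using eq3 by (simp add: weak_form_def set_lebesgue_integral_def rx_def F_def s_def)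
qed

lemma weak_grad_diff:
 fixes D1 D2 :: "'a::euclidean_space \<times> real => 'a"
 assumes "weak_grad_x w1 D1" "weak_grad_x w2 D2" shows "weak_grad_x (%z. w1 z - w2 z) (%z. D1 z - D2 z)"
 unfolding weak_grad_x_def
proof (intro conjI allI impI)
 have l: "locally_integrable w1" "locally_integrable w2" "locally_integrable D1" "locally_integrable D2"
  using assms by (auto simp: weak_grad_x_def)
 show "locally_integrable (%z. w1 z - w2 z)" "locally_integrable (%z. D1 z - D2 z)" using l by (auto intro: loc_int_diff)
 fix \<phi> :: "'a \<times> real => real" assume \<phi>: "test_fun \<phi>"
 have g: "S_integrable (%z. w z *. grad_x \<phi> z)" if "locally_integrable w" for w :: "'a \<times> real => real"
 proof -
  have "integrable lborel (%z. \<Sum>b\<in>Basis. (indicator S_infty z *. (pd (b, 0) \<phi> z *. w z)) *. b)"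
   using that by (intro Bochner_Integration.integrable_sum integrable_scaleR_left loc_int_test test_fun_pd[OF \<phi>] Basis_x)
  then show ?thesis by (simp add: grad_x_def scaleR_sum_right mult_ac)
 qed
 have eqs: "(LI z. indicator S_infty z *. (w1 z *. grad_x \<phi> z)) = - (LI z. indicator S_infty z *. (\<phi> z *. D1 z))"
  "(LI z. indicator S_infty z *. (w2 z *. grad_x \<phi> z)) = - (LI z. indicator S_infty z *. (\<phi> z *. D2 z))"
  using assms \<phi> by (simp_all only: weak_grad_x_def set_lebesgue_integral_def)
 have "(LIS z. (w1 z - w2 z) *. grad_x \<phi> z) = (LI z. indicator S_infty z *. (w1 z *. grad_x \<phi> z)) - (LI z. indicator S_infty z *. (w2 z *. grad_x \<phi> z))"
  unfolding set_lebesgue_integral_def scaleR_diff_left scaleR_diff_right by (rule Bochner_Integration.integral_diff) (intro g l)+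
 also have "... = - ((LI z. indicator S_infty z *. (\<phi> z *. D1 z)) - (LI z. indicator S_infty z *. (\<phi> z *. D2 z)))"
  unfolding eqs by simp
 also have "... = - (LIS z. \<phi> z *. (D1 z - D2 z))"
  unfolding set_lebesgue_integral_def scaleR_diff_right
  by (subst Bochner_Integration.integral_diff) (intro loc_int_test l \<phi> refl)+
 finally show "(LIS z. (w1 z - w2 z) *. grad_x \<phi> z) = - (LIS z. \<phi> z *. (D1 z - D2 z))" .
qed

lemma weak_dt_diff:
 fixes d1 d2 :: "'a::euclidean_space \<times> real => real"
 assumes "weak_dt w1 d1" "weak_dt w2 d2" shows "weak_dt (%z. w1 z - w2 z) (%z. d1 z - d2 z)"
 unfolding weak_dt_def
proof (intro conjI allI impI)
 have l: "locally_integrable w1" "locally_integrable w2" "locally_integrable d1" "locally_integrable d2"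
  using assms by (auto simp: weak_dt_def)
 show "locally_integrable (%z. w1 z - w2 z)" "locally_integrable (%z. d1 z - d2 z)" using l by (auto intro: loc_int_diff)
 fix \<phi> :: "'a \<times> real => real" assume \<phi>: "test_fun \<phi>"
 have \<phi>': "test_fun (dt \<phi>)" unfolding dt_def[abs_def] by (rule test_fun_pd[OF \<phi> Basis_t])
 have eqs: "(LI z. indicator S_infty z *. (dt \<phi> z *. w1 z)) = - (LI z. indicator S_infty z *. (\<phi> z *. d1 z))"
  "(LI z. indicator S_infty z *. (dt \<phi> z *. w2 z)) = - (LI z. indicator S_infty z *. (\<phi> z *. d2 z))"
  using assms \<phi> by (simp_all add: weak_dt_def set_lebesgue_integral_def mult.commute)
 have "(LIS z. (w1 z - w2 z) * dt \<phi> z) = (LI z. indicator S_infty z *. (dt \<phi> z *. w1 z)) - (LI z. indicator S_infty z *. (dt \<phi> z *. w2 z))"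
  using loc_int_test[OF l(1) \<phi>'] loc_int_test[OF l(2) \<phi>']
  by (subst Bochner_Integration.integral_diff[symmetric]) (auto simp: set_lebesgue_integral_def algebra_simps)
 also have "... = - ((LI z. indicator S_infty z *. (\<phi> z *. d1 z)) - (LI z. indicator S_infty z *. (\<phi> z *. d2 z)))"
  unfolding eqs by simp
 also have "... = - (LIS z. (d1 z - d2 z) * \<phi> z)"
  using loc_int_test[OF l(3) \<phi>] loc_int_test[OF l(4) \<phi>]
  by (subst Bochner_Integration.integral_diff[symmetric]) (auto simp: set_lebesgue_integral_def algebra_simps)
 finally show "(LIS z. (w1 z - w2 z) * dt \<phi> z) = - (LIS z. (d1 z - d2 z) * \<phi> z)" .
qed

section \<open>A Kato-type inequality for the positive part of the difference\<close>

locale strong_pair =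
 fixes \<rho> :: "real => real" and p m R :: real and u v :: "'a::euclidean_space => real => real"
  and Du Dv :: "'a \<times> real => 'a" and ut vt :: "'a \<times> real => real"
 assumes p: "1 < p" "p + m - 3 > 0"
  and \<rho>m: "(%x::'a. \<rho> (norm x)) \<in> meas"
  and \<rho>0: "!!x::'a. 0 <= \<rho> (norm x)" and \<rho>R: "!!x::'a. \<rho> (norm x) <= R"
  and eu: "energy_class \<rho> p m u Du" and ev: "energy_class \<rho> p m v Dv"
  and wut: "weak_dt (%(x, t). u x t) ut" and wvt: "weak_dt (%(x, t). v x t) vt"
  and sub: "!!\<eta>. test_fun \<eta> ==> (!!z. 0 <= \<eta> z) ==> weak_form \<rho> p m u Du \<eta> <= 0"
  and super: "!!\<eta>. test_fun \<eta> ==> (!!z. 0 <= \<eta> z) ==> 0 <= weak_form \<rho> p m v Dv \<eta>"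
begin

definition d where "d z = u (fst z) (snd z) - v (fst z) (snd z)" for z
definition rx where "rx z = \<rho> (norm (fst z))" for z :: "'a \<times> real"

lemma \<rho>b: "\<bar>\<rho> (norm x)\<bar> <= R" for x :: 'a using \<rho>0 \<rho>R by (simp add: abs_of_nonneg)
lemma rx_bounds: "0 <= rx z" "rx z <= R" using \<rho>0 \<rho>R by (simp_all add: rx_def)

lemma fst_measurable: "fst \<in> borel_measurable (borel :: ('a \<times> real) measure)"
 by (intro continuous_measurable continuous_on_fst continuous_on_id)

lemma rx_measurable: "rx \<in> meas"
 using measurable_compose[OF fst_measurable \<rho>m] by (simp add: rx_def[abs_def])

lemma wd: "weak_dt d (%z. ut z - vt z)"
 using weak_dt_diff[OF wut wvt] by (simp add: split_beta d_def[abs_def])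

definition Y where "Y \<theta> z = indicator S_infty z *. (\<theta> z *. (ut z - vt z))" for \<theta> :: "'a \<times> real => real" and z

lemma Y_integrable: "test_fun \<theta> ==> integrable lborel (Y \<theta>)"
 unfolding Y_def using wd by (intro loc_int_test) (auto simp: weak_dt_def)

lemma uv_measurable:
 "(%z. indicator S_infty z * u (fst z) (snd z)) \<in> meas"
 "(%z. indicator S_infty z * v (fst z) (snd z)) \<in> meas"
 using eu ev by (simp_all add: energy_class_def set_borel_measurable_def split_beta)

lemma d_measurable: "(%z. indicator S_infty z * d z) \<in> meas"
proof -
 note [measurable] = uv_measurable
 have "indicator S_infty z * d z = indicator S_infty z * u (fst z) (snd z) - indicator S_infty z * v (fst z) (snd z)" for z
  by (simp add: d_def algebra_simps)
 then show ?thesis by simp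
qed

lemma sign_inequality:
 assumes \<theta>: "test_fun \<theta>" "!!z. 0 <= \<theta> z" and flat: "!!z. z \<in> S_infty ==> 0 < u (fst z) (snd z) ==> grad_x \<theta> z = 0"
 shows "(LI z. rx z * (indicator {z. 0 < d z} z * Y \<theta> z)) <= 0"
proof -
 obtain S S' :: "real => real" where S: "smooth S" "smooth S'" "!!x. (S has_real_derivative S' x) (at x)" "!!x. S' x >= 0"
  "!!x. x <= 0 ==> S x = 0" "!!x. x >= 1 ==> S x = 1"
  "!!x. 0 <= S x" "!!x. S x <= 1" "!!x. x <= 0 \<or> x >= 1 ==> S' x = 0"
  using smooth_step_exists by metis
 have cs: "csupp 1 S'" unfolding csupp_def
 proof (intro conjI allI impI S(2))
  show "S' y = 0" if "1 < norm y" for y by (rule S(9)) (use that in auto)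
 qed
 obtain M where M: "M >= 0" "!!x. \<bar>S' x\<bar> <= M" using csupp_bounded[OF cs] by metis
 define s where "s = sigma p m"
 have s: "s > 0" unfolding s_def by (rule sigma_pos[OF p])
 define q where "q = p / (p - 1)"
 have q: "q > 0" using p by (simp add: q_def)
 define W where "W z = u (fst z) (snd z) powr s - v (fst z) (snd z) powr s" for z
 define D where "D z = Du z - Dv z" for z
 define F where "F z = pflux s p (Du z) - pflux s p (Dv z)" for z
 have wW: "weak_grad_x W D"
  using weak_grad_diff[of "%(x, t). u x t powr s" Du "%(x, t). v x t powr s" Dv] eu ev
  by (simp add: energy_class_def s_def split_beta W_def[abs_def] D_def[abs_def])
 have mD: "set_borel_measurable lborel S_infty Du" "set_borel_measurable lborel S_infty Dv"
  and lD: "locally_integrable (%z. norm (Du z) powr p)" "locally_integrable (%z. norm (Dv z) powr p)"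
  using eu ev by (auto simp: energy_class_def)
 have setm_diff: "set_borel_measurable lborel S_infty (%z. f z - g z)"
  if "set_borel_measurable lborel S_infty f" "set_borel_measurable lborel S_infty g" for f g :: "'a \<times> real => 'a"
  using that by (auto simp: set_borel_measurable_def scaleR_diff_right)
 have diffp: "locally_integrable (%z. norm (f z - g z) powr r)"
  if "set_borel_measurable lborel S_infty f" "set_borel_measurable lborel S_infty g"
    "locally_integrable (%z. norm (f z) powr r)" "locally_integrable (%z. norm (g z) powr r)" "0 <= r" for f g :: "'a \<times> real => 'a" and r
 proof (rule loc_int_bound)
  have [measurable]: "(%z. indicator S_infty z *. (f z - g z)) \<in> meas"
   using setm_diff[OF that(1,2)] by (simp add: set_borel_measurable_def)
  have eq: "indicator S_infty z *. norm (f z - g z) powr r = indicator S_infty z * norm (indicator S_infty z *. (f z - g z)) powr r" for z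
   by (simp add: indicator_def)
  show "set_borel_measurable lborel S_infty (%z. norm (f z - g z) powr r)"
   unfolding set_borel_measurable_def eq by measurable
  show "locally_integrable (%z. 2 powr r * (norm (f z) powr r + norm (g z) powr r))"
   by (intro loc_int_cmult loc_int_add that)
  show "norm (norm (f z - g z) powr r) <= 2 powr r * (norm (f z) powr r + norm (g z) powr r)" for z
  proof -
   have "norm (f z - g z) powr r <= (norm (f z) + norm (g z)) powr r" by (rule powr_mono2[OF that(5) norm_ge_zero norm_triangle_ineq4])
   also have "... <= 2 powr r * (norm (f z) powr r + norm (g z) powr r)" by (rule powr_add_le[OF norm_ge_zero norm_ge_zero that(5)])
   finally show ?thesis by simp
  qed
 qed
 have Dp: "locally_integrable (%z. norm (D z) powr p)" unfolding D_def using p by (intro diffp mD lD) simp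
 note cu = pflux_class[OF s p(1) q_def mD(1) lD(1)] and cv = pflux_class[OF s p(1) q_def mD(2) lD(2)]
 have Fc: "set_borel_measurable lborel S_infty F" "locally_integrable F" "locally_integrable (%z. norm (F z) powr q)"
  unfolding F_def using cu cv q by (auto intro!: setm_diff loc_int_diff diffp)
 have AEpos: "AE z in lborel. z \<in> S_infty --> 0 <= u (fst z) (snd z) \<and> 0 <= v (fst z) (snd z)"
  using energy_nonneg[OF eu] energy_nonneg[OF ev] by eventually_elim simp
 have iY: "integrable lborel (Y \<theta>)" by (rule Y_integrable[OF \<theta>(1)])
 note [measurable] = uv_measurable rx_measurable borel_measurable_integrable[OF iY, simplified]
 have mW: "(%z. indicator S_infty z * W z) \<in> meas"
 proof -
  have "indicator S_infty z * W z = (indicator S_infty z * u (fst z) (snd z)) powr s - (indicator S_infty z * v (fst z) (snd z)) powr s" for z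
   by (simp add: W_def indicator_def)
  then show ?thesis by simp
 qed
 define A where "A j z = rx z * (S (real (Suc j) * W z) * Y \<theta> z)" for j z
 have [measurable]: "S \<in> meas" by (rule smooth_measurable[OF S(1)])
 have Aeq: "A j z = rx z * (S (real (Suc j) * (indicator S_infty z * W z)) * Y \<theta> z)" for j z
  by (cases "z \<in> S_infty") (auto simp: A_def Y_def)
 have mA: "A j \<in> borel_measurable lborel" for j
  unfolding Aeq[abs_def] using mW by measurable
 have iRY: "integrable lborel (%z. R * \<bar>Y \<theta> z\<bar>)" using iY by simp
 have Ab: "\<bar>A j z\<bar> <= R * \<bar>Y \<theta> z\<bar>" for j z
 proof -
  have "\<bar>rx z\<bar> * (\<bar>S (real (Suc j) * W z)\<bar> * \<bar>Y \<theta> z\<bar>) <= R * (1 * \<bar>Y \<theta> z\<bar>)"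
   using rx_bounds[of z] S(7,8)[of "real (Suc j) * W z"] by (intro mult_mono) auto
  then show ?thesis by (simp add: A_def abs_mult)
 qed
 have neg: "(LI z. A j z) <= 0" for j
 proof -
  define H where "H x = S (real (Suc j) * x)" for x
  define H' where "H' x = real (Suc j) * S' (real (Suc j) * x)" for x
  have lin: "smooth (%x::real. real (Suc j) * x)" by (intro smooth_linear bounded_linear_mult_right)
  have Hs: "smooth H" unfolding H_def[abs_def] by (rule smooth_compose_real[OF lin S(1)])
  have Hd: "(H has_real_derivative H' x) (at x)" for x
  proof -
   have "((%x. real (Suc j) * x) has_real_derivative real (Suc j)) (at x)" by (auto intro!: derivative_eq_intros)
   from DERIV_chain2[OF S(3) this] show ?thesis by (simp add: H_def[abs_def] H'_def mult.commute del: of_nat_Suc)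
  qed
  have Hc: "continuous_on UNIV H'" unfolding H'_def[abs_def]
   by (intro continuous_on_mult continuous_on_const smooth_continuous[OF smooth_compose_real[OF lin S(2)]])
  have Hb: "\<bar>H x\<bar> <= 1" for x using S(7,8)[of "real (Suc j) * x"] by (simp add: H_def del: of_nat_Suc)
  have Hb': "\<bar>H' x\<bar> <= real (Suc j) * M" for x unfolding H'_def abs_mult using M by (intro mult_mono) auto
  from weak_chain[OF wW p(1) q_def Dp Hs Hd Hc Hb Hb' \<theta>(1)] obtain c where
   c: "!!n::nat. test_fun (%z. \<theta> z * H (c n z))"
   and cAE: "AE z in lborel. z \<in> S_infty --> (%n. \<theta> z * H (c n z)) ----> \<theta> z * H (W z)"
   and lim: "\<forall>F. set_borel_measurable lborel S_infty F --> locally_integrable F --> locally_integrable (%z. norm (F z) powr q) -->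
   S_integrable (%z. F z \<bullet> (H (W z) *. grad_x \<theta> z + (\<theta> z * H' (W z)) *. D z)) \<and>
   (\<forall>n::nat. S_integrable (%z. F z \<bullet> grad_x (%z. \<theta> z * H (c n z)) z)) \<and>
   (%n. LIS z. F z \<bullet> grad_x (%z. \<theta> z * H (c n z)) z) ---->
   (LIS z. F z \<bullet> (H (W z) *. grad_x \<theta> z + (\<theta> z * H' (W z)) *. D z))"
   by auto
  note l = lim[rule_format, OF Fc]
  define \<eta> where "\<eta> n z = \<theta> z * H (c n z)" for n z
  have \<eta>t: "test_fun (\<eta> n)" for n using c[of n] by (simp add: \<eta>_def[abs_def])
  have \<eta>0: "0 <= \<eta> n z" for n z using \<theta>(2)[of z] S(7) by (simp add: \<eta>_def H_def)
  define B where "B n z = rx z * (H (c n z) * Y \<theta> z)" for n z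
  have Beq: "B n z = indicator S_infty z *. (rx z * (ut z - vt z) * \<eta> n z)" for n z
   by (simp add: B_def Y_def \<eta>_def)
  have Bb: "\<bar>B n z\<bar> <= R * \<bar>Y \<theta> z\<bar>" for n z
  proof -
   have "\<bar>rx z\<bar> * (\<bar>H (c n z)\<bar> * \<bar>Y \<theta> z\<bar>) <= R * (1 * \<bar>Y \<theta> z\<bar>)"
    using rx_bounds[of z] Hb[of "c n z"] by (intro mult_mono) auto
   then show ?thesis by (simp add: B_def abs_mult)
  qed
  \<comment> \<open>For fixed \<open>j\<close>, the mollified test function is admissible in both
    weak forms and nonnegative, so the inequalities may be subtracted; the limit in \<open>n\<close>
    follows.\<close>
  have step: "(LI z. B n z) + (LIS z. F z \<bullet> grad_x (\<eta> n) z) <= 0" and mB: "B n \<in> borel_measurable lborel" for n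
  proof -
   note fu = weak_form_strong[OF eu p wut \<rho>m \<rho>b \<eta>t[of n]]
   note fv = weak_form_strong[OF ev p wvt \<rho>m \<rho>b \<eta>t[of n]]
   have b: "B n z = indicator S_infty z *. (\<rho> (norm (fst z)) * ut z * \<eta> n z) - indicator S_infty z *. (\<rho> (norm (fst z)) * vt z * \<eta> n z)" for z
    by (simp add: Beq rx_def algebra_simps)
   have f: "indicator S_infty z *. (F z \<bullet> grad_x (\<eta> n) z) = indicator S_infty z *. (pflux (sigma p m) p (Du z) \<bullet> grad_x (\<eta> n) z) - indicator S_infty z *. (pflux (sigma p m) p (Dv z) \<bullet> grad_x (\<eta> n) z)" for z
    by (simp add: F_def s_def inner_diff_left algebra_simps)
   have "weak_form \<rho> p m u Du (\<eta> n) - weak_form \<rho> p m v Dv (\<eta> n) <= 0"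
    using sub[OF \<eta>t \<eta>0] super[OF \<eta>t \<eta>0] by (smt (verit))
   moreover have "(LI z. B n z) = (LIS z. \<rho> (norm (fst z)) * ut z * \<eta> n z) - (LIS z. \<rho> (norm (fst z)) * vt z * \<eta> n z)"
    unfolding b set_lebesgue_integral_def by (rule Bochner_Integration.integral_diff[OF fu(1) fv(1)])
   moreover have "(LIS z. F z \<bullet> grad_x (\<eta> n) z) = (LIS z. pflux (sigma p m) p (Du z) \<bullet> grad_x (\<eta> n) z) - (LIS z. pflux (sigma p m) p (Dv z) \<bullet> grad_x (\<eta> n) z)"
    unfolding set_lebesgue_integral_def f by (rule Bochner_Integration.integral_diff[OF fu(2) fv(2)])
   ultimately show "(LI z. B n z) + (LIS z. F z \<bullet> grad_x (\<eta> n) z) <= 0"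
    unfolding fu(3) fv(3) by linarith
   show "B n \<in> borel_measurable lborel"
    unfolding b[abs_def] by (rule borel_measurable_integrable[OF Bochner_Integration.integrable_diff[OF fu(1) fv(1)]])
  qed
  have limB: "(%n. LI z. B n z) ----> (LI z. A j z)"
  proof (rule dominated_conv[OF mA mB iRY])
   show "AE z in lborel. (%n. B n z) ----> A j z" using cAE
   proof eventually_elim
    case (elim z)
    show ?case
    proof (cases "z \<in> S_infty")
     case True
     then have e: "(%n. \<theta> z * H (c n z)) ----> \<theta> z * H (W z)" using elim by simp
     from tendsto_mult[OF tendsto_const[of "rx z"] tendsto_mult[OF e tendsto_const[of "ut z - vt z"]]]
     show ?thesis using True by (simp add: B_def A_def Y_def H_def mult_ac del: of_nat_Suc)
    qed (simp add: B_def A_def Y_def)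
   qed
   show "AE z in lborel. norm (B n z) <= R * \<bar>Y \<theta> z\<bar>" for n using Bb by (intro AE_I2) simp
  qed
  have nn: "0 <= (LIS z. F z \<bullet> (H (W z) *. grad_x \<theta> z + (\<theta> z * H' (W z)) *. D z))"
   unfolding set_lebesgue_integral_def
  proof (rule integral_nonneg_AE)
   show "AE z in lborel. 0 <= indicator S_infty z *. (F z \<bullet> (H (W z) *. grad_x \<theta> z + (\<theta> z * H' (W z)) *. D z))"
    using AEpos
   proof eventually_elim
    case (elim z)
    show ?case
    proof (cases "z \<in> S_infty")
     case True
     have h0: "H (W z) *. grad_x \<theta> z = 0"
     proof (cases "W z <= 0")
      case True
      then have "real (Suc j) * W z <= 0" by (simp add: mult_nonneg_nonpos del: of_nat_Suc)
      then show ?thesis by (simp add: H_def S(5) del: of_nat_Suc)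
     next
      case False
      then have "u (fst z) (snd z) ~= 0" by (auto simp: W_def)
      then show ?thesis using elim True by (simp add: flat)
     qed
     have hF: "0 <= F z \<bullet> D z" unfolding F_def D_def by (rule pflux_mono[OF s p(1)])
     have hH: "0 <= H' (W z)" using S(4) by (simp add: H'_def del: of_nat_Suc)
     have "0 <= (\<theta> z * H' (W z)) * (F z \<bullet> D z)" using \<theta>(2)[of z] hF hH by (intro mult_nonneg_nonneg)
     then show ?thesis using True by (simp only: h0 add_0_left inner_scaleR_right indicator_simps scaleR_one)
    qed simp
   qed
  qed
  have "(%n. (LI z. B n z) + (LIS z. F z \<bullet> grad_x (\<eta> n) z)) ---->
   (LI z. A j z) + (LIS z. F z \<bullet> (H (W z) *. grad_x \<theta> z + (\<theta> z * H' (W z)) *. D z))"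
   using l by (intro tendsto_add limB) (simp add: \<eta>_def[abs_def])
  then have "(LI z. A j z) + (LIS z. F z \<bullet> (H (W z) *. grad_x \<theta> z + (\<theta> z * H' (W z)) *. D z)) <= 0"
   by (rule LIMSEQ_le_const2) (use step in blast)
  then show ?thesis using nn by linarith
 qed
 have "(%j. LI z. A j z) ----> (LI z. rx z * (indicator {z. 0 < d z} z * Y \<theta> z))"
 proof (rule dominated_conv[OF _ mA iRY])
  note [measurable] = d_measurable
  have [measurable]: "{z. 0 < indicator S_infty z * d z} \<in> sets borel"
  proof -
   have "{z \<in> space borel. 0 < indicator S_infty z * d z} \<in> sets borel" by measurable
   then show ?thesis by simp
  qed
  have eq: "rx z * (indicator {z. 0 < d z} z * Y \<theta> z) = rx z * (indicator {z. 0 < indicator S_infty z * d z} z * Y \<theta> z)" for z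
   by (cases "z \<in> S_infty") (auto simp: Y_def indicator_def)
  show "(%z. rx z * (indicator {z. 0 < d z} z * Y \<theta> z)) \<in> borel_measurable lborel" unfolding eq by measurable
  show "AE z in lborel. (%j. A j z) ----> rx z * (indicator {z. 0 < d z} z * Y \<theta> z)" using AEpos
  proof eventually_elim
   case (elim z)
   show ?case
   proof (cases "z \<in> S_infty")
    case True
    have Wd: "0 < W z \<longleftrightarrow> 0 < d z" using elim True s powr_less_cancel2[of s "v (fst z) (snd z)" "u (fst z) (snd z)"]
     powr_less_mono2[of s "v (fst z) (snd z)" "u (fst z) (snd z)"]
     by (cases "v (fst z) (snd z) = 0 \<or> u (fst z) (snd z) = 0") (auto simp: W_def d_def)
    have "(%j. S (real (Suc j) * W z)) ----> indicator {z. 0 < d z} z"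
    proof (cases "0 < W z")
     case W: True
     have "eventually (%j. 1 / W z <= real j) sequentially"
      using eventually_ge_at_top[of "nat \<lceil>1 / W z\<rceil>"] by eventually_elim linarith
     then have "eventually (%j. S (real (Suc j) * W z) = 1) sequentially"
     proof eventually_elim
      case (elim j)
      then have "1 <= real j * W z" using W by (simp add: divide_le_eq)
      also have "... <= real (Suc j) * W z" using W by (simp add: mult_right_mono)
      finally show ?case by (rule S(6))
     qed
     then show ?thesis using W Wd by (simp add: tendsto_eventually del: of_nat_Suc)
    next
     case W: False
     then have "S (real (Suc j) * W z) = 0" for j by (intro S(5)) (simp add: mult_nonneg_nonpos del: of_nat_Suc)
     then show ?thesis using W Wd by (simp del: of_nat_Suc)
    qed
    then show ?thesis unfolding A_def by (intro tendsto_intros)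
   qed (simp add: A_def Y_def)
  qed
  show "AE z in lborel. norm (A j z) <= R * \<bar>Y \<theta> z\<bar>" for j using Ab by (intro AE_I2) simp
 qed
 then show ?thesis by (rule LIMSEQ_le_const2) (use neg in auto)
qed

text \<open>The time term of \<open>sign_inequality\<close> is recognised as the derivative of a
  positive part. A primitive of the step, rescaled to \<open>\<Phi> j\<close>, has derivative
  \<open>S(j d)\<close> and tends to the positive part, so the chain rule in time moves the
  derivative back to \<open>\<theta>\<close>.\<close>

lemma positive_part_inequality:
 assumes \<theta>: "test_fun \<theta>" "!!z. 0 <= \<theta> z" and flat: "!!z. z \<in> S_infty ==> 0 < u (fst z) (snd z) ==> grad_x \<theta> z = 0"
 shows "S_integrable (%z. rx z * max 0 (d z) * dt \<theta> z)" (is ?c1)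
  "0 <= (LIS z. rx z * max 0 (d z) * dt \<theta> z)" (is ?c2)
proof -
 obtain S S' :: "real => real" where S: "smooth S" "smooth S'" "!!x. (S has_real_derivative S' x) (at x)" "!!x. S' x >= 0"
  "!!x. x <= 0 ==> S x = 0" "!!x. x >= 1 ==> S x = 1"
  "!!x. 0 <= S x" "!!x. S x <= 1" "!!x. x <= 0 \<or> x >= 1 ==> S' x = 0"
  using smooth_step_exists by metis
 have Sc: "isCont S x" for x using S(3) DERIV_isCont by blast
 obtain P0 where P0: "!!x. (P0 has_real_derivative S x) (at x)"
 proof -
  have "\<exists>F. \<forall>x. (F has_vector_derivative S x) (at x)"
   using einterval_antiderivative[of "-\<infinity>" "\<infinity>" S] Sc by auto
  then show ?thesis using that by (auto simp: has_real_derivative_iff_has_vector_derivative)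
 qed
 define P where "P x = P0 x - P0 0" for x
 have P': "(P has_real_derivative S x) (at x)" for x unfolding P_def by (auto intro!: derivative_eq_intros P0)
 have Pneg: "P x = 0" if "x <= 0" for x
 proof (cases "x = 0")
  case False
  then have "x < 0" using that by simp
  then obtain z where "x < z" "z < 0" "P 0 - P x = (0 - x) * S z" using MVT2[of x 0 P S] P' by auto
  then show ?thesis by (simp add: S(5) P_def)
 qed (simp add: P_def)
 have Pbetween: "0 <= P x \<and> P x <= x" if "0 <= x" for x
 proof (cases "x = 0")
  case False
  then have "0 < x" using that by simp
  then obtain z where "0 < z" "z < x" "P x - P 0 = (x - 0) * S z" using MVT2[of 0 x P S] P' by auto
  then show ?thesis using S(7,8)[of z] by (simp add: P_def mult_left_le)
 qed (simp add: P_def)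
 have Pclose: "x - P x <= 1" if "0 <= x" for x
 proof (cases "x <= 1")
  case True then show ?thesis using Pbetween[OF that] by simp
 next
  case False
  then have "1 < x" by simp
  then obtain z where "1 < z" "z < x" "P x - P 1 = (x - 1) * S z" using MVT2[of 1 x P S] P' by auto
  then show ?thesis using S(6)[of z] Pbetween[of 1] by simp
 qed
 have close: "\<bar>P x - max 0 x\<bar> <= 1" and Pabs: "\<bar>P x\<bar> <= \<bar>x\<bar>" for x
  using Pneg[of x] Pbetween[of x] Pclose[of x] by (cases "x <= 0"; simp)+
 \<comment> \<open>\<open>P\<close> stays within 1 of the positive part, so after scaling by
   \<open>j + 1\<close> the distance is at most \<open>1 / (j + 1)\<close>, uniformly.\<close>
 define \<Phi> where "\<Phi> j x = P (real (Suc j) * x) / real (Suc j)" for j x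
 have \<Phi>close: "\<bar>\<Phi> j x - max 0 x\<bar> <= 1 / real (Suc j)" for j x
 proof -
  have "max 0 (real (Suc j) * x) = real (Suc j) * max 0 x"
  proof (cases "x <= 0")
   case True
   then have "real (Suc j) * x <= 0" by (intro mult_nonneg_nonpos) simp_all
   then show ?thesis using True by (simp only: max_absorb1 mult_zero_right)
  next
   case False
   then have "0 <= real (Suc j) * x" by (intro mult_nonneg_nonneg) simp_all
   then show ?thesis using False by (simp only: max_absorb2 not_le less_imp_le)
  qed
  then have "\<Phi> j x - max 0 x = (P (real (Suc j) * x) - max 0 (real (Suc j) * x)) / real (Suc j)"
   by (simp add: \<Phi>_def diff_divide_distrib del: of_nat_Suc)
  then show ?thesis using close[of "real (Suc j) * x"] by (simp add: divide_right_mono abs_divide del: of_nat_Suc)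
 qed
 have \<Phi>abs: "\<bar>\<Phi> j x\<bar> <= \<bar>x\<bar>" for j x
  using Pabs[of "real (Suc j) * x"] by (simp add: \<Phi>_def abs_mult divide_le_eq mult.commute del: of_nat_Suc)
 have \<Phi>': "(\<Phi> j has_real_derivative S (real (Suc j) * x)) (at x)" for j x
 proof -
  have "((%x. real (Suc j) * x) has_real_derivative real (Suc j)) (at x)" by (auto intro!: derivative_eq_intros)
  from DERIV_cdivide[OF DERIV_chain2[OF P' this], of "real (Suc j)"] show ?thesis by (simp add: \<Phi>_def[abs_def] del: of_nat_Suc)
 qed
 have \<Phi>c: "continuous_on UNIV (%x. S (real (Suc j) * x))" for j
  by (rule smooth_continuous[OF smooth_compose_real[OF smooth_linear[OF bounded_linear_mult_right] S(1)]])
 have \<Phi>b: "\<bar>S (real (Suc j) * x)\<bar> <= 1" for j x using S(7,8)[of "real (Suc j) * x"] by simp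
 note tc = weak_time_chain[OF wd \<Phi>' \<Phi>c \<Phi>b \<rho>m \<rho>b \<theta>(1)]
 define T where "T j z = indicator S_infty z *. (rx z * \<Phi> j (d z) * dt \<theta> z)" for j z
 define T0 where "T0 z = indicator S_infty z *. (rx z * max 0 (d z) * dt \<theta> z)" for z
 have iT: "integrable lborel (T j)" for j using tc(1)[of j] by (simp add: T_def[abs_def] rx_def)
 define w where "w z = R * \<bar>indicator S_infty z *. (dt \<theta> z *. d z)\<bar>" for z
 have iw: "integrable lborel w"
 proof -
  have "S_integrable (%z. dt \<theta> z *. d z)"
   unfolding dt_def using wd by (intro loc_int_test test_fun_pd[OF \<theta>(1) Basis_t]) (simp add: weak_dt_def)
  then show ?thesis unfolding w_def by simp
 qed
 have Tw: "\<bar>T j z\<bar> <= w z" for j z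
 proof (cases "z \<in> S_infty")
  case True
  have "\<bar>rx z\<bar> * \<bar>\<Phi> j (d z)\<bar> * \<bar>dt \<theta> z\<bar> <= R * \<bar>d z\<bar> * \<bar>dt \<theta> z\<bar>"
   using rx_bounds[of z] \<Phi>abs by (intro mult_mono) auto
  then show ?thesis using True by (simp add: T_def w_def abs_mult mult_ac)
 qed (simp add: T_def w_def)
 have lim: "(%j. T j z) ----> T0 z" for z
 proof -
  have "(%j. \<Phi> j (d z) - max 0 (d z)) ----> 0"
  proof (rule Lim_null_comparison)
   show "eventually (%j. norm (\<Phi> j (d z) - max 0 (d z)) <= 1 / real (Suc j)) sequentially"
    using \<Phi>close by (intro always_eventually allI) simp
   show "(%j. 1 / real (Suc j)) ----> 0" using LIMSEQ_Suc[OF lim_const_over_n[of 1]] by simp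
  qed
  then have "(%j. \<Phi> j (d z)) ----> max 0 (d z)" by (rule LIM_zero_cancel)
  then show ?thesis unfolding T_def T0_def by (intro tendsto_intros)
 qed
 have mT: "T j \<in> borel_measurable lborel" for j by (rule borel_measurable_integrable[OF iT])
 have mT0: "T0 \<in> borel_measurable lborel" by (rule borel_measurable_LIMSEQ_metric[OF mT lim])
 have limAE: "AE z in lborel. (%j. T j z) ----> T0 z" using lim by simp
 have TAE: "AE z in lborel. norm (T j z) <= w z" for j using Tw by (intro AE_I2) simp
 have iT0: "integrable lborel T0"
  by (rule integrable_dominated_convergence[where s = T, OF mT0 mT iw limAE TAE])
 have limT: "(%j. LI z. T j z) ----> (LI z. T0 z)"
  by (rule dominated_conv[where s = T, OF mT0 mT iw limAE TAE])
 define Q where "Q j z = indicator S_infty z *. (rx z * (S (real (Suc j) * d z) * (ut z - vt z)) * \<theta> z)" for j z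
 have iQ: "integrable lborel (Q j)" for j using tc(2)[of j] by (simp add: Q_def[abs_def] rx_def del: of_nat_Suc)
 have TQ: "(LI z. T j z) = - (LI z. Q j z)" for j
  using tc(3)[of j] by (simp add: T_def Q_def set_lebesgue_integral_def rx_def del: of_nat_Suc)
 have Qeq: "Q j z = rx z * (S (real (Suc j) * d z) * Y \<theta> z)" for j z by (simp add: Q_def Y_def)
 have iY: "integrable lborel (Y \<theta>)" by (rule Y_integrable[OF \<theta>(1)])
 define Q0 where "Q0 z = rx z * (indicator {z. 0 < d z} z * Y \<theta> z)" for z
 have limQz: "(%j. Q j z) ----> Q0 z" for z
 proof -
  have "(%j. S (real (Suc j) * d z)) ----> indicator {z. 0 < d z} z"
  proof (cases "0 < d z")
   case W: True
   have "eventually (%j. 1 / d z <= real j) sequentially"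
    using eventually_ge_at_top[of "nat \<lceil>1 / d z\<rceil>"] by eventually_elim linarith
   then have "eventually (%j. S (real (Suc j) * d z) = 1) sequentially"
   proof eventually_elim
    case (elim j)
    then have "1 <= real j * d z" using W by (simp add: divide_le_eq)
    also have "... <= real (Suc j) * d z" using W by (simp add: mult_right_mono)
    finally show ?case by (rule S(6))
   qed
   then show ?thesis using W by (simp add: tendsto_eventually del: of_nat_Suc)
  next
   case W: False
   then have "S (real (Suc j) * d z) = 0" for j by (intro S(5)) (simp add: mult_nonneg_nonpos del: of_nat_Suc)
   then show ?thesis using W by (simp del: of_nat_Suc)
  qed
  then show ?thesis unfolding Qeq Q0_def by (intro tendsto_intros)
 qed
 have mQ: "Q j \<in> borel_measurable lborel" for j by (rule borel_measurable_integrable[OF iQ])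
 have mQ0: "Q0 \<in> borel_measurable lborel" by (rule borel_measurable_LIMSEQ_metric[OF mQ limQz])
 have iRY: "integrable lborel (%z. R * \<bar>Y \<theta> z\<bar>)" using iY by simp
 have Qb: "\<bar>Q j z\<bar> <= R * \<bar>Y \<theta> z\<bar>" for j z
 proof -
  have "\<bar>rx z\<bar> * (\<bar>S (real (Suc j) * d z)\<bar> * \<bar>Y \<theta> z\<bar>) <= R * (1 * \<bar>Y \<theta> z\<bar>)"
   using rx_bounds[of z] \<Phi>b[of j "d z"] by (intro mult_mono) auto
  then show ?thesis by (simp add: Qeq abs_mult)
 qed
 have limQ: "(%j. LI z. Q j z) ----> (LI z. Q0 z)"
 proof (rule dominated_conv[where s = Q, OF mQ0 mQ iRY])
  show "AE z in lborel. (%j. Q j z) ----> Q0 z" using limQz by simp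
  show "AE z in lborel. norm (Q j z) <= R * \<bar>Y \<theta> z\<bar>" for j using Qb by (intro AE_I2) simp
 qed
 have "(LI z. T0 z) = - (LI z. Q0 z)"
  using LIMSEQ_unique[OF limT] tendsto_minus[OF limQ] by (simp add: TQ)
 moreover have "(LI z. Q0 z) <= 0" unfolding Q0_def by (rule sign_inequality[OF \<theta> flat])
 ultimately show ?c2
  by (simp add: set_lebesgue_integral_def T0_def)
 show ?c1
  using iT0 by (simp add: T0_def[abs_def])
qed

end

lemma smooth_norm_fst_sq: "smooth (%z :: 'a::euclidean_space \<times> real. (norm (fst z))\<^sup>2)"
proof -
 have "(norm (fst z))\<^sup>2 = (\<Sum>i\<in>Basis. (z \<bullet> (i, 0)) * (z \<bullet> (i, 0)))" for z :: "'a \<times> real"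
  by (simp add: power2_norm_eq_inner euclidean_inner[of "fst z" "fst z"] inner_prod_def)
 then show ?thesis
  using smooth_linear[OF bounded_linear_inner_left] unfolding smooth_def by (auto intro!: Ck_sum Ck_mult)
qed

lemma grad_x_locally_constant:
 assumes s: "smooth \<theta>" and e: "e > 0" and c: "!!y. norm (y - fst z) < e ==> \<theta> (y, snd z) = \<theta> z"
 shows "grad_x \<theta> z = 0"
proof -
 have "pd (b, 0) \<theta> z = 0" if b: "b \<in> Basis" for b
 proof -
  have d: "((%t. \<theta> (z + t *. (b, 0))) has_real_derivative pd (b, 0) \<theta> z) (at 0)"
   using smooth_line_derivative[OF s, of z "(b, 0)" 0] by (simp add: zero_prod_def[symmetric])
  have "eventually (%t::real. \<bar>t\<bar> < e) (nhds 0)"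
   using eventually_nhds_in_open[of "ball 0 e" "0::real"] e by (auto elim: eventually_mono)
  then have "eventually (%t. \<theta> (z + t *. (b, 0)) = \<theta> z) (nhds 0)"
  proof eventually_elim
   case (elim t)
   have "\<theta> (fst z + t *. b, snd z) = \<theta> z" by (rule c) (use elim b in simp)
   then show ?case by (simp add: plus_prod_def)
  qed
  moreover have "((%t. \<theta> z) has_real_derivative 0) (at (0::real))" by simp
  ultimately have "((%t. \<theta> (z + t *. (b, 0))) has_real_derivative 0) (at 0)" by (simp add: DERIV_cong_ev)
  from DERIV_unique[OF d this] show ?thesis .
 qed
 then show ?thesis by (simp add: grad_x_def)
qed

section \<open>Decay of the weighted mass of the positive part\<close>

context strong_pair
begin

abbreviation "N == rho_measure \<rho> :: 'a measure"

definition M where "M t = (LINT x|N. max 0 (u x t - v x t))"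

lemma N_integrable: "f \<in> meas ==> integrable N f \<longleftrightarrow> integrable lborel (%x. \<rho> (norm x) *. f x)" for f :: "'a => real"
 unfolding rho_measure_def by (rule integrable_density) (use \<rho>m \<rho>0 in auto)

lemma N_integral: "f \<in> meas ==> (LINT x|N. f x) = (LI x. \<rho> (norm x) *. f x)" for f :: "'a => real"
 unfolding rho_measure_def by (rule integral_density) (use \<rho>m \<rho>0 in auto)

lemma slice:
 assumes "0 <= t"
 shows "integrable N (%x. u x t)" "integrable N (%x. v x t)"
  "(%x. u x t) \<in> meas" "(%x. v x t) \<in> meas"
proof -
 show i: "integrable N (%x. u x t)" "integrable N (%x. v x t)"
  using eu ev assms by (auto simp: energy_class_def continuous_L1_def)
 show "(%x. u x t) \<in> meas" "(%x. v x t) \<in> meas"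
  using borel_measurable_integrable[OF i(1)] borel_measurable_integrable[OF i(2)] by (auto simp: rho_measure_def)
qed

lemma M_nonneg: "0 <= M t" unfolding M_def by (rule Bochner_Integration.integral_nonneg) simp

lemma M_tendsto:
 assumes t: "0 <= t" shows "(M \<longlongrightarrow> M t) (at t within {0..})"
proof (rule LIM_zero_cancel, rule Lim_null_comparison)
 define A where "A s = (LINT x|N. \<bar>u x s - u x t\<bar>) + (LINT x|N. \<bar>v x s - v x t\<bar>)" for s
 show "(A \<longlongrightarrow> 0) (at t within {0..})"
  using eu ev t unfolding A_def by (auto simp: energy_class_def continuous_L1_def intro!: tendsto_add_zero)
 have "norm (M s - M t) <= A s" if s: "0 <= s" for s
 proof -
  note i = slice(1,2)[OF s] slice(1,2)[OF t]
  have "norm (M s - M t) = norm (LINT x|N. max 0 (u x s - v x s) - max 0 (u x t - v x t))"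
   unfolding M_def using i by (subst Bochner_Integration.integral_diff) auto
  also have "... <= (LINT x|N. \<bar>u x s - u x t\<bar> + \<bar>v x s - v x t\<bar>)"
   by (rule Bochner_Integration.integral_norm_bound_integral) (use i in auto)
  also have "... = A s" unfolding A_def using i by (intro Bochner_Integration.integral_add) auto
  finally show ?thesis .
 qed
 then show "eventually (%s. norm (M s - M t) <= A s) (at t within {0..})"
  unfolding eventually_at_filter by (intro always_eventually) auto
qed

lemma M_continuous: "continuous_on {0..} M"
 unfolding continuous_on_def using M_tendsto by auto

text \<open>If \<open>M b\<close> exceeded \<open>M a\<close>, continuity would keep the gap on
  short intervals after \<open>a\<close> and \<open>b\<close>. Testing with a function that rises on
  \<open>[a, a+h]\<close> and falls on \<open>[b, b+h]\<close> compares averages of \<open>M\<close>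
  over these intervals and contradicts the gap. Each average costs at most a third of it.\<close>

lemma M_decreasing:
 assumes supp: "!!T. \<exists>Rd. \<forall>x t. 0 < t --> t <= T --> Rd <= norm x --> u x t <= 0"
  and ab: "0 < a" "a < b"
 shows "M b <= M a"
proof (rule ccontr)
 assume "\<not> M b <= M a"
 then have lt: "M a < M b" by simp
 define e where "e = (M b - M a) / 3"
 have e: "e > 0" using lt by (simp add: e_def)
 have near: "\<exists>h>0. \<forall>t. c <= t --> t <= c + h --> \<bar>M t - M c\<bar> < e" if c: "0 < c" for c
 proof -
  have "c \<in> {0..}" using c by simp
  then obtain h where h: "h > 0" "!!t. t \<in> {0..} ==> dist t c < h ==> dist (M t) (M c) < e"
   using M_continuous[unfolded continuous_on_iff] e by blast
  show ?thesis by (rule exI[of _ "h / 2"]) (use h c in "auto simp: dist_real_def")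
 qed
 obtain h1 where h1: "h1 > 0" "!!t. a <= t ==> t <= a + h1 ==> \<bar>M t - M a\<bar> < e" using near[OF ab(1)] by blast
 have b0: "0 < b" using ab by simp
 obtain h2 where h2: "h2 > 0" "!!t. b <= t ==> t <= b + h2 ==> \<bar>M t - M b\<bar> < e" using near[OF b0] by blast
 define h where "h = min h1 h2"
 have h: "h > 0" "h <= h1" "h <= h2" using h1 h2 by (auto simp: h_def)
 obtain S S' :: "real => real" where S: "smooth S" "smooth S'" "!!x. (S has_real_derivative S' x) (at x)" "!!x. S' x >= 0"
  "!!x. x <= 0 ==> S x = 0" "!!x. x >= 1 ==> S x = 1"
  "!!x. 0 <= S x" "!!x. S x <= 1" "!!x. x <= 0 \<or> x >= 1 ==> S' x = 0"
  using smooth_step_exists by metis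
 have Smono: "S x <= S y" if "x <= y" for x y
  by (rule DERIV_nonneg_imp_nondecreasing[OF that]) (use S(3,4) in blast)
 \<comment> \<open>The derivative of the ramp is a nonnegative kernel of mass 1 on
   \<open>[c, c+h]\<close>; integrating \<open>K c\<close> against \<open>M\<close> gives an average
   of \<open>M\<close> just after \<open>c\<close>.\<close>
 define K where "K c t = S' ((t - c) / h) / h" for c t
 have Kc: "continuous_on UNIV (K c)" for c
 proof -
  have "continuous_on UNIV (%t. S' ((t - c) / h))"
   by (rule continuous_on_compose2[OF smooth_continuous[OF S(2)]]) (use h in "auto intro!: continuous_intros")
  then show ?thesis unfolding K_def[abs_def] using h by (intro continuous_on_divide continuous_on_const) auto
 qed
 have K0: "K c t = 0" if "t <= c \<or> c + h <= t" for c t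
  unfolding K_def using that h by (subst S(9)) (auto simp: field_simps)
 have Kn: "0 <= K c t" for c t using S(4) h by (simp add: K_def)
 have SK: "((%t. S ((t - c) / h)) has_real_derivative K c t) (at t)" for c t
 proof -
  have "((%t. (t - c) / h) has_real_derivative 1 / h) (at t)" using h by (auto intro!: derivative_eq_intros)
  from DERIV_chain2[OF S(3) this] show ?thesis by (simp add: K_def)
 qed
 have KI: "has_bochner_integral lborel (%t. K c t * indicator {c..c+h} t) 1" for c
 proof -
  have "has_bochner_integral lborel (%t. K c t * indicator {c..c+h} t) (S ((c + h - c) / h) - S ((c - c) / h))"
   by (rule has_bochner_integral_FTC_Icc_real) (use h SK Kc in "auto simp: continuous_on_eq_continuous_at")
  then show ?thesis using h S(5)[of 0] S(6)[of 1] by simp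
 qed
 have KM: "integrable lborel (%t. indicator {c..c+h} t *. (K c t * M t))" if "0 <= c" for c
 proof -
  have "continuous_on {c..c+h} (%t. K c t * M t)"
   using that by (intro continuous_on_mult continuous_on_subset[OF Kc] continuous_on_subset[OF M_continuous]) auto
  from borel_integrable_atLeastAtMost'[OF this] show ?thesis by (simp add: set_integrable_def)
 qed
 obtain Rd where Rd: "!!x t. 0 < t ==> t <= b + h ==> Rd <= norm x ==> u x t <= 0" using supp[of "b + h"] by blast
 \<comment> \<open>Equal to 1 up to radius \<open>Rd\<close>, beyond which \<open>u\<close> is
   nonpositive until time \<open>b + h\<close>. Later times are cut off by \<open>chi\<close>, so
   the product is spatially flat wherever \<open>u > 0\<close>.\<close>
 define th where "th x = S (Rd\<^sup>2 + 1 + (-1) * (norm x)\<^sup>2)" for x :: 'a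
 define chi where "chi t = S ((t - a) / h) - S ((t - b) / h)" for t
 define \<theta> where "\<theta> z = th (fst z) * chi (snd z)" for z
 have chi0: "chi t = 0" if "t <= a \<or> b + h <= t" for t
 proof (cases "t <= a")
  case True
  then have "(t - a) / h <= 0" "(t - b) / h <= 0" using h ab by (auto simp: divide_le_0_iff)
  then show ?thesis by (simp add: chi_def S(5))
 next
  case False
  then have "1 <= (t - a) / h" "1 <= (t - b) / h" using that h ab by (auto simp: le_divide_eq)
  then show ?thesis by (simp add: chi_def S(6))
 qed
 have chin: "0 <= chi t" for t
  unfolding chi_def using Smono[of "(t - b) / h" "(t - a) / h"] h ab by (simp add: divide_right_mono)
 have th1: "th x = 1" if "norm x <= Rd" for x :: 'a
  unfolding th_def using that power_mono[of "norm x" Rd 2] by (intro S(6)) simp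
 have th0: "th x = 0" if "norm x > \<bar>Rd\<bar> + 1" for x :: 'a
 proof -
  have "(\<bar>Rd\<bar> + 1)\<^sup>2 <= (norm x)\<^sup>2" using that by (intro power_mono) auto
  moreover have "(\<bar>Rd\<bar> + 1)\<^sup>2 >= Rd\<^sup>2 + 1" by (simp add: power2_sum)
  ultimately have "Rd\<^sup>2 + 1 <= (norm x)\<^sup>2" by (rule order_trans[rotated])
  then show ?thesis unfolding th_def by (intro S(5)) simp
 qed
 have sm\<theta>: "smooth \<theta>"
 proof -
  have l: "smooth (%z::'a\<times>real. (snd z - c) / h)" for c
   unfolding divide_inverse by (intro smooth_mult smooth_diff smooth_const smooth_linear[OF bounded_linear_snd])
  show ?thesis unfolding \<theta>_def[abs_def] th_def chi_def
   by (intro smooth_mult smooth_diff smooth_compose_real[OF l S(1)] smooth_compose_real[OF smooth_add[OF smooth_const smooth_mult[OF smooth_const smooth_norm_fst_sq]] S(1)])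
 qed
 have t\<theta>: "test_fun \<theta>"
 proof (rule test_funI[OF sm\<theta> ab(1)])
  show "z \<in> Bx (\<bar>Rd\<bar> + 1) a (b + h)" if nz: "\<theta> z ~= 0" for z
  proof -
   have "chi (snd z) ~= 0" "th (fst z) ~= 0" using nz by (auto simp: \<theta>_def)
   then show ?thesis using chi0[of "snd z"] th0[of "fst z"] by (fastforce simp: mem_Bx)
  qed
 qed
 have \<theta>n: "0 <= \<theta> z" for z using chin S(7) by (simp add: \<theta>_def th_def)
 have flat: "grad_x \<theta> z = 0" if z: "z \<in> S_infty" "0 < u (fst z) (snd z)" for z
 proof (cases "snd z <= b + h")
  case True
  then have n: "norm (fst z) < Rd" using Rd[of "snd z" "fst z"] z by (force simp: mem_S)
  show ?thesis
  proof (rule grad_x_locally_constant[OF sm\<theta>, of "Rd - norm (fst z)"])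
   fix y :: 'a assume "norm (y - fst z) < Rd - norm (fst z)"
   then have "norm y <= Rd" using norm_triangle_ineq2[of y "fst z"] by linarith
   then show "\<theta> (y, snd z) = \<theta> z" using n by (simp add: \<theta>_def th1)
  qed (use n in simp)
 next
  case False
  show ?thesis by (rule grad_x_locally_constant[OF sm\<theta>, of 1]) (use False in \<open>simp_all add: \<theta>_def chi0\<close>)
 qed
 have dt\<theta>: "dt \<theta> z = th (fst z) * (K a (snd z) - K b (snd z))" for z
 proof -
  have d: "((%t. \<theta> (z + t *. (0, 1))) has_real_derivative dt \<theta> z) (at 0)"
   using smooth_line_derivative[OF sm\<theta>, of z "(0, 1)" 0] by (simp add: zero_prod_def[symmetric] dt_def)
  have sh: "((%t. snd z + t) has_real_derivative 1) (at 0)" by (auto intro!: derivative_eq_intros)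
  have "((%t. S ((snd z + t - c) / h)) has_real_derivative K c (snd z + 0) * 1) (at 0)" for c
   by (rule DERIV_chain2[of "%t. S ((t - c) / h)", OF SK sh])
  from DERIV_cmult[OF DERIV_diff[OF this[of a] this[of b]], of "th (fst z)"]
  have "((%t. \<theta> (z + t *. (0, 1))) has_real_derivative th (fst z) * (K a (snd z) - K b (snd z))) (at 0)"
   by (simp add: \<theta>_def chi_def)
  from DERIV_unique[OF d this] show ?thesis .
 qed
 note pp = positive_part_inequality[OF t\<theta> \<theta>n flat]
 define k where "k t = K a t - K b t" for t
 have kz: "k t = 0" if "t <= a \<or> b + h <= t" for t
  using that K0[of t a] K0[of t b] h ab by (auto simp: k_def)
 define f where "f x t = indicator {0<..} t * (k t * (\<rho> (norm x) * max 0 (u x t - v x t)))" for x :: 'a and t :: real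
 have eqAE: "AE z in lborel. indicator S_infty z *. (rx z * max 0 (d z) * dt \<theta> z) = f (fst z) (snd z)"
  using energy_nonneg[OF eu] energy_nonneg[OF ev]
 proof eventually_elim
  case (elim z)
  show ?case
  proof (cases "z \<in> S_infty")
   case True
   have "max 0 (d z) * (th (fst z) * k (snd z)) = max 0 (d z) * k (snd z)"
   proof (cases "0 < d z \<and> a < snd z \<and> snd z < b + h")
    case T: True
    then have "0 < u (fst z) (snd z)" using elim True by (simp add: d_def)
    then have "norm (fst z) < Rd" using Rd[of "snd z" "fst z"] T True by (force simp: mem_S)
    then show ?thesis by (simp add: th1)
   next
    case False
    then have "max 0 (d z) = 0 \<or> k (snd z) = 0" using kz[of "snd z"] by auto
    then show ?thesis by auto
   qed
   then show ?thesis using True by (auto simp add: f_def dt\<theta> k_def[symmetric] rx_def d_def mem_S mult_ac)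
  next
   case False
   then show ?thesis by (simp add: f_def mem_S)
  qed
 qed
 have mf: "(%z. f (fst z) (snd z)) \<in> meas"
 proof -
  note [measurable] = rx_measurable d_measurable
  have ks: "continuous_on UNIV k" unfolding k_def[abs_def] by (intro continuous_on_diff Kc)
  have [measurable]: "(%z::'a\<times>real. k (snd z)) \<in> meas"
   by (rule continuous_measurable[OF continuous_on_compose2[OF ks continuous_on_snd[OF continuous_on_id]]]) auto
  have "f (fst z) (snd z) = k (snd z) * (rx z * max 0 (indicator S_infty z * d z))" for z
   by (cases "z \<in> S_infty") (auto simp: f_def rx_def d_def mem_S)
  then show ?thesis by simp
 qed
 have if': "integrable lborel (%z. f (fst z) (snd z))"
  by (rule integrable_cong_AE_imp[OF pp(1)]) (use mf eqAE in "auto elim: eventually_mono")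
 have fn: "0 <= (LI z. f (fst z) (snd z))"
 proof -
  have "(LI z. f (fst z) (snd z)) = (LI z. indicator S_infty z *. (rx z * max 0 (d z) * dt \<theta> z))"
   by (rule Bochner_Integration.integral_cong_AE) (use mf borel_measurable_integrable[OF pp(1)] eqAE in "auto elim: eventually_mono")
  then show ?thesis using pp(2) by (simp add: set_lebesgue_integral_def)
 qed
 have ifp: "integrable (lborel \<Otimes>\<^sub>M lborel) (case_prod f)" unfolding lborel_prod using if' by (simp add: case_prod_unfold)
 have "(LI t. (LI x. f x t)) = (LI z. f (fst z) (snd z))"
  using lborel_pair.integral_snd[OF ifp] unfolding lborel_prod by (simp add: case_prod_unfold)
 moreover have inner: "(LI x. f x t) = indicator {a..a+h} t *. (K a t * M t) - indicator {b..b+h} t *. (K b t * M t)" for t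
 proof (cases "0 < t")
  case True
  have [measurable]: "(%x. u x t) \<in> meas" "(%x. v x t) \<in> meas" using slice(3,4)[of t] True by auto
  have "(LI x. f x t) = k t * (LI x. \<rho> (norm x) *. max 0 (u x t - v x t))"
   using True by (simp add: f_def)
  also have "(LI x. \<rho> (norm x) *. max 0 (u x t - v x t)) = M t"
   unfolding M_def by (rule N_integral[symmetric]) measurable
  finally show ?thesis using K0[of t a] K0[of t b] by (auto simp: k_def indicator_def algebra_simps)
 next
  case False
  then show ?thesis using ab by (auto simp: f_def indicator_def)
 qed
 ultimately have "0 <= (LI t. indicator {a..a+h} t *. (K a t * M t) - indicator {b..b+h} t *. (K b t * M t))"
  using fn by simp
 also have "... = (LI t. indicator {a..a+h} t *. (K a t * M t)) - (LI t. indicator {b..b+h} t *. (K b t * M t))"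
  by (rule Bochner_Integration.integral_diff) (use KM ab in auto)
 finally have ge: "0 <= (LI t. indicator {a..a+h} t *. (K a t * M t)) - (LI t. indicator {b..b+h} t *. (K b t * M t))" .
 have Ia: "(LI t. indicator {a..a+h} t *. (K a t * M t)) <= (LI t. (M a + e) * (K a t * indicator {a..a+h} t))"
 proof (rule integral_mono)
  show "integrable lborel (%t. indicator {a..a+h} t *. (K a t * M t))" using KM ab by simp
  show "integrable lborel (%t. (M a + e) * (K a t * indicator {a..a+h} t))"
   using KI[of a] by (intro integrable_mult_right) (auto simp: has_bochner_integral_iff)
  show "indicator {a..a+h} t *. (K a t * M t) <= (M a + e) * (K a t * indicator {a..a+h} t)" for t
  proof (cases "t \<in> {a..a+h}")
   case True
   then have "M t <= M a + e" using h1(2)[of t] h by auto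
   then have "K a t * M t <= K a t * (M a + e)" by (rule mult_left_mono) (rule Kn)
   then show ?thesis using True by (simp add: mult.commute)
  qed simp
 qed
 have Ia': "(LI t. (M a + e) * (K a t * indicator {a..a+h} t)) = M a + e"
  using KI[of a] by (simp add: has_bochner_integral_iff)
 have Ib: "(LI t. indicator {b..b+h} t *. (K b t * M t)) >= (LI t. (M b - e) * (K b t * indicator {b..b+h} t))"
 proof (rule integral_mono)
  show "integrable lborel (%t. indicator {b..b+h} t *. (K b t * M t))" using KM ab by simp
  show "integrable lborel (%t. (M b - e) * (K b t * indicator {b..b+h} t))"
   using KI[of b] by (intro integrable_mult_right) (auto simp: has_bochner_integral_iff)
  show "(M b - e) * (K b t * indicator {b..b+h} t) <= indicator {b..b+h} t *. (K b t * M t)" for t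
  proof (cases "t \<in> {b..b+h}")
   case True
   then have "M b - e <= M t" using h2(2)[of t] h by auto
   then have "K b t * (M b - e) <= K b t * M t" by (rule mult_left_mono) (rule Kn)
   then show ?thesis using True by (simp add: mult.commute)
  qed simp
 qed
 have Ib': "(LI t. (M b - e) * (K b t * indicator {b..b+h} t)) = M b - e"
  using KI[of b] by (simp add: has_bochner_integral_iff)
 have "M b - e <= M a + e" using ge Ia Ib unfolding Ia' Ib' by linarith
 then show False using lt by (simp add: e_def field_simps)
qed

text \<open>The weak formulation gives decay only between positive times. Continuity in
  \<open>L^1\<close> down to \<open>t = 0\<close> connects this with the ordered initial data, for
  which \<open>M 0 = 0\<close>.\<close>

theorem comparison:
 assumes supp: "!!T. \<exists>Rd. \<forall>x t. 0 < t --> t <= T --> Rd <= norm x --> u x t <= 0"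
  and init: "AE x in lborel. u x 0 <= v x 0" and \<rho>pos: "AE x in (lborel :: 'a measure). 0 < \<rho> (norm x)"
  and t: "0 < t"
 shows "AE x in lborel. u x t <= v x t"
proof -
 have [measurable]: "(%x. u x s) \<in> meas" "(%x. v x s) \<in> meas" if "0 <= s" for s
  using slice(3,4)[OF that] by auto
 have Meq: "M s = (LI x. \<rho> (norm x) *. max 0 (u x s - v x s))" if "0 <= s" for s
  unfolding M_def by (rule N_integral) (use that in measurable)
 have "(LI x. \<rho> (norm x) *. max 0 (u x 0 - v x 0)) = (LINT x|(lborel::'a measure). 0)"
 proof (rule Bochner_Integration.integral_cong_AE)
  show "(%x. \<rho> (norm x) *. max 0 (u x 0 - v x 0)) \<in> borel_measurable lborel" using \<rho>m by simp
  show "AE x in lborel. \<rho> (norm x) *. max 0 (u x 0 - v x 0) = 0" using init by eventually_elim simp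
 qed simp
 then have M0: "M 0 = 0" using Meq[of 0] by simp
 have "M t <= M s" if "0 < s" "s < t" for s using M_decreasing[OF supp that] .
 moreover have "(M \<longlongrightarrow> M 0) (at_right 0)"
  using M_tendsto[of 0] by (rule tendsto_within_subset) auto
 ultimately have "M t <= M 0"
  using t by (intro tendsto_lowerbound[of M "M 0" "at_right 0"]) (auto simp: eventually_at_right_field intro!: exI[of _ t])
 then have Mt: "M t = 0" using M0 M_nonneg[of t] by simp
 have i: "integrable N (%x. max 0 (u x t - v x t))" using slice(1,2)[of t] t by auto
 then have il: "integrable lborel (%x. \<rho> (norm x) *. max 0 (u x t - v x t))"
  using t by (subst (asm) N_integrable) auto
 have "AE x in lborel. \<rho> (norm x) *. max 0 (u x t - v x t) = 0"
  using integral_nonneg_eq_0_iff_AE[OF il] \<rho>0 Mt Meq[of t] t by simp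
 then show ?thesis using \<rho>pos
 proof eventually_elim
  case (elim x)
  then show ?case by (auto simp: max_def split: if_splits)
 qed
qed

end

section \<open>The radial functions\<close>

locale radial =
 fixes p m \<alpha>1 \<alpha>2 :: real and g rhat :: "real => real" and N :: nat
 assumes p1: "1 < p" and pN: "p < real N" and pm: "p + m - 3 > 0"
  and gc: "continuous_on {0..} g" and gC1: "g C1_differentiable_on {0<..}"
  and g0: "g 0 = 0" and gpos: "!!s. s > 0 ==> g s > 0"
  and \<alpha>: "0 < \<alpha>1" "\<alpha>1 <= \<alpha>2" "\<alpha>2 < p"
  and growth: "!!s. s > 0 ==> \<alpha>1 * (g s / s) <= deriv g s \<and> deriv g s <= \<alpha>2 * (g s / s)"
  and rad: "radial_change N p g rhat"
begin

lemma g_deriv: "r > 0 ==> (g has_real_derivative deriv g r) (at r)"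
proof -
 assume r: "r > 0"
 obtain D where "\<forall>x\<in>{0<..}. (g has_vector_derivative D x) (at x)"
  using gC1 unfolding C1_differentiable_on_def by blast
 then have "(g has_real_derivative D r) (at r)" using r by (simp add: has_real_derivative_iff_has_vector_derivative)
 then show ?thesis using DERIV_imp_deriv by fastforce
qed

lemma g'_nonneg: "0 < r ==> 0 <= deriv g r"
 using growth[of r] gpos[of r] \<alpha> by (smt (verit) divide_pos_pos mult_pos_pos)

definition gs where "gs s = g s / s" for s :: real

lemma gs_measurable: "(%s. indicator {0<..} s *. gs s) \<in> meas"
proof (rule borel_measurable_continuous_on_indicator)
 show "continuous_on {0<..} gs" unfolding gs_def[abs_def]
  by (intro continuous_on_divide continuous_on_id continuous_on_subset[OF gc]) auto
qed simp

lemma g'_integral: "0 <= r ==> (deriv g has_integral g r) {0..r}"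
proof -
 assume r: "0 <= r"
 have "(deriv g has_integral (g r - g 0)) {0..r}"
  by (rule fundamental_theorem_of_calculus_interior[OF r])
    (use g_deriv continuous_on_subset[OF gc] in "auto simp: has_real_derivative_iff_has_vector_derivative[symmetric]")
 then show ?thesis by (simp add: g0)
qed

text \<open>The integrand may be unbounded near 0. The lower growth bound dominates it by
  \<open>g' / \<alpha>1\<close>, which is integrable up to 0 because \<open>g\<close> is continuous
  there.\<close>

lemma gs_integrable: "gs integrable_on {0..r}"
proof (cases "0 <= r")
 case True
 have "(%x. (1 / \<alpha>1) * deriv g x) integrable_on {0..r}"
  using g'_integral[OF True] by (intro integrable_on_mult_right) auto
 moreover have "(%s. indicator {0<..} s *. gs s) \<in> borel_measurable (lebesgue_on {0..r})"
  using gs_measurable by (intro measurable_restrict_space1 borel_measurable_if_I measurable_completion) auto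
 moreover have "norm (indicator {0<..} s *. gs s) <= (1 / \<alpha>1) * deriv g s" if "s \<in> {0..r} - {0}" for s
  using growth[of s] gpos[of s] \<alpha> that by (simp add: gs_def field_simps)
 ultimately have "(%s. indicator {0<..} s *. gs s) integrable_on {0..r}"
 proof -
  assume a: "(%x. (1 / \<alpha>1) * deriv g x) integrable_on {0..r}"
   and b: "(%s. indicator {0<..} s *. gs s) \<in> borel_measurable (lebesgue_on {0..r})"
   and c: "!!s. s \<in> {0..r} - {0} ==> norm (indicator {0<..} s *. gs s) <= (1 / \<alpha>1) * deriv g s"
  have "(%x. if x = 0 then 0 else (1 / \<alpha>1) * deriv g x) integrable_on {0..r}"
   by (rule integrable_spike[OF a, of "{0}"]) auto
  from measurable_bounded_by_integrable_imp_integrable[OF b this]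
  show ?thesis using c by (force simp: indicator_def)
 qed
 then show ?thesis
  by (rule integrable_eq) (use g0 in "auto simp: gs_def indicator_def")
next
 case False
 then show ?thesis by (simp add: integrable_on_empty)
qed

lemma G_eq: "G g r = integral {0..r} gs" by (simp add: G_def gs_def[abs_def])

lemma G0: "G g 0 = 0" by (simp add: G_eq)

lemma G_cont: "continuous_on {0..} (G g)"
proof -
 have "continuous_on {0..b} (%x. integral {0..x} gs)" for b by (rule indefinite_integral_continuous_1[OF gs_integrable])
 then have c: "continuous_on {0..b} (G g)" for b unfolding G_eq[abs_def] .
 show ?thesis unfolding continuous_on_def
 proof
  fix x :: real assume x: "x \<in> {0..}"
  have "(G g \<longlongrightarrow> G g x) (at x within {0..x+1})" using c[of "x + 1"] x by (auto simp: continuous_on_def)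
  moreover have "at x within {0..} = at x within {0..x+1}"
   by (rule at_within_nhd[of x "{..<x+1}"]) auto
  ultimately show "(G g \<longlongrightarrow> G g x) (at x within {0..})" by simp
 qed
qed

lemma G_deriv: "r > 0 ==> (G g has_real_derivative g r / r) (at r)"
proof -
 assume r: "r > 0"
 have "isCont g r" using g_deriv[OF r] DERIV_isCont by blast
 then have "isCont gs r" unfolding gs_def[abs_def] using r by (intro continuous_intros) auto
 then have "continuous (at r within {0..r+1} - {}) gs" by (simp add: continuous_at_imp_continuous_at_within)
 from integral_has_vector_derivative_continuous_at[OF gs_integrable _ _ this]
 have "((%u. integral {0..u} gs) has_vector_derivative gs r) (at r within {0..r+1} - {})" using r by auto
 then have "(G g has_real_derivative gs r) (at r within {0..r+1})"
  by (simp add: G_eq[abs_def] has_real_derivative_iff_has_vector_derivative)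
 then show ?thesis using r at_within_interior[of r "{0..r+1}"] by (simp add: gs_def)
qed

lemma deriv_G: "r > 0 ==> deriv (G g) r = g r / r" using G_deriv DERIV_imp_deriv by blast

text \<open>Integrating the growth condition from 0, where \<open>g\<close> vanishes. At the
  endpoint the derivative is replaced by 0 to match the value of \<open>gs\<close> under division by
  zero.\<close>

lemma G_bounds: assumes r: "0 <= r" shows "\<alpha>1 * G g r <= g r" "g r <= \<alpha>2 * G g r"
proof -
 have i: "(gs has_integral G g r) {0..r}" unfolding G_eq using gs_integrable by blast
 have z: "0 * x / 0 = (0::real)" for x by simp
 have sp: "((%x. if x = 0 then 0 else deriv g x) has_integral g r) {0..r}"
  by (rule has_integral_spike[OF _ _ g'_integral[OF r], of "{0}"]) auto
 have "gs 0 = 0" by (simp add: gs_def)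
 show "\<alpha>1 * G g r <= g r"
  by (rule has_integral_le[OF has_integral_mult_right[OF i] sp]) (use growth \<open>gs 0 = 0\<close> in "auto simp: gs_def")
 show "g r <= \<alpha>2 * G g r"
  by (rule has_integral_le[OF sp has_integral_mult_right[OF i]]) (use growth \<open>gs 0 = 0\<close> in "auto simp: gs_def")
qed

lemma G_pos: "0 < r ==> 0 < G g r"
 using G_bounds(2)[of r] gpos[of r] \<alpha> by (smt (verit) mult_nonneg_nonpos)

lemma G_strict: assumes "0 <= a" "a < b" shows "G g a < G g b"
proof -
 have "\<exists>l z. a < z \<and> z < b \<and> (G g has_real_derivative l) (at z) \<and> G g b - G g a = (b - a) * l"
 proof (rule MVT[OF assms(2)])
  show "continuous_on {a..b} (G g)" by (rule continuous_on_subset[OF G_cont]) (use assms in auto)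
  show "G g differentiable (at x)" if "a < x" "x < b" for x
   using G_deriv[of x] that assms real_differentiable_def by force
 qed
 then obtain l z where z: "a < z" "(G g has_real_derivative l) (at z)" "G g b - G g a = (b - a) * l" by blast
 have "l = g z / z" using DERIV_unique[OF z(2) G_deriv[of z]] z(1) assms by simp
 then have "l > 0" using gpos[of z] z(1) assms by simp
 then show ?thesis using z(3) assms by (smt (verit) mult_pos_pos)
qed

lemma G_mono: "0 <= a ==> a <= b ==> G g a <= G g b" using G_strict[of a b] by (cases "a = b") auto

text \<open>The logarithmic derivative \<open>r G'(r) / G(r)\<close> equals \<open>g / G\<close> and
  lies between \<open>\<alpha>1\<close> and \<open>\<alpha>2\<close>. Hence
  \<open>ln G - \<alpha>2 ln r\<close> is nonincreasing and \<open>ln G - \<alpha>1 ln r\<close> is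
  nondecreasing.\<close>

lemma G_ratio:
 assumes r: "0 < r" "r <= R"
 shows "G g R <= G g r * (R / r) powr \<alpha>2" (is ?c1) "G g r * (R / r) powr \<alpha>1 <= G g R" (is ?c2)
proof -
 have d: "((%x. ln (G g x) - c * ln x) has_real_derivative (g x / x) / G g x - c / x) (at x)" if "x > 0" for x c
  using that G_pos[OF that] by (auto intro!: derivative_eq_intros G_deriv)
 have "ln (G g R) - \<alpha>2 * ln R <= ln (G g r) - \<alpha>2 * ln r"
 proof (rule DERIV_nonpos_imp_nonincreasing[OF r(2)])
  fix x assume x: "r <= x" "x <= R"
  then have x0: "0 < x" using r by simp
  have "(g x / x) / G g x - \<alpha>2 / x <= 0" using G_bounds(2)[of x] G_pos[OF x0] x0 by (simp add: field_simps)
  then show "\<exists>y. ((%a. ln (G g a) - \<alpha>2 * ln a) has_real_derivative y) (at x) \<and> y <= 0" using d[OF x0] by blast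
 qed
 then have "ln (G g R) <= ln (G g r * (R / r) powr \<alpha>2)"
  using r G_pos[of r] by (simp add: ln_mult ln_powr ln_div algebra_simps)
 then show ?c1 using r G_pos[of r] G_pos[of R] by (subst (asm) ln_le_cancel_iff) auto
 have "ln (G g r) - \<alpha>1 * ln r <= ln (G g R) - \<alpha>1 * ln R"
 proof (rule DERIV_nonneg_imp_nondecreasing[OF r(2)])
  fix x assume x: "r <= x" "x <= R"
  then have x0: "0 < x" using r by simp
  have "(g x / x) / G g x - \<alpha>1 / x >= 0" using G_bounds(1)[of x] G_pos[OF x0] x0 by (simp add: field_simps)
  then show "\<exists>y. ((%a. ln (G g a) - \<alpha>1 * ln a) has_real_derivative y) (at x) \<and> 0 <= y" using d[OF x0] by blast
 qed
 then have "ln (G g r * (R / r) powr \<alpha>1) <= ln (G g R)"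
  using r G_pos[of r] by (simp add: ln_mult ln_powr ln_div algebra_simps)
 then show ?c2 using r G_pos[of r] G_pos[of R] by (subst (asm) ln_le_cancel_iff) auto
qed

lemma G_surj: assumes "0 <= \<tau>" shows "\<exists>r\<ge>0. G g r = \<tau>"
proof -
 \<comment> \<open>Large enough for the power lower bound on \<open>G\<close>, started at radius 1,
   to reach \<open>\<tau>\<close>; the intermediate value theorem then applies.\<close>
 define R where "R = 1 + (\<tau> / G g 1) powr (1 / \<alpha>1)"
 have G1: "G g 1 > 0" by (rule G_pos) simp
 have "\<tau> <= G g R"
 proof -
  have "\<tau> / G g 1 = ((\<tau> / G g 1) powr (1 / \<alpha>1)) powr \<alpha>1" using assms G1 \<alpha> by (simp add: powr_powr)
  also have "... <= R powr \<alpha>1" unfolding R_def using \<alpha> by (intro powr_mono2) auto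
  finally have "\<tau> <= G g 1 * (R / 1) powr \<alpha>1" using G1 by (simp add: field_simps)
  also have "... <= G g R" by (rule G_ratio(2)) (auto simp: R_def)
  finally show ?thesis .
 qed
 moreover have "0 <= R" by (simp add: R_def)
 ultimately obtain r where "0 <= r" "r <= R" "G g r = \<tau>"
  using IVT'[of "G g" 0 \<tau> R] G0 assms continuous_on_subset[OF G_cont, of "{0..R}"] by auto
 then show ?thesis by blast
qed

lemma G_inj: "inj_on (G g) {0..}"
 by (rule inj_onI) (metis G_strict atLeast_iff less_irrefl linorder_neqE_linordered_idom)

lemma G_inv_G: "0 <= r ==> G_inv g (G g r) = r"
 unfolding G_inv_def using the_inv_into_f_f[OF G_inj] by simp

lemma G_G_inv: assumes "0 <= \<tau>" shows "G g (G_inv g \<tau>) = \<tau>" "0 <= G_inv g \<tau>"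
proof -
 obtain r where r: "r >= 0" "G g r = \<tau>" using G_surj[OF assms] by blast
 then have "G_inv g \<tau> = r" using G_inv_G[OF r(1)] by simp
 then show "G g (G_inv g \<tau>) = \<tau>" "0 <= G_inv g \<tau>" using r by auto
qed

lemma G_inv_mono: assumes "0 <= \<sigma>" "\<sigma> <= \<tau>" shows "G_inv g \<sigma> <= G_inv g \<tau>"
proof (rule ccontr)
 assume "\<not> ?thesis"
 then have "G g (G_inv g \<tau>) < G g (G_inv g \<sigma>)" using assms G_G_inv(2)[of \<tau>] by (intro G_strict) auto
 then show False using G_G_inv(1) assms by simp
qed

lemma G_inv_pos: assumes "0 < \<tau>" shows "0 < G_inv g \<tau>"
 using G_G_inv[of \<tau>] G0 assms by (metis less_eq_real_def order_less_irrefl)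

lemma G_inv_deriv: assumes t: "0 < \<tau>" shows "(G_inv g has_real_derivative G_inv g \<tau> / g (G_inv g \<tau>)) (at \<tau>)"
proof -
 define r where "r = G_inv g \<tau>"
 have r: "r > 0" unfolding r_def by (rule G_inv_pos[OF t])
 have Gr: "G g r = \<tau>" unfolding r_def using G_G_inv(1) t by simp
 have "(G_inv g has_real_derivative inverse (g r / r)) (at \<tau>)"
 proof (rule DERIV_inverse_function[where f = "G g" and a = 0 and b = "\<tau> + 1"])
  show "(G g has_real_derivative g r / r) (at (G_inv g \<tau>))" unfolding r_def[symmetric] by (rule G_deriv[OF r])
  show "g r / r ~= 0" using gpos[OF r] r by simp
  show "G g (G_inv g y) = y" if "0 < y" "y < \<tau> + 1" for y using G_G_inv(1) that by simp
  show "isCont (G_inv g) \<tau>"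
  proof -
   have "isCont (G_inv g) (G g r)"
   proof (rule isCont_inverse_function[where f = "G g" and x = r and d = "r / 2"])
    show "G_inv g (G g z) = z" if "\<bar>z - r\<bar> <= r / 2" for z
     using abs_le_D2[OF that] r by (intro G_inv_G) linarith
    show "isCont (G g) z" if "\<bar>z - r\<bar> <= r / 2" for z
    proof -
     have "0 < z" using abs_le_D2[OF that] r by linarith
     then show ?thesis using G_deriv DERIV_isCont by blast
    qed
   qed (use r in simp)
   then show ?thesis by (simp add: Gr)
  qed
 qed (use t in auto)
 then show ?thesis by (simp add: r_def)
qed

subsection \<open>The change of variable\<close>

definition rp where "rp s = (exp (g (rhat s)) * (rhat s ^ (N - 1) / s ^ (N - 1))) powr (1 / (p - 1))" for s

lemma rhat_pos: "s > 0 ==> rhat s > 0" and rhat_deriv: "s > 0 ==> (rhat has_real_derivative rp s) (at s)"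
 and rhat_0: "rhat 0 = 0" and rhat_strict: "strict_mono_on {0..} rhat" and rhat_top: "filterlim rhat at_top at_top"
 and rhat_lim0: "(rhat \<longlongrightarrow> 0) (at_right 0)"
 using rad unfolding radial_change_def rp_def by auto

lemma N2: "N >= 2" using p1 pN by linarith

lemma rp_pos: "s > 0 ==> rp s > 0"
 using rhat_pos[of s] by (simp add: rp_def)

lemma rp_powr: assumes s: "s > 0" shows "rp s powr (p - 1) = exp (g (rhat s)) * (rhat s / s) powr (real N - 1)"
proof -
 have "rp s powr (p - 1) = exp (g (rhat s)) * (rhat s ^ (N - 1) / s ^ (N - 1))"
  using s rhat_pos[OF s] p1 unfolding rp_def by (simp add: powr_powr)
 also have "rhat s ^ (N - 1) / s ^ (N - 1) = (rhat s / s) powr (real N - 1)"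
  using s rhat_pos[OF s] N2 by (simp add: powr_realpow[symmetric] of_nat_diff powr_divide)
 finally show ?thesis .
qed

lemma rhat_cont: "continuous_on {0..} rhat"
 unfolding continuous_on_def
proof
 fix x :: real assume "x \<in> {0..}"
 show "(rhat \<longlongrightarrow> rhat x) (at x within {0..})"
 proof (cases "x = 0")
  case True
  have "at 0 within {0..} = at_right (0::real)" by (simp add: at_within_Ici_at_right)
  then show ?thesis using rhat_lim0 True rhat_0 by simp
 next
  case False
  then have "isCont rhat x" using \<open>x \<in> {0..}\<close> rhat_deriv[of x] DERIV_isCont by (metis atLeast_iff less_eq_real_def)
  then show ?thesis by (simp add: continuous_at_imp_continuous_at_within continuous_within[symmetric])
 qed
qed

lemma rhat_mono: "0 <= a ==> a <= b ==> rhat a <= rhat b"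
 using rhat_strict by (metis atLeast_iff order_le_less order_trans strict_mono_on_def)

lemma rhat_less: "0 <= a ==> a < b ==> rhat a < rhat b"
 using rhat_strict by (simp add: strict_mono_on_def)

text \<open>Decay at infinity selects the solution with this bound: the difference of the two sides, in
 the form W below, decreases to its limit 0.\<close>

lemma rhat_bound:
 assumes s: "s > 0"
 shows "exp (g (rhat s)) * (rhat s / s) powr (real N - p) <= 1"
proof -
 define a where "a = (real N - p) / (p - 1)"
 have a: "a > 0" using p1 pN by (simp add: a_def)
 have ha: "a * (p - 1) = real N - p" using p1 by (simp add: a_def)
 have a1: "a + 1 = (real N - 1) / (p - 1)" using p1 by (simp add: a_def field_simps)
 define V where "V x = exp (- g (rhat x) / (p - 1)) * rhat x powr (- a)" for x
 define W where "W x = V x - x powr (- a)" for x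
 \<comment> \<open>This is the differential equation with its variables separated; the exponent fits
   because \<open>a + 1 = (N - 1) / (p - 1)\<close>. Therefore only the term with \<open>g'\<close>
   survives in the derivative of \<open>W\<close>.\<close>
 have key: "exp (- g (rhat x) / (p - 1)) * rhat x powr (- a - 1) * rp x = x powr (- a - 1)" if x: "x > 0" for x
 proof -
  have "rp x = (rp x powr (p - 1)) powr (1 / (p - 1))" using p1 rp_pos[OF x] by (simp add: powr_powr)
  also have "... = exp (g (rhat x) / (p - 1)) * (rhat x / x) powr (a + 1)"
   using x rhat_pos[OF x] unfolding rp_powr[OF x] by (simp add: powr_mult powr_powr a1 exp_powr_real)
  also have "(rhat x / x) powr (a + 1) = rhat x powr (a + 1) * x powr (- a - 1)"
   using x rhat_pos[OF x] powr_minus_divide[of x "a + 1"] by (simp add: powr_divide)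
  finally have r: "rp x = exp (g (rhat x) / (p - 1)) * (rhat x powr (a + 1) * x powr (- a - 1))" .
  have e: "exp (- g (rhat x) / (p - 1)) * exp (g (rhat x) / (p - 1)) = 1" by (simp flip: exp_add)
  have q: "rhat x powr (- a - 1) * rhat x powr (a + 1) = 1" using rhat_pos[OF x] by (simp flip: powr_add)
  have "exp (- g (rhat x) / (p - 1)) * rhat x powr (- a - 1) * rp x
    = (exp (- g (rhat x) / (p - 1)) * exp (g (rhat x) / (p - 1))) * (rhat x powr (- a - 1) * rhat x powr (a + 1)) * x powr (- a - 1)"
   unfolding r by (simp only: mult_ac)
  then show ?thesis unfolding e q by simp
 qed
 have dW: "(W has_real_derivative (- (deriv g (rhat x) * rp x / (p - 1)) * V x)) (at x)" if x: "x > 0" for x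
 proof -
  have dg: "((%x. g (rhat x)) has_real_derivative deriv g (rhat x) * rp x) (at x)"
   by (rule DERIV_chain2[OF g_deriv[OF rhat_pos[OF x]] rhat_deriv[OF x]])
  have de: "((%x. exp (- g (rhat x) / (p - 1))) has_real_derivative exp (- g (rhat x) / (p - 1)) * (- (deriv g (rhat x) * rp x) / (p - 1))) (at x)"
   by (rule DERIV_chain2[OF DERIV_exp]) (rule DERIV_cdivide[OF DERIV_minus[OF dg]])
  have dr: "((%x. rhat x powr (- a)) has_real_derivative (- a) * rhat x powr (- a - 1) * rp x) (at x)"
   by (rule DERIV_chain2[OF has_real_derivative_powr rhat_deriv[OF x]]) (rule rhat_pos[OF x])
  have ds: "((%x. x powr (- a)) has_real_derivative (- a) * x powr (- a - 1)) (at x)"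
   by (rule has_real_derivative_powr[OF x])
  from DERIV_diff[OF DERIV_mult[OF de dr] ds]
  have "(W has_real_derivative exp (- g (rhat x) / (p - 1)) * (- (deriv g (rhat x) * rp x) / (p - 1)) * rhat x powr (- a)
    + (- a) * rhat x powr (- a - 1) * rp x * exp (- g (rhat x) / (p - 1)) - (- a) * x powr (- a - 1)) (at x)"
   unfolding W_def V_def .
  moreover have "exp (- g (rhat x) / (p - 1)) * (- (deriv g (rhat x) * rp x) / (p - 1)) * rhat x powr (- a)
    + (- a) * rhat x powr (- a - 1) * rp x * exp (- g (rhat x) / (p - 1)) - (- a) * x powr (- a - 1)
    = - (deriv g (rhat x) * rp x / (p - 1)) * V x - a * (exp (- g (rhat x) / (p - 1)) * rhat x powr (- a - 1) * rp x - x powr (- a - 1))"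
   by (simp add: V_def algebra_simps)
  ultimately show ?thesis unfolding key[OF x] by simp
 qed
 have dec: "W y <= W s" if "s <= y" for y
 proof (rule DERIV_nonpos_imp_nonincreasing[OF that])
  fix x assume x: "s <= x" "x <= y"
  then have x0: "x > 0" using s by simp
  have "- (deriv g (rhat x) * rp x / (p - 1)) * V x <= 0"
   using g'_nonneg[OF rhat_pos[OF x0]] rp_pos[OF x0] p1 by (auto simp: V_def intro!: mult_nonneg_nonneg divide_nonneg_nonneg)
  then show "\<exists>l. (W has_real_derivative l) (at x) \<and> l <= 0" using dW[OF x0] by blast
 qed
 have lim: "(W \<longlongrightarrow> 0) at_top"
 proof -
  have p0: "((%x::real. x powr (- a)) \<longlongrightarrow> 0) at_top" using a by (intro tendsto_neg_powr filterlim_ident) auto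
  have r0: "((%x. rhat x powr (- a)) \<longlongrightarrow> 0) at_top" using a rhat_top by (intro tendsto_neg_powr) auto
  have "(V \<longlongrightarrow> 0) at_top"
  proof (rule Lim_null_comparison[OF _ r0])
   show "eventually (%x. norm (V x) <= rhat x powr (- a)) at_top"
    using eventually_gt_at_top[of 0]
   proof eventually_elim
    case (elim x)
    have "exp (- g (rhat x) / (p - 1)) <= 1" using gpos[OF rhat_pos[OF elim]] p1 by simp
    then show ?case by (simp add: V_def abs_mult mult_left_le_one_le)
   qed
  qed
  from tendsto_diff[OF this p0] show ?thesis by (simp add: W_def[abs_def])
 qed
 have "0 <= W s"
 proof (rule tendsto_upperbound[OF lim])
  show "eventually (%y. W y <= W s) at_top" by (rule eventually_mono[OF eventually_ge_at_top[of s]]) (rule dec)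
 qed simp
 then have "s powr (- a) <= V s" by (simp add: W_def)
 then have "(s powr (- a)) powr (p - 1) <= V s powr (p - 1)" using p1 by (intro powr_mono2) auto
 moreover have "(s powr (- a)) powr (p - 1) = s powr (- (real N - p))" by (simp add: powr_powr ha)
 moreover have "V s powr (p - 1) = exp (- g (rhat s)) * rhat s powr (- (real N - p))"
  using p1 by (simp add: V_def powr_mult powr_powr ha exp_powr_real)
 ultimately have "s powr (- (real N - p)) <= exp (- g (rhat s)) * rhat s powr (- (real N - p))" by simp
 then have "exp (g (rhat s)) * rhat s powr (real N - p) <= s powr (real N - p)"
  using s rhat_pos[OF s] by (simp only: powr_minus exp_minus) (simp add: field_simps)
 then show ?thesis using s rhat_pos[OF s] by (simp add: powr_divide divide_le_eq)
qed

text \<open>In \<open>rp s powr (p - 1)\<close> the quantity bounded by \<open>rhat_bound\<close>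
  splits off, and \<open>(rhat s / s) powr (p - 1)\<close> remains.\<close>

lemma rp_le: assumes s: "s > 0" shows "rp s <= rhat s / s"
proof -
 have "rp s powr (p - 1) = exp (g (rhat s)) * (rhat s / s) powr (real N - p) * (rhat s / s) powr (p - 1)"
  using s rhat_pos[OF s] unfolding rp_powr[OF s] by (simp flip: powr_add)
 also have "... <= 1 * (rhat s / s) powr (p - 1)" by (intro mult_right_mono rhat_bound[OF s]) simp
 finally have "rp s powr (p - 1) <= (rhat s / s) powr (p - 1)" by simp
 then show ?thesis using p1 rp_pos[OF s] s rhat_pos[OF s] by (meson divide_pos_pos diff_gt_0_iff_gt linorder_not_less powr_less_mono2 order_less_imp_le)
qed

lemma rhat_le: assumes s: "s > 0" shows "rhat s <= s"
proof (rule ccontr)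
 assume "\<not> rhat s <= s"
 then have "1 < (rhat s / s) powr (real N - p)" using s pN by (intro gr_one_powr) auto
 moreover have "1 <= exp (g (rhat s))" using gpos[OF rhat_pos[OF s]] by simp
 ultimately have "1 * 1 < exp (g (rhat s)) * (rhat s / s) powr (real N - p)" by (intro mult_le_less_imp_less) auto
 then show False using rhat_bound[OF s] by simp
qed

lemma rp_le1: "s > 0 ==> rp s <= 1"
 using rp_le[of s] rhat_le[of s] by (simp add: order_trans[of _ "rhat s / s"])

lemma g_rhat_le: assumes s: "s > 0" shows "g (rhat s) <= (real N - p) * (ln s - ln (rhat s))"
proof -
 have "ln (exp (g (rhat s)) * (rhat s / s) powr (real N - p)) <= ln 1"
  using rhat_bound[OF s] s rhat_pos[OF s] by (subst ln_le_cancel_iff) auto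
 then show ?thesis using s rhat_pos[OF s] by (simp add: ln_mult ln_powr ln_div algebra_simps)
qed

lemma rho_eq: assumes s: "s > 0" shows "rho p rhat s = rp s powr p"
proof -
 have "at s within {0..} = at s" using s by (intro at_within_interior) simp
 then show ?thesis using vector_derivative_at[of rhat "rp s" s] rhat_deriv[OF s]
  by (simp add: rho_def has_real_derivative_iff_has_vector_derivative)
qed

end

section \<open>The barrier\<close>

lemma DERIV_glue:
 fixes f1 f2 :: "real => real"
 assumes "(f1 has_real_derivative D) (at c)" "(f2 has_real_derivative D) (at c)" "f1 c = f2 c"
 shows "((%x. if x >= c then f1 x else f2 x) has_real_derivative D) (at c)"
proof -
 let ?f = "%x. if x >= c then f1 x else f2 x"
 have "((%y. (?f y - ?f c) / (y - c)) \<longlongrightarrow> D) (at_right c)"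
 proof (rule Lim_transform_eventually)
  show "((%y. (f1 y - f1 c) / (y - c)) \<longlongrightarrow> D) (at_right c)"
   using assms(1) by (simp add: has_field_derivative_iff filterlim_at_split)
  show "eventually (%y. (f1 y - f1 c) / (y - c) = (?f y - ?f c) / (y - c)) (at_right c)"
   by (auto simp: eventually_at_filter)
 qed
 moreover have "((%y. (?f y - ?f c) / (y - c)) \<longlongrightarrow> D) (at_left c)"
 proof (rule Lim_transform_eventually)
  show "((%y. (f2 y - f2 c) / (y - c)) \<longlongrightarrow> D) (at_left c)"
   using assms(2) by (simp add: has_field_derivative_iff filterlim_at_split)
  show "eventually (%y. (f2 y - f2 c) / (y - c) = (?f y - ?f c) / (y - c)) (at_left c)"
   using assms(3) by (auto simp: eventually_at_filter)
 qed
 ultimately show ?thesis by (simp add: has_field_derivative_iff filterlim_at_split)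
qed

locale barrier = radial +
 fixes r0 :: real
 assumes r0: "0 < r0"
begin

definition \<nu> where "\<nu> = nu0 p g r0"
definition jf where "jf r = (if r >= r0 then J p g r powr (1 / (p - 1)) else I_fun p g r0 r)"
text \<open>This is \<open>r J'(r) / J(r)\<close>. By the growth condition it lies between
  \<open>p - \<alpha>2\<close> and \<open>p\<close>, and its positivity makes the profile
  increasing.\<close>

definition cc where "cc r = p - g r / G g r"
definition djf where "djf r = (if r >= r0 then (1 / (p - 1)) * (jf r / r) * cc r
  else \<nu> * (p / (p - 1)) * (r powr (1 / (p - 1)) * G g r0 powr (- 1 / (p - 1))))"

lemma nu_eq: "\<nu> = cc r0 / p"
 using r0 p1 by (simp add: \<nu>_def nu0_def deriv_G[OF r0] cc_def diff_divide_distrib)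

lemma cc_bounds: assumes "0 < r" shows "p - \<alpha>2 <= cc r" "cc r <= p" "0 < cc r"
proof -
 have "g r / G g r <= \<alpha>2" "0 <= g r / G g r"
  using G_bounds[of r] G_pos[OF assms] gpos[OF assms] assms by (simp_all add: divide_le_eq)
 then show "p - \<alpha>2 <= cc r" "cc r <= p" "0 < cc r" using \<alpha> by (auto simp: cc_def)
qed

lemma nu_pos: "0 < \<nu>" using cc_bounds(3)[OF r0] p1 by (simp add: nu_eq)

lemma J_pos: "0 < r ==> 0 < J p g r" using G_pos[of r] by (simp add: J_def)

lemma J_root_deriv:
 assumes r: "0 < r"
 shows "((%r. J p g r powr (1 / (p - 1))) has_real_derivative (1 / (p - 1)) * (J p g r powr (1 / (p - 1)) / r) * cc r) (at r)"
proof -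
 have dJ: "(J p g has_real_derivative J p g r / r * cc r) (at r)"
 proof -
  have "((%r. r powr p / G g r) has_real_derivative (p * r powr (p - 1) * G g r - r powr p * (g r / r)) / (G g r * G g r)) (at r)"
   by (rule DERIV_divide[OF has_real_derivative_powr[OF r] G_deriv[OF r]]) (use G_pos[OF r] in simp)
  moreover have "(p * r powr (p - 1) * G g r - r powr p * (g r / r)) / (G g r * G g r) = J p g r / r * cc r"
  proof -
   have "r powr p = r * r powr (p - 1)" using r powr_mult_base[of r "p - 1"] by simp
   then show ?thesis using r G_pos[OF r] by (simp add: J_def cc_def field_simps)
  qed
  ultimately show ?thesis by (simp add: J_def[abs_def])
 qed
 have "((%r. J p g r powr (1 / (p - 1))) has_real_derivative (1 / (p - 1)) * J p g r powr (1 / (p - 1) - 1) * (J p g r / r * cc r)) (at r)"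
  by (rule DERIV_chain2[OF has_real_derivative_powr[OF J_pos[OF r]] dJ])
 moreover have "J p g r powr (1 / (p - 1) - 1) * J p g r = J p g r powr (1 / (p - 1))"
  using J_pos[OF r] powr_mult_base[of "J p g r" "1 / (p - 1) - 1"] by (simp add: mult.commute)
 ultimately show ?thesis by (simp add: mult.assoc[symmetric])
qed

lemma I_eq: assumes "0 <= r"
 shows "I_fun p g r0 r = \<nu> * (r powr (p / (p - 1)) * G g r0 powr (- 1 / (p - 1))) + (1 - \<nu>) * J p g r0 powr (1 / (p - 1))"
proof -
 have "(r powr p / G g r0) powr (1 / (p - 1)) = r powr (p / (p - 1)) * G g r0 powr (- 1 / (p - 1))"
  using G_pos[OF r0] assms by (simp add: powr_divide powr_powr powr_minus_divide[of _ "1 / (p - 1)"])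
 then show ?thesis by (simp add: I_fun_def \<nu>_def)
qed

lemma I_deriv: assumes r: "0 < r"
 shows "(I_fun p g r0 has_real_derivative \<nu> * (p / (p - 1)) * (r powr (1 / (p - 1)) * G g r0 powr (- 1 / (p - 1)))) (at r)"
proof -
 have e: "p / (p - 1) - 1 = 1 / (p - 1)" using p1 by (simp add: field_simps)
 have "((%r. \<nu> * (r powr (p / (p - 1)) * G g r0 powr (- 1 / (p - 1))) + (1 - \<nu>) * J p g r0 powr (1 / (p - 1)))
  has_real_derivative \<nu> * ((p / (p - 1) * r powr (p / (p - 1) - 1)) * G g r0 powr (- 1 / (p - 1)))) (at r)"
  using r by (auto intro!: derivative_eq_intros has_real_derivative_powr)
 then have d: "((%r. \<nu> * (r powr (p / (p - 1)) * G g r0 powr (- 1 / (p - 1))) + (1 - \<nu>) * J p g r0 powr (1 / (p - 1)))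
  has_real_derivative \<nu> * (p / (p - 1)) * (r powr (1 / (p - 1)) * G g r0 powr (- 1 / (p - 1)))) (at r)"
  unfolding e by (simp add: mult_ac)
 have "eventually (%x. I_fun p g r0 x = \<nu> * (x powr (p / (p - 1)) * G g r0 powr (- 1 / (p - 1))) + (1 - \<nu>) * J p g r0 powr (1 / (p - 1))) (nhds r)"
  using eventually_nhds_in_open[of "{0<..}" r] r by (auto elim!: eventually_mono simp: I_eq)
 then show ?thesis using d by (simp add: DERIV_cong_ev)
qed

lemma glue_values: "J p g r0 powr (1 / (p - 1)) = r0 powr (p / (p - 1)) * G g r0 powr (- 1 / (p - 1))"
 using G_pos[OF r0] r0 by (simp add: J_def powr_divide powr_powr powr_minus_divide[of _ "1 / (p - 1)"])

lemma jf_deriv: assumes r: "0 < r" shows "(jf has_real_derivative djf r) (at r)"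
proof -
 consider "r > r0" | "r < r0" | "r = r0" by linarith
 then show ?thesis
 proof cases
  case 1
  have "eventually (%x. jf x = J p g x powr (1 / (p - 1))) (nhds r)"
   using eventually_nhds_in_open[of "{r0<..}" r] 1 by (auto elim!: eventually_mono simp: jf_def)
  then show ?thesis using J_root_deriv[OF r] 1 by (simp add: DERIV_cong_ev djf_def jf_def)
 next
  case 2
  have "eventually (%x. jf x = I_fun p g r0 x) (nhds r)"
   using eventually_nhds_in_open[of "{..<r0}" r] 2 by (auto elim!: eventually_mono simp: jf_def)
  then show ?thesis using I_deriv[OF r] 2 by (simp add: DERIV_cong_ev djf_def)
 next
  case 3
  have ex: "r0 powr (p / (p - 1)) = r0 * r0 powr (1 / (p - 1))"
   using powr_mult_base[of r0 "1 / (p - 1)"] r0 p1 by (simp add: field_simps)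
  \<comment> \<open>The value of \<open>\<nu>\<close> enters here: \<open>p * \<nu> = cc r0\<close>
    makes the slopes of the two branches agree at \<open>r0\<close>.\<close>
  have "\<nu> * (p / (p - 1)) * (r0 powr (1 / (p - 1)) * G g r0 powr (- 1 / (p - 1))) = (1 / (p - 1)) * (J p g r0 powr (1 / (p - 1)) / r0) * cc r0"
   using r0 p1 unfolding glue_values ex nu_eq by simp
  then have "(I_fun p g r0 has_real_derivative (1 / (p - 1)) * (J p g r0 powr (1 / (p - 1)) / r0) * cc r0) (at r0)"
   using I_deriv[OF r0] by simp
  moreover have "J p g r0 powr (1 / (p - 1)) = I_fun p g r0 r0"
   using r0 by (simp add: I_eq glue_values algebra_simps)
  ultimately show ?thesis
   using DERIV_glue[OF J_root_deriv[OF r0], of "I_fun p g r0"] 3 by (simp add: jf_def[abs_def] djf_def)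
 qed
qed

lemma jf_pos: assumes "0 <= r" shows "0 < jf r"
proof (cases "r >= r0")
 case True
 then show ?thesis using J_pos[of r] r0 by (simp add: jf_def)
next
 case False
 have "\<nu> < 1" using G_bounds(1)[of r0] G_pos[OF r0] gpos[OF r0] r0 p1 \<alpha> by (simp add: nu_eq cc_def)
 then have "0 < (1 - \<nu>) * J p g r0 powr (1 / (p - 1))" using J_pos[OF r0] by simp
 moreover have "0 <= \<nu> * (r powr (p / (p - 1)) * G g r0 powr (- 1 / (p - 1)))" using nu_pos by simp
 ultimately have "0 < \<nu> * (r powr (p / (p - 1)) * G g r0 powr (- 1 / (p - 1))) + (1 - \<nu>) * J p g r0 powr (1 / (p - 1))"
  by (rule add_nonneg_pos[rotated])
 then show ?thesis using False by (simp add: jf_def I_eq[OF assms])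
qed

lemma djf_pos: assumes r: "0 < r" shows "0 < djf r"
 using cc_bounds(3)[OF r] jf_pos[of r] r p1 nu_pos G_pos[OF r0] by (simp add: djf_def)

lemma jf_cont: "continuous_on {0..} jf"
 unfolding continuous_on_def
proof
 fix x :: real assume x: "x \<in> {0..}"
 show "(jf \<longlongrightarrow> jf x) (at x within {0..})"
 proof (cases "x = 0")
  case True
  have c: "continuous_on {0..} (%r. \<nu> * (r powr (p / (p - 1)) * G g r0 powr (- 1 / (p - 1))) + (1 - \<nu>) * J p g r0 powr (1 / (p - 1)))"
   by (intro continuous_intros continuous_on_powr') (use p1 in auto)
  have v: "jf 0 = \<nu> * (0 powr (p / (p - 1)) * G g r0 powr (- 1 / (p - 1))) + (1 - \<nu>) * J p g r0 powr (1 / (p - 1))"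
   using r0 I_eq[of 0] by (simp add: jf_def)
  have "((%r. \<nu> * (r powr (p / (p - 1)) * G g r0 powr (- 1 / (p - 1))) + (1 - \<nu>) * J p g r0 powr (1 / (p - 1))) \<longlongrightarrow> jf 0) (at 0 within {0..})"
   unfolding v by (rule bspec[OF c[unfolded continuous_on_def], of 0]) simp
  moreover have "eventually (%r. \<nu> * (r powr (p / (p - 1)) * G g r0 powr (- 1 / (p - 1))) + (1 - \<nu>) * J p g r0 powr (1 / (p - 1)) = jf r) (at 0 within {0..})"
  proof -
   have "eventually (%r. r < r0) (at 0 within {0..})"
    using r0 by (intro order_tendstoD(2)[OF tendsto_ident_at])
   moreover have "eventually (%r. r \<in> {0..}) (at 0 within {0..})" by (simp add: eventually_at_filter)
   ultimately show ?thesis by eventually_elim (auto simp: jf_def I_eq)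
  qed
  ultimately show ?thesis unfolding True by (rule Lim_transform_eventually)
 next
  case False
  then have "isCont jf x" using x jf_deriv[of x] DERIV_isCont by fastforce
  then show ?thesis by (simp add: continuous_at_imp_continuous_at_within continuous_within[symmetric])
 qed
qed

lemma jf_less: assumes "0 <= a" "a < b" shows "jf a < jf b"
proof -
 have "\<exists>l z. a < z \<and> z < b \<and> (jf has_real_derivative l) (at z) \<and> jf b - jf a = (b - a) * l"
 proof (rule MVT[OF assms(2)])
  show "continuous_on {a..b} jf" by (rule continuous_on_subset[OF jf_cont]) (use assms in auto)
  show "jf differentiable (at x)" if "a < x" "x < b" for x
   using jf_deriv[of x] that assms real_differentiable_def by force
 qed
 then obtain l z where z: "a < z" "(jf has_real_derivative l) (at z)" "jf b - jf a = (b - a) * l" by blast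
 have "l = djf z" using DERIV_unique[OF z(2) jf_deriv[of z]] z(1) assms by simp
 then have "l > 0" using djf_pos[of z] z(1) assms by simp
 then show ?thesis using z(3) assms by (smt (verit) mult_pos_pos)
qed

lemma jf_le: "0 <= a ==> a <= b ==> jf a <= jf b" using jf_less[of a b] by (cases "a = b") auto

lemma jf_powr: assumes "r0 <= r" shows "jf r powr (p - 1) = r powr p / G g r"
proof -
 have "0 < J p g r" using J_pos[of r] assms r0 by simp
 then show ?thesis using assms p1 by (simp add: jf_def powr_powr) (simp add: J_def)
qed

definition K0 where "K0 = (1 / (p - 1)) powr (p - 1)"

text \<open>The flux of the profile in the variable \<open>r\<close>. The inner branch
  \<open>I_fun\<close> is built from \<open>r^(p/(p-1))\<close>, whose flux is linear in
  \<open>r\<close>.\<close>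

definition bb where "bb r = djf r powr (p - 1)"

lemma bb_outer: assumes r: "r0 <= r" shows "bb r = K0 * (cc r powr (p - 1) * (r / G g r))"
proof -
 have r': "0 < r" using r r0 by simp
 have "bb r = K0 * (jf r powr (p - 1) / r powr (p - 1)) * cc r powr (p - 1)"
  using r r' cc_bounds(3)[OF r'] jf_pos[of r] p1 by (simp add: bb_def djf_def K0_def powr_mult powr_divide)
 also have "jf r powr (p - 1) / r powr (p - 1) = r / G g r"
  unfolding jf_powr[OF r] using r' powr_mult_base[of r "p - 1"] by (simp add: divide_simps)
 finally show ?thesis by simp
qed

definition \<kappa> where "\<kappa> = K0 * (cc r0 powr (p - 1) / G g r0)"

lemma bb_inner: assumes r: "0 < r" "r <= r0" shows "bb r = \<kappa> * r"
proof (cases "r = r0")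
 case True
 then show ?thesis using bb_outer[of r0] by (simp add: \<kappa>_def)
next
 case False
 define c1 where "c1 = 1 / (p - 1)"
 have c1: "c1 > 0" "c1 * (p - 1) = 1" using p1 by (simp_all add: c1_def)
 have x: "(r powr (1 / (p - 1)) * G g r0 powr (- 1 / (p - 1))) powr (p - 1) = r * G g r0 powr (- 1)"
  using r p1 G_pos[OF r0] by (simp add: powr_mult powr_powr)
 have "djf r = \<nu> * (p / (p - 1)) * (r powr (1 / (p - 1)) * G g r0 powr (- 1 / (p - 1)))" using False r by (simp add: djf_def)
 also have "\<nu> * (p / (p - 1)) = c1 * cc r0" using p1 by (simp add: nu_eq c1_def)
 finally have "bb r = (c1 * cc r0 * (r powr (1 / (p - 1)) * G g r0 powr (- 1 / (p - 1)))) powr (p - 1)"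
  by (simp only: bb_def)
 also have "... = (c1 powr (p - 1) * cc r0 powr (p - 1)) * (r powr (1 / (p - 1)) * G g r0 powr (- 1 / (p - 1))) powr (p - 1)"
  using c1(1) cc_bounds(3)[OF r0] by (simp only: powr_mult less_imp_le)
 also have "... = K0 * cc r0 powr (p - 1) * (r * G g r0 powr (- 1))"
  unfolding x by (simp only: K0_def c1_def)
 also have "G g r0 powr (- 1) = 1 / G g r0" using G_pos[OF r0] by (simp add: powr_minus_divide)
 finally show ?thesis by (simp add: \<kappa>_def)
qed

definition dcc where "dcc r = - ((deriv g r * G g r - g r * (g r / r)) / (G g r * G g r))"

lemma cc_deriv: "0 < r ==> (cc has_real_derivative dcc r) (at r)"
proof -
 assume r: "0 < r"
 have "((%r. p - g r / G g r) has_real_derivative 0 - (deriv g r * G g r - g r * (g r / r)) / (G g r * G g r)) (at r)"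
  by (intro DERIV_diff DERIV_const DERIV_divide g_deriv G_deriv r) (use G_pos[OF r] in simp)
 then show ?thesis by (simp add: cc_def[abs_def] dcc_def)
qed

definition dbb where "dbb r = (if r < r0 then \<kappa> else
  K0 * ((p - 1) * cc r powr (p - 2) * dcc r * (r / G g r) + cc r powr (p - 1) * ((1 - g r / G g r) / G g r)))"

lemma bb_deriv: assumes r: "0 < r" "r ~= r0" shows "(bb has_real_derivative dbb r) (at r)"
proof (cases "r < r0")
 case True
 have "eventually (%x. bb x = \<kappa> * x) (nhds r)"
  using eventually_nhds_in_open[of "{0<..<r0}" r] r True by (auto elim!: eventually_mono intro!: bb_inner)
 moreover have "((%x. \<kappa> * x) has_real_derivative \<kappa>) (at r)" by (auto intro!: derivative_eq_intros)
 ultimately show ?thesis using True by (simp add: DERIV_cong_ev dbb_def)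
next
 case False
 have dc: "((%x. cc x powr (p - 1)) has_real_derivative (p - 1) * cc r powr (p - 1 - 1) * dcc r) (at r)"
  by (rule DERIV_chain2[OF has_real_derivative_powr[OF cc_bounds(3)[OF r(1)]] cc_deriv[OF r(1)]])
 have dd: "((%x. x / G g x) has_real_derivative (1 * G g r - r * (g r / r)) / (G g r * G g r)) (at r)"
  by (intro DERIV_divide G_deriv r DERIV_ident) (use G_pos[OF r(1)] in simp)
 have e: "(1 * G g r - r * (g r / r)) / (G g r * G g r) = (1 - g r / G g r) / G g r"
  using G_pos[OF r(1)] r by (simp add: field_simps)
 from DERIV_cmult[OF DERIV_mult[OF dc dd[unfolded e]], of K0]
 have "((%x. K0 * (cc x powr (p - 1) * (x / G g x))) has_real_derivative dbb r) (at r)"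
  using False by (simp add: dbb_def algebra_simps)
 moreover have "eventually (%x. bb x = K0 * (cc x powr (p - 1) * (x / G g x))) (nhds r)"
  using eventually_nhds_in_open[of "{r0<..}" r] r False by (auto elim!: eventually_mono simp: bb_outer)
 ultimately show ?thesis by (simp add: DERIV_cong_ev)
qed

text \<open>The \<open>p\<close>-Laplacian of the profile in \<open>x\<close> is the density times
  \<open>LL (rhat |x|)\<close>; see \<open>aa_has_deriv\<close> and \<open>div_Mv\<close>. The two
  summands after \<open>dbb\<close> come from differentiating \<open>exp g\<close> and the power of
  \<open>rhat\<close> in the equation for \<open>rhat\<close>.\<close>

definition LL where "LL r = dbb r + bb r * (deriv g r + (real N - 1) / r)"

definition A0 where "A0 = K0 * (p powr (p - 1) / G g r0)"

lemma K0_pos: "K0 > 0" using p1 by (simp add: K0_def)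

lemma A0_pos: "A0 > 0" using K0_pos p1 G_pos[OF r0] by (simp add: A0_def)

lemma bb_le: assumes r: "0 < r" shows "bb r <= A0 * r"
proof (cases "r0 <= r")
 case True
 have "cc r powr (p - 1) <= p powr (p - 1)" using cc_bounds[OF r] p1 by (intro powr_mono2) auto
 moreover have "r / G g r <= r / G g r0" using G_mono[of r0 r] True r0 G_pos[OF r0] r by (intro divide_left_mono) auto
 ultimately have "cc r powr (p - 1) * (r / G g r) <= p powr (p - 1) * (r / G g r0)"
  using r G_pos[OF r] by (intro mult_mono) auto
 then have "K0 * (cc r powr (p - 1) * (r / G g r)) <= K0 * (p powr (p - 1) * (r / G g r0))"
  using K0_pos by (intro mult_left_mono) auto
 then show ?thesis unfolding bb_outer[OF True] A0_def by (simp add: mult_ac)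
next
 case False
 have "cc r0 powr (p - 1) <= p powr (p - 1)" using cc_bounds[OF r0] p1 by (intro powr_mono2) auto
 then have "\<kappa> <= A0" unfolding \<kappa>_def A0_def using K0_pos G_pos[OF r0] by (intro mult_left_mono divide_right_mono) auto
 then show ?thesis using bb_inner[of r] False r by (simp add: mult_right_mono)
qed

lemma bb_pos: "0 < r ==> 0 < bb r" using djf_pos[of r] by (simp add: bb_def)

text \<open>Outside \<open>r0\<close> the flux is of size \<open>r / G\<close>, while
  \<open>r g'\<close> and \<open>g\<close> are at most multiples of \<open>G\<close>, so every term
  is bounded by constants over \<open>G g r0\<close>. Inside \<open>r0\<close> the flux is linear in
  \<open>r\<close> and compensates the factor \<open>1 / r\<close>.\<close>

lemma LL_bounded: obtains L0 where "L0 > 0" "!!r. 0 < r ==> r ~= r0 ==> \<bar>LL r\<bar> <= L0"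
proof -
 define G0 where "G0 = G g r0"
 have G0: "G0 > 0" unfolding G0_def by (rule G_pos[OF r0])
 \<comment> \<open>The sum covers both signs of \<open>p - 2\<close>: the power of \<open>cc\<close>
   is largest at the upper end of its range for \<open>p\<close> at least 2 and at the lower end
   otherwise.\<close>
 define c2 where "c2 = (p - \<alpha>2) powr (p - 2) + p powr (p - 2)"
 define D where "D = A0 + K0 * ((p - 1) * c2 * ((\<alpha>2 * \<alpha>2) / G0) + p powr (p - 1) * ((1 + \<alpha>2) / G0))"
 define H where "H = A0 * (\<alpha>2 * g r0 + real N) + K0 * (p powr (p - 1) * (\<alpha>2 * \<alpha>2 + real N / G0))"
 have al2: "\<alpha>2 > 0" using \<alpha> by simp
 have gG: "0 <= g r / G g r" "g r / G g r <= \<alpha>2" if "0 < r" for r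
  using G_bounds[of r] G_pos[OF that] gpos[OF that] that by (simp_all add: divide_le_eq)
 have rg: "0 <= r * deriv g r" "r * deriv g r <= \<alpha>2 * g r" if "0 < r" for r
  using g'_nonneg[OF that] growth[OF that] that by (simp_all add: field_simps)
 have cp: "cc r powr (p - 1) <= p powr (p - 1)" if "0 < r" for r
  using cc_bounds[OF that] p1 by (intro powr_mono2) auto
 have c2: "cc r powr (p - 2) <= c2" if "0 < r" for r
 proof (cases "2 <= p")
  case True
  then have "cc r powr (p - 2) <= p powr (p - 2)" using cc_bounds[OF that] by (intro powr_mono2) auto
  then show ?thesis unfolding c2_def by (simp add: add_increasing)
 next
  case False
  then have "cc r powr (p - 2) <= (p - \<alpha>2) powr (p - 2)" using cc_bounds[OF that] \<alpha> by (intro powr_mono2') auto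
  then show ?thesis unfolding c2_def by (simp add: add_increasing2)
 qed
 have c20: "c2 >= 0" by (simp add: c2_def)
 have Db: "\<bar>dbb r\<bar> <= D" if r: "0 < r" for r
 proof (cases "r < r0")
  case True
  have "bb r <= A0 * r" by (rule bb_le[OF r])
  then have "\<kappa> <= A0" using bb_inner[of r] True r by simp
  moreover have "\<kappa> > 0" using K0_pos cc_bounds(3)[OF r0] G_pos[OF r0] by (simp add: \<kappa>_def)
  moreover have "0 <= K0 * ((p - 1) * c2 * ((\<alpha>2 * \<alpha>2) / G0) + p powr (p - 1) * ((1 + \<alpha>2) / G0))"
   using K0_pos p1 c20 G0 al2 by (intro mult_nonneg_nonneg add_nonneg_nonneg divide_nonneg_nonneg) auto
  ultimately show ?thesis using True by (simp add: dbb_def D_def)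
 next
  case False
  have GG: "G0 <= G g r" unfolding G0_def using G_mono[of r0 r] False r0 by simp
  have Gp: "0 < G g r" by (rule G_pos[OF r])
  have "dcc r * r = (g r / G g r) * (g r / G g r) - (r * deriv g r) / G g r"
   using Gp r by (simp add: dcc_def field_simps)
  moreover have "0 <= (g r / G g r) * (g r / G g r)" using gG[OF r] by (intro mult_nonneg_nonneg)
  moreover have "(g r / G g r) * (g r / G g r) <= \<alpha>2 * \<alpha>2"
   by (rule mult_mono[OF gG(2)[OF r] gG(2)[OF r] less_imp_le[OF al2] gG(1)[OF r]])
  moreover have "0 <= (r * deriv g r) / G g r" "(r * deriv g r) / G g r <= \<alpha>2 * \<alpha>2"
  proof -
   show "0 <= (r * deriv g r) / G g r" using rg[OF r] Gp by simp
   have "(r * deriv g r) / G g r <= \<alpha>2 * (g r / G g r)" using rg[OF r] Gp by (simp add: divide_right_mono)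
   also have "... <= \<alpha>2 * \<alpha>2" using gG[OF r] al2 by (intro mult_left_mono) auto
   finally show "(r * deriv g r) / G g r <= \<alpha>2 * \<alpha>2" .
  qed
  ultimately have dr: "\<bar>dcc r * r\<bar> <= \<alpha>2 * \<alpha>2" by linarith
  have t1: "\<bar>(p - 1) * cc r powr (p - 2) * dcc r * (r / G g r)\<bar> <= (p - 1) * c2 * ((\<alpha>2 * \<alpha>2) / G0)"
  proof -
   have "\<bar>(p - 1) * cc r powr (p - 2) * dcc r * (r / G g r)\<bar> = (p - 1) * cc r powr (p - 2) * (\<bar>dcc r * r\<bar> / G g r)"
    using p1 Gp by (simp add: abs_mult)
   also have "... <= (p - 1) * c2 * ((\<alpha>2 * \<alpha>2) / G0)"
    using p1 c2[OF r] c20 dr GG G0 Gp by (intro mult_mono frac_le) auto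
   finally show ?thesis .
  qed
  have t2: "\<bar>cc r powr (p - 1) * ((1 - g r / G g r) / G g r)\<bar> <= p powr (p - 1) * ((1 + \<alpha>2) / G0)"
  proof -
   have "\<bar>1 - g r / G g r\<bar> <= 1 + \<alpha>2" using gG[OF r] by (simp add: abs_le_iff)
   then have "\<bar>1 - g r / G g r\<bar> / G g r <= (1 + \<alpha>2) / G0" using GG G0 al2 by (intro frac_le) auto
   then have "cc r powr (p - 1) * (\<bar>1 - g r / G g r\<bar> / G g r) <= p powr (p - 1) * ((1 + \<alpha>2) / G0)"
    using cp[OF r] Gp by (intro mult_mono) auto
   then show ?thesis using Gp by (simp add: abs_mult)
  qed
  have "\<bar>dbb r\<bar> = K0 * \<bar>(p - 1) * cc r powr (p - 2) * dcc r * (r / G g r) + cc r powr (p - 1) * ((1 - g r / G g r) / G g r)\<bar>"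
   using False K0_pos by (simp add: dbb_def abs_mult)
  also have "... <= K0 * ((p - 1) * c2 * ((\<alpha>2 * \<alpha>2) / G0) + p powr (p - 1) * ((1 + \<alpha>2) / G0))"
   using t1 t2 K0_pos by (intro mult_left_mono) linarith+
  finally show ?thesis using A0_pos by (simp add: D_def)
 qed
 have Hb: "0 <= bb r * (deriv g r + (real N - 1) / r) \<and> bb r * (deriv g r + (real N - 1) / r) <= H" if r: "0 < r" for r
 proof -
  have eq: "bb r * (deriv g r + (real N - 1) / r) = (bb r / r) * (r * deriv g r + (real N - 1))"
   using r by (simp add: field_simps)
  have N1: "real N - 1 >= 0" using N2 by simp
  have nn: "0 <= (bb r / r) * (r * deriv g r + (real N - 1))"
   using bb_pos[OF r] rg[OF r] N1 r by (intro mult_nonneg_nonneg) auto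
  have P1: "0 <= A0 * (\<alpha>2 * g r0 + real N)" using A0_pos al2 gpos[OF r0] by simp
  have P2: "0 <= K0 * (p powr (p - 1) * (\<alpha>2 * \<alpha>2 + real N / G0))" using K0_pos al2 G0 by simp
  have "(bb r / r) * (r * deriv g r + (real N - 1)) <= H"
  proof (cases "r < r0")
   case True
   have "bb r / r <= A0" using bb_le[OF r] r by (simp add: divide_le_eq)
   moreover have "r * deriv g r + (real N - 1) <= \<alpha>2 * g r0 + real N"
   proof -
    have "g r <= g r0"
    proof (rule DERIV_nonneg_imp_nondecreasing[of r r0 g])
     fix x assume "r <= x" "x <= r0"
     then have "0 < x" using r by simp
     then show "\<exists>y. (g has_real_derivative y) (at x) \<and> 0 <= y" using g_deriv g'_nonneg by blast
    qed (use True in simp)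
    then have "\<alpha>2 * g r <= \<alpha>2 * g r0" using al2 by (intro mult_left_mono) auto
    then show ?thesis using rg[OF r] by linarith
   qed
   ultimately have "(bb r / r) * (r * deriv g r + (real N - 1)) <= A0 * (\<alpha>2 * g r0 + real N)"
    using A0_pos rg[OF r] N1 by (intro mult_mono) auto
   then show ?thesis using P2 by (simp add: H_def)
  next
   case False
   have GG: "G0 <= G g r" unfolding G0_def using G_mono[of r0 r] False r0 by simp
   have Gp: "0 < G g r" by (rule G_pos[OF r])
   have "(bb r / r) * (r * deriv g r + (real N - 1)) = K0 * (cc r powr (p - 1) * ((r * deriv g r) / G g r + (real N - 1) / G g r))"
    using False r Gp by (simp add: bb_outer field_simps)
   also have "... <= K0 * (p powr (p - 1) * (\<alpha>2 * \<alpha>2 + real N / G0))"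
   proof -
    have "(r * deriv g r) / G g r <= \<alpha>2 * (g r / G g r)" using rg[OF r] Gp by (simp add: divide_right_mono)
    also have "... <= \<alpha>2 * \<alpha>2" using gG[OF r] al2 by (intro mult_left_mono) auto
    finally have x1: "(r * deriv g r) / G g r <= \<alpha>2 * \<alpha>2" .
    have x2: "(real N - 1) / G g r <= real N / G0" using GG G0 by (intro frac_le) auto
    show ?thesis using x1 x2 K0_pos cp[OF r] rg[OF r] Gp N1 by (intro mult_left_mono mult_mono add_mono) auto
   qed
   finally show ?thesis using P1 by (simp add: H_def)
  qed
  then show ?thesis using nn unfolding eq by simp
 qed
 have D0: "0 <= D" using Db[OF r0] by linarith
 have H0: "0 <= H" using Hb[OF r0] by linarith
 show ?thesis
 proof (rule that[of "D + H + 1"])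
  show "D + H + 1 > 0" using D0 H0 by simp
  show "\<bar>LL r\<bar> <= D + H + 1" if "0 < r" "r ~= r0" for r
   using Db[OF that(1)] Hb[OF that(1)] unfolding LL_def by linarith
 qed
qed

end

section \<open>The profile and its flux in the original radius\<close>

context barrier
begin

definition yy where "yy s = jf (rhat s)"
definition dy where "dy s = djf (rhat s) * rp s"
text \<open>The radial component of the \<open>p\<close>-Laplacian flux of \<open>yy (|x|)\<close>.
  The value 0 at the centre is its limit there, by \<open>aa_le\<close>.\<close>

definition aa where "aa s = (if s <= 0 then 0 else dy s powr (p - 1))"

lemma yy_deriv: "0 < s ==> (yy has_real_derivative dy s) (at s)"
 unfolding yy_def[abs_def] dy_def by (rule DERIV_chain2[OF jf_deriv[OF rhat_pos] rhat_deriv])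

lemma dy_pos: "0 < s ==> 0 < dy s"
 using djf_pos[OF rhat_pos[of s]] rp_pos[of s] by (simp add: dy_def)

lemma rhat_nonneg: "0 <= s ==> 0 <= rhat s" using rhat_pos[of s] rhat_0 by (cases "s = 0") auto

lemma yy_cont: "continuous_on {0..} yy"
 unfolding yy_def[abs_def] by (rule continuous_on_compose2[OF jf_cont rhat_cont]) (use rhat_nonneg in auto)

lemma aa_eq: assumes s: "0 < s" shows "aa s = rp s powr (p - 1) * bb (rhat s)"
 using s djf_pos[OF rhat_pos[OF s]] rp_pos[OF s] by (simp add: aa_def dy_def bb_def powr_mult mult.commute)

lemma aa_nonneg: "0 <= aa s" by (simp add: aa_def)

lemma aa_le: assumes s: "0 <= s" shows "aa s <= A0 * s"
proof (cases "s = 0")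
 case False
 then have s: "0 < s" using s by simp
 have "rp s powr (p - 1) <= 1" using rp_le1[OF s] rp_pos[OF s] p1 by (intro powr_le1) auto
 moreover have "bb (rhat s) <= A0 * s"
  using bb_le[OF rhat_pos[OF s]] mult_left_mono[OF rhat_le[OF s] less_imp_le[OF A0_pos]] by (rule order_trans)
 ultimately have "rp s powr (p - 1) * bb (rhat s) <= 1 * (A0 * s)" using bb_pos[OF rhat_pos[OF s]] by (intro mult_mono) auto
 then show ?thesis by (simp add: aa_eq[OF s])
qed (simp add: aa_def)

lemma bb_isCont: assumes r: "0 < r" shows "isCont bb r"
proof (cases "r = r0")
 case False
 then show ?thesis using bb_deriv[OF r] DERIV_isCont by blast
next
 case True
 have c1: "continuous_on {r0/2..r0} bb"
 proof (rule continuous_on_eq)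
  show "continuous_on {r0/2..r0} (%r. \<kappa> * r)" by (intro continuous_intros)
  show "\<kappa> * x = bb x" if "x \<in> {r0/2..r0}" for x
   using that r0 by (intro bb_inner[symmetric]) auto
 qed
 have c2: "continuous_on {r0..} bb"
 proof (rule continuous_on_eq)
  have gc': "continuous_on {r0..} g" "continuous_on {r0..} (G g)"
   using r0 by (auto intro: continuous_on_subset[OF gc] continuous_on_subset[OF G_cont])
  have Gn: "G g x ~= 0" if "x \<in> {r0..}" for x using G_pos[of x] that r0 by auto
  have cn: "continuous_on {r0..} cc" unfolding cc_def[abs_def]
   by (intro continuous_on_diff continuous_on_const continuous_on_divide gc') (use Gn in auto)
  show "continuous_on {r0..} (%r. K0 * (cc r powr (p - 1) * (r / G g r)))"
  proof (intro continuous_on_mult continuous_on_const continuous_on_divide continuous_on_id gc' continuous_on_powr cn)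
   show "\<forall>x\<in>{r0..}. G g x ~= 0" using Gn by blast
   show "\<forall>x\<in>{r0..}. cc x ~= 0"
   proof
    fix x assume "x \<in> {r0..}"
    then show "cc x ~= 0" using cc_bounds(3)[of x] r0 by simp
   qed
  qed
  show "K0 * (cc x powr (p - 1) * (x / G g x)) = bb x" if "x \<in> {r0..}" for x using bb_outer[of x] that by simp
 qed
 have "continuous_on ({r0/2..r0} \<union> {r0..}) bb" by (rule continuous_on_closed_Un[OF _ _ c1 c2]) auto
 moreover have "{r0/2..r0} \<union> {r0..} = {r0/2..}" using r0 by auto
 ultimately have "continuous_on {r0/2..} bb" by simp
 then show ?thesis unfolding True
  by (rule continuous_on_interior) (use r0 in auto)
qed

definition daa where "daa s = rp s powr p * LL (rhat s) - (real N - 1) * (aa s / s)"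

text \<open>Here \<open>aa\<close> is \<open>rp^(p-1) * bb(rhat)\<close>, and the equation gives
  \<open>rp^(p-1) = exp (g rhat) (rhat/s)^(N-1)\<close>. Of its logarithmic derivative the part
  \<open>-(N-1)/s\<close> is exactly what a radial divergence adds back. All other terms gain one
  factor \<open>rp\<close> from the chain rule, which completes \<open>rp^p\<close>, the
  density.\<close>

lemma aa_has_deriv: assumes s: "0 < s" "rhat s ~= r0" shows "(aa has_real_derivative daa s) (at s)"
proof -
 define e where "e = real N - 1"
 define h where "h x = exp (g (rhat x)) * (rhat x / x) powr e" for x
 have hp: "h s = rp s powr (p - 1)" using rp_powr[OF s(1)] by (simp add: h_def e_def)
 have rs: "0 < rhat s" by (rule rhat_pos[OF s(1)])
 have dq: "((%x. rhat x / x) has_real_derivative (rp s * s - rhat s * 1) / (s * s)) (at s)"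
  by (intro DERIV_divide rhat_deriv DERIV_ident) (use s in auto)
 have dp: "((%x. (rhat x / x) powr e) has_real_derivative e * (rhat s / s) powr (e - 1) * ((rp s * s - rhat s * 1) / (s * s))) (at s)"
  by (rule DERIV_chain2[OF has_real_derivative_powr dq]) (use rs s in simp)
 have pe: "(rhat s / s) powr (e - 1) * (rhat s / s) = (rhat s / s) powr e"
  using rs s powr_mult_base[of "rhat s / s" "e - 1"] by (simp add: mult.commute)
 have quo: "(rp s * s - rhat s * 1) / (s * s) = (rhat s / s) * (rp s / rhat s - 1 / s)"
  using rs s by (simp add: field_simps)
 have dp': "((%x. (rhat x / x) powr e) has_real_derivative e * (rhat s / s) powr e * (rp s / rhat s - 1 / s)) (at s)"
  using dp unfolding quo by (simp only: pe[symmetric] mult.assoc)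
 have dg: "((%x. exp (g (rhat x))) has_real_derivative exp (g (rhat s)) * (deriv g (rhat s) * rp s)) (at s)"
  by (rule DERIV_chain2[OF DERIV_exp DERIV_chain2[OF g_deriv[OF rs] rhat_deriv[OF s(1)]]])
 have dh: "(h has_real_derivative h s * (deriv g (rhat s) * rp s + e * (rp s / rhat s - 1 / s))) (at s)"
  using DERIV_mult[OF dg dp'] unfolding h_def by (simp add: algebra_simps)
 have db: "((%x. bb (rhat x)) has_real_derivative dbb (rhat s) * rp s) (at s)"
  by (rule DERIV_chain2[OF bb_deriv[OF rs s(2)] rhat_deriv[OF s(1)]])
 have val: "h s * (deriv g (rhat s) * rp s + e * (rp s / rhat s - 1 / s)) * bb (rhat s) + dbb (rhat s) * rp s * h s = daa s"
 proof -
  have rpp: "rp s powr p = rp s powr (p - 1) * rp s" using rp_pos[OF s(1)] powr_mult_base[of "rp s" "p - 1"] by (simp add: mult.commute)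
  show ?thesis unfolding daa_def LL_def aa_eq[OF s(1)] rpp hp e_def[symmetric]
   by (simp only: divide_inverse ring_distribs mult_ac mult_1_left)
 qed
 have "((%x. h x * bb (rhat x)) has_real_derivative daa s) (at s)"
  using DERIV_mult[OF dh db] unfolding val .
 moreover have "eventually (%x. aa x = h x * bb (rhat x)) (nhds s)"
  using eventually_nhds_in_open[of "{0<..}" s] s by (auto elim!: eventually_mono simp: aa_eq rp_powr h_def e_def)
 ultimately show ?thesis by (simp add: DERIV_cong_ev)
qed

lemma aa_cont: "continuous_on {0..} aa"
 unfolding continuous_on_def
proof
 fix x :: real assume x: "x \<in> {0..}"
 show "(aa \<longlongrightarrow> aa x) (at x within {0..})"
 proof (cases "x = 0")
  case True
  have "((%s. A0 * s) \<longlongrightarrow> A0 * 0) (at 0 within {0..})" by (intro tendsto_intros)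
  then have l: "((%s. A0 * s) \<longlongrightarrow> 0) (at 0 within {0..})" by simp
  have "(aa \<longlongrightarrow> 0) (at 0 within {0..})"
   by (rule Lim_null_comparison[OF _ l]) (use aa_le aa_nonneg in "auto simp: eventually_at_filter")
  then show ?thesis using True by (simp add: aa_def)
 next
  case False
  then have s: "0 < x" using x by simp
  have c1: "isCont (%s. bb (rhat s)) x"
   using isCont_o2[of x rhat bb] bb_isCont[OF rhat_pos[OF s]] DERIV_isCont[OF rhat_deriv[OF s]] by blast
  have c2: "isCont (%s. exp (g (rhat s)) * (rhat s / s) powr (real N - 1)) x"
  proof -
   have "isCont rhat x" using DERIV_isCont[OF rhat_deriv[OF s]] .
   moreover have "isCont (%s. g (rhat s)) x"
    using isCont_o2[of x rhat g] \<open>isCont rhat x\<close> DERIV_isCont[OF g_deriv[OF rhat_pos[OF s]]] by blast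
   ultimately show ?thesis using s rhat_pos[OF s] by (intro continuous_intros) auto
  qed
  have "isCont (%s. exp (g (rhat s)) * (rhat s / s) powr (real N - 1) * bb (rhat s)) x" by (rule isCont_mult[OF c2 c1])
  moreover have "eventually (%s. aa s = exp (g (rhat s)) * (rhat s / s) powr (real N - 1) * bb (rhat s)) (nhds x)"
   using eventually_nhds_in_open[of "{0<..}" x] s by (auto elim!: eventually_mono simp: aa_eq rp_powr)
  ultimately have "isCont aa x" by (simp add: isCont_cong)
  then show ?thesis by (simp add: continuous_at_imp_continuous_at_within continuous_within[symmetric])
 qed
qed

lemma rhat_inj: "0 <= a ==> 0 <= b ==> rhat a = rhat b ==> a = b"
 using rhat_less[of a b] rhat_less[of b a] by (cases a b rule: linorder_cases) auto

text \<open>The derivative \<open>daa\<close> is bounded away from the radius where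
  \<open>rhat\<close> equals \<open>r0\<close>. By injectivity of \<open>rhat\<close> there is at
  most one such radius, and \<open>aa\<close> is continuous across it, so the fundamental theorem
  with a finite exceptional set applies.\<close>

lemma aa_lipschitz:
 obtains L where "L >= 0" "!!s t. 0 <= s ==> 0 <= t ==> \<bar>aa s - aa t\<bar> <= L * \<bar>s - t\<bar>"
proof -
 obtain L0 where L0: "L0 > 0" "!!r. 0 < r ==> r ~= r0 ==> \<bar>LL r\<bar> <= L0" using LL_bounded by metis
 define L where "L = L0 + (real N - 1) * A0"
 have N1: "real N - 1 >= 0" using N2 by simp
 have L: "L >= 0" using L0 N1 A0_pos by (simp add: L_def)
 have bound: "\<bar>daa s\<bar> <= L" if s: "0 < s" "rhat s ~= r0" for s
 proof -
  have "rp s powr p <= 1" using rp_le1[OF s(1)] rp_pos[OF s(1)] p1 by (intro powr_le1) auto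
  then have "\<bar>rp s powr p * LL (rhat s)\<bar> <= 1 * L0"
   unfolding abs_mult using L0(2)[OF rhat_pos[OF s(1)] s(2)] by (intro mult_mono) auto
  moreover have "\<bar>(real N - 1) * (aa s / s)\<bar> <= (real N - 1) * A0"
  proof -
   have "aa s / s <= A0" "0 <= aa s / s" using aa_le[of s] aa_nonneg[of s] s by (auto simp: divide_le_eq)
   then have "0 <= (real N - 1) * (aa s / s)" "(real N - 1) * (aa s / s) <= (real N - 1) * A0"
    using mult_nonneg_nonneg[OF N1] mult_left_mono[OF _ N1] by blast+
   then show ?thesis by (simp only: abs_of_nonneg)
  qed
  ultimately show ?thesis unfolding daa_def L_def by linarith
 qed
 have main: "\<bar>aa t - aa s\<bar> <= L * (t - s)" if st: "0 <= s" "s <= t" for s t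
 proof -
  define E where "E = {x. 0 <= x \<and> rhat x = r0}"
  have fE: "finite E"
  proof (cases "E = {}")
   case False
   then obtain x0 where "x0 \<in> E" by blast
   then have "E \<subseteq> {x0}" using rhat_inj by (auto simp: E_def)
   then show ?thesis using finite_subset by blast
  qed simp
  have i: "((%x. if x \<in> insert s (insert t E) then 0 else daa x) has_integral (aa t - aa s)) {s..t}"
  proof (rule fundamental_theorem_of_calculus_interior_strong[of "insert s (insert t E)"])
   show "finite (insert s (insert t E))" using fE by simp
   show "continuous_on {s..t} aa" by (rule continuous_on_subset[OF aa_cont]) (use st in auto)
   fix x assume x: "x \<in> {s<..<t} - insert s (insert t E)"
   then have "0 < x" "rhat x ~= r0" using st by (auto simp: E_def)
   then show "(aa has_vector_derivative (if x \<in> insert s (insert t E) then 0 else daa x)) (at x)"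
    using aa_has_deriv x by (auto simp: has_real_derivative_iff_has_vector_derivative[symmetric])
  qed (use st in auto)
  have "norm (aa t - aa s) <= L * Henstock_Kurzweil_Integration.content {s..t}"
  proof (rule has_integral_bound_real[OF L _ i, of "{}"])
   show "norm (if x \<in> insert s (insert t E) then 0 else daa x) <= L" if "x \<in> {s..t} - {}" for x
    using bound[of x] that st L by (auto simp: E_def)
  qed simp
  then show ?thesis using st by simp
 qed
 show ?thesis
 proof (rule that[OF L])
  fix s t :: real assume "0 <= s" "0 <= t"
  then show "\<bar>aa s - aa t\<bar> <= L * \<bar>s - t\<bar>"
   using main[of s t] main[of t s] by (cases "s <= t") (auto simp: abs_minus_commute)
 qed
qed

lemma dy_le: assumes "0 < s" "s <= S" shows "dy s <= (A0 * S) powr (1 / (p - 1))"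
proof -
 have "dy s = (dy s powr (p - 1)) powr (1 / (p - 1))" using dy_pos[OF assms(1)] p1 by (simp add: powr_powr)
 also have "... = aa s powr (1 / (p - 1))" using assms by (simp add: aa_def)
 also have "... <= (A0 * S) powr (1 / (p - 1))"
 proof (rule powr_mono2)
  show "aa s <= A0 * S" using order_trans[OF aa_le[of s] mult_left_mono[OF assms(2) less_imp_le[OF A0_pos]]] assms by simp
 qed (use p1 aa_nonneg in auto)
 finally show ?thesis .
qed

lemma yy_diff: assumes "0 <= s" "s < t" shows "\<exists>z. s < z \<and> z < t \<and> yy t - yy s = (t - s) * dy z"
proof -
 have "\<exists>l z. s < z \<and> z < t \<and> (yy has_real_derivative l) (at z) \<and> yy t - yy s = (t - s) * l"
 proof (rule MVT[OF assms(2)])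
  show "continuous_on {s..t} yy" by (rule continuous_on_subset[OF yy_cont]) (use assms in auto)
  show "yy differentiable (at x)" if "s < x" "x < t" for x
   using yy_deriv[of x] that assms real_differentiable_def by force
 qed
 then obtain l z where z: "s < z" "z < t" "(yy has_real_derivative l) (at z)" "yy t - yy s = (t - s) * l" by blast
 have "l = dy z" using DERIV_unique[OF z(3) yy_deriv[of z]] z(1) assms by simp
 then show ?thesis using z by blast
qed

lemma yy_lipschitz: assumes "0 <= s" "s <= S" "0 <= t" "t <= S"
 shows "\<bar>yy s - yy t\<bar> <= (A0 * S) powr (1 / (p - 1)) * \<bar>s - t\<bar>"
proof -
 have m: "\<bar>yy t - yy s\<bar> <= (A0 * S) powr (1 / (p - 1)) * (t - s)" if st: "0 <= s" "s < t" "t <= S" for s t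
 proof -
  obtain z where z: "s < z" "z < t" "yy t - yy s = (t - s) * dy z" using yy_diff[OF st(1,2)] by blast
  have "0 <= dy z" "dy z <= (A0 * S) powr (1 / (p - 1))" using dy_pos[of z] dy_le[of z S] z st by auto
  then show ?thesis using z st by (simp add: abs_mult mult.commute mult_left_mono)
 qed
 show ?thesis using m[of s t] m[of t s] assms by (cases s t rule: linorder_cases) (auto simp: abs_minus_commute)
qed

lemma yy_le: "0 <= s ==> s <= t ==> yy s <= yy t"
 unfolding yy_def by (intro jf_le rhat_mono rhat_nonneg)

end

text \<open>\<open>R0_eq\<close> places the initial front at \<open>R0\<close>, and
  \<open>half\<close> keeps the inner branch below half the height of the barrier profile.
  \<open>cond_C\<close> makes the divergence term at most half of the decay term of order
  \<open>Z\<close>. \<open>cond_1\<close> (large \<open>t0\<close>) and \<open>cond_2\<close> (small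
  \<open>\<Gamma>\<close>) control the motion of the front far below it and close to it,
  respectively.\<close>

locale full = barrier +
 fixes Cs t0 \<Gamma> R0 L0 :: real
 assumes Cs: "0 < Cs" and t0: "1 < t0" and \<Gamma>: "0 < \<Gamma>" and R0: "r0 < R0" and R0_eq: "\<Gamma> * ln t0 = G g R0"
  and half: "jf r0 <= jf R0 / 2"
  and LL: "!!r. 0 < r ==> r ~= r0 ==> \<bar>LL r\<bar> <= L0"
  and cond_C: "Cs powr (p + m - 2) * ((p - 1) / (p + m - 3)) powr (p - 1) * L0 <= Cs * (1 / (p + m - 3)) / 2"
  and cond_1: "max ((p - 1) / (p + m - 3)) 2 * (p / ((p - 1) * \<alpha>1)) / ln t0 <= (1 / (p + m - 3)) / 4"
  and cond_2: "Cs * \<Gamma> * (p / ((p - 1) * \<alpha>1)) <= Cs powr (p + m - 2) * ((p - 1) / (p + m - 3)) powr (p - 1) * ((p - \<alpha>2) / (2 * (p - 1))) powr p"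
begin

definition k where "k = 1 / (p + m - 3)"
definition q where "q = (p - 1) / (p + m - 3)"
text \<open>The constant in \<open>Z * Psi' <= Q * Psi\<close>, valid for every regularisation
  parameter; for the exact power \<open>Z^q\<close> it would be \<open>q\<close>.\<close>

definition Q where "Q = max q 2"
definition B where "B = Cs powr (p + m - 2) * q powr (p - 1)"
text \<open>The radius, in the variable \<open>r\<close>, at which the barrier vanishes. As it
  exceeds \<open>r0\<close>, the function \<open>ee\<close> below is \<open>E^(1/(p-1))\<close>, and
  \<open>de\<close> is its time derivative.\<close>

definition RR where "RR t = G_inv g (\<Gamma> * ln (t + t0))"
definition ee where "ee t = jf (RR t)"
definition de where "de t = djf (RR t) * (RR t / g (RR t)) * (\<Gamma> / (t + t0))"

lemma k_pos: "0 < k" and q_pos: "0 < q" and Q_ge: "2 <= Q" "q <= Q" and B_pos: "0 < B" and q_k: "q = (p - 1) * k"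
 using pm p1 Cs by (simp_all add: k_def q_def Q_def B_def)

lemma tau_ge: assumes "0 <= t" shows "G g R0 <= \<Gamma> * ln (t + t0)" "0 < \<Gamma> * ln (t + t0)"
proof -
 have "ln t0 <= ln (t + t0)" using assms t0 by simp
 then show "G g R0 <= \<Gamma> * ln (t + t0)" unfolding R0_eq[symmetric] using \<Gamma> by (intro mult_left_mono) auto
 then show "0 < \<Gamma> * ln (t + t0)" using G_pos[of R0] R0 r0 by linarith
qed

lemma RR_ge: assumes "0 <= t" shows "R0 <= RR t"
proof -
 have "G_inv g (G g R0) <= RR t" unfolding RR_def
  using tau_ge[OF assms] G_pos[of R0] R0 r0 by (intro G_inv_mono) auto
 then show ?thesis using G_inv_G[of R0] R0 r0 by simp
qed

lemma RR_gt: "0 <= t ==> r0 < RR t" "0 <= t ==> 0 < RR t" using RR_ge[of t] R0 r0 by auto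

lemma G_RR: "0 <= t ==> G g (RR t) = \<Gamma> * ln (t + t0)"
 unfolding RR_def by (rule G_G_inv(1)) (use tau_ge(2)[of t] in simp)

lemma ee_deriv: assumes t: "0 <= t" shows "(ee has_real_derivative de t) (at t)"
proof -
 have "((%t. \<Gamma> * ln (t + t0)) has_real_derivative \<Gamma> * (1 / (t + t0))) (at t)"
  using t t0 by (auto intro!: derivative_eq_intros)
 from DERIV_chain2[OF G_inv_deriv[OF tau_ge(2)[OF t]] this]
 have "(RR has_real_derivative RR t / g (RR t) * (\<Gamma> * (1 / (t + t0)))) (at t)" unfolding RR_def .
 from DERIV_chain2[OF jf_deriv[OF RR_gt(2)[OF t]] this]
 show ?thesis unfolding ee_def[abs_def] de_def by (simp add: mult_ac)
qed

lemma de_pos: assumes t: "0 <= t" shows "0 < de t"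
 using djf_pos[OF RR_gt(2)[OF t]] RR_gt(2)[OF t] gpos[OF RR_gt(2)[OF t]] \<Gamma> t t0 by (simp add: de_def)

lemma ee_mono: assumes "0 <= s" "s <= t" shows "ee s <= ee t"
proof -
 have "RR s <= RR t" unfolding RR_def
  using assms tau_ge(2)[of s] \<Gamma> t0 by (intro G_inv_mono mult_left_mono) auto
 then show ?thesis unfolding ee_def using RR_gt(2)[OF assms(1)] by (intro jf_le) auto
qed

text \<open>Divided by the density and by \<open>(t + t0)^(-1-k)\<close>, the subsolution inequality
  for \<open>Z^q\<close> reads \<open>q X <= Z Y\<close>, with
  \<open>X = Cs (t + t0) ee' - B jf'^p\<close> and \<open>Y = Cs k - B LL\<close>. It is proved with
  the larger factor \<open>Q\<close>, as required by the regularised power.\<close>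

lemma key_inequality:
 assumes t: "0 <= t" and r: "0 < r" "r ~= r0" and lt: "jf r < ee t"
 shows "0 <= Cs * k - B * LL r"
  "Q * (Cs * ((t + t0) * de t) - B * djf r powr p) <= (ee t - jf r) * (Cs * k - B * LL r)" (is ?c1)
proof -
 define R where "R = RR t"
 have R: "r0 < R" "0 < R" "R0 <= R" using RR_gt[OF t] RR_ge[OF t] by (auto simp: R_def)
 have jR: "0 < jf R" using jf_pos[of R] R by simp
 have GR: "G g R = \<Gamma> * ln (t + t0)" using G_RR[OF t] by (simp add: R_def)
 have GRp: "0 < G g R" by (rule G_pos[OF R(2)])
 have lnp: "0 < ln (t + t0)" "0 < ln t0" "ln t0 <= ln (t + t0)" using t t0 by auto
 have BL: "B * LL r <= Cs * k / 2"
 proof -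
  have "B * LL r <= B * L0" using LL[OF r] B_pos by (intro mult_left_mono) auto
  also have "... <= Cs * k / 2" using cond_C by (simp add: B_def q_def k_def)
  finally show ?thesis .
 qed
 have Ck: "0 < Cs * k" using Cs k_pos by simp
 have Y: "Cs * k / 2 <= Cs * k - B * LL r" using BL by (simp add: field_simps)
 then show Y0: "0 <= Cs * k - B * LL r" using Ck by linarith
 have djR: "djf R <= (p / (p - 1)) * (jf R / R)"
 proof -
  have "djf R = (1 / (p - 1)) * (jf R / R) * cc R" using R by (simp add: djf_def)
  also have "... <= (1 / (p - 1)) * (jf R / R) * p" using cc_bounds(2)[OF R(2)] jR R p1 by (intro mult_left_mono) auto
  finally show ?thesis by (simp add: mult_ac)
 qed
 \<comment> \<open>The scaled velocity is \<open>\<Gamma> jf'(R) R / g(R)\<close>. Inserting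
   \<open>jf' <= p/(p-1) * jf / R\<close> and \<open>g >= \<alpha>1 G\<close> gives the quantity
   \<open>jf R / G R\<close>, in which both regions are measured.\<close>
 have e1: "(t + t0) * de t <= \<Gamma> * (p / ((p - 1) * \<alpha>1)) * (jf R / G g R)"
 proof -
  have gR: "0 < g R" by (rule gpos[OF R(2)])
  have "(t + t0) * de t = \<Gamma> * (djf R * (R / g R))" using t t0 by (simp add: de_def R_def)
  also have "... <= \<Gamma> * ((p / (p - 1)) * (jf R / (\<alpha>1 * G g R)))"
  proof (rule mult_left_mono)
   have "djf R * (R / g R) <= (p / (p - 1)) * (jf R / R) * (R / g R)" using djR R gR by (intro mult_right_mono) auto
   also have "... = (p / (p - 1)) * (jf R / g R)" using R by simp
   also have "... <= (p / (p - 1)) * (jf R / (\<alpha>1 * G g R))"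
   proof (rule mult_left_mono)
    show "jf R / g R <= jf R / (\<alpha>1 * G g R)" using G_bounds(1)[of R] GRp \<alpha> jR R gR by (intro divide_left_mono) auto
   qed (use p1 in simp)
   finally show "djf R * (R / g R) <= (p / (p - 1)) * (jf R / (\<alpha>1 * G g R))" .
  qed (use \<Gamma> in simp)
  finally have "(t + t0) * de t <= \<Gamma> * ((p / (p - 1)) * (jf R / (\<alpha>1 * G g R)))" .
  then show ?thesis by (simp add: mult_ac)
 qed
 have ee: "ee t = jf R" by (simp add: ee_def R_def)
 have Z: "0 < jf R - jf r" using lt ee by simp
 have Qp: "0 < Q" using Q_ge by simp
 show ?c1
 proof (cases "jf r <= jf R / 2")
  \<comment> \<open>Far below the front \<open>Z\<close> is at least half of \<open>jf R\<close>.
    Since \<open>G R = \<Gamma> ln (t + t0)\<close>, the velocity term carries a factor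
    \<open>1 / ln t0\<close>, and \<open>cond_1\<close> lets half of the decay term absorb
    it.\<close>
  case True
  have "Q * (Cs * ((t + t0) * de t) - B * djf r powr p) <= Q * (Cs * ((t + t0) * de t))"
   using Qp B_pos by (intro mult_left_mono) auto
  also have "... <= Q * (Cs * (\<Gamma> * (p / ((p - 1) * \<alpha>1)) * (jf R / G g R)))"
   using e1 Qp Cs by (intro mult_left_mono) auto
  also have "... = Cs * jf R * (Q * (p / ((p - 1) * \<alpha>1)) / ln (t + t0))"
   unfolding GR using \<Gamma> by (simp add: mult_ac)
  also have "... <= Cs * jf R * (Q * (p / ((p - 1) * \<alpha>1)) / ln t0)"
   using Cs jR Qp p1 \<alpha> lnp by (intro mult_left_mono divide_left_mono mult_nonneg_nonneg divide_nonneg_nonneg) auto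
  also have "... <= Cs * jf R * (k / 4)"
   using cond_1 Cs jR by (intro mult_left_mono) (auto simp: Q_def q_def k_def)
  also have "... = (jf R / 2) * (Cs * k / 2)" by simp
  also have "... <= (ee t - jf r) * (Cs * k - B * LL r)"
   using True Y Ck jR unfolding ee by (intro mult_mono) auto
  finally show ?thesis .
 next
  \<comment> \<open>Near the front the assumption \<open>half\<close> excludes
    \<open>r < r0\<close>. Monotonicity gives \<open>r <= R\<close>, so \<open>jf'(r)\<close> is at
    least a multiple of \<open>jf R / R\<close>, whose \<open>p\<close>-th power is
    \<open>jf R / G R\<close>. This matches the velocity term, and \<open>cond_2\<close> gives
    \<open>X <= 0\<close>.\<close>
  case False
  have rr0: "r0 <= r"
  proof (rule ccontr)
   assume "\<not> r0 <= r"
   then have "jf r <= jf r0" using jf_le[of r r0] r by simp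
   moreover have "jf R0 <= jf R" using jf_le[of R0 R] R R0 r0 by simp
   ultimately show False using half False by linarith
  qed
  have rR: "r <= R"
  proof (rule ccontr)
   assume "\<not> r <= R"
   then have "jf R <= jf r" using jf_le[of R r] R by simp
   then show False using Z by simp
  qed
  have low: "((p - \<alpha>2) / (2 * (p - 1))) * (jf R / R) <= djf r"
  proof -
   have "((p - \<alpha>2) / (2 * (p - 1))) * (jf R / R) = (1 / (p - 1)) * ((jf R / 2) / R) * (p - \<alpha>2)" using p1 by (simp add: field_simps)
   also have "... <= (1 / (p - 1)) * (jf r / r) * cc r"
   proof (intro mult_mono)
    show "(jf R / 2) / R <= jf r / r" using False r rR jR by (intro frac_le) auto
    show "p - \<alpha>2 <= cc r" by (rule cc_bounds(1)[OF r(1)])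
   qed (use p1 \<alpha> jf_pos[of r] jR R r in auto)
   also have "... = djf r" using rr0 by (simp only: djf_def if_True)
   finally show ?thesis .
  qed
  have jpow: "(jf R / R) powr p = jf R / G g R"
  proof -
   have "jf R powr p = jf R * jf R powr (p - 1)" using jR powr_mult_base[of "jf R" "p - 1"] by simp
   also have "... = jf R * (R powr p / G g R)" using jf_powr[of R] R by simp
   finally show ?thesis using R jR by (simp add: powr_divide)
  qed
  have "((p - \<alpha>2) / (2 * (p - 1))) powr p * (jf R / G g R) <= djf r powr p"
  proof -
   have "(((p - \<alpha>2) / (2 * (p - 1))) * (jf R / R)) powr p <= djf r powr p"
    by (rule powr_mono2[OF _ _ low]) (use p1 \<alpha> jR R in "auto intro!: mult_nonneg_nonneg divide_nonneg_nonneg")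
   moreover have "(((p - \<alpha>2) / (2 * (p - 1))) * (jf R / R)) powr p = ((p - \<alpha>2) / (2 * (p - 1))) powr p * (jf R / R) powr p"
    by (rule powr_mult)
   ultimately show ?thesis by (simp only: jpow)
  qed
  then have "B * (((p - \<alpha>2) / (2 * (p - 1))) powr p * (jf R / G g R)) <= B * djf r powr p"
   using B_pos by (intro mult_left_mono) auto
  moreover have "Cs * ((t + t0) * de t) <= Cs * (\<Gamma> * (p / ((p - 1) * \<alpha>1)) * (jf R / G g R))"
   using e1 Cs by (intro mult_left_mono) auto
  moreover have "(Cs * \<Gamma> * (p / ((p - 1) * \<alpha>1))) * (jf R / G g R) <= (B * ((p - \<alpha>2) / (2 * (p - 1))) powr p) * (jf R / G g R)"
   using cond_2 jR GRp by (intro mult_right_mono) (auto simp: B_def q_def)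
  ultimately have "Cs * ((t + t0) * de t) - B * djf r powr p <= 0" by (simp add: mult_ac)
  then have "Q * (Cs * ((t + t0) * de t) - B * djf r powr p) <= 0" using Qp by (intro mult_nonneg_nonpos) auto
  also have "0 <= (ee t - jf r) * (Cs * k - B * LL r)" using Z Y0 ee by (intro mult_nonneg_nonneg) auto
  finally show ?thesis .
 qed
qed

lemma u_tilde_eq: assumes t: "0 <= t"
 shows "u_tilde p m g Cs t0 r0 \<Gamma> r t = Cs / (t + t0) powr k * max 0 (ee t - jf r) powr q"
proof -
 have "E p g (\<Gamma> * ln (t + t0)) powr (1 / (p - 1)) = ee t"
  using RR_gt(1)[OF t] by (simp add: E_def ee_def jf_def RR_def)
 then show ?thesis by (simp add: u_tilde_def Let_def jf_def k_def q_def)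
qed

end

section \<open>Lipschitz criteria, cut-offs and a regularised power\<close>

lemma lipschitz_of_deriv:
 fixes f :: "real => real"
 assumes d: "!!x. a <= x ==> x <= b ==> (f has_real_derivative f' x) (at x)" and c: "continuous_on {a..b} f'"
 shows "\<exists>L\<ge>0. \<forall>x\<in>{a..b}. \<forall>y\<in>{a..b}. \<bar>f x - f y\<bar> <= L * \<bar>x - y\<bar>"
proof -
 have "bounded (f' ` {a..b})" by (rule compact_imp_bounded[OF compact_continuous_image[OF c]]) simp
 then obtain L where L: "!!x. x \<in> {a..b} ==> norm (f' x) <= L" unfolding bounded_iff by blast
 show ?thesis
 proof (intro exI[of _ "max L 0"] conjI ballI)
  fix x y assume xy: "x \<in> {a..b}" "y \<in> {a..b}"
  have "norm (f x - f y) <= max L 0 * norm (x - y)"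
  proof (rule field_differentiable_bound[of "{a..b}" f f'])
   show "(f has_real_derivative f' z) (at z within {a..b})" if "z \<in> {a..b}" for z
    using d[of z] that by (auto intro: has_field_derivative_at_within)
   show "norm (f' z) <= max L 0" if "z \<in> {a..b}" for z using L[OF that] by simp
  qed (use xy in auto)
  then show "\<bar>f x - f y\<bar> <= max L 0 * \<bar>x - y\<bar>" by simp
 qed simp
qed

lemma LD_lip:
 fixes a :: "'a::euclidean_space \<times> real => real"
 assumes b: "b \<in> Basis"
  and lip: "!!r t1 t2. 0 < t1 ==> \<exists>L. \<forall>z\<in>Bx r t1 t2. \<forall>w\<in>Bx r t1 t2. \<bar>a z - a w\<bar> <= L * norm (z - w)"
 shows "LD b a"
 unfolding LD_def
proof (intro allI impI)
 fix r t1 t2 :: real assume t1: "0 < t1"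
 let ?B = "Bx r t1 t2 :: ('a \<times> real) set"
 obtain L0 where L0: "!!z w. z \<in> ?B ==> w \<in> ?B ==> \<bar>a z - a w\<bar> <= L0 * norm (z - w)" using lip[OF t1] by blast
 have L: "\<bar>a z - a w\<bar> <= \<bar>L0\<bar> * norm (z - w)" if "z \<in> ?B" "w \<in> ?B" for z w
  by (rule order_trans[OF L0[OF that]]) (intro mult_right_mono, auto)
 show "\<exists>M. \<forall>z\<in>?B. \<bar>a z\<bar> <= M \<and> (\<forall>t. z + t *. b \<in> ?B --> \<bar>a (z + t *. b) - a z\<bar> <= M * \<bar>t\<bar>)"
 proof (cases "?B = {}")
  case False
  then obtain w where w: "w \<in> ?B" by blast
  show ?thesis
  proof (intro exI[of _ "\<bar>a w\<bar> + \<bar>L0\<bar> * (2 * (r + t2)) + \<bar>L0\<bar>"] ballI conjI allI impI)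
   have w2: "norm w <= r + t2" using norm_Bx[OF w] t1 by simp
   then have rt: "0 <= r + t2" using norm_ge_zero[of w] by linarith
   fix z assume z: "z \<in> ?B"
   have "norm (z - w) <= 2 * (r + t2)" using norm_triangle_ineq4[of z w] w2 norm_Bx[OF z] t1 by simp
   then have "\<bar>L0\<bar> * norm (z - w) <= \<bar>L0\<bar> * (2 * (r + t2))" by (intro mult_left_mono) auto
   then show "\<bar>a z\<bar> <= \<bar>a w\<bar> + \<bar>L0\<bar> * (2 * (r + t2)) + \<bar>L0\<bar>" using L[OF z w] by linarith
   fix t assume zt: "z + t *. b \<in> ?B"
   have "\<bar>a (z + t *. b) - a z\<bar> <= \<bar>L0\<bar> * \<bar>t\<bar>" using L[OF zt z] b by (simp add: norm_Basis)
   also have "... <= (\<bar>a w\<bar> + \<bar>L0\<bar> * (2 * (r + t2)) + \<bar>L0\<bar>) * \<bar>t\<bar>" using rt by (intro mult_right_mono) auto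
   finally show "\<bar>a (z + t *. b) - a z\<bar> <= (\<bar>a w\<bar> + \<bar>L0\<bar> * (2 * (r + t2)) + \<bar>L0\<bar>) * \<bar>t\<bar>" .
  qed
 qed simp
qed

lemma LD_time:
 fixes h :: "real => real"
 assumes b: "b \<in> Basis" and d: "!!t. 0 < t ==> (h has_real_derivative h' t) (at t)" and c: "continuous_on {0<..} h'"
 shows "LD b (%z :: 'a::euclidean_space \<times> real. h (snd z))"
proof (rule LD_lip[OF b])
 fix r t1 t2 :: real assume t1: "0 < t1"
 have "\<exists>L\<ge>0. \<forall>x\<in>{t1..t2}. \<forall>y\<in>{t1..t2}. \<bar>h x - h y\<bar> <= L * \<bar>x - y\<bar>"
  by (rule lipschitz_of_deriv[of _ _ h h']) (use d t1 in "auto intro!: continuous_on_subset[OF c]")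
 then obtain L where L: "L >= 0" "!!x y. x \<in> {t1..t2} ==> y \<in> {t1..t2} ==> \<bar>h x - h y\<bar> <= L * \<bar>x - y\<bar>" by blast
 show "\<exists>L. \<forall>z\<in>Bx r t1 t2. \<forall>w\<in>Bx r t1 t2. \<bar>h (snd z) - h (snd w)\<bar> <= L * norm (z - w :: 'a \<times> real)"
 proof (intro exI ballI)
  fix z w :: "'a \<times> real" assume zw: "z \<in> Bx r t1 t2" "w \<in> Bx r t1 t2"
  have "\<bar>h (snd z) - h (snd w)\<bar> <= L * \<bar>snd z - snd w\<bar>" using zw by (intro L) (auto simp: mem_Bx)
  also have "... <= L * norm (z - w)" using L(1) norm_snd'[of "z - w"] by (intro mult_left_mono) auto
  finally show "\<bar>h (snd z) - h (snd w)\<bar> <= L * norm (z - w)" .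
 qed
qed

lemma loc_int_bounded:
 fixes F :: "'a::euclidean_space \<times> real => 'c::euclidean_space"
 assumes m: "set_borel_measurable lborel S_infty F"
  and b: "!!r t1 t2. 0 < t1 ==> \<exists>M. \<forall>z\<in>Bx r t1 t2. norm (F z) <= M"
 shows "locally_integrable F"
 unfolding locally_integrable_def
proof (intro allI impI)
 fix K :: "('a \<times> real) set" assume K: "compact K \<and> K \<subseteq> S_infty"
 obtain r t1 t2 where B: "0 < t1" "K \<subseteq> Bx r t1 t2" using compact_in_Bx[of K] K by metis
 obtain M where M: "!!z. z \<in> Bx r t1 t2 ==> norm (F z) <= M" using b[OF B(1)] by blast
 have Ks: "K \<in> sets borel" using K compact_imp_closed borel_closed by blast
 have [measurable]: "(%z. indicator S_infty z *. F z) \<in> meas"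
  using m by (simp add: set_borel_measurable_def)
 have eq: "indicator K z *. F z = indicator K z *. (indicator S_infty z *. F z)" for z
  using K by (auto simp: indicator_def)
 have [measurable]: "(%z. indicator K z *. F z) \<in> borel_measurable lborel" unfolding eq using Ks by measurable
 show "set_integrable lborel K F" unfolding set_integrable_def
 proof (rule integrableI_bounded_set[of K])
  show "emeasure lborel K < \<infinity>" using K emeasure_compact_finite by blast
  show "AE x in lborel. x \<in> K --> norm (indicator K x *. F x) <= M"
  proof (intro AE_I2 impI)
   fix x assume "x \<in> K"
   then show "norm (indicator K x *. F x) <= M" using M[of x] B(2) by auto
  qed
 qed (use Ks in auto)
qed

lemma test_cutoff_exists:
 fixes r t1 t2 :: real
 assumes t1: "0 < t1"
 obtains \<eta> :: "'a::euclidean_space \<times> real => real"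
 where "test_fun \<eta>" "!!z. 0 <= \<eta> z" "!!z. z \<in> Bx r t1 t2 ==> \<eta> z = 1"
proof -
 obtain S S' :: "real => real" where S: "smooth S" "smooth S'" "!!x. (S has_real_derivative S' x) (at x)" "!!x. S' x >= 0"
  "!!x. x <= 0 ==> S x = 0" "!!x. x >= 1 ==> S x = 1"
  "!!x. 0 <= S x" "!!x. S x <= 1" "!!x. x <= 0 \<or> x >= 1 ==> S' x = 0"
  using smooth_step_exists by metis
 define \<eta> :: "'a \<times> real => real" where
  "\<eta> z = S (r\<^sup>2 + 1 - (norm (fst z))\<^sup>2) * (S ((2 / t1) * snd z - 1) * S (t2 + 1 - snd z))" for z
 have lin: "smooth (%z :: 'a \<times> real. snd z)" by (rule smooth_linear) (rule bounded_linear_snd)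
 have sm: "smooth \<eta>" unfolding \<eta>_def
  by (rule smooth_mult[OF smooth_compose_real[OF smooth_diff[OF smooth_const smooth_norm_fst_sq] S(1)]
   smooth_mult[OF smooth_compose_real[OF smooth_diff[OF smooth_mult[OF smooth_const lin] smooth_const] S(1)]
    smooth_compose_real[OF smooth_diff[OF smooth_const lin] S(1)]]])
 show ?thesis
 proof
  show "test_fun \<eta>"
  proof (rule test_funI[OF sm, of "t1 / 2" "\<bar>r\<bar> + 1" "t2 + 1"])
   fix z assume nz: "\<eta> z ~= 0"
   have Sp: "0 < x" if "S x ~= 0" for x using S(5)[of x] that by (cases "x <= 0") auto
   have a: "0 < r\<^sup>2 + 1 - (norm (fst z))\<^sup>2" and b: "0 < (2 / t1) * snd z - 1" and c: "0 < t2 + 1 - snd z"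
    using nz Sp[of "r\<^sup>2 + 1 - (norm (fst z))\<^sup>2"] Sp[of "(2 / t1) * snd z - 1"] Sp[of "t2 + 1 - snd z"]
    unfolding \<eta>_def by auto
   have "(norm (fst z))\<^sup>2 <= (\<bar>r\<bar> + 1)\<^sup>2" using a by (simp add: power2_sum)
   then have "norm (fst z) <= \<bar>r\<bar> + 1" by (rule power2_le_imp_le) simp
   then show "z \<in> Bx (\<bar>r\<bar> + 1) (t1 / 2) (t2 + 1)" using b c t1 by (simp add: mem_Bx field_simps)
  qed (use t1 in simp)
  show "0 <= \<eta> z" for z using S(7) by (simp add: \<eta>_def)
  show "\<eta> z = 1" if "z \<in> Bx r t1 t2" for z
  proof -
   have "(norm (fst z))\<^sup>2 <= r\<^sup>2" using that by (intro power_mono) (auto simp: mem_Bx)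
   moreover have "(2 / t1) * snd z >= (2 / t1) * t1" using that t1 by (intro mult_left_mono) (auto simp: mem_Bx)
   ultimately show ?thesis using that t1 by (simp add: \<eta>_def mem_Bx S(6))
  qed
 qed
qed

text \<open>A continuously differentiable substitute for the positive part to the power
  \<open>q\<close>. The square removes the corner at 0 for every \<open>q\<close>, and the shift by
  \<open>e\<close> keeps the remaining power away from its singularity; as \<open>e\<close> tends to
  0 the power is recovered.\<close>

definition Psi :: "real => real => real => real" where
 "Psi q e y = (max 0 y)\<^sup>2 * (max 0 y + e) powr (q - 2)"
definition Psi' :: "real => real => real => real" where
 "Psi' q e y = max 0 y * (max 0 y + e) powr (q - 3) * (q * max 0 y + 2 * e)"

lemma Psi_deriv: assumes e: "0 < e" shows "(Psi q e has_real_derivative Psi' q e y) (at y)"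
proof -
 define f where "f y = y\<^sup>2 * (y + e) powr (q - 2)" for y
 have d: "(f has_real_derivative y * (y + e) powr (q - 3) * (q * y + 2 * e)) (at y)" if "0 <= y" for y
 proof -
  have "(f has_real_derivative 2 * y * (y + e) powr (q - 2) + ((q - 2) * (y + e) powr (q - 2 - 1)) * y\<^sup>2) (at y)"
   unfolding f_def[abs_def] using that e by (auto intro!: derivative_eq_intros has_real_derivative_powr)
  moreover have "(y + e) powr (q - 2) = (y + e) * (y + e) powr (q - 3)"
   using powr_mult_base[of "y + e" "q - 3"] that e by simp
  ultimately show ?thesis by (simp add: algebra_simps power2_eq_square)
 qed
 have fe: "f y = Psi q e y" if "0 <= y" for y using that by (simp add: f_def Psi_def)
 consider "y < 0" | "y = 0" | "0 < y" by linarith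
 then show ?thesis
 proof cases
  case 1
  have "eventually (%x. Psi q e x = 0) (nhds y)"
   using eventually_nhds_in_open[of "{..<0}" y] 1 by (auto elim!: eventually_mono simp: Psi_def)
  then show ?thesis using 1 by (simp add: DERIV_cong_ev Psi'_def)
 next
  case 2
  have eq: "Psi q e = (%x. if x >= 0 then f x else 0)" by (auto simp: fe Psi_def fun_eq_iff)
  show ?thesis unfolding 2 eq by (rule DERIV_glue) (use d[of 0] in "simp_all add: Psi'_def", simp add: f_def)
 next
  case 3
  have "eventually (%x. Psi q e x = f x) (nhds y)"
   using eventually_nhds_in_open[of "{0<..}" y] 3 by (auto elim!: eventually_mono simp: fe)
  then show ?thesis using 3 d[of y] by (simp add: DERIV_cong_ev Psi'_def)
 qed
qed

lemma Psi'_cont: "0 < e ==> continuous_on UNIV (Psi' q e)"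
 unfolding Psi'_def[abs_def] by (intro continuous_on_mult continuous_on_add continuous_on_powr continuous_on_max continuous_on_const continuous_on_id) (auto simp: max_def)

lemma Psi_cont: "0 < e ==> continuous_on UNIV (Psi q e)"
 by (intro continuous_at_imp_continuous_on ballI DERIV_isCont[OF Psi_deriv])

lemma Psi_lip: assumes e: "0 < e"
 shows "\<exists>L. \<forall>x y. \<bar>x\<bar> <= R --> \<bar>y\<bar> <= R --> \<bar>Psi q e x - Psi q e y\<bar> <= L * \<bar>x - y\<bar>"
proof -
 have "\<exists>L\<ge>0. \<forall>x\<in>{-R..R}. \<forall>y\<in>{-R..R}. \<bar>Psi q e x - Psi q e y\<bar> <= L * \<bar>x - y\<bar>"
  by (rule lipschitz_of_deriv[OF Psi_deriv[OF e] continuous_on_subset[OF Psi'_cont[OF e]]]) simp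
 then obtain L where L: "!!x y. x \<in> {-R..R} ==> y \<in> {-R..R} ==> \<bar>Psi q e x - Psi q e y\<bar> <= L * \<bar>x - y\<bar>" by blast
 show ?thesis by (intro exI[of _ L] allI impI L) auto
qed

text \<open>The bounds on \<open>Psi'\<close> rest on \<open>q w + 2 e <= max q 2 * (w + e)\<close>
  for \<open>w = max 0 y\<close>. The last two are uniform in \<open>e\<close>: a locally bounded
  majorant for \<open>q\<close> at least 1, and for \<open>q\<close> at most 1 a multiple of
  \<open>y^(q-1)\<close>, which may be singular at 0.\<close>

lemma Psi_bounds:
 assumes e: "0 < e" "e <= 1" and q: "0 < q"
 shows "0 <= Psi q e y" "Psi q e y <= (max 0 y + 1) powr q" "0 <= Psi' q e y"
  "max 0 y * Psi' q e y <= max q 2 * Psi q e y" (is ?c1) "y <= 0 ==> Psi q e y = 0" "y <= 0 ==> Psi' q e y = 0"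
  "1 <= q ==> Psi' q e y <= max q 2 * (max 0 y + 1) powr (q - 1)"
  "q <= 1 ==> 0 < y ==> Psi' q e y <= 2 * y powr (q - 1)"
proof -
 define w where "w = max 0 y"
 have w: "0 <= w" "0 < w + e" using e by (auto simp: w_def)
 show "0 <= Psi q e y" by (simp add: Psi_def)
 show "0 <= Psi' q e y" using w e q unfolding Psi'_def w_def[symmetric] by (intro mult_nonneg_nonneg) auto
 show "y <= 0 ==> Psi q e y = 0" "y <= 0 ==> Psi' q e y = 0" by (simp_all add: Psi_def Psi'_def)
 have e1: "(w + e) powr q = (w + e)\<^sup>2 * (w + e) powr (q - 2)"
  using w powr_add[of "w + e" 2 "q - 2"] by (simp add: powr_numeral)
 have e2: "(w + e) powr (q - 1) = (w + e) * (w + e) powr (q - 2)"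
  using w powr_mult_base[of "w + e" "q - 2"] by simp
 have e3: "(w + e) powr (q - 2) = (w + e) * (w + e) powr (q - 3)"
  using w powr_mult_base[of "w + e" "q - 3"] by simp
 have "Psi q e y <= (w + e)\<^sup>2 * (w + e) powr (q - 2)"
  unfolding Psi_def w_def[symmetric] using w e by (intro mult_right_mono power_mono) auto
 also have "... = (w + e) powr q" using e1 by simp
 also have "... <= (w + 1) powr q" using w e q by (intro powr_mono2) auto
 finally show "Psi q e y <= (max 0 y + 1) powr q" by (simp add: w_def)
 have qw: "q * w + 2 * e <= max q 2 * (w + e)"
 proof -
  have "q * w <= max q 2 * w" "2 * e <= max q 2 * e" using w e by (auto intro!: mult_right_mono)
  then show ?thesis by (simp add: distrib_left)
 qed
 have P': "Psi' q e y <= max q 2 * (w * (w + e) powr (q - 2))"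
 proof -
  have "Psi' q e y <= w * (w + e) powr (q - 3) * (max q 2 * (w + e))"
   unfolding Psi'_def w_def[symmetric] using w qw by (intro mult_left_mono) auto
  then show ?thesis unfolding e3 by (simp add: mult_ac)
 qed
 show ?c1
  using mult_left_mono[OF P' w(1)] unfolding Psi_def w_def[symmetric] by (simp add: mult_ac power2_eq_square)
 have P'': "Psi' q e y <= max q 2 * (w + e) powr (q - 1)"
 proof -
  have "w * (w + e) powr (q - 2) <= (w + e) powr (q - 1)" unfolding e2 using w e by (intro mult_right_mono) auto
  then have "max q 2 * (w * (w + e) powr (q - 2)) <= max q 2 * (w + e) powr (q - 1)" by (intro mult_left_mono) auto
  then show ?thesis using P' by simp
 qed
 show "Psi' q e y <= max q 2 * (max 0 y + 1) powr (q - 1)" if "1 <= q"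
 proof -
  have "(w + e) powr (q - 1) <= (w + 1) powr (q - 1)" using that w e by (intro powr_mono2) auto
  then have "max q 2 * (w + e) powr (q - 1) <= max q 2 * (w + 1) powr (q - 1)" by (intro mult_left_mono) auto
  then show ?thesis using P'' by (simp add: w_def)
 qed
 show "Psi' q e y <= 2 * y powr (q - 1)" if "q <= 1" "0 < y"
 proof -
  have "(w + e) powr (q - 1) <= y powr (q - 1)" using that w e by (intro powr_mono2') (auto simp: w_def)
  then show ?thesis using P'' that by (simp add: max_def)
 qed
qed

lemma Psi_tendsto:
 assumes e: "e ----> 0" "!!n. 0 < e n" and q: "0 < q"
 shows "(%n. Psi q (e n) y) ----> max 0 y powr q" (is ?c1)
  "(%n. Psi' q (e n) y) ----> (if 0 < y then q * y powr (q - 1) else 0)" (is ?c2)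
proof -
 show ?c1
 proof (cases "0 < y")
  case True
  have "(%n. y\<^sup>2 * (y + e n) powr (q - 2)) ----> y\<^sup>2 * (y + 0) powr (q - 2)"
   using True e(1) by (intro tendsto_intros) auto
  moreover have "y\<^sup>2 * y powr (q - 2) = y powr q"
   using powr_add[of y 2 "q - 2"] True by (simp add: powr_numeral)
  ultimately show ?thesis using True by (simp add: Psi_def[abs_def])
 qed (simp add: Psi_def)
 show ?c2
 proof (cases "0 < y")
  case True
  have "(%n. y * (y + e n) powr (q - 3) * (q * y + 2 * e n)) ----> y * (y + 0) powr (q - 3) * (q * y + 2 * 0)"
   using True e(1) by (intro tendsto_intros) auto
  moreover have "y * y powr (q - 3) * (q * y) = q * y powr (q - 1)"
   using powr_add[of y 2 "q - 3"] True by (simp add: powr_numeral power2_eq_square)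
  ultimately show ?thesis using True by (simp add: Psi'_def[abs_def])
 qed (simp add: Psi'_def)
qed

lemma powr_pos_part_deriv:
 assumes k: "0 < k"
 shows "((%y. max 0 y powr (1 + k)) has_real_derivative (1 + k) * max 0 y powr k) (at (y::real))"
proof -
 consider "y < 0" | "y = 0" | "0 < y" by linarith
 then show ?thesis
 proof cases
  case 1
  have "eventually (%x. max 0 x powr (1 + k) = 0) (nhds y)"
   using eventually_nhds_in_open[of "{..<0}" y] 1 by (auto elim!: eventually_mono)
  from DERIV_cong_ev[OF refl this refl, of 0] show ?thesis using 1 k by simp
 next
  case 2
  have l: "((%h. \<bar>h\<bar> powr k) \<longlongrightarrow> 0) (at 0)"
   using tendsto_powr'[of "%h. \<bar>h\<bar>" 0 "at (0::real)" "%_. k" k] k by (auto intro!: tendsto_eq_intros)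
  have "((%h. max 0 h powr (1 + k) / h) \<longlongrightarrow> 0) (at 0)"
  proof (rule Lim_null_comparison[OF _ l])
   show "eventually (%h. norm (max 0 h powr (1 + k) / h) <= \<bar>h\<bar> powr k) (at 0)"
    unfolding eventually_at_filter
   proof (intro always_eventually allI impI)
    fix h :: real assume "h ~= 0"
    show "norm (max 0 h powr (1 + k) / h) <= \<bar>h\<bar> powr k" using powr_mult_base[of h k] by (cases "0 < h") (auto simp: powr_add)
   qed
  qed
  then show ?thesis using 2 by (simp add: has_field_derivative_iff)
 next
  case 3
  have "eventually (%x. max 0 x powr (1 + k) = x powr (1 + k)) (nhds y)"
   using eventually_nhds_in_open[of "{0<..}" y] 3 by (auto elim!: eventually_mono)
  moreover have "((%x. x powr (1 + k)) has_real_derivative (1 + k) * y powr (1 + k - 1)) (at y)"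
   by (rule has_real_derivative_powr[OF 3])
  ultimately show ?thesis using 3 by (simp add: DERIV_cong_ev)
 qed
qed

lemma powr_pos_part_cont: "0 < (k::real) ==> continuous_on UNIV (%y. max 0 y powr k)"
 by (intro continuous_on_powr' continuous_on_max continuous_on_const continuous_on_id) auto

lemma powr_pos_part_lip: assumes k: "0 < k"
 shows "\<exists>L. \<forall>x y. \<bar>x\<bar> <= R --> \<bar>y\<bar> <= R --> \<bar>max 0 x powr (1 + k) - max 0 y powr (1 + k)\<bar> <= L * \<bar>x - y :: real\<bar>"
proof -
 have "\<exists>L\<ge>0. \<forall>x\<in>{-R..R}. \<forall>y\<in>{-R..R}. \<bar>max 0 x powr (1 + k) - max 0 y powr (1 + k)\<bar> <= L * \<bar>x - y\<bar>"
  by (rule lipschitz_of_deriv[OF powr_pos_part_deriv[OF k]])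
    (intro continuous_intros continuous_on_subset[OF powr_pos_part_cont[OF k]], simp)
 then obtain L where L: "!!x y. x \<in> {-R..R} ==> y \<in> {-R..R} ==> \<bar>max 0 x powr (1 + k) - max 0 y powr (1 + k)\<bar> <= L * \<bar>x - y\<bar>" by blast
 show ?thesis by (intro exI[of _ L] allI impI L) auto
qed

text \<open>The direction \<open>x / |x|\<close> is singular at the origin. The difference is
  written as \<open>(a s / s)\<close> times \<open>x - y\<close> plus a multiple of
  \<open>y\<close>, and the linear bound on \<open>a\<close> compensates the variation of
  \<open>1 / s\<close>.\<close>

lemma radial_field_lipschitz:
 fixes x y :: "'a::euclidean_space"
 assumes A: "!!s. 0 <= s ==> \<bar>a s\<bar> <= A * s" and L: "!!s t. 0 <= s ==> 0 <= t ==> \<bar>a s - a t\<bar> <= L * \<bar>s - t\<bar>"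
  and L0: "0 <= L"
 shows "norm ((a (norm x) / norm x) *. x - (a (norm y) / norm y) *. y) <= (2 * A + L) * norm (x - y)"
proof -
 have A0: "0 <= A" using A[of 1] by auto
 define s t where "s = norm x" and "t = norm y"
 have st: "\<bar>s - t\<bar> <= norm (x - y)" unfolding s_def t_def by (rule norm_triangle_ineq3)
 consider "x = 0" | "y = 0" | "x ~= 0" "y ~= 0" by blast
 then show ?thesis
 proof cases
  case 1
  have "\<bar>a t\<bar> <= A * t" using A[of t] by (simp add: t_def)
  also have "... <= (2 * A + L) * t" using A0 L0 by (intro mult_right_mono) (auto simp: t_def)
  finally show ?thesis using 1 by (cases "y = 0") (simp_all add: t_def)
 next
  case 2
  have "\<bar>a s\<bar> <= A * s" using A[of s] by (simp add: s_def)
  also have "... <= (2 * A + L) * s" using A0 L0 by (intro mult_right_mono) (auto simp: s_def)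
  finally show ?thesis using 2 by (cases "x = 0") (simp_all add: s_def)
 next
  case 3
  then have p: "0 < s" "0 < t" by (auto simp: s_def t_def)
  have e: "(a s / s) *. x - (a t / t) *. y = (a s / s) *. (x - y) + (a s * (1 / s - 1 / t) + (a s - a t) / t) *. y"
   by (simp add: algebra_simps diff_divide_distrib)
  have n1: "norm ((a s / s) *. (x - y)) <= A * norm (x - y)"
  proof -
   have "\<bar>a s / s\<bar> <= A" using A[of s] p by (simp add: divide_le_eq)
   then show ?thesis unfolding norm_scaleR by (rule mult_right_mono) simp
  qed
  have "\<bar>a s * (1 / s - 1 / t) + (a s - a t) / t\<bar> <= (A + L) * norm (x - y) / t"
  proof -
   have "a s * (1 / s - 1 / t) = (a s / s) * ((t - s) / t)" using p by (simp add: field_simps)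
   then have "\<bar>a s * (1 / s - 1 / t)\<bar> = (\<bar>a s\<bar> / s) * (\<bar>s - t\<bar> / t)" using p by (simp add: abs_mult abs_minus_commute)
   also have "... <= A * (norm (x - y) / t)"
    using A[of s] A0 p st by (intro mult_mono divide_right_mono) (auto simp: divide_le_eq)
   finally have i1: "\<bar>a s * (1 / s - 1 / t)\<bar> <= A * (norm (x - y) / t)" .
   have "\<bar>a s - a t\<bar> <= L * norm (x - y)" using L[of s t] p mult_left_mono[OF st L0] by linarith
   then have "\<bar>(a s - a t) / t\<bar> <= L * norm (x - y) / t" using p by (simp add: divide_right_mono)
   then show ?thesis using i1 abs_triangle_ineq[of "a s * (1 / s - 1 / t)" "(a s - a t) / t"]
    by (simp add: distrib_right add_divide_distrib)
  qed
  then have "norm ((a s * (1 / s - 1 / t) + (a s - a t) / t) *. y) <= (A + L) * norm (x - y) / t * t"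
   unfolding norm_scaleR t_def[symmetric] using p by (intro mult_right_mono) auto
  then have n2: "norm ((a s * (1 / s - 1 / t) + (a s - a t) / t) *. y) <= (A + L) * norm (x - y)" using p by simp
  have "norm ((a s / s) *. x - (a t / t) *. y) <= A * norm (x - y) + (A + L) * norm (x - y)"
   unfolding e by (rule order_trans[OF norm_triangle_ineq add_mono[OF n1 n2]])
  then show ?thesis unfolding s_def[symmetric] t_def[symmetric] by (simp add: algebra_simps)
 qed
qed

lemma norm_line_derivative:
 fixes x b :: "'a::euclidean_space"
 assumes x: "x ~= 0"
 shows "((%t. norm (x + t *. b)) has_real_derivative (x \<bullet> b) / norm x) (at 0)"
proof -
 have "((%t. sqrt ((x + t *. b) \<bullet> (x + t *. b))) has_real_derivative
   (inverse (sqrt (x \<bullet> x)) / 2) * (2 * (x \<bullet> b))) (at 0)"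
 proof (rule DERIV_chain2[of sqrt])
  have "((%t. x \<bullet> x + 2 * (x \<bullet> b) * t + (b \<bullet> b) * t\<^sup>2) has_real_derivative 2 * (x \<bullet> b)) (at 0)"
   by (auto intro!: derivative_eq_intros)
  moreover have "(x + t *. b) \<bullet> (x + t *. b) = x \<bullet> x + 2 * (x \<bullet> b) * t + (b \<bullet> b) * t\<^sup>2" for t
   by (simp add: inner_add_left inner_add_right power2_eq_square inner_commute algebra_simps)
  ultimately show "((%t. (x + t *. b) \<bullet> (x + t *. b)) has_real_derivative 2 * (x \<bullet> b)) (at 0)" by simp
  show "(sqrt has_real_derivative inverse (sqrt (x \<bullet> x)) / 2) (at ((x + 0 *. b) \<bullet> (x + 0 *. b)))"
   using DERIV_real_sqrt[of "x \<bullet> x"] x by simp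
 qed
 then show ?thesis by (simp add: norm_eq_sqrt_inner field_simps)
qed

section \<open>The barrier as a function on space-time\<close>

locale spacetime = full +
 fixes ty :: "'a::euclidean_space itself"
 assumes NN: "N = DIM('a)"
begin

text \<open>Time is truncated at 0 so that \<open>TT\<close> and \<open>Zr\<close> are continuous,
  hence Borel, on the whole space; on \<open>S_infty\<close> they are \<open>t + t0\<close> and the
  bracket of the barrier before its positive part is taken.\<close>

definition TT where "TT z = max 0 (snd z) + t0" for z :: "'a \<times> real"
definition Zr where "Zr z = ee (max 0 (snd z)) - yy (norm (fst z))" for z :: "'a \<times> real"
text \<open>For \<open>y(x) = yy |x|\<close>, \<open>Mv\<close> is the field
  \<open>|grad y|^(p-2) grad y\<close> and \<open>dY\<close> is the gradient of \<open>y\<close>.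
  Writing both through \<open>aa\<close> makes them vanish at the origin.\<close>

definition Mv where "Mv x = (aa (norm x) / norm x) *. x" for x :: 'a
definition dY where "dY x = (aa (norm x) powr (1 / (p - 1)) / norm x) *. x" for x :: 'a
definition rx where "rx x = rho p rhat (norm x)" for x :: 'a

lemma TT_ge: "t0 <= TT z" "1 < TT z" "0 < TT z" using t0 by (auto simp: TT_def)

lemma ee_isCont: "0 <= t ==> isCont ee t" using DERIV_isCont[OF ee_deriv] .

lemma fst_snd_cont: "continuous_on UNIV (snd :: 'a \<times> real => real)" "continuous_on UNIV (fst :: 'a \<times> real => 'a)"
 by (auto intro: continuous_intros)

lemma eem_cont: "continuous_on UNIV (%z :: 'a \<times> real. ee (max 0 (snd z)))"
proof (rule continuous_on_compose2[of "{0..}" ee])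
 show "continuous_on {0..} ee" using ee_isCont by (intro continuous_at_imp_continuous_on) auto
qed (auto intro!: continuous_intros)

lemma yyn_cont: "continuous_on UNIV (%x :: 'a. yy (norm x))"
 by (rule continuous_on_compose2[OF yy_cont]) (auto intro!: continuous_intros)

lemma Zr_cont: "continuous_on UNIV Zr" unfolding Zr_def[abs_def]
 by (intro continuous_on_diff eem_cont continuous_on_compose2[OF yyn_cont fst_snd_cont(2)]) auto

lemma TT_cont: "continuous_on UNIV TT" unfolding TT_def[abs_def] by (intro continuous_intros)

lemma TTp_cont: "continuous_on UNIV (%z. TT z powr c)"
proof (intro continuous_on_powr TT_cont continuous_on_const ballI)
 show "TT z ~= 0" for z using TT_ge(3)[of z] by simp
qed

lemma Mv_lip: obtains L where "L >= 0" "!!x y. norm (Mv x - Mv y) <= L * norm (x - y)"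
proof -
 obtain L where L: "L >= 0" "!!s t. 0 <= s ==> 0 <= t ==> \<bar>aa s - aa t\<bar> <= L * \<bar>s - t\<bar>" using aa_lipschitz by metis
 show ?thesis
 proof (rule that[of "2 * A0 + L"])
  show "norm (Mv x - Mv y) <= (2 * A0 + L) * norm (x - y)" for x y
   unfolding Mv_def by (rule radial_field_lipschitz[OF _ L(2) L(1)]) (use aa_le aa_nonneg in auto)
 qed (use L A0_pos in simp)
qed

lemma Mv_cont: "continuous_on UNIV Mv"
proof -
 obtain L where L: "L >= 0" "!!x y. norm (Mv x - Mv y) <= L * norm (x - y)" using Mv_lip by metis
 have "L-lipschitz_on UNIV Mv" by (rule lipschitz_onI) (use L in "auto simp: dist_norm")
 then show ?thesis by (rule lipschitz_on_continuous_on)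
qed

lemma norm_Mv: "norm (Mv x) = aa (norm x)"
 using aa_nonneg by (cases "x = 0") (auto simp: Mv_def aa_def)

lemma norm_dY: "norm (dY x) = aa (norm x) powr (1 / (p - 1))"
 by (cases "x = 0") (auto simp: dY_def aa_def)

lemma norm_dY_powr: "norm (dY x) powr (p - 1) = aa (norm x)"
 using p1 aa_nonneg[of "norm x"] by (cases "aa (norm x) = 0") (auto simp: norm_dY powr_powr)

lemma norm_dY_le: "norm x <= S ==> norm (dY x) <= (A0 * S) powr (1 / (p - 1))"
proof -
 assume "norm x <= S"
 then have "aa (norm x) <= A0 * S" using order_trans[OF aa_le[of "norm x"] mult_left_mono[OF _ less_imp_le[OF A0_pos]]] by simp
 then show ?thesis unfolding norm_dY using p1 aa_nonneg by (intro powr_mono2) auto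
qed

lemma dY_measurable [measurable]: "dY \<in> meas"
proof -
 have "continuous_on UNIV (%x :: 'a. aa (norm x))"
  by (rule continuous_on_compose2[OF aa_cont]) (auto intro!: continuous_intros)
 then have [measurable]: "(%x :: 'a. aa (norm x)) \<in> meas" by (rule continuous_measurable)
 show ?thesis unfolding dY_def[abs_def] by measurable
qed

lemma Mv_LD: assumes b: "b \<in> Basis" shows "LD b (%z :: 'a \<times> real. Mv (fst z) \<bullet> i)"
proof (rule LD_lip[OF b])
 fix r t1 t2 :: real
 obtain L where L: "L >= 0" "!!x y. norm (Mv x - Mv y) <= L * norm (x - y)" using Mv_lip by metis
 show "\<exists>K. \<forall>z\<in>Bx r t1 t2. \<forall>w\<in>Bx r t1 t2. \<bar>Mv (fst z) \<bullet> i - Mv (fst w) \<bullet> i\<bar> <= K * norm (z - w)"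
 proof (intro exI ballI)
  fix z w :: "'a \<times> real"
  have "\<bar>Mv (fst z) \<bullet> i - Mv (fst w) \<bullet> i\<bar> <= norm (Mv (fst z) - Mv (fst w)) * norm i"
   using Cauchy_Schwarz_ineq2[of "Mv (fst z) - Mv (fst w)" i] by (simp add: inner_diff_left)
  also have "... <= (L * norm (z - w)) * norm i"
  proof (rule mult_right_mono)
   show "norm (Mv (fst z) - Mv (fst w)) <= L * norm (z - w)"
    using L(2)[of "fst z" "fst w"] mult_left_mono[OF norm_fst'[of "z - w"] L(1)] by simp
  qed simp
  also have "... = (L * norm i) * norm (z - w)" by simp
  finally show "\<bar>Mv (fst z) \<bullet> i - Mv (fst w) \<bullet> i\<bar> <= (L * norm i) * norm (z - w)" .
 qed
qed

lemma yy_LD: assumes b: "b \<in> Basis" shows "LD b (%z :: 'a \<times> real. yy (norm (fst z)))"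
proof (rule LD_lip[OF b])
 fix r t1 t2 :: real
 define C where "C = (A0 * r) powr (1 / (p - 1))"
 show "\<exists>K. \<forall>z\<in>Bx r t1 t2. \<forall>w\<in>Bx r t1 t2. \<bar>yy (norm (fst z)) - yy (norm (fst w))\<bar> <= K * norm (z - w :: 'a \<times> real)"
 proof (intro exI ballI)
  fix z w :: "'a \<times> real" assume zw: "z \<in> Bx r t1 t2" "w \<in> Bx r t1 t2"
  have "\<bar>yy (norm (fst z)) - yy (norm (fst w))\<bar> <= C * \<bar>norm (fst z) - norm (fst w)\<bar>"
   unfolding C_def using zw by (intro yy_lipschitz) (auto simp: mem_Bx)
  also have "... <= C * norm (z - w)"
   using norm_triangle_ineq3[of "fst z" "fst w"] norm_fst'[of "z - w"] by (intro mult_left_mono) (auto simp: C_def)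
  finally show "\<bar>yy (norm (fst z)) - yy (norm (fst w))\<bar> <= C * norm (z - w)" .
 qed
qed

lemma de_cont: "continuous_on {0..} de"
proof -
 have RRc: "continuous_on {0..} RR"
 proof (intro continuous_at_imp_continuous_on ballI)
  fix t :: real assume "t \<in> {0..}"
  then have t: "0 <= t" by simp
  have "isCont (%t. \<Gamma> * ln (t + t0)) t" using t t0 by (intro continuous_intros) auto
  then show "isCont RR t" unfolding RR_def[abs_def]
   by (rule isCont_o2) (rule DERIV_isCont[OF G_inv_deriv[OF tau_ge(2)[OF t]]])
 qed
 have gR: "continuous_on {0..} (%t. g (RR t))" "continuous_on {0..} (%t. G g (RR t))" "continuous_on {0..} (%t. jf (RR t))"
  by (rule continuous_on_compose2[OF gc RRc] continuous_on_compose2[OF G_cont RRc] continuous_on_compose2[OF jf_cont RRc],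
    use RR_gt(2) less_imp_le in blast)+
 have ne0: "RR t ~= 0" "g (RR t) ~= 0" "G g (RR t) ~= 0" "t + t0 ~= 0" if "t \<in> {0..}" for t
  using RR_gt(2)[of t] gpos[of "RR t"] G_pos[of "RR t"] that t0 by auto
 have ne: "\<forall>t\<in>{0..}. RR t ~= 0" "\<forall>t\<in>{0..}. g (RR t) ~= 0" "\<forall>t\<in>{0..}. G g (RR t) ~= 0" "\<forall>t\<in>{0..}. t + t0 ~= 0"
  using ne0(1) ne0(2) ne0(3) ne0(4) by simp_all
 have "continuous_on {0..} (%t. ((1 / (p - 1)) * (jf (RR t) / RR t) * (p - g (RR t) / G g (RR t))) * (RR t / g (RR t)) * (\<Gamma> / (t + t0)))"
  by (intro continuous_on_mult continuous_on_divide continuous_on_diff continuous_on_add continuous_on_const continuous_on_id gR RRc)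
   (rule ne)+
 then show ?thesis
 proof (rule continuous_on_eq)
  show "((1 / (p - 1)) * (jf (RR t) / RR t) * (p - g (RR t) / G g (RR t))) * (RR t / g (RR t)) * (\<Gamma> / (t + t0)) = de t" if "t \<in> {0..}" for t
   using RR_gt(1)[of t] that by (simp add: de_def djf_def cc_def)
 qed
qed

lemma LD_cong_S:
 fixes f h :: "'a \<times> real => real"
 assumes "LD b f" "!!z. z \<in> S_infty ==> h z = f z" shows "LD b h"
 unfolding LD_def
proof (intro allI impI)
 fix r t1 t2 :: real assume t1: "0 < t1"
 have e: "h z = f z" if "z \<in> Bx r t1 t2" for z using assms(2) Bx_S[OF t1] that by blast
 obtain L where L: "!!z. z \<in> Bx r t1 t2 ==> \<bar>f z\<bar> <= L"
  "!!z t. z \<in> Bx r t1 t2 ==> z + t *. b \<in> Bx r t1 t2 ==> \<bar>f (z + t *. b) - f z\<bar> <= L * \<bar>t\<bar>" using LD_E[OF assms(1) t1] by metis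
 show "\<exists>L. \<forall>z\<in>Bx r t1 t2. \<bar>h z\<bar> <= L \<and> (\<forall>t. z + t *. b \<in> Bx r t1 t2 --> \<bar>h (z + t *. b) - h z\<bar> <= L * \<bar>t\<bar>)"
 proof (rule exI[of _ L], intro ballI conjI allI impI)
  fix z :: "'a \<times> real" assume z: "z \<in> Bx r t1 t2"
  show "\<bar>h z\<bar> <= L" using L(1)[OF z] e[OF z] by simp
  fix t assume z': "z + t *. b \<in> Bx r t1 t2"
  show "\<bar>h (z + t *. b) - h z\<bar> <= L * \<bar>t\<bar>" using L(2)[OF z z'] e[OF z] e[OF z'] by simp
 qed
qed

lemma LD_diff: assumes "LD b f" "LD b h" shows "LD b (%z :: 'a \<times> real. f z - h z)"
 unfolding LD_def
proof (intro allI impI)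
 fix r t1 t2 :: real assume t1: "0 < t1"
 obtain L where L: "!!z. z \<in> Bx r t1 t2 ==> \<bar>f z\<bar> <= L"
  "!!z t. z \<in> Bx r t1 t2 ==> z + t *. b \<in> Bx r t1 t2 ==> \<bar>f (z + t *. b) - f z\<bar> <= L * \<bar>t\<bar>" using LD_E[OF assms(1) t1] by metis
 obtain M where M: "!!z. z \<in> Bx r t1 t2 ==> \<bar>h z\<bar> <= M"
  "!!z t. z \<in> Bx r t1 t2 ==> z + t *. b \<in> Bx r t1 t2 ==> \<bar>h (z + t *. b) - h z\<bar> <= M * \<bar>t\<bar>" using LD_E[OF assms(2) t1] by metis
 show "\<exists>L. \<forall>z\<in>Bx r t1 t2. \<bar>f z - h z\<bar> <= L \<and> (\<forall>t. z + t *. b \<in> Bx r t1 t2 --> \<bar>f (z + t *. b) - h (z + t *. b) - (f z - h z)\<bar> <= L * \<bar>t\<bar>)"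
 proof (rule exI[of _ "L + M"], intro ballI conjI allI impI)
  fix z :: "'a \<times> real" assume z: "z \<in> Bx r t1 t2"
  show "\<bar>f z - h z\<bar> <= L + M" using L(1)[OF z] M(1)[OF z] by linarith
  fix t assume z': "z + t *. b \<in> Bx r t1 t2"
  show "\<bar>f (z + t *. b) - h (z + t *. b) - (f z - h z)\<bar> <= (L + M) * \<bar>t\<bar>"
   using L(2)[OF z z'] M(2)[OF z z'] by (simp add: distrib_right)
 qed
qed

lemma Zr_LD: assumes b: "b \<in> Basis" shows "LD b Zr"
proof (rule LD_cong_S)
 show "LD b (%z :: 'a \<times> real. ee (snd z) - yy (norm (fst z)))"
 proof (rule LD_diff[OF LD_time[OF b] yy_LD[OF b]])
  show "(ee has_real_derivative de t) (at t)" if "0 < t" for t using ee_deriv[of t] that by simp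
  show "continuous_on {0<..} de" by (rule continuous_on_subset[OF de_cont]) auto
 qed
qed (auto simp: Zr_def mem_S)

lemma TTp_LD: assumes b: "b \<in> Basis" shows "LD b (%z. TT z powr c)"
proof (rule LD_cong_S)
 show "LD b (%z :: 'a \<times> real. (snd z + t0) powr c)"
 proof (rule LD_time[OF b])
  show "((%t. (t + t0) powr c) has_real_derivative c * (t + t0) powr (c - 1)) (at t)" if "0 < t" for t
   using that t0 by (auto intro!: derivative_eq_intros has_real_derivative_powr)
  show "continuous_on {0<..} (%t. c * (t + t0) powr (c - 1))"
   using t0 by (intro continuous_intros) auto
 qed
qed (auto simp: TT_def mem_S)

lemma Zr_time_deriv: assumes "0 < snd z" shows "((%t. Zr (z + t *. (0, 1))) has_real_derivative de (snd z)) (at 0)"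
proof -
 have "((%t. ee (snd z + t) - yy (norm (fst z))) has_real_derivative de (snd z)) (at 0)"
 proof -
  have "((%t. snd z + t) has_real_derivative 1) (at 0)" by (auto intro!: derivative_eq_intros)
  from DERIV_chain2[of ee _ "%t. snd z + t" 0, OF _ this] ee_deriv[of "snd z"] assms
  have "((%t. ee (snd z + t)) has_real_derivative de (snd z)) (at 0)" by simp
  from DERIV_diff[OF this DERIV_const] show ?thesis by simp
 qed
 moreover have "eventually (%t. Zr (z + t *. (0, 1)) = ee (snd z + t) - yy (norm (fst z))) (nhds 0)"
  using eventually_nhds_in_open[of "{- snd z<..}" 0] assms by (auto elim!: eventually_mono simp: Zr_def)
 ultimately show ?thesis by (simp add: DERIV_cong_ev)
qed

lemma TTp_time_deriv: assumes "0 < snd z"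
 shows "((%t. TT (z + t *. (0, 1)) powr c) has_real_derivative c * TT z powr (c - 1)) (at 0)"
proof -
 have "((%t. (snd z + t + t0) powr c) has_real_derivative c * (snd z + 0 + t0) powr (c - 1)) (at 0)"
  using assms t0 by (auto intro!: derivative_eq_intros has_real_derivative_powr)
 moreover have "eventually (%t. TT (z + t *. (0, 1)) powr c = (snd z + t + t0) powr c) (nhds 0)"
  using eventually_nhds_in_open[of "{- snd z<..}" 0] assms by (auto elim!: eventually_mono simp: TT_def)
 ultimately show ?thesis using assms by (simp add: DERIV_cong_ev TT_def)
qed

lemma dY_eq: "x ~= 0 ==> dY x = (dy (norm x) / norm x) *. x"
 using dy_pos[of "norm x"] p1 by (simp add: dY_def aa_def powr_powr)

lemma Zr_space_deriv: assumes x: "fst z ~= 0"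
 shows "((%t. Zr (z + t *. (b, 0))) has_real_derivative - (dY (fst z) \<bullet> b)) (at 0)"
proof -
 have "((%t. yy (norm (fst z + t *. b))) has_real_derivative dy (norm (fst z)) * ((fst z \<bullet> b) / norm (fst z))) (at 0)"
  by (rule DERIV_chain2[OF _ norm_line_derivative[OF x]]) (use yy_deriv[of "norm (fst z)"] x in simp)
 from DERIV_diff[OF DERIV_const[of "ee (max 0 (snd z))"] this]
 show ?thesis using x by (simp add: Zr_def dY_eq)
qed

lemma Mv_space_deriv: assumes x: "x ~= 0" "rhat (norm x) ~= r0"
 shows "((%t. Mv (x + t *. b) \<bullet> b) has_real_derivative
   (daa (norm x) / norm x - aa (norm x) / (norm x)\<^sup>2) * ((x \<bullet> b)\<^sup>2 / norm x) + aa (norm x) / norm x * (b \<bullet> b)) (at 0)"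
proof -
 have s: "0 < norm x" using x by simp
 have "((%s. aa s / s) has_real_derivative (daa (norm x) * norm x - aa (norm x) * 1) / (norm x * norm x)) (at (norm (x + 0 *. b)))"
  using DERIV_divide[OF aa_has_deriv[OF s x(2)] DERIV_ident] s by simp
 from DERIV_chain2[OF this norm_line_derivative[OF x(1)]]
 have d1: "((%t. aa (norm (x + t *. b)) / norm (x + t *. b)) has_real_derivative
   (daa (norm x) * norm x - aa (norm x) * 1) / (norm x * norm x) * ((x \<bullet> b) / norm x)) (at 0)" .
 have d2: "((%t. (x + t *. b) \<bullet> b) has_real_derivative b \<bullet> b) (at 0)"
  unfolding inner_add_left inner_scaleR_left by (auto intro!: derivative_eq_intros)
 have v: "(daa (norm x) * norm x - aa (norm x) * 1) / (norm x * norm x) * ((x \<bullet> b) / norm x) * ((x + 0 *. b) \<bullet> b)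
   + b \<bullet> b * (aa (norm (x + 0 *. b)) / norm (x + 0 *. b)) =
   (daa (norm x) / norm x - aa (norm x) / (norm x)\<^sup>2) * ((x \<bullet> b)\<^sup>2 / norm x) + aa (norm x) / norm x * (b \<bullet> b)"
  using s by (simp add: field_simps power2_eq_square)
 show ?thesis using DERIV_mult[OF d1 d2] unfolding v by (simp add: Mv_def)
qed

text \<open>The divergence of \<open>(a(s)/s) x\<close> is \<open>a' + (N-1) a/s\<close>, and in
  \<open>daa\<close> the second term cancels. What is left is the density times \<open>LL\<close>;
  the product in \<open>dY_Mv\<close> carries the same density factor.\<close>

lemma div_Mv: assumes x: "x ~= (0 :: 'a)"
 shows "(\<Sum>b\<in>Basis. (daa (norm x) / norm x - aa (norm x) / (norm x)\<^sup>2) * ((x \<bullet> b)\<^sup>2 / norm x) + aa (norm x) / norm x * (b \<bullet> b))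
  = rp (norm x) powr p * LL (rhat (norm x))"
proof -
 have s: "0 < norm x" using x by simp
 have "(\<Sum>b\<in>Basis. (x \<bullet> b)\<^sup>2) = (norm x)\<^sup>2"
  unfolding power2_norm_eq_inner unfolding power2_eq_square by (rule euclidean_inner[symmetric])
 then have 1: "(\<Sum>b\<in>Basis. (x \<bullet> b)\<^sup>2 / norm x) = norm x" using s by (simp add: sum_divide_distrib[symmetric] power2_eq_square)
 have "(\<Sum>b\<in>Basis. (daa (norm x) / norm x - aa (norm x) / (norm x)\<^sup>2) * ((x \<bullet> b)\<^sup>2 / norm x) + aa (norm x) / norm x * (b \<bullet> b))
  = (daa (norm x) / norm x - aa (norm x) / (norm x)\<^sup>2) * norm x + aa (norm x) / norm x * real N"
  unfolding sum.distrib sum_distrib_left[symmetric] 1 by (simp add: NN)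
 also have "... = rp (norm x) powr p * LL (rhat (norm x))"
  using s by (simp add: daa_def field_simps power2_eq_square)
 finally show ?thesis .
qed

lemma dY_Mv: assumes x: "x ~= (0 :: 'a)" shows "(\<Sum>b\<in>Basis. (dY x \<bullet> b) * (Mv x \<bullet> b)) = rp (norm x) powr p * djf (rhat (norm x)) powr p"
proof -
 have s: "0 < norm x" using x by simp
 have "(\<Sum>b\<in>Basis. (dY x \<bullet> b) * (Mv x \<bullet> b)) = dY x \<bullet> Mv x" by (rule euclidean_inner[symmetric])
 also have "... = dy (norm x) * aa (norm x)"
  using s x by (simp add: dY_eq Mv_def power2_norm_eq_inner[symmetric] power2_eq_square)
 also have "... = dy (norm x) powr p" using s dy_pos[OF s] powr_mult_base[of "dy (norm x)" "p - 1"] by (simp add: aa_def)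
 also have "... = rp (norm x) powr p * djf (rhat (norm x)) powr p"
  unfolding dy_def by (subst powr_mult) (simp add: mult.commute)
 finally show ?thesis .
qed

lemma rx_eq: "x ~= (0::'a) ==> rx x = rp (norm x) powr p" using rho_eq[of "norm x"] by (simp add: rx_def)

lemma rx_nonneg: "0 <= rx x" by (simp add: rx_def rho_def)

lemma rx_pos: "x ~= 0 ==> 0 < rx x" using rp_pos[of "norm x"] by (simp add: rx_eq)

text \<open>Away from the origin the density is at most 1 because \<open>rp <= 1\<close>. At the
  origin it is defined by a one-sided derivative of \<open>rhat\<close>, whose value is simply
  included in the maximum.\<close>

definition RM where "RM = max 1 (rx 0)"

lemma rx_le: "rx x <= RM"
proof (cases "x = 0")
 case False
 have "rp (norm x) powr p <= 1" using rp_le1[of "norm x"] rp_pos[of "norm x"] False p1 by (intro powr_le1) auto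
 then show ?thesis using False by (simp add: rx_eq RM_def)
qed (simp add: RM_def)

lemma rx_measurable [measurable]: "rx \<in> meas"
proof -
 have "continuous_on (- {0}) (%x :: 'a. rp (norm x) powr p)"
 proof (intro continuous_at_imp_continuous_on ballI)
  fix x :: 'a assume "x \<in> - {0}"
  then have s: "0 < norm x" by simp
  have "isCont rp (norm x)"
  proof -
   have c: "isCont rhat (norm x)" using DERIV_isCont[OF rhat_deriv[OF s]] .
   moreover have "isCont (%s. g (rhat s)) (norm x)"
    using isCont_o2[OF c DERIV_isCont[OF g_deriv[OF rhat_pos[OF s]]]] .
   ultimately show ?thesis unfolding rp_def[abs_def] using s rhat_pos[OF s] p1 by (intro continuous_intros) auto
  qed
  then have "isCont (%x. rp (norm x)) x" by (rule isCont_o2[OF isCont_norm[OF continuous_ident]])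
  then show "isCont (%x. rp (norm x) powr p) x" using rp_pos[OF s] by (intro continuous_intros) auto
 qed
 then have m: "(%x. indicator (- {0}) x *. (rp (norm x) powr p)) \<in> borel_measurable (borel :: 'a measure)"
  by (rule borel_measurable_continuous_on_indicator[rotated]) simp
 have e: "rx = (%x. indicator (- {0}) x *. (rp (norm x) powr p) + indicator {0} x * rx 0)"
  by (auto simp: fun_eq_iff indicator_def rx_eq)
 from m have "(%x. indicator (- {0}) x *. (rp (norm x) powr p) + indicator {0} x * rx 0) \<in> borel_measurable (borel :: 'a measure)"
  by measurable
 then show ?thesis using e by simp
qed

end

lemma test_dct:
 fixes F :: "nat => 'a::euclidean_space \<times> real => real"
 assumes m: "!!n. (%z. indicator S_infty z * F n z) \<in> meas"
  and lim: "!!z. z \<in> S_infty ==> (%n. F n z) ----> F0 z"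
  and W: "locally_integrable W" "!!n z. z \<in> S_infty ==> \<bar>F n z\<bar> <= W z"
  and c: "c \<in> meas" "!!z. \<bar>c z\<bar> <= M" "!!z. z \<notin> Bx r t1 t2 ==> c z = 0" "0 < t1"
 shows "S_integrable (%z. F n z * c z)"
  "(%n. LIS z. F n z * c z) ----> (LIS z. F0 z * c z)" (is ?c1)
proof -
 have I: "S_integrable (%z. \<bar>c z\<bar> *. W z)"
  by (rule loc_int_times[OF W(1), of _ M r t1 t2]) (use c in auto)
 have eq: "indicator S_infty z *. (F n z * c z) = (indicator S_infty z * F n z) * c z" for n z by simp
 have mm: "(%z. indicator S_infty z *. (F n z * c z)) \<in> borel_measurable lborel" for n
  unfolding eq using m[of n] c(1) by (simp add: borel_measurable_times)
 have b: "norm (indicator S_infty z *. (F n z * c z)) <= indicator S_infty z *. (\<bar>c z\<bar> *. W z)" for n z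
 proof (cases "z \<in> S_infty")
  case True
  have "\<bar>F n z\<bar> * \<bar>c z\<bar> <= W z * \<bar>c z\<bar>" by (intro mult_right_mono W(2)[OF True]) simp
  then show ?thesis using True by (simp add: abs_mult mult.commute)
 qed simp
 have l: "(%n. indicator S_infty z *. (F n z * c z)) ----> indicator S_infty z *. (F0 z * c z)" for z
  by (cases "z \<in> S_infty") (auto intro!: tendsto_mult tendsto_const lim)
 have m0: "(%z. indicator S_infty z *. (F0 z * c z)) \<in> borel_measurable lborel"
  by (rule borel_measurable_LIMSEQ_real[OF l mm])
 show "S_integrable (%z. F n z * c z)"
  by (rule integrable_dominated[OF I mm], rule AE_I2, rule order_trans[OF b]) (simp add: abs_le_iff)
 show ?c1
  unfolding set_lebesgue_integral_def
  by (rule dominated_conv[OF m0 mm I AE_I2[OF l] AE_I2[OF b]])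
qed

text \<open>Supplies integrability of a limit from bounds on the integrals alone, for the singular
  time derivative of the barrier where a majorant is not yet at hand.\<close>

lemma integrable_Fatou:
 fixes f :: "nat => 'b => real"
 assumes f: "!!n. integrable M (f n)" "!!n x. 0 <= f n x" "!!n. (LINT x|M. f n x) <= C"
  and lim: "!!x. (%n. f n x) ----> h x"
 shows "integrable M h"
proof -
 have m: "h \<in> borel_measurable M" by (rule borel_measurable_LIMSEQ_real[OF lim]) (use f in auto)
 have h0: "0 <= h x" for x by (rule LIMSEQ_le_const[OF lim]) (use f in auto)
 have "(\<integral>\<^sup>+x. ennreal (h x) \<partial>M) = (\<integral>\<^sup>+x. liminf (%n. ennreal (f n x)) \<partial>M)"
 proof (rule nn_integral_cong)
  fix x
  have "(%n. ennreal (f n x)) ----> ennreal (h x)" by (rule tendsto_ennrealI[OF lim])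
  then show "ennreal (h x) = liminf (%n. ennreal (f n x))" by (simp add: lim_imp_Liminf)
 qed
 also have "... <= liminf (%n. \<integral>\<^sup>+x. ennreal (f n x) \<partial>M)" by (rule nn_integral_liminf) (use f in simp)
 also have "... <= ennreal C"
 proof (rule Liminf_le)
  show "eventually (%n. (\<integral>\<^sup>+x. ennreal (f n x) \<partial>M) <= ennreal C) sequentially"
   using f by (intro always_eventually allI) (subst nn_integral_eq_integral, auto intro!: ennreal_leI)
 qed simp
 finally have "(\<integral>\<^sup>+x. ennreal (h x) \<partial>M) < \<infinity>" by (simp add: le_less_trans)
 then show ?thesis using m h0 by (intro integrableI_nonneg) auto
qed

lemma cont_bounded_Bx:
 fixes f :: "'a::euclidean_space \<times> real => 'c::real_normed_vector"
 assumes "continuous_on UNIV f"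
 obtains M where "M >= 0" "!!z. z \<in> Bx r t1 t2 ==> norm (f z) <= M"
proof -
 have "bounded (f ` Bx r t1 t2)"
  by (rule compact_imp_bounded[OF compact_continuous_image[OF _ compact_Bx]]) (rule continuous_on_subset[OF assms], simp)
 then obtain M where "\<forall>y\<in>f ` Bx r t1 t2. norm y <= M" unfolding bounded_iff by blast
 then have "norm (f z) <= max M 0" if "z \<in> Bx r t1 t2" for z using that by (metis image_eqI max.coboundedI1)
 then show ?thesis using that[of "max M 0"] by simp
qed

lemma cont_loc_int:
 fixes f :: "'a::euclidean_space \<times> real => 'c::euclidean_space"
 assumes f: "continuous_on UNIV f" shows "locally_integrable f"
proof (rule loc_int_bounded)
 show "set_borel_measurable lborel S_infty f"
  unfolding set_borel_measurable_def using continuous_measurable[OF f] by measurable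
 show "\<exists>M. \<forall>z\<in>Bx r t1 t2. norm (f z) <= M" for r t1 t2 using cont_bounded_Bx[OF f] by metis
qed

lemma add_zero_pair [simp]: "(z :: 'a::euclidean_space \<times> real) + (0, 0) = z" by (simp add: prod_eq_iff)

section \<open>The weak time derivative of the barrier\<close>

context spacetime
begin

definition U where "U z = Cs * TT z powr (- k) * max 0 (Zr z) powr q"
definition ut where "ut z = Cs * (- k * TT z powr (- k - 1)) * max 0 (Zr z) powr q
 + Cs * TT z powr (- k) * ((if 0 < Zr z then q * Zr z powr (q - 1) else 0) * de (max 0 (snd z)))"
text \<open>The time derivative of \<open>Cs * TT powr (- k) * Psi q e (Zr z)\<close>, whose
  pointwise limit as \<open>e\<close> tends to 0 is \<open>ut\<close>.\<close>

definition uet where "uet e z = Cs * (- k * TT z powr (- k - 1)) * Psi q e (Zr z)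
 + Cs * TT z powr (- k) * (Psi' q e (Zr z) * de (max 0 (snd z)))"

lemma u_tilde_U: "0 <= t ==> u_tilde p m g Cs t0 r0 \<Gamma> (rhat (norm x)) t = U (x, t)"
 by (simp add: u_tilde_eq U_def TT_def Zr_def yy_def powr_minus_divide[of _ k])

lemma dem_cont: "continuous_on UNIV (%z :: 'a \<times> real. de (max 0 (snd z)))"
 by (rule continuous_on_compose2[OF de_cont]) (auto intro!: continuous_intros)

lemma Zp_cont: "0 < c ==> continuous_on UNIV (%z. max 0 (Zr z) powr c)"
 by (rule continuous_on_compose2[OF powr_pos_part_cont Zr_cont]) auto

lemma U_cont: "continuous_on UNIV U" unfolding U_def[abs_def]
 by (intro continuous_on_mult continuous_on_const TTp_cont Zp_cont q_pos)

lemma PZ_cont: "0 < e ==> continuous_on UNIV (%z. Psi q e (Zr z))" "0 < e ==> continuous_on UNIV (%z. Psi' q e (Zr z))"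
 by (rule continuous_on_compose2[OF Psi_cont Zr_cont], auto)
   (rule continuous_on_compose2[OF Psi'_cont Zr_cont], auto)

lemma uet_cont: "0 < e ==> continuous_on UNIV (uet e)" unfolding uet_def[abs_def]
 by (intro continuous_on_mult continuous_on_add continuous_on_const TTp_cont PZ_cont dem_cont)

lemma line_shift: "fst (z + t *. (0, 1)) = fst z" "snd (z + t *. (b, 0)) = snd z" "fst (z + t *. (b, 0)) = fst z + t *. b"
 for z :: "'a \<times> real" by simp_all

lemma cont_meas: "continuous_on UNIV f ==> (%z. indicator S_infty z * f z) \<in> meas" for f :: "'a \<times> real => real"
 using continuous_measurable[of f] by measurable

lemma time_ibp:
 assumes c [measurable]: "c \<in> meas" and cR: "!!x :: 'a. \<bar>c x\<bar> <= R" and e: "0 < e" and \<phi>: "test_fun \<phi>"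
 shows "S_integrable (%z. c (fst z) * (Cs * TT z powr (- k) * Psi q e (Zr z)) * pd (0, 1) \<phi> z)"
  "S_integrable (%z. c (fst z) * uet e z * \<phi> z)"
  "(LIS z. c (fst z) * (Cs * TT z powr (- k) * Psi q e (Zr z)) * pd (0, 1) \<phi> z)
   = - (LIS z. c (fst z) * uet e z * \<phi> z)"
proof -
 let ?a = "%z. c (fst z) * (Cs * TT z powr (- k) * Psi q e (Zr z))"
 let ?a' = "%z. c (fst z) * uet e z"
 have cf: "(%z :: 'a \<times> real. c (fst z)) \<in> meas"
  by (rule measurable_compose[OF continuous_measurable[OF fst_snd_cont(2)] c])
 have LDa: "LD (0, 1) ?a"
  by (rule LD_mult[OF LD_space[OF cR] LD_mult[OF LD_mult[OF LD_const TTp_LD[OF Basis_t]] LD_compose[OF Zr_LD[OF Basis_t] Psi_lip[OF e]]]])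
 have ma: "(%z. indicator S_infty z * ?a z) \<in> meas"
  and ma': "(%z. indicator S_infty z * ?a' z) \<in> meas"
  using cf continuous_measurable[OF TTp_cont[of "- k"]] continuous_measurable[OF PZ_cont(1)[OF e]]
   continuous_measurable[OF uet_cont[OF e]]
  by measurable
 have der: "AE z in lborel. z \<in> S_infty --> ((%t. ?a (z + t *. (0, 1))) has_real_derivative ?a' z) (at 0)"
 proof (intro AE_I2 impI)
  fix z :: "'a \<times> real" assume "z \<in> S_infty"
  then have z: "0 < snd z" by (simp add: mem_S)
  have d1: "((%t. Psi q e (Zr (z + t *. (0, 1)))) has_real_derivative Psi' q e (Zr z) * de (snd z)) (at 0)"
   by (rule DERIV_chain2[OF _ Zr_time_deriv[OF z]]) (use Psi_deriv[OF e] in simp)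
  from DERIV_cmult[OF DERIV_mult[OF DERIV_cmult[OF TTp_time_deriv[OF z, of "- k"], of Cs] d1], of "c (fst z)"]
  show "((%t. ?a (z + t *. (0, 1))) has_real_derivative ?a' z) (at 0)"
   unfolding line_shift(1) using z by (simp add: uet_def algebra_simps)
 qed
 show "S_integrable (%z. ?a z * pd (0, 1) \<phi> z)"
  "S_integrable (%z. ?a' z * \<phi> z)"
  "(LIS z. ?a z * pd (0, 1) \<phi> z) = - (LIS z. ?a' z * \<phi> z)"
  using integration_by_parts_test[OF Basis_t LDa ma ma' der \<phi>] .
qed

lemma simple_time_ibp:
 assumes e: "0 < e" and \<phi>: "test_fun \<phi>"
 shows "S_integrable (%z. Psi q e (Zr z) * pd (0, 1) \<phi> z)" (is ?c1)
  "S_integrable (%z. Psi' q e (Zr z) * de (max 0 (snd z)) * \<phi> z)"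
  "(LIS z. Psi q e (Zr z) * pd (0, 1) \<phi> z) = - (LIS z. Psi' q e (Zr z) * de (max 0 (snd z)) * \<phi> z)" (is ?c2)
proof -
 have der: "AE z in lborel. z \<in> S_infty --> ((%t. Psi q e (Zr (z + t *. (0, 1)))) has_real_derivative Psi' q e (Zr z) * de (max 0 (snd z))) (at 0)"
 proof (intro AE_I2 impI)
  fix z :: "'a \<times> real" assume "z \<in> S_infty"
  then have z: "0 < snd z" by (simp add: mem_S)
  have "((%t. Psi q e (Zr (z + t *. (0, 1)))) has_real_derivative Psi' q e (Zr z) * de (snd z)) (at 0)"
   by (rule DERIV_chain2[OF _ Zr_time_deriv[OF z]]) (use Psi_deriv[OF e] in simp)
  then show "((%t. Psi q e (Zr (z + t *. (0, 1)))) has_real_derivative Psi' q e (Zr z) * de (max 0 (snd z))) (at 0)"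
   using z by simp
 qed
 note I = integration_by_parts_test[OF Basis_t LD_compose[OF Zr_LD[OF Basis_t] Psi_lip[OF e]]
  cont_meas[OF PZ_cont(1)[OF e]] cont_meas[OF continuous_on_mult[OF PZ_cont(2)[OF e] dem_cont]] der \<phi>]
 show ?c1
  "S_integrable (%z. Psi' q e (Zr z) * de (max 0 (snd z)) * \<phi> z)"
  ?c2
  using I by simp_all
qed

definition ep where "ep n = 1 / real (Suc n)" for n
lemma ep: "0 < ep n" "ep n <= 1" "ep ----> 0"
 using LIMSEQ_inverse_real_of_nat by (auto simp: ep_def[abs_def] inverse_eq_divide)

text \<open>The time derivative of the positive part of \<open>Zr\<close> to the power
  \<open>q\<close>, with value 0 where \<open>Zr\<close> is not positive. For \<open>q < 1\<close>
  it may be unbounded at the free boundary.\<close>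

definition hZ where "hZ z = (if 0 < Zr z then q * Zr z powr (q - 1) else 0) * de (max 0 (snd z))"
definition Zb where "Zb z = (max 0 (Zr z) + 1) powr q"

lemma Zb_cont: "continuous_on UNIV Zb"
 unfolding Zb_def[abs_def] by (intro continuous_on_powr continuous_on_add continuous_on_max Zr_cont continuous_on_const) (auto simp: max_def)

lemma de_nonneg: "0 <= de (max 0 t)" using de_pos[of "max 0 t"] by simp

lemma hZ_nonneg: "0 <= hZ z" using q_pos de_nonneg by (simp add: hZ_def)

lemma hZ_lim: "(%n. Psi' q (ep n) (Zr z) * de (max 0 (snd z))) ----> hZ z"
 unfolding hZ_def by (intro tendsto_mult tendsto_const Psi_tendsto(2) ep q_pos)

text \<open>The regularised derivatives are nonnegative because the front moves outward. Against a
  nonnegative cut-off their integrals are bounded by transferring the derivative to the cut-off,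
  where only \<open>Psi\<close> itself occurs. Fatou's lemma then gives integrability of the
  limit.\<close>

lemma hZ_loc_int: "locally_integrable hZ"
 unfolding locally_integrable_def
proof (intro allI impI)
 fix K :: "('a \<times> real) set" assume K: "compact K \<and> K \<subseteq> S_infty"
 obtain r t1 t2 where B: "0 < t1" "K \<subseteq> Bx r t1 t2" using compact_in_Bx[of K] K by metis
 obtain \<eta> :: "'a \<times> real => real" where \<eta>: "test_fun \<eta>" "!!z. 0 <= \<eta> z" "!!z. z \<in> Bx r t1 t2 ==> \<eta> z = 1"
  using test_cutoff_exists[OF B(1)] by metis
 have t\<eta>: "test_fun (pd (0, 1) \<eta>)" by (rule test_fun_pd[OF \<eta>(1) Basis_t])
 have Ib: "S_integrable (%z. pd (0, 1) \<eta> z *. Zb z)"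
  by (rule loc_int_test[OF cont_loc_int[OF Zb_cont] t\<eta>])
 define C where "C = (LI z. norm (indicator S_infty z *. (pd (0, 1) \<eta> z *. Zb z)))"
 have "S_integrable (%z. hZ z * \<eta> z)"
 proof (rule integrable_Fatou[where C = C])
  show "S_integrable (%z. Psi' q (ep n) (Zr z) * de (max 0 (snd z)) * \<eta> z)" for n
   by (rule simple_time_ibp(2)[OF ep(1) \<eta>(1)])
  show "0 <= indicator S_infty z *. (Psi' q (ep n) (Zr z) * de (max 0 (snd z)) * \<eta> z)" for n z
   using Psi_bounds(3)[OF ep(1,2) q_pos] de_nonneg \<eta>(2) by (auto intro!: mult_nonneg_nonneg)
  show "(LI z. indicator S_infty z *. (Psi' q (ep n) (Zr z) * de (max 0 (snd z)) * \<eta> z)) <= C" for n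
  proof -
   have "(LI z. indicator S_infty z *. (Psi' q (ep n) (Zr z) * de (max 0 (snd z)) * \<eta> z))
    = - (LI z. indicator S_infty z *. (Psi q (ep n) (Zr z) * pd (0, 1) \<eta> z))"
    using simple_time_ibp(3)[OF ep(1) \<eta>(1)] by (simp add: set_lebesgue_integral_def)
   also have "... <= norm (LI z. indicator S_infty z *. (Psi q (ep n) (Zr z) * pd (0, 1) \<eta> z))" by simp
   also have "... <= C" unfolding C_def
   proof (rule Bochner_Integration.integral_norm_bound_integral[OF simple_time_ibp(1)[OF ep(1) \<eta>(1)] integrable_norm[OF Ib]])
    fix z :: "'a \<times> real"
    have "\<bar>Psi q (ep n) (Zr z)\<bar> <= \<bar>Zb z\<bar>" using Psi_bounds(1,2)[OF ep(1,2) q_pos] by (simp add: Zb_def)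
    then have "\<bar>Psi q (ep n) (Zr z)\<bar> * \<bar>pd (0, 1) \<eta> z\<bar> <= \<bar>Zb z\<bar> * \<bar>pd (0, 1) \<eta> z\<bar>" by (rule mult_right_mono) simp
    then show "norm (indicator S_infty z *. (Psi q (ep n) (Zr z) * pd (0, 1) \<eta> z)) <= norm (indicator S_infty z *. (pd (0, 1) \<eta> z *. Zb z))"
     by (cases "z \<in> S_infty") (simp_all add: abs_mult mult.commute)
   qed
   finally show ?thesis .
  qed
  show "(%n. indicator S_infty z *. (Psi' q (ep n) (Zr z) * de (max 0 (snd z)) * \<eta> z)) ----> indicator S_infty z *. (hZ z * \<eta> z)" for z
   by (intro tendsto_scaleR tendsto_const tendsto_mult[OF hZ_lim tendsto_const])
 qed
 then have i: "set_integrable lborel S_infty (%z. hZ z * \<eta> z)" by (simp add: set_integrable_def)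
 have Ks: "K \<in> sets borel" using K compact_imp_closed borel_closed by blast
 have "set_integrable lborel K (%z. hZ z * \<eta> z)" by (rule set_integrable_subset[OF i]) (use K Ks in auto)
 moreover have "hZ z * \<eta> z = hZ z" if "z \<in> K" for z using \<eta>(3)[of z] B(2) that by auto
 ultimately show "set_integrable lborel K hZ" by (simp cong: set_integrable_cong)
qed

text \<open>Once \<open>hZ\<close> is known to be locally integrable, this majorant is free of
  \<open>n\<close> and serves both ranges of \<open>q\<close>: the first term for \<open>q\<close>
  at least 1, the second for smaller \<open>q\<close>.\<close>

lemma Psi'_dom: "Psi' q (ep n) (Zr z) * de (max 0 (snd z)) <= max q 2 * (max 0 (Zr z) + 1) powr (q - 1) * de (max 0 (snd z)) + (2 / q) * hZ z"
proof -
 have x: "0 <= max q 2 * (max 0 (Zr z) + 1) powr (q - 1)" by simp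
 have "Psi' q (ep n) (Zr z) <= max q 2 * (max 0 (Zr z) + 1) powr (q - 1) + (2 / q) * (if 0 < Zr z then q * Zr z powr (q - 1) else 0)"
 proof (cases "1 <= q")
  case True
  have "0 <= (2 / q) * (if 0 < Zr z then q * Zr z powr (q - 1) else 0)" using q_pos by simp
  then show ?thesis using Psi_bounds(7)[OF ep(1,2) q_pos True, of n "Zr z"] by linarith
 next
  case False
  show ?thesis
  proof (cases "0 < Zr z")
   case True
   have P: "Psi' q (ep n) (Zr z) <= 2 * Zr z powr (q - 1)"
    by (rule Psi_bounds(8)[OF ep(1,2) q_pos _ True]) (use False in simp)
   have e: "(2 / q) * (if 0 < Zr z then q * Zr z powr (q - 1) else 0) = 2 * Zr z powr (q - 1)" using True q_pos by simp
   show ?thesis unfolding e using P x by linarith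
  next
   case False
   then show ?thesis using Psi_bounds(6)[OF ep(1,2) q_pos, of "Zr z" n] x by simp
  qed
 qed
 from mult_right_mono[OF this de_nonneg[of "snd z"]] show ?thesis by (simp add: hZ_def algebra_simps)
qed

lemma weak_dt_U: "weak_dt U ut"
proof -
 have utl: "(%n. uet (ep n) z) ----> ut z" for z
  unfolding uet_def ut_def hZ_def[symmetric]
  by (intro tendsto_add tendsto_mult[OF tendsto_const] Psi_tendsto(1) hZ_lim ep q_pos)
 define W where "W z = Cs * k * TT z powr (- k - 1) * Zb z + Cs * TT z powr (- k) * (max q 2 * (max 0 (Zr z) + 1) powr (q - 1) * de (max 0 (snd z)))
  + (Cs * (2 / q)) * hZ z" for z
 have Wc: "continuous_on UNIV (%z. Cs * k * TT z powr (- k - 1) * Zb z + Cs * TT z powr (- k) * (max q 2 * (max 0 (Zr z) + 1) powr (q - 1) * de (max 0 (snd z))))"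
  by (intro continuous_on_mult continuous_on_add continuous_on_const TTp_cont Zb_cont dem_cont continuous_on_powr continuous_on_max Zr_cont)
    (auto simp: max_def)
 have Wi: "locally_integrable W" unfolding W_def
  by (rule loc_int_add[OF cont_loc_int[OF Wc] loc_int_cmult[OF hZ_loc_int]])
 have Wb: "\<bar>uet (ep n) z\<bar> <= W z" for n z
 proof -
  have T1: "TT z powr (- k) <= 1" using TT_ge(2)[of z] k_pos powr_mono[of "- k" 0 "TT z"] by simp
  have P: "0 <= Psi' q (ep n) (Zr z) * de (max 0 (snd z))" "0 <= Psi q (ep n) (Zr z)" "Psi q (ep n) (Zr z) <= Zb z"
   using Psi_bounds(1,2,3)[OF ep(1,2) q_pos] de_nonneg by (simp_all add: Zb_def)
  have "Cs * TT z powr (- k) * (Psi' q (ep n) (Zr z) * de (max 0 (snd z)))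
   <= Cs * TT z powr (- k) * (max q 2 * (max 0 (Zr z) + 1) powr (q - 1) * de (max 0 (snd z)) + (2 / q) * hZ z)"
   using Psi'_dom Cs by (intro mult_left_mono) auto
  also have "... = Cs * TT z powr (- k) * (max q 2 * (max 0 (Zr z) + 1) powr (q - 1) * de (max 0 (snd z))) + TT z powr (- k) * ((Cs * (2 / q)) * hZ z)"
   by (simp add: algebra_simps)
  also have "TT z powr (- k) * ((Cs * (2 / q)) * hZ z) <= 1 * ((Cs * (2 / q)) * hZ z)"
   using T1 Cs q_pos hZ_nonneg by (intro mult_right_mono) auto
  finally have a: "Cs * TT z powr (- k) * (Psi' q (ep n) (Zr z) * de (max 0 (snd z))) <=
   Cs * TT z powr (- k) * (max q 2 * (max 0 (Zr z) + 1) powr (q - 1) * de (max 0 (snd z))) + (Cs * (2 / q)) * hZ z" by simp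
  have a0: "0 <= Cs * TT z powr (- k) * (Psi' q (ep n) (Zr z) * de (max 0 (snd z)))" using P(1) Cs by simp
  have b: "Cs * k * TT z powr (- k - 1) * Psi q (ep n) (Zr z) <= Cs * k * TT z powr (- k - 1) * Zb z"
   using P Cs k_pos by (intro mult_left_mono) auto
  have b0: "0 <= Cs * k * TT z powr (- k - 1) * Psi q (ep n) (Zr z)" using P Cs k_pos by simp
  have "uet (ep n) z = - (Cs * k * TT z powr (- k - 1) * Psi q (ep n) (Zr z)) + Cs * TT z powr (- k) * (Psi' q (ep n) (Zr z) * de (max 0 (snd z)))"
   by (simp add: uet_def)
  then show ?thesis using a a0 b b0 unfolding W_def by linarith
 qed
 have utm: "ut \<in> borel_measurable lborel"
  by (rule borel_measurable_LIMSEQ_real[OF utl]) (use continuous_measurable[OF uet_cont[OF ep(1)]] in simp)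
 have uti: "locally_integrable ut"
 proof (rule loc_int_bound[OF _ Wi])
  show "set_borel_measurable lborel S_infty ut" unfolding set_borel_measurable_def using utm by measurable
  show "norm (ut z) <= W z" for z
   using LIMSEQ_le_const2[OF tendsto_rabs[OF utl[of z]], of "W z"] Wb by auto
 qed
 show ?thesis unfolding weak_dt_dir weak_dir_def
 proof (intro conjI allI impI)
  show "locally_integrable U" by (rule cont_loc_int[OF U_cont])
  show "locally_integrable ut" by (rule uti)
  fix \<phi> :: "'a \<times> real => real" assume \<phi>: "test_fun \<phi>"
  have \<phi>': "test_fun (pd (0, 1) \<phi>)" by (rule test_fun_pd[OF \<phi> Basis_t])
  obtain r t1 t2 where B: "0 < t1" "!!z. z \<notin> Bx r t1 t2 ==> \<phi> z = 0" using test_fun_supp[OF \<phi>] by metis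
  obtain r' s1 s2 where B': "0 < s1" "!!z. z \<notin> Bx r' s1 s2 ==> pd (0, 1) \<phi> z = 0" using test_fun_supp[OF \<phi>'] by metis
  obtain M where M: "!!z. \<bar>\<phi> z\<bar> <= M" using test_fun_bounded[OF \<phi>] by metis
  obtain M' where M': "!!z. \<bar>pd (0, 1) \<phi> z\<bar> <= M'" using test_fun_bounded[OF \<phi>'] by metis
  have "(%n. LIS z. uet (ep n) z * \<phi> z) ----> (LIS z. ut z * \<phi> z)"
   by (rule test_dct(2)[OF cont_meas[OF uet_cont[OF ep(1)]] utl Wi Wb smooth_measurable[OF test_fun_smooth[OF \<phi>]] M B(2) B(1)])
  moreover have "(%n. LIS z. Cs * TT z powr (- k) * Psi q (ep n) (Zr z) * pd (0, 1) \<phi> z) ----> (LIS z. U z * pd (0, 1) \<phi> z)"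
  proof (rule test_dct(2)[OF _ _ _ _ smooth_measurable[OF test_fun_smooth[OF \<phi>']] M' B'(2) B'(1)])
   show "(%z. indicator S_infty z * (Cs * TT z powr (- k) * Psi q (ep n) (Zr z))) \<in> meas" for n
    by (intro cont_meas continuous_on_mult continuous_on_const TTp_cont PZ_cont ep)
   show "(%n. Cs * TT z powr (- k) * Psi q (ep n) (Zr z)) ----> U z" for z
    unfolding U_def by (intro tendsto_mult[OF tendsto_const] Psi_tendsto(1) ep q_pos)
   show "locally_integrable (%z. Cs * TT z powr (- k) * Zb z)"
    by (intro cont_loc_int continuous_on_mult continuous_on_const TTp_cont Zb_cont)
   show "\<bar>Cs * TT z powr (- k) * Psi q (ep n) (Zr z)\<bar> <= Cs * TT z powr (- k) * Zb z" for n z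
    using Psi_bounds(1,2)[OF ep(1,2) q_pos] Cs by (simp add: abs_mult Zb_def mult_left_mono)
  qed
  moreover have "(LIS z. Cs * TT z powr (- k) * Psi q (ep n) (Zr z) * pd (0, 1) \<phi> z) = - (LIS z. uet (ep n) z * \<phi> z)" for n
   using time_ibp(3)[of "%_. 1" 1, OF _ _ ep(1) \<phi>] by simp
  ultimately have "(%n. - (LIS z. uet (ep n) z * \<phi> z)) ----> (LIS z. U z * pd (0, 1) \<phi> z)"
   "(%n. - (LIS z. uet (ep n) z * \<phi> z)) ----> - (LIS z. ut z * \<phi> z)"
   by (simp_all add: tendsto_minus)
  then show "(LIS z. U z * pd (0, 1) \<phi> z) = - (LIS z. ut z * \<phi> z)" by (rule LIMSEQ_unique)
 qed
qed

end

lemma weak_grad_xI: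
 fixes D :: "'a::euclidean_space \<times> real => 'a"
 assumes w: "locally_integrable w" and D: "locally_integrable D"
  and dir: "!!b \<phi>. b \<in> Basis ==> test_fun \<phi> ==>
   (LIS z. w z * pd (b, 0) \<phi> z) = - (LIS z. (D z \<bullet> b) * \<phi> z)"
 shows "weak_grad_x w D"
 unfolding weak_grad_x_def
proof (intro conjI allI impI w D)
 fix \<phi> :: "'a \<times> real => real" assume \<phi>: "test_fun \<phi>"
 obtain r t1 t2 where B: "0 < t1" "!!z. z \<notin> Bx r t1 t2 ==> \<phi> z = 0" using test_fun_supp[OF \<phi>] by metis
 obtain M where M: "!!z. norm (grad_x \<phi> z) <= M" using grad_x_bounded[OF \<phi>] by metis
 have i1: "S_integrable (%z. w z *. grad_x \<phi> z)"
 proof -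
  have e: "indicator S_infty z *. (w z *. grad_x \<phi> z) = (\<Sum>b\<in>Basis. (indicator S_infty z *. (pd (b, 0) \<phi> z *. w z)) *. b)" for z
   unfolding grad_x_def by (simp add: scaleR_sum_right mult_ac)
  show ?thesis unfolding e
   by (intro Bochner_Integration.integrable_sum integrable_scaleR_left impI loc_int_test[OF w] test_fun_pd[OF \<phi>] Basis_x)
 qed
 have i2: "S_integrable (%z. \<phi> z *. D z)" by (rule loc_int_test[OF D \<phi>])
 show "(LIS z. w z *. grad_x \<phi> z) = - (LIS z. \<phi> z *. D z)"
 proof (rule euclidean_eqI)
  fix b :: 'a assume b: "b \<in> Basis"
  have "(LIS z. w z *. grad_x \<phi> z) \<bullet> b = (LIS z. w z * pd (b, 0) \<phi> z)"
   unfolding set_lebesgue_integral_def integral_inner_left[OF i1, symmetric]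
   by (simp add: grad_x_inner[OF b] mult.assoc)
  moreover have "(LIS z. \<phi> z *. D z) \<bullet> b = (LIS z. (D z \<bullet> b) * \<phi> z)"
   unfolding set_lebesgue_integral_def integral_inner_left[OF i2, symmetric]
   by (simp add: mult_ac)
  ultimately show "(LIS z. w z *. grad_x \<phi> z) \<bullet> b = (- (LIS z. \<phi> z *. D z)) \<bullet> b"
   using dir[OF b \<phi>] by (simp add: inner_minus_left)
 qed
qed

lemma derivative_as_sequence:
 fixes f :: "real => real"
 assumes "(f has_real_derivative D) (at 0)"
 shows "(%n. real (Suc n) * (f (inverse (real (Suc n))) - f 0)) ----> D"
proof -
 have "((%h. (f h - f 0) / h) \<longlongrightarrow> D) (at 0)" using assms by (simp add: has_field_derivative_iff)
 moreover have "filterlim (%n. inverse (real (Suc n))) (at 0) sequentially"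
  by (rule filterlim_atI[OF LIMSEQ_inverse_real_of_nat]) simp
 ultimately have "(%n. (f (inverse (real (Suc n))) - f 0) / inverse (real (Suc n))) ----> D" by (rule filterlim_compose)
 then show ?thesis by (simp add: divide_inverse mult.commute del: of_nat_Suc)
qed

section \<open>Spatial gradient and flux of the barrier, and the pointwise inequality\<close>

context spacetime
begin

definition \<sigma> where "\<sigma> = sigma p m"
text \<open>This is \<open>U^\<sigma>\<close>, as \<open>WW_eq\<close> confirms. Since
  \<open>q \<sigma> = 1 + k\<close> exceeds 1, this power of \<open>Zr\<close> is continuously
  differentiable across the free boundary even when \<open>U\<close> is not.\<close>

definition WW where "WW z = Cs powr \<sigma> * TT z powr (- k * \<sigma>) * max 0 (Zr z) powr (1 + k)"
definition DD where "DD z = - (Cs powr \<sigma> * TT z powr (- k * \<sigma>) * ((1 + k) * max 0 (Zr z) powr k)) *. dY (fst z)"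

lemma sig: "0 < \<sigma>" "q * \<sigma> = 1 + k" "\<sigma> * (p - 1) = p + m - 2" "k * \<sigma> * (p - 1) = 1 + k" "(1 + k) / \<sigma> = q"
proof -
 show s: "0 < \<sigma>" using sigma_pos[OF p1 pm] by (simp add: \<sigma>_def)
 have k1: "k * (p + m - 3) = 1" using pm by (simp add: k_def)
 show a: "\<sigma> * (p - 1) = p + m - 2" using p1 by (simp add: \<sigma>_def sigma_def)
 have b: "k * (p + m - 2) = 1 + k" using k1 by (simp add: algebra_simps)
 show "k * \<sigma> * (p - 1) = 1 + k" using a b by (simp only: mult.assoc)
 then show c: "q * \<sigma> = 1 + k" by (simp add: q_k mult_ac)
 show "(1 + k) / \<sigma> = q" using c s by (simp add: field_simps)
qed

lemma U_nonneg: "0 <= U z" using Cs by (simp add: U_def)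

lemma WW_eq: "U z powr \<sigma> = WW z"
 unfolding U_def WW_def by (simp only: powr_mult powr_powr sig(2))

lemma WW_cont: "continuous_on UNIV WW" unfolding WW_def[abs_def]
 by (intro continuous_on_mult continuous_on_const TTp_cont Zp_cont) (use k_pos in simp)

text \<open>The exponents combine as \<open>\<sigma> (p - 1) = p + m - 2\<close> for
  \<open>Cs\<close>, \<open>k \<sigma> (p - 1) = 1 + k\<close> for time and
  \<open>k (p - 1) = q\<close> for \<open>Zr\<close>. The numerical factor
  \<open>((1 + k) / \<sigma>)^(p-1)\<close> becomes \<open>q^(p-1)\<close> inside \<open>B\<close>.
  The sign is negative because \<open>Zr\<close> decreases with \<open>|x|\<close>.\<close>

lemma pflux_DD: "pflux \<sigma> p (DD z) = (- (B * TT z powr (- 1 - k) * max 0 (Zr z) powr q)) *. Mv (fst z)"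
proof -
 define x where "x = fst z"
 define c where "c = Cs powr \<sigma> * TT z powr (- k * \<sigma>) * ((1 + k) * max 0 (Zr z) powr k)"
 have c0: "0 <= c" using k_pos by (simp add: c_def)
 have D: "DD z = (- c) *. dY x" by (simp add: DD_def c_def x_def)
 have cp: "\<sigma> powr (1 - p) * c powr (p - 1) = B * TT z powr (- 1 - k) * max 0 (Zr z) powr q"
 proof -
  have "c powr (p - 1) = Cs powr (\<sigma> * (p - 1)) * TT z powr (- k * \<sigma> * (p - 1)) * ((1 + k) powr (p - 1) * max 0 (Zr z) powr (k * (p - 1)))"
   unfolding c_def powr_mult powr_powr ..
  also have "- k * \<sigma> * (p - 1) = - 1 - k" using sig(4) by simp
  also have "k * (p - 1) = q" using q_k by simp
  finally have 1: "c powr (p - 1) = Cs powr (p + m - 2) * TT z powr (- 1 - k) * ((1 + k) powr (p - 1) * max 0 (Zr z) powr q)"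
   unfolding sig(3) .
  have "\<sigma> powr (1 - p) = inverse (\<sigma> powr (p - 1))" using powr_minus[of \<sigma> "p - 1"] by simp
  then have "\<sigma> powr (1 - p) * (1 + k) powr (p - 1) = ((1 + k) / \<sigma>) powr (p - 1)"
   using powr_divide[of "1 + k" \<sigma> "p - 1"] sig(1) k_pos by (simp add: divide_inverse mult.commute)
  then have 2: "\<sigma> powr (1 - p) * (1 + k) powr (p - 1) = q powr (p - 1)" unfolding sig(5) .
  have "\<sigma> powr (1 - p) * c powr (p - 1) = Cs powr (p + m - 2) * (\<sigma> powr (1 - p) * (1 + k) powr (p - 1)) * TT z powr (- 1 - k) * max 0 (Zr z) powr q"
   unfolding 1 by (simp add: mult_ac)
  then show ?thesis unfolding 2 B_def .
 qed
 have n: "norm (DD z) = c * norm (dY x)" using c0 by (simp add: D)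
 show ?thesis
 proof (cases "c = 0 \<or> dY x = 0")
  case True
  then have "DD z = 0" by (auto simp: D)
  moreover have "(- (B * TT z powr (- 1 - k) * max 0 (Zr z) powr q)) *. Mv x = 0"
  proof (cases "c = 0")
   case True
   then show ?thesis unfolding cp[symmetric] using p1 by simp
  next
   case False
   then have "aa (norm x) = 0" using norm_dY_powr[of x] True p1 by simp
   then show ?thesis by (simp add: Mv_def)
  qed
  ultimately show ?thesis by (simp add: pflux_def x_def)
 next
  case False
  then have x: "x ~= 0" by (auto simp: dY_def)
  define y where "y = norm (dY x)"
  have y: "0 < y" using False by (simp add: y_def)
  have dYx: "dY x = (y / norm x) *. x" by (simp add: dY_def y_def norm_dY)
  have ya: "y * y powr (p - 2) = aa (norm x)" using norm_dY_powr[of x] powr_mult_base[of y "p - 2"] y by (simp add: y_def)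
  have ca: "c * c powr (p - 2) = c powr (p - 1)" using powr_mult_base[of c "p - 2"] c0 False by simp
  have "pflux \<sigma> p (DD z) = (\<sigma> powr (1 - p) * (c powr (p - 2) * y powr (p - 2))) *. (- c) *. (y / norm x) *. x"
   unfolding pflux_def n y_def[symmetric] powr_mult unfolding D dYx ..
  also have "... = (- (\<sigma> powr (1 - p) * (c * c powr (p - 2)))) *. ((y * y powr (p - 2)) / norm x) *. x"
   by (simp add: mult_ac)
  also have "... = (- (B * TT z powr (- 1 - k) * max 0 (Zr z) powr q)) *. Mv x"
   unfolding ca ya cp by (simp add: Mv_def)
  finally show ?thesis by (simp add: x_def)
 qed
qed

text \<open>The derivative formulas may fail at the origin and on the sphere where the two branches
  of the profile meet. Both are null sets in every time slice.\<close>

lemma AE_good: "AE z in (lborel :: ('a \<times> real) measure). z \<in> S_infty --> fst z ~= 0 \<and> rhat (norm (fst z)) ~= r0"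
proof -
 obtain s0 where s0: "!!s. 0 <= s ==> rhat s = r0 ==> s = s0" using rhat_inj by metis
 have "AE z in lborel. z \<in> S_infty --> (fst z ~= (0::'a) \<and> norm (fst z) ~= s0)"
 proof (rule AE_S_slices)
  have [measurable]: "fst \<in> borel_measurable (borel :: ('a \<times> real) measure)"
   by (rule continuous_measurable[OF fst_snd_cont(2)])
  show "{z :: 'a \<times> real. fst z ~= 0 \<and> norm (fst z) ~= s0} \<in> sets borel" by measurable
  have n: "sphere 0 s0 \<in> null_sets (lborel :: 'a measure)"
   using negligible_sphere[of "0::'a" s0] by (simp add: negligible_iff_null_sets null_sets_completion_iff borel_closed)
  show "AE x in lborel. fst (x, t) ~= (0::'a) \<and> norm (fst (x, t)) ~= s0" for t :: real
   using AE_not_in[OF n] AE_lborel_singleton[of "0::'a"] by eventually_elim auto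
 qed
 then show ?thesis using s0 by (auto elim!: eventually_mono)
qed

lemma TT_space: "TT (z + t *. (b, 0)) = TT z" by (simp add: TT_def)

lemma dY_fst_measurable: "(%z :: 'a \<times> real. dY (fst z)) \<in> meas"
 by (rule measurable_compose[OF continuous_measurable[OF fst_snd_cont(2)] dY_measurable])

lemma DD_measurable: "DD \<in> meas"
proof -
 have "continuous_on UNIV (%z. - (Cs powr \<sigma> * TT z powr (- k * \<sigma>) * ((1 + k) * max 0 (Zr z) powr k)))"
  by (intro continuous_on_minus continuous_on_mult continuous_on_const TTp_cont Zp_cont k_pos)
 then show ?thesis unfolding DD_def[abs_def]
  by (rule borel_measurable_scaleR[OF continuous_measurable dY_fst_measurable])
qed

lemma DD_bounded: "\<exists>M\<ge>0. \<forall>z\<in>Bx r t1 t2. norm (DD z) <= M"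
proof -
 have c: "continuous_on UNIV (%z. Cs powr \<sigma> * TT z powr (- k * \<sigma>) * ((1 + k) * max 0 (Zr z) powr k))"
  by (intro continuous_on_mult continuous_on_const TTp_cont Zp_cont k_pos)
 obtain M where M: "M >= 0" "!!z. z \<in> Bx r t1 t2 ==> norm (Cs powr \<sigma> * TT z powr (- k * \<sigma>) * ((1 + k) * max 0 (Zr z) powr k)) <= M"
  using cont_bounded_Bx[OF c] by metis
 show ?thesis
 proof (intro exI[of _ "M * (A0 * r) powr (1 / (p - 1))"] conjI ballI)
  fix z :: "'a \<times> real" assume z: "z \<in> Bx r t1 t2"
  have d: "norm (dY (fst z)) <= (A0 * r) powr (1 / (p - 1))" by (rule norm_dY_le) (use z in "simp add: mem_Bx")
  have "norm (DD z) = norm (Cs powr \<sigma> * TT z powr (- k * \<sigma>) * ((1 + k) * max 0 (Zr z) powr k)) * norm (dY (fst z))"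
   unfolding DD_def norm_scaleR by simp
  also have "... <= M * (A0 * r) powr (1 / (p - 1))" by (rule mult_mono[OF M(2)[OF z] d M(1)]) simp
  finally show "norm (DD z) <= M * (A0 * r) powr (1 / (p - 1))" .
 qed (use M in simp)
qed

lemma weak_grad_WW: "weak_grad_x WW DD"
proof (rule weak_grad_xI)
 show "locally_integrable WW" by (rule cont_loc_int[OF WW_cont])
 show "locally_integrable DD"
 proof (rule loc_int_bounded)
  show "set_borel_measurable lborel S_infty DD" unfolding set_borel_measurable_def using DD_measurable by measurable
  show "\<exists>M. \<forall>z\<in>Bx r t1 t2. norm (DD z) <= M" for r t1 t2 using DD_bounded by blast
 qed
 fix b :: 'a and \<phi> :: "'a \<times> real => real" assume b: "b \<in> Basis" and \<phi>: "test_fun \<phi>"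
 note bx = Basis_x[OF b]
 have LDa: "LD (b, 0) WW" unfolding WW_def
  by (rule LD_mult[OF LD_mult[OF LD_const TTp_LD[OF bx]] LD_compose[OF Zr_LD[OF bx] powr_pos_part_lip[OF k_pos]]])
 have m: "(%z. indicator S_infty z * (DD z \<bullet> b)) \<in> meas" using DD_measurable by measurable
 have der: "AE z in lborel. z \<in> S_infty --> ((%t. WW (z + t *. (b, 0))) has_real_derivative DD z \<bullet> b) (at 0)"
  using AE_good
 proof (rule eventually_mono, intro impI)
  fix z :: "'a \<times> real" assume "z \<in> S_infty --> fst z ~= 0 \<and> rhat (norm (fst z)) ~= r0" "z \<in> S_infty"
  then have z: "fst z ~= 0" by simp
  have d1: "((%t. max 0 (Zr (z + t *. (b, 0))) powr (1 + k)) has_real_derivative (1 + k) * max 0 (Zr z) powr k * - (dY (fst z) \<bullet> b)) (at 0)"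
   by (rule DERIV_chain2[OF _ Zr_space_deriv[OF z]]) (use powr_pos_part_deriv[OF k_pos] in simp)
  show "((%t. WW (z + t *. (b, 0))) has_real_derivative DD z \<bullet> b) (at 0)"
   unfolding WW_def TT_space using DERIV_cmult[OF d1, of "Cs powr \<sigma> * TT z powr (- k * \<sigma>)"] by (simp add: DD_def mult_ac)
 qed
 show "(LIS z. WW z * pd (b, 0) \<phi> z) = - (LIS z. (DD z \<bullet> b) * \<phi> z)"
  by (rule integration_by_parts_test(3)[OF bx LDa cont_meas[OF WW_cont] m der \<phi>])
qed

lemma DD_p_loc_int: "locally_integrable (%z. norm (DD z) powr p)"
proof (rule loc_int_bounded)
 show "set_borel_measurable lborel S_infty (%z. norm (DD z) powr p)"
  unfolding set_borel_measurable_def using DD_measurable by measurable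
 fix r t1 t2 :: real
 obtain M where M: "M >= 0" "!!z. z \<in> Bx r t1 t2 ==> norm (DD z) <= M" using DD_bounded by metis
 show "\<exists>M. \<forall>z\<in>Bx r t1 t2. norm (norm (DD z) powr p) <= M"
  by (rule exI[of _ "M powr p"]) (use M p1 in "auto intro!: powr_mono2")
qed

text \<open>The directional derivative is taken as a limit along the steps
  \<open>1 / (n + 1)\<close>, which makes it Borel on the whole space whether or not the derivative
  exists everywhere.\<close>

definition mvd where "mvd b x = lim (%n. real (Suc n) * (Mv (x + inverse (real (Suc n)) *. b) \<bullet> b - Mv x \<bullet> b))" for b x :: 'a

lemma mvd_measurable [measurable]: "mvd b \<in> meas"
 unfolding mvd_def[abs_def]
proof (rule borel_measurable_lim_metric)
 fix n
 have "continuous_on UNIV (%x. Mv (x + inverse (real (Suc n)) *. b))"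
  by (rule continuous_on_compose2[OF Mv_cont]) (auto intro!: continuous_intros)
 then show "(%x. real (Suc n) * (Mv (x + inverse (real (Suc n)) *. b) \<bullet> b - Mv x \<bullet> b)) \<in> meas"
  by (intro continuous_measurable continuous_on_mult continuous_on_const continuous_on_diff continuous_on_inner Mv_cont)
qed

lemma mvd_eq: assumes x: "x ~= 0" "rhat (norm x) ~= r0"
 shows "mvd b x = (daa (norm x) / norm x - aa (norm x) / (norm x)\<^sup>2) * ((x \<bullet> b)\<^sup>2 / norm x) + aa (norm x) / norm x * (b \<bullet> b)"
 unfolding mvd_def using derivative_as_sequence[OF Mv_space_deriv[OF x, of b]] by (simp add: limI del: of_nat_Suc)

lemma mvd_deriv: assumes x: "x ~= 0" "rhat (norm x) ~= r0"
 shows "((%t. Mv (x + t *. b) \<bullet> b) has_real_derivative mvd b x) (at 0)"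
 using Mv_space_deriv[OF x] by (simp add: mvd_eq[OF x])

text \<open>The \<open>b\<close>-component of the divergence of the flux with \<open>Psi\<close> in
  place of the power of \<open>Zr\<close>. The minus sign before the product term reflects that the
  gradient of \<open>Zr\<close> is \<open>- dY\<close>.\<close>

definition sdiv where "sdiv e b z = - B * TT z powr (- 1 - k) *
 (Psi q e (Zr z) * mvd b (fst z) - Psi' q e (Zr z) * (dY (fst z) \<bullet> b) * (Mv (fst z) \<bullet> b))" for b z

lemma space_ibp:
 assumes e: "0 < e" and \<phi>: "test_fun \<phi>" and b: "b \<in> Basis"
 shows "S_integrable (%z. (- B * TT z powr (- 1 - k) * (Psi q e (Zr z) * (Mv (fst z) \<bullet> b))) * pd (b, 0) \<phi> z)"
  "S_integrable (%z. sdiv e b z * \<phi> z)" (is ?c1)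
  "(LIS z. (- B * TT z powr (- 1 - k) * (Psi q e (Zr z) * (Mv (fst z) \<bullet> b))) * pd (b, 0) \<phi> z)
   = - (LIS z. sdiv e b z * \<phi> z)"
proof -
 let ?a = "%z. - B * TT z powr (- 1 - k) * (Psi q e (Zr z) * (Mv (fst z) \<bullet> b))"
 note bx = Basis_x[OF b]
 have LDa: "LD (b, 0) ?a"
  by (rule LD_mult[OF LD_mult[OF LD_const TTp_LD[OF bx]] LD_mult[OF LD_compose[OF Zr_LD[OF bx] Psi_lip[OF e]] Mv_LD[OF bx]]])
 have Mc: "continuous_on UNIV (%z :: 'a \<times> real. Mv (fst z) \<bullet> b)"
  by (intro continuous_on_inner continuous_on_const continuous_on_compose2[OF Mv_cont fst_snd_cont(2)]) auto
 have ma: "(%z. indicator S_infty z * ?a z) \<in> meas"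
  by (intro cont_meas continuous_on_mult continuous_on_const TTp_cont PZ_cont e Mc)
 have mf: "(%z :: 'a \<times> real. mvd b (fst z)) \<in> meas"
  by (rule measurable_compose[OF continuous_measurable[OF fst_snd_cont(2)] mvd_measurable])
 have ma': "(%z. indicator S_infty z * sdiv e b z) \<in> meas"
  unfolding sdiv_def
  using mf continuous_measurable[OF Mc] continuous_measurable[OF TTp_cont[of "- 1 - k"]]
   continuous_measurable[OF PZ_cont(1)[OF e]] continuous_measurable[OF PZ_cont(2)[OF e]] dY_fst_measurable
  by measurable
 have der: "AE z in lborel. z \<in> S_infty --> ((%t. ?a (z + t *. (b, 0))) has_real_derivative sdiv e b z) (at 0)"
  using AE_good
 proof (rule eventually_mono, intro impI)
  fix z :: "'a \<times> real" assume "z \<in> S_infty --> fst z ~= 0 \<and> rhat (norm (fst z)) ~= r0" "z \<in> S_infty"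
  then have z: "fst z ~= 0" "rhat (norm (fst z)) ~= r0" by auto
  have d1: "((%t. Psi q e (Zr (z + t *. (b, 0)))) has_real_derivative Psi' q e (Zr z) * - (dY (fst z) \<bullet> b)) (at 0)"
   by (rule DERIV_chain2[OF _ Zr_space_deriv[OF z(1)]]) (use Psi_deriv[OF e] in simp)
  have d2: "((%t. Mv (fst (z + t *. (b, 0))) \<bullet> b) has_real_derivative mvd b (fst z)) (at 0)"
   unfolding line_shift(3) by (rule mvd_deriv[OF z])
  show "((%t. ?a (z + t *. (b, 0))) has_real_derivative sdiv e b z) (at 0)"
   unfolding TT_space using DERIV_cmult[OF DERIV_mult[OF d1 d2], of "- B * TT z powr (- 1 - k)"]
   by (simp add: sdiv_def algebra_simps)
 qed
 show "S_integrable (%z. ?a z * pd (b, 0) \<phi> z)"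
  ?c1
  "(LIS z. ?a z * pd (b, 0) \<phi> z) = - (LIS z. sdiv e b z * \<phi> z)"
  using integration_by_parts_test[OF bx LDa ma ma' der \<phi>] .
qed

text \<open>After removal of the common factor \<open>rp^p TT^(-1-k)\<close> the claim is
  \<open>P' X <= P Y\<close>. It is immediate when \<open>X <= 0\<close>. Otherwise both sides are
  multiplied by \<open>Zr > 0\<close>, and \<open>Zr P' <= Q P\<close> is combined with
  \<open>Q X <= Zr Y\<close>.\<close>

lemma pointwise_sub:
 assumes e: "0 < e" "e <= 1" and z: "z \<in> S_infty" "fst z ~= 0" "rhat (norm (fst z)) ~= r0"
 shows "rx (fst z) * uet e z - (\<Sum>b\<in>Basis. sdiv e b z) <= 0"
proof -
 define s where "s = norm (fst z)"
 define P where "P = Psi q e (Zr z)"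
 define P' where "P' = Psi' q e (Zr z)"
 have s: "0 < s" using z by (simp add: s_def)
 have t: "0 < snd z" using z by (simp add: mem_S)
 have P0: "0 <= P" "0 <= P'" using Psi_bounds(1,3)[OF e q_pos] by (simp_all add: P_def P'_def)
 have S1: "(\<Sum>b\<in>Basis. mvd b (fst z)) = rp s powr p * LL (rhat s)"
  using div_Mv[OF z(2)] by (simp add: mvd_eq[OF z(2,3)] s_def)
 have S2: "(\<Sum>b\<in>Basis. (dY (fst z) \<bullet> b) * (Mv (fst z) \<bullet> b)) = rp s powr p * djf (rhat s) powr p"
  using dY_Mv[OF z(2)] by (simp add: s_def)
 have S: "(\<Sum>b\<in>Basis. sdiv e b z) = - B * TT z powr (- 1 - k) * (P * (rp s powr p * LL (rhat s)) - P' * (rp s powr p * djf (rhat s) powr p))"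
 proof -
  have "(\<Sum>b\<in>Basis. sdiv e b z) = - B * TT z powr (- 1 - k) * (P * (\<Sum>b\<in>Basis. mvd b (fst z)) - P' * (\<Sum>b\<in>Basis. (dY (fst z) \<bullet> b) * (Mv (fst z) \<bullet> b)))"
   unfolding sdiv_def P_def[symmetric] P'_def[symmetric]
   by (simp add: sum_distrib_left sum_subtractf right_diff_distrib mult.assoc sum_negf)
  then show ?thesis unfolding S1 S2 .
 qed
 have Tk: "TT z powr (- k) = TT z * TT z powr (- 1 - k)" using powr_mult_base[of "TT z" "- 1 - k"] TT_ge(3)[of z] by simp
 have Tk': "TT z powr (- k - 1) = TT z powr (- 1 - k)" by (rule arg_cong[of _ _ "%x. TT z powr x"]) simp
 define X where "X = Cs * (TT z * de (snd z)) - B * djf (rhat s) powr p"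
 define Y where "Y = Cs * k - B * LL (rhat s)"
 have eq: "rx (fst z) * uet e z - (\<Sum>b\<in>Basis. sdiv e b z) = rp s powr p * TT z powr (- 1 - k) * (P' * X - P * Y)"
  unfolding S uet_def rx_eq[OF z(2)] s_def[symmetric] P_def[symmetric] P'_def[symmetric] Tk Tk' X_def Y_def
  using t by (simp add: algebra_simps)
 have "P' * X - P * Y <= 0"
 proof (cases "0 < Zr z")
  case False
  then show ?thesis using Psi_bounds(5,6)[OF e q_pos, of "Zr z"] by (simp add: P_def P'_def)
 next
  case True
  have Zr: "Zr z = ee (snd z) - jf (rhat s)" using t by (simp add: Zr_def yy_def s_def)
  have lt: "jf (rhat s) < ee (snd z)" using True Zr by simp
  have TTz: "TT z = snd z + t0" using t by (simp add: TT_def)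
  note key = key_inequality[OF less_imp_le[OF t] rhat_pos[OF s] z(3)[folded s_def] lt]
  have Y0: "0 <= Y" using key(1) by (simp add: Y_def)
  have QX: "Q * X <= Zr z * Y" using key(2) by (simp add: X_def Y_def TTz Zr)
  have ZP: "Zr z * P' <= Q * P" using Psi_bounds(4)[OF e q_pos, of "Zr z"] True by (simp add: P_def P'_def Q_def)
  show ?thesis
  proof (cases "X <= 0")
   case True
   have "P' * X <= 0" "0 <= P * Y" using True P0 Y0 by (auto intro: mult_nonneg_nonpos)
   then show ?thesis by linarith
  next
   case False
   have "Zr z * (P' * X) <= Q * P * X" using mult_right_mono[OF ZP, of X] False by (simp add: mult_ac)
   also have "... <= P * (Zr z * Y)" using mult_left_mono[OF QX P0(1)] by (simp add: mult_ac)
   finally have "Zr z * (P' * X) <= Zr z * (P * Y)" by (simp add: mult_ac)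
   then have "P' * X <= P * Y" using True by simp
   then show ?thesis by simp
  qed
 qed
 then show ?thesis unfolding eq by (intro mult_nonneg_nonpos) auto
qed

text \<open>Both the density term and the flux of the barrier are multiples of the same power of
  \<open>Zr\<close>, so the integrand of the weak form is that power times \<open>cf\<close>.
  Replacing the power by \<open>Psi\<close> is then a linear change.\<close>

definition cf where "cf \<eta> z = - (rx (fst z) * (Cs * TT z powr (- k)) * dt \<eta> z) - B * TT z powr (- 1 - k) * (Mv (fst z) \<bullet> grad_x \<eta> z)" for \<eta> z

lemma approx_sub:
 assumes e: "0 < e" "e <= 1" and \<eta>: "test_fun \<eta>" "!!z. 0 <= \<eta> z"
 shows "(LIS z. Psi q e (Zr z) * cf \<eta> z) <= 0"
proof -
 have RMb: "\<bar>rx x\<bar> <= RM" for x using rx_nonneg[of x] rx_le[of x] by simp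
 note T = time_ibp[OF rx_measurable RMb e(1) \<eta>(1)]
 note S = space_ibp[OF e(1) \<eta>(1)]
 let ?s = "%b z. (- B * TT z powr (- 1 - k) * (Psi q e (Zr z) * (Mv (fst z) \<bullet> b))) * pd (b, 0) \<eta> z"
 let ?t = "%z. rx (fst z) * (Cs * TT z powr (- k) * Psi q e (Zr z)) * pd (0, 1) \<eta> z"
 have eq: "indicator S_infty z *. (Psi q e (Zr z) * cf \<eta> z) = (\<Sum>b\<in>Basis. indicator S_infty z *. ?s b z) - indicator S_infty z *. ?t z" for z
 proof -
  have "Mv (fst z) \<bullet> grad_x \<eta> z = (\<Sum>b\<in>Basis. (Mv (fst z) \<bullet> b) * pd (b, 0) \<eta> z)"
   unfolding grad_x_def inner_sum_right by (simp add: mult.commute)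
  then have "Psi q e (Zr z) * cf \<eta> z = (\<Sum>b\<in>Basis. ?s b z) - ?t z"
   by (simp add: cf_def dt_def sum_distrib_left sum_negf algebra_simps)
  then show ?thesis by (simp only: scaleR_right_diff_distrib scaleR_sum_right)
 qed
 have s3: "(\<Sum>b\<in>Basis. LIS z. ?s b z) = (\<Sum>b\<in>Basis. - (LIS z. sdiv e b z * \<eta> z))"
  by (rule sum.cong[OF refl S(3)])
 have "(LIS z. Psi q e (Zr z) * cf \<eta> z) = (\<Sum>b\<in>Basis. LIS z. ?s b z) - (LIS z. ?t z)"
  unfolding set_lebesgue_integral_def eq
  by (subst Bochner_Integration.integral_diff[OF Bochner_Integration.integrable_sum[OF S(1)] T(1)], assumption)
    (subst Bochner_Integration.integral_sum[OF S(1)], auto)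
 also have "... = (LIS z. rx (fst z) * uet e z * \<eta> z) - (\<Sum>b\<in>Basis. LIS z. sdiv e b z * \<eta> z)"
  unfolding T(3) s3 sum_negf by simp
 also have "... = (LI z. indicator S_infty z *. (rx (fst z) * uet e z * \<eta> z) - (\<Sum>b\<in>Basis. indicator S_infty z *. (sdiv e b z * \<eta> z)))"
  unfolding set_lebesgue_integral_def
  by (subst Bochner_Integration.integral_diff[OF T(2) Bochner_Integration.integrable_sum[OF S(2)]], assumption)
    (subst Bochner_Integration.integral_sum[OF S(2)], auto)
 also have "... <= 0"
 proof -
  let ?f = "%z. indicator S_infty z *. (rx (fst z) * uet e z * \<eta> z) - (\<Sum>b\<in>Basis. indicator S_infty z *. (sdiv e b z * \<eta> z))"
  have "AE z in lborel. indicator S_infty z *. (rx (fst z) * uet e z * \<eta> z) - (\<Sum>b\<in>Basis. indicator S_infty z *. (sdiv e b z * \<eta> z)) <= 0"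
   using AE_good
  proof (rule eventually_mono)
   fix z :: "'a \<times> real" assume z: "z \<in> S_infty --> fst z ~= 0 \<and> rhat (norm (fst z)) ~= r0"
   show "indicator S_infty z *. (rx (fst z) * uet e z * \<eta> z) - (\<Sum>b\<in>Basis. indicator S_infty z *. (sdiv e b z * \<eta> z)) <= 0"
   proof (cases "z \<in> S_infty")
    case True
    have "(rx (fst z) * uet e z - (\<Sum>b\<in>Basis. sdiv e b z)) * \<eta> z <= 0"
     using pointwise_sub[OF e True] z True \<eta>(2) by (intro mult_nonpos_nonneg) auto
    then show ?thesis using True by (simp add: sum_distrib_right left_diff_distrib)
   qed simp
  qed
  then have "AE z in lborel. 0 <= - ?f z" by (rule eventually_mono) linarith
  from integral_nonneg_AE[OF this] show ?thesis by (simp only: Bochner_Integration.integral_minus neg_0_le_iff_le)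
 qed
 finally show ?thesis .
qed

end

section \<open>Solution class, subsolution property and comparison for the barrier\<close>

context spacetime
begin

abbreviation ub :: "'a => real => real" where
 "ub == %x t. u_tilde p m g Cs t0 r0 \<Gamma> (rhat (norm x)) t"

lemma ub_S: "z \<in> S_infty ==> ub (fst z) (snd z) = U z"
 using u_tilde_U[of "snd z" "fst z"] by (simp add: mem_S)

lemma U_support: "\<exists>Rd. \<forall>x t. 0 <= t --> t <= T --> Rd <= norm x --> U (x, t) = 0"
proof -
 obtain s where s: "!!s'. s <= s' ==> RR (max 0 T) <= rhat s'"
  using rhat_top unfolding filterlim_at_top eventually_at_top_linorder by metis
 show ?thesis
 proof (intro exI[of _ s] allI impI)
  fix x :: 'a and t :: real assume t: "0 <= t" "t <= T" and x: "s <= norm x"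
  have "ee t <= ee (max 0 T)" using t by (intro ee_mono) auto
  also have "... <= yy (norm x)" unfolding ee_def yy_def
   using s[OF x] RR_gt(2)[of "max 0 T"] by (intro jf_le) auto
  finally show "U (x, t) = 0" using t by (simp add: U_def Zr_def)
 qed
qed

lemma U_slice_cont: "continuous_on UNIV (%x. U (x, t))"
 by (rule continuous_on_compose2[OF U_cont]) (auto intro!: continuous_intros)

text \<open>With \<open>T = t + t0\<close>, the barrier is at most
  \<open>Cs * (RR^p / (\<Gamma> ln T * T))^k\<close>. The lower power bound on \<open>G\<close>
  gives \<open>RR^\<alpha>1\<close> at most a multiple of \<open>ln T\<close>, and
  \<open>ln T <= T^a / a\<close> with \<open>a = \<alpha>1 / p\<close> turns this into
  \<open>RR^p\<close> at most a multiple of \<open>T\<close>.\<close>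

lemma U_bound: obtains M where "M >= 0" "!!x t. 0 <= t ==> U (x, t) <= M"
proof -
 define a where "a = \<alpha>1 / p"
 have a: "0 < a" using \<alpha> p1 by (simp add: a_def)
 define K where "K = (\<Gamma> / (a * G g R0)) powr (p / \<alpha>1)"
 define K2 where "K2 = R0 powr p * K / G g R0"
 have R0p: "0 < R0" using R0 r0 by simp
 have GR0: "0 < G g R0" by (rule G_pos[OF R0p])
 have K0: "0 <= K" "0 <= K2" using GR0 by (auto simp: K_def K2_def)
 have main: "U (x, t) <= Cs * K2 powr k" if t: "0 <= t" for x t
 proof -
  define T where "T = t + t0"
  have T: "1 < T" using t t0 by (simp add: T_def)
  have RRp: "0 < RR t" "R0 <= RR t" using RR_gt(2)[OF t] RR_ge[OF t] by auto
  have tau: "G g (RR t) = \<Gamma> * ln T" using G_RR[OF t] by (simp add: T_def)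
  have taup: "0 < \<Gamma> * ln T" "G g R0 <= \<Gamma> * ln T" using tau_ge[OF t] by (auto simp: T_def)
  have lnT: "ln T <= T powr a / a" by (rule ln_powr_bound) (use T a in auto)
  have "(RR t / R0) powr \<alpha>1 <= (\<Gamma> / (a * G g R0)) * T powr a"
  proof -
   have "G g R0 * (RR t / R0) powr \<alpha>1 <= \<Gamma> * ln T" using G_ratio(2)[OF R0p RRp(2)] tau by simp
   also have "... <= \<Gamma> * (T powr a / a)" using lnT \<Gamma> by (intro mult_left_mono) auto
   finally show ?thesis using GR0 a by (simp add: field_simps)
  qed
  then have "((RR t / R0) powr \<alpha>1) powr (p / \<alpha>1) <= ((\<Gamma> / (a * G g R0)) * T powr a) powr (p / \<alpha>1)"
   using p1 \<alpha> by (intro powr_mono2) auto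
  moreover have "((RR t / R0) powr \<alpha>1) powr (p / \<alpha>1) = (RR t / R0) powr p" using \<alpha> by (simp add: powr_powr)
  ultimately have "(RR t / R0) powr p <= K * (T powr a) powr (p / \<alpha>1)" by (simp only: powr_mult K_def)
  moreover have "(T powr a) powr (p / \<alpha>1) = T" using \<alpha> p1 T by (simp add: powr_powr a_def)
  ultimately have "RR t powr p / R0 powr p <= K * T" using R0p RRp by (simp add: powr_divide)
  then have "RR t powr p <= R0 powr p * K * T" using R0p by (simp add: field_simps)
  then have "RR t powr p / (\<Gamma> * ln T) / T <= R0 powr p * K * T / (\<Gamma> * ln T) / T" using taup T by (intro divide_right_mono) auto
  also have "... = R0 powr p * K / (\<Gamma> * ln T)" using T by simp
  also have "... <= K2" unfolding K2_def using taup GR0 K0 by (intro divide_left_mono) auto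
  finally have key: "RR t powr p / (\<Gamma> * ln T) / T <= K2" .
  have e0: "0 <= ee t" unfolding ee_def using jf_pos[of "RR t"] RRp by simp
  have yn: "0 <= yy (norm x)" unfolding yy_def using jf_pos[of "rhat (norm x)"] rhat_nonneg[of "norm x"] by simp
  have "max 0 (Zr (x, t)) powr q <= ee t powr q"
   using e0 yn t q_pos by (intro powr_mono2) (auto simp: Zr_def)
  also have "ee t powr q = (ee t powr (p - 1)) powr k" by (simp add: powr_powr q_k)
  also have "ee t powr (p - 1) = RR t powr p / (\<Gamma> * ln T)" unfolding ee_def using jf_powr[of "RR t"] RR_gt(1)[OF t] tau by simp
  finally have "max 0 (Zr (x, t)) powr q <= (RR t powr p / (\<Gamma> * ln T)) powr k" .
  then have "U (x, t) <= Cs * T powr (- k) * (RR t powr p / (\<Gamma> * ln T)) powr k"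
   unfolding U_def using Cs t by (intro mult_mono) (auto simp: TT_def T_def)
  also have "... = Cs * (RR t powr p / (\<Gamma> * ln T) / T) powr k"
   using T by (subst powr_divide[of _ T]) (simp add: powr_minus_divide)
  also have "... <= Cs * K2 powr k" using key Cs k_pos taup T by (intro mult_left_mono powr_mono2) auto
  finally show ?thesis .
 qed
 show ?thesis by (rule that[of "Cs * K2 powr k"]) (use Cs main in auto)
qed

lemma continuous_L1_ub: "continuous_L1 (rho p rhat) ub"
proof -
 have mU: "(%x. U (x, t)) \<in> meas" for t by (rule continuous_measurable[OF U_slice_cont])
 have ID: "integrable (rho_measure (rho p rhat)) f \<longleftrightarrow> integrable lborel (%x. rx x *. f x)" if "f \<in> meas" for f :: "'a => real"
  unfolding rho_measure_def rx_def[symmetric] by (rule integrable_density) (use that rx_nonneg in auto)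
 have LD': "(LINT x|rho_measure (rho p rhat). f x) = (LI x. rx x *. f x)" if "f \<in> meas" for f :: "'a => real"
  unfolding rho_measure_def rx_def[symmetric] by (rule integral_density) (use that rx_nonneg in auto)
 obtain M where M: "M >= 0" "!!x t. 0 <= t ==> U (x, t) <= M" using U_bound by metis
 have Ic: "integrable lborel (%x :: 'a. indicator (cball 0 R) x * c)" for R c :: real
  by (intro integrable_mult_left integrable_real_indicator) (use emeasure_compact_finite[OF compact_cball] in auto)
 have dom: "norm (rx x *. f) <= indicator (cball 0 Rd) x * (RM * M)" if "Rd <= norm x ==> f = 0" "\<bar>f\<bar> <= M" for f Rd and x :: 'a
 proof (cases "norm x <= Rd")
  case True
  have "\<bar>rx x\<bar> * \<bar>f\<bar> <= RM * M" using rx_le[of x] rx_nonneg[of x] that(2) by (intro mult_mono) auto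
  then show ?thesis using True by (simp add: abs_mult)
 qed (use that in simp)
 show ?thesis unfolding continuous_L1_def
 proof (intro conjI allI impI)
  fix t :: real assume t: "0 <= t"
  obtain Rd where Rd: "!!x t'. 0 <= t' ==> t' <= t ==> Rd <= norm x ==> U (x, t') = 0" using U_support[of t] by metis
  have "integrable lborel (%x. rx x *. U (x, t))"
  proof (rule integrable_dominated[OF Ic[of Rd "RM * M"]])
   show "(%x. rx x *. U (x, t)) \<in> borel_measurable lborel" using mU[of t] rx_measurable by measurable
   show "AE x in lborel. norm (rx x *. U (x, t)) <= norm (indicator (cball 0 Rd) x * (RM * M))"
   proof (rule AE_I2)
    fix x :: 'a
    have "norm (rx x *. U (x, t)) <= indicator (cball 0 Rd) x * (RM * M)"
     by (rule dom) (use Rd[of t x] M(2)[OF t, of x] U_nonneg[of "(x, t)"] t in auto)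
    then show "norm (rx x *. U (x, t)) <= norm (indicator (cball 0 Rd) x * (RM * M))"
     by (rule order_trans) (simp only: real_norm_def abs_ge_self)
   qed
  qed
  then show "integrable (rho_measure (rho p rhat)) (%x. ub x t)" using ID[OF mU[of t]] by (simp add: u_tilde_U[OF t])
  show "((%s. LINT x|rho_measure (rho p rhat). \<bar>ub x s - ub x t\<bar>) \<longlongrightarrow> 0) (at t within {0..})"
   unfolding tendsto_at_iff_sequentially
  proof (intro allI impI)
   \<comment> \<open>Continuity is checked along sequences so that dominated convergence applies;
     the times of a convergent sequence are bounded, and one radius contains all the
     supports.\<close>
   fix X :: "nat => real" assume X: "\<forall>i. X i \<in> {0..} - {t}" "X ----> t"
   have X0: "0 <= X i" for i using X(1) by auto
   obtain T where T: "!!i. X i <= T"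
    using convergent_imp_Bseq[OF convergentI[OF X(2)]] unfolding Bseq_def by (metis abs_le_D1 real_norm_def)
   have tT: "t <= T" by (rule LIMSEQ_le_const2[OF X(2)]) (use T in auto)
   obtain Rd where Rd: "!!x t'. 0 <= t' ==> t' <= T ==> Rd <= norm x ==> U (x, t') = 0" using U_support[of T] by metis
   have m: "(%x. \<bar>U (x, X i) - U (x, t)\<bar>) \<in> meas" for i using mU[of "X i"] mU[of t] by measurable
   have "(%i. LI x. rx x *. \<bar>U (x, X i) - U (x, t)\<bar>) ----> (LINT x|(lborel :: 'a measure). 0)"
   proof (rule dominated_conv[OF _ _ Ic[of Rd "RM * M"]])
    show "(%x. rx x *. \<bar>U (x, X i) - U (x, t)\<bar>) \<in> borel_measurable lborel" for i using m[of i] rx_measurable by measurable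
    show "AE x in lborel. (%i. rx x *. \<bar>U (x, X i) - U (x, t)\<bar>) ----> 0"
    proof (rule AE_I2)
     fix x :: 'a
     have "isCont U (x, t)" using U_cont by (simp add: continuous_on_eq_continuous_at)
     then have "(%i. U (x, X i)) ----> U (x, t)" by (rule isCont_tendsto_compose) (intro tendsto_Pair tendsto_const X(2))
     then have "(%i. rx x *. \<bar>U (x, X i) - U (x, t)\<bar>) ----> rx x *. \<bar>U (x, t) - U (x, t)\<bar>" by (intro tendsto_intros)
     then show "(%i. rx x *. \<bar>U (x, X i) - U (x, t)\<bar>) ----> 0" by simp
    qed
    show "AE x in lborel. norm (rx x *. \<bar>U (x, X i) - U (x, t)\<bar>) <= indicator (cball 0 Rd) x * (RM * M)" for i
    proof (rule AE_I2, rule dom)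
     fix x :: 'a
     show "\<bar>U (x, X i) - U (x, t)\<bar> = 0" if "Rd <= norm x" using Rd[OF X0 T that] Rd[OF t tT that] by simp
     show "\<bar>\<bar>U (x, X i) - U (x, t)\<bar>\<bar> <= M"
      using M(2)[OF X0, of x i] M(2)[OF t, of x] U_nonneg[of "(x, X i)"] U_nonneg[of "(x, t)"] by linarith
    qed
   qed simp
   then show "((%s. LINT x|rho_measure (rho p rhat). \<bar>ub x s - ub x t\<bar>) \<circ> X) ----> 0"
    by (simp add: o_def u_tilde_U[OF t] u_tilde_U[OF X0] LD'[OF m])
  qed
 qed
qed

lemma locally_integrable_cong_S:
 fixes f h :: "'a \<times> real => 'c::{banach, second_countable_topology}"
 assumes "!!z. z \<in> S_infty ==> f z = h z" shows "locally_integrable f \<longleftrightarrow> locally_integrable h"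
proof -
 have "set_integrable lborel K f \<longleftrightarrow> set_integrable lborel K h" if "K \<subseteq> S_infty" for K
  by (rule set_integrable_cong) (use that assms in auto)
 then show ?thesis unfolding locally_integrable_def by blast
qed

lemma energy_ub: "energy_class (rho p rhat) p m ub DD"
 unfolding energy_class_def
proof (intro conjI)
 show "\<forall>t\<ge>0. AE x in lborel. 0 <= ub x t" using U_nonneg by (simp add: u_tilde_U)
 have e: "indicator S_infty z *. (case z of (x, t) => ub x t) = indicator S_infty z * U z" for z
  using ub_S[of z] by (cases "z \<in> S_infty") (simp_all add: split_beta)
 show "set_borel_measurable lborel S_infty (%(x, t). ub x t)"
  unfolding set_borel_measurable_def e using cont_meas[OF U_cont] by simp
 show "set_borel_measurable lborel S_infty DD" unfolding set_borel_measurable_def using DD_measurable by measurable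
 show "continuous_L1 (rho p rhat) ub" by (rule continuous_L1_ub)
 obtain M where M: "M >= 0" "!!x t. 0 <= t ==> U (x, t) <= M" using U_bound by metis
 show "bounded_after ub" unfolding bounded_after_def
 proof (intro allI impI exI[of _ M] AE_I2)
  fix T :: real and z :: "'a \<times> real" assume "0 < T" "T < snd z"
  then have "z \<in> S_infty" "0 <= snd z" by (auto simp: mem_S)
  then show "\<bar>ub (fst z) (snd z)\<bar> <= M" using M(2)[of "snd z" "fst z"] U_nonneg[of z] by (simp add: ub_S)
 qed
 have w: "(case z of (x, t) => ub x t powr sigma p m) = WW z" if "z \<in> S_infty" for z
  using ub_S[OF that] WW_eq[of z] by (simp add: split_beta \<sigma>_def)
 show "weak_grad_x (%(x, t). ub x t powr sigma p m) DD"
  unfolding weak_grad_x_def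
 proof (intro conjI allI impI)
  show "locally_integrable (%(x, t). ub x t powr sigma p m)"
   using weak_grad_WW locally_integrable_cong_S[OF w] by (simp add: weak_grad_x_def)
  show "locally_integrable DD" using weak_grad_WW by (simp add: weak_grad_x_def)
  fix \<phi> :: "'a \<times> real => real" assume \<phi>: "test_fun \<phi>"
  have "(LIS z. (case z of (x, t) => ub x t powr sigma p m) *. grad_x \<phi> z) = (LIS z. WW z *. grad_x \<phi> z)"
   by (rule set_lebesgue_integral_cong) (use w in auto)
  then show "(LIS z. (case z of (x, t) => ub x t powr sigma p m) *. grad_x \<phi> z) = - (LIS z. \<phi> z *. DD z)"
   using weak_grad_WW \<phi> by (simp add: weak_grad_x_def)
 qed
 show "locally_integrable (%z. norm (DD z) powr p)" by (rule DD_p_loc_int)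
qed

lemma weak_dt_ub: "weak_dt (%(x, t). ub x t) ut"
 unfolding weak_dt_def
proof (intro conjI allI impI)
 have w: "(case z of (x, t) => ub x t) = U z" if "z \<in> S_infty" for z using ub_S[OF that] by (simp add: split_beta)
 show "locally_integrable (%(x, t). ub x t)" using weak_dt_U locally_integrable_cong_S[OF w] by (simp add: weak_dt_def)
 show "locally_integrable ut" using weak_dt_U by (simp add: weak_dt_def)
 fix \<phi> :: "'a \<times> real => real" assume \<phi>: "test_fun \<phi>"
 have "(LIS z. (case z of (x, t) => ub x t) * dt \<phi> z) = (LIS z. U z * dt \<phi> z)"
  by (rule set_lebesgue_integral_cong) (use w in auto)
 then show "(LIS z. (case z of (x, t) => ub x t) * dt \<phi> z) = - (LIS z. ut z * \<phi> z)"
  using weak_dt_U \<phi> by (simp add: weak_dt_def)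
qed

text \<open>Where the barrier vanishes so does \<open>DD\<close>, hence its flux is given by
  \<open>pflux_DD\<close> on all of \<open>S_infty\<close>. The weak form is then the limit of the
  integrals in \<open>approx_sub\<close>.\<close>

lemma weak_form_ub:
 assumes \<eta>: "test_fun \<eta>" "!!z. 0 <= \<eta> z"
 shows "weak_form (rho p rhat) p m ub DD \<eta> <= 0"
proof -
 have "flux p m ub DD z = (- (B * TT z powr (- 1 - k) * max 0 (Zr z) powr q)) *. Mv (fst z)" if z: "z \<in> S_infty" for z
 proof -
  have "flux p m ub DD z = pflux (sigma p m) p (DD z)"
  proof (rule flux_eq_pflux[OF p1 pm])
   show "0 <= ub (fst z) (snd z)" using ub_S[OF z] U_nonneg by simp
   show "DD z = 0" if "ub (fst z) (snd z) = 0"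
   proof -
    have "max 0 (Zr z) = 0" using that ub_S[OF z] Cs TT_ge(3)[of z] by (simp add: U_def)
    then show ?thesis by (simp add: DD_def)
   qed
  qed
  then show ?thesis using pflux_DD[of z] by (simp only: \<sigma>_def)
 qed
 then have "weak_form (rho p rhat) p m ub DD \<eta> = (LIS z. max 0 (Zr z) powr q * cf \<eta> z)"
  unfolding weak_form_def
  by (intro set_lebesgue_integral_cong) (auto simp: ub_S[of "(_, _)", simplified] cf_def U_def rx_def algebra_simps)
 moreover have lim: "(%n. LIS z. Psi q (ep n) (Zr z) * cf \<eta> z) ----> (LIS z. max 0 (Zr z) powr q * cf \<eta> z)"
 proof -
  have \<eta>': "test_fun (pd (0, 1) \<eta>)" by (rule test_fun_pd[OF \<eta>(1) Basis_t])
  obtain r t1 t2 where B0: "0 < r" "0 < t1" "!!z. z \<notin> Bx r t1 t2 ==> \<eta> z = 0" using test_fun_supp[OF \<eta>(1)] by metis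
  obtain M' where M': "!!z. \<bar>pd (0, 1) \<eta> z\<bar> <= M'" using test_fun_bounded[OF \<eta>'] by metis
  obtain Mg where Mg: "!!z. norm (grad_x \<eta> z) <= Mg" using grad_x_bounded[OF \<eta>(1)] by metis
  have off: "cf \<eta> z = 0" if "z \<notin> Bx r t1 t2" for z
   using pd_zero_off_Bx[OF B0(3) that] grad_x_zero[OF B0(3) that] by (simp add: cf_def dt_def)
  have M'0: "0 <= M'" and Mg0: "0 <= Mg" using M'[of 0] Mg[of 0] norm_ge_zero[of "grad_x \<eta> 0"] by linarith+
  define C where "C = RM * (Cs * M') + B * (A0 * r * Mg)"
  have RM0: "0 <= RM" by (simp add: RM_def)
  have C0: "0 <= C" using RM0 Cs M'0 Mg0 B_pos A0_pos B0(1) by (simp add: C_def)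
  have bd: "\<bar>cf \<eta> z\<bar> <= C" for z
  proof (cases "z \<in> Bx r t1 t2")
   case True
   have T1: "TT z powr (- k) <= 1" "TT z powr (- 1 - k) <= 1"
    using TT_ge(2)[of z] k_pos powr_mono[of "- k" 0 "TT z"] powr_mono[of "- 1 - k" 0 "TT z"] by simp_all
   have a1: "\<bar>rx (fst z) * (Cs * TT z powr (- k)) * dt \<eta> z\<bar> <= RM * (Cs * M')"
   proof -
    have "\<bar>rx (fst z) * (Cs * TT z powr (- k)) * dt \<eta> z\<bar> = rx (fst z) * (Cs * (TT z powr (- k) * \<bar>dt \<eta> z\<bar>))"
     using rx_nonneg[of "fst z"] Cs by (simp add: abs_mult)
    also have "... <= RM * (Cs * (1 * M'))"
     using rx_nonneg[of "fst z"] rx_le[of "fst z"] Cs T1 M'[of z] RM0 by (intro mult_mono) (auto simp: dt_def)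
    finally show ?thesis by simp
   qed
   have a2: "\<bar>B * TT z powr (- 1 - k) * (Mv (fst z) \<bullet> grad_x \<eta> z)\<bar> <= B * (A0 * r * Mg)"
   proof -
    have n: "norm (Mv (fst z)) <= A0 * r" unfolding norm_Mv
     using order_trans[OF aa_le[of "norm (fst z)"] mult_left_mono[OF _ less_imp_le[OF A0_pos]]] True by (simp add: mem_Bx)
    have "\<bar>Mv (fst z) \<bullet> grad_x \<eta> z\<bar> <= norm (Mv (fst z)) * norm (grad_x \<eta> z)" by (rule Cauchy_Schwarz_ineq2)
    also have "... <= A0 * r * Mg" using n Mg[of z] A0_pos B0(1) by (intro mult_mono) auto
    finally have i: "\<bar>Mv (fst z) \<bullet> grad_x \<eta> z\<bar> <= A0 * r * Mg" .
    have "\<bar>B * TT z powr (- 1 - k) * (Mv (fst z) \<bullet> grad_x \<eta> z)\<bar> = B * (TT z powr (- 1 - k) * \<bar>Mv (fst z) \<bullet> grad_x \<eta> z\<bar>)"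
     using B_pos by (simp add: abs_mult)
    also have "... <= B * (1 * (A0 * r * Mg))" using i T1 B_pos by (intro mult_mono) auto
    finally show ?thesis by simp
   qed
   show ?thesis unfolding cf_def C_def using a1 a2 by linarith
  qed (use off C0 in simp)
  have mcf: "cf \<eta> \<in> meas"
  proof -
   have c1: "(%z :: 'a \<times> real. rx (fst z)) \<in> meas"
    by (rule measurable_compose[OF continuous_measurable[OF fst_snd_cont(2)] rx_measurable])
   have c2: "(%z :: 'a \<times> real. Mv (fst z)) \<in> meas"
    by (intro continuous_measurable continuous_on_compose2[OF Mv_cont fst_snd_cont(2)]) auto
   have c3: "dt \<eta> \<in> meas" using smooth_measurable[OF test_fun_smooth[OF \<eta>']] by (simp add: dt_def[abs_def])
   have c4: "grad_x \<eta> \<in> meas" by (rule grad_x_measurable[OF test_fun_smooth[OF \<eta>(1)]])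
   show ?thesis unfolding cf_def[abs_def]
    using c1 c2 c3 c4 continuous_measurable[OF TTp_cont[of "- k"]] continuous_measurable[OF TTp_cont[of "- 1 - k"]]
    by measurable
  qed
  show ?thesis
  proof (rule test_dct(2)[OF cont_meas[OF PZ_cont(1)[OF ep(1)]] _ cont_loc_int[OF Zb_cont] _ mcf bd off B0(2)])
   show "(%n. Psi q (ep n) (Zr z)) ----> max 0 (Zr z) powr q" for z by (rule Psi_tendsto(1)[OF ep(3,1) q_pos])
   show "\<bar>Psi q (ep n) (Zr z)\<bar> <= Zb z" for n z using Psi_bounds(1,2)[OF ep(1,2) q_pos] by (simp add: Zb_def)
  qed
 qed
 moreover have "(LIS z. max 0 (Zr z) powr q * cf \<eta> z) <= 0"
  by (rule LIMSEQ_le_const2[OF lim]) (use approx_sub[OF ep(1,2) \<eta>] in blast)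
 ultimately show ?thesis by simp
qed

lemma weak_subsolution_ub: "weak_subsolution (rho p rhat) p m ub"
 unfolding weak_subsolution_def using energy_ub weak_form_ub by blast

lemma comparison_ub:
 assumes v: "strong_solution (rho p rhat) p m v" and init: "AE x in lborel. U (x, 0) <= v x 0" and t: "0 < t"
 shows "AE x in lborel. ub x t <= v x t"
proof -
 obtain Dv where Dv: "energy_class (rho p rhat) p m v Dv" "!!\<eta>. test_fun \<eta> ==> weak_form (rho p rhat) p m v Dv \<eta> = 0"
  using v unfolding strong_solution_def weak_solution_def by blast
 obtain vt where vt: "weak_dt (%(x, t). v x t) vt" using v unfolding strong_solution_def by blast
 interpret sp: strong_pair "rho p rhat" p m RM ub v DD Dv ut vt
  by unfold_locales
   (use p1 pm rx_measurable rx_nonneg rx_le energy_ub Dv weak_dt_ub vt weak_form_ub in "auto simp: rx_def[symmetric, abs_def]")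
 show ?thesis
 proof (rule sp.comparison[OF _ _ _ t])
  fix T
  obtain Rd where Rd: "!!x t. 0 <= t ==> t <= T ==> Rd <= norm x ==> U (x, t) = 0" using U_support[of T] by metis
  show "\<exists>Rd. \<forall>x t. 0 < t --> t <= T --> Rd <= norm x --> ub x t <= 0"
   by (rule exI[of _ Rd]) (use Rd u_tilde_U in auto)
  show "AE x in lborel. ub x 0 <= v x 0" using init by (simp add: u_tilde_U)
  show "AE x in (lborel :: 'a measure). 0 < rho p rhat (norm x)"
   using AE_lborel_singleton[of "0::'a"] by (rule eventually_mono) (use rx_pos in "auto simp: rx_def")
 qed
qed

end

text \<open>By the upper growth bound, shrinking the radius by a factor \<open>\<delta>\<close>
  multiplies \<open>J\<close> by at most \<open>\<delta>^(p-\<alpha>2)\<close>, which is small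
  because \<open>\<alpha>2 < p\<close>. The chosen \<open>\<delta>\<close> makes this factor
  \<open>2^(-(p-1))\<close>, so the root of order \<open>p - 1\<close> is halved.\<close>

lemma (in radial) J_root_small:
 assumes R: "0 < R"
 obtains r where "0 < r" "r < R" "J p g r powr (1 / (p - 1)) <= J p g R powr (1 / (p - 1)) / 2"
proof -
 define \<delta> where "\<delta> = (1 / 2 :: real) powr ((p - 1) / (p - \<alpha>2))"
 have d: "0 < \<delta>" by (simp add: \<delta>_def)
 have d1: "\<delta> < 1"
  using powr_less_mono'[of "1 / 2" 0 "(p - 1) / (p - \<alpha>2)"] p1 \<alpha> by (simp add: \<delta>_def)
 define r where "r = \<delta> * R"
 have r: "0 < r" "r < R" using d d1 R by (simp_all add: r_def)
 have Gp: "0 < G g r" "0 < G g R" using r R by (simp_all add: G_pos)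
 have "R / r = 1 / \<delta>" using R d by (simp add: r_def)
 then have GR: "G g R <= G g r * (1 / \<delta>) powr \<alpha>2" using G_ratio(1)[OF r(1) less_imp_le[OF r(2)]] by simp
 have dd: "\<delta> powr (p - \<alpha>2) = (1 / 2) powr (p - 1)" unfolding \<delta>_def powr_powr using \<alpha> by simp
 have "J p g r <= (1 / 2) powr (p - 1) * J p g R"
 proof -
  have "J p g r = \<delta> powr p * (R powr p / G g R) * (G g R / G g r)" using Gp by (simp add: J_def r_def powr_mult)
  also have "... <= \<delta> powr p * (R powr p / G g R) * (1 / \<delta>) powr \<alpha>2"
   using GR Gp by (intro mult_left_mono) (auto simp: divide_le_eq mult.commute)
  also have "... = (\<delta> powr p * (1 / \<delta>) powr \<alpha>2) * J p g R" by (simp add: J_def)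
  also have "\<delta> powr p * (1 / \<delta>) powr \<alpha>2 = \<delta> powr (p - \<alpha>2)" using d by (simp add: powr_divide powr_diff)
  finally show ?thesis unfolding dd .
 qed
 then have "J p g r powr (1 / (p - 1)) <= ((1 / 2) powr (p - 1) * J p g R) powr (1 / (p - 1))"
  using p1 Gp by (intro powr_mono2) (auto simp: J_def)
 also have "... = J p g R powr (1 / (p - 1)) / 2" using p1 by (simp add: powr_mult powr_powr)
 finally show ?thesis using that r by blast
qed

section \<open>Positivity set of the barrier and support of the solution\<close>

context spacetime
begin

lemma RR_0: "RR 0 = R0"
 unfolding RR_def using R0_eq G_inv_G[of R0] R0 r0 by simp

lemma U_initial:
 assumes l: "0 < l" "R0 = rhat l"
 shows "U (x, 0) <= Cs * jf R0 powr q" "l <= norm x ==> U (x, 0) = 0"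
proof -
 have yn: "0 <= yy (norm x)" unfolding yy_def using jf_pos[of "rhat (norm x)"] rhat_nonneg[of "norm x"] by simp
 have e0: "ee 0 = jf R0" "0 < jf R0" using jf_pos[of R0] R0 r0 by (simp_all add: ee_def RR_0)
 have "max 0 (Zr (x, 0)) powr q <= jf R0 powr q" using yn e0 q_pos by (intro powr_mono2) (auto simp: Zr_def)
 moreover have "TT (x, 0) powr (- k) <= 1" using TT_ge(2)[of "(x, 0)"] k_pos powr_mono[of "- k" 0 "TT (x, 0)"] by simp
 ultimately have "Cs * (TT (x, 0) powr (- k) * max 0 (Zr (x, 0)) powr q) <= Cs * (1 * jf R0 powr q)"
  using Cs by (intro mult_left_mono mult_mono) auto
 then show "U (x, 0) <= Cs * jf R0 powr q" by (simp add: U_def)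
 show "U (x, 0) = 0" if "l <= norm x"
  using yy_le[of l "norm x"] that l e0 by (simp add: U_def Zr_def yy_def)
qed

lemma U_pos:
 assumes t: "0 <= t" and s: "G g (rhat (norm x)) < \<Gamma> * ln (t + t0)"
 shows "0 < U (x, t)"
proof -
 have r: "0 <= rhat (norm x)" by (rule rhat_nonneg) simp
 have "rhat (norm x) < RR t"
 proof (rule ccontr)
  assume "\<not> rhat (norm x) < RR t"
  then have "G g (RR t) <= G g (rhat (norm x))" using RR_gt(2)[OF t] by (intro G_mono) auto
  then show False using s G_RR[OF t] by simp
 qed
 then have "0 < Zr (x, t)" using jf_less[OF r, of "RR t"] t by (simp add: Zr_def yy_def ee_def)
 then show ?thesis using Cs TT_ge(3)[of "(x, t)"] by (simp add: U_def)
qed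

text \<open>Write \<open>A = (N - p) / \<alpha>1\<close>. Since \<open>\<alpha>1 G <= g\<close>, the
  logarithmic bound on \<open>g (rhat s)\<close> gives
  \<open>G (rhat s) <= A (ln s - ln (rhat 1))\<close> for \<open>s\<close> at least 1. With
  \<open>s = t^cR\<close> the first term is \<open>\<Gamma> / 2 * ln t\<close>, and from time
  \<open>tR\<close> on the second is at most the other half of \<open>\<Gamma> ln t\<close>.\<close>

definition cR where "cR = \<Gamma> * \<alpha>1 / (2 * (real N - p))"
definition tR where "tR = exp (2 * ((real N - p) / \<alpha>1) * - ln (rhat 1) / \<Gamma>)"

lemma cR_pos: "0 < cR" using \<Gamma> \<alpha> pN by (simp add: cR_def)

lemma U_pos_far:
 assumes t: "tR <= t" and x: "norm x < t powr cR"
 shows "0 < U (x, t)"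
proof -
 define A where "A = (real N - p) / \<alpha>1"
 define b where "b = - ln (rhat 1)"
 have A: "0 < A" using pN \<alpha> by (simp add: A_def)
 have r1: "0 < rhat 1" "rhat 1 <= 1" using rhat_pos[of 1] rhat_le[of 1] by simp_all
 have b: "0 <= b" using r1 by (simp add: b_def)
 have tR: "tR = exp (2 * A * b / \<Gamma>)" by (simp add: tR_def A_def b_def)
 have "1 <= tR" unfolding tR using A b \<Gamma> by simp
 then have t1: "1 <= t" using t by simp
 have lt: "2 * A * b / \<Gamma> <= ln t" using t t1 unfolding tR by (simp add: ln_ge_iff)
 define s where "s = t powr cR"
 have s: "1 <= s" unfolding s_def using t1 cR_pos by (simp add: ge_one_powr_ge_zero)
 have lns: "ln s = cR * ln t" using t1 by (simp add: s_def ln_powr)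
 have "rhat 1 <= rhat s" using s by (intro rhat_mono) auto
 then have rs: "ln (rhat 1) <= ln (rhat s)" using r1 by simp
 have "G g (rhat (norm x)) <= G g (rhat s)" using x by (intro G_mono rhat_nonneg rhat_mono) (auto simp: s_def)
 also have "... <= g (rhat s) / \<alpha>1"
  using G_bounds(1)[of "rhat s"] rhat_pos[of s] s \<alpha> by (simp add: le_divide_eq mult.commute)
 also have "... <= (real N - p) * (ln s - ln (rhat s)) / \<alpha>1"
  using g_rhat_le[of s] s \<alpha> by (intro divide_right_mono) auto
 also have "... = A * (ln s - ln (rhat s))" by (simp add: A_def)
 also have "... <= A * (ln s + b)" using rs A by (intro mult_left_mono) (auto simp: b_def)
 also have "... = (A * cR) * ln t + A * b" by (simp add: lns algebra_simps)
 also have "A * cR = \<Gamma> / 2"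
 proof -
  define d where "d = real N - p"
  have "0 < d" using pN by (simp add: d_def)
  then show ?thesis unfolding A_def cR_def d_def[symmetric] using \<alpha> by simp
 qed
 also have "\<Gamma> / 2 * ln t + A * b <= \<Gamma> * ln t"
 proof -
  have "A * b <= \<Gamma> / 2 * ln t" using lt \<Gamma> by (simp add: field_simps)
  then show ?thesis by (simp add: field_simps)
 qed
 also have "... < \<Gamma> * ln (t + t0)" using \<Gamma> t1 t0 by (intro mult_strict_left_mono) auto
 finally show ?thesis using t1 by (intro U_pos) auto
qed

lemma U_pos_near:
 assumes t: "0 <= t" and l: "0 < l" "R0 = rhat l" and x: "norm x < l"
 shows "0 < U (x, t)"
proof (rule U_pos[OF t])
 have "G g (rhat (norm x)) < G g R0" unfolding l(2) using x by (intro G_strict rhat_nonneg rhat_less) auto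
 then show "G g (rhat (norm x)) < \<Gamma> * ln (t + t0)" using tau_ge(1)[OF t] by simp
qed

text \<open>Before \<open>tR\<close> the initial radius \<open>l\<close> is used: the barrier is
  positive for \<open>|x| < l\<close> at time 0, and its front does not retreat afterwards.\<close>

definition Rt where "Rt l t = (if tR <= t then t powr cR else l)"

lemma U_pos_ball:
 assumes l: "0 < l" "R0 = rhat l" and t: "0 < t" and x: "x \<in> ball 0 (Rt l t)"
 shows "0 < U (x, t)"
 using x U_pos_far[of t x] U_pos_near[OF _ l, of t x] t by (auto simp: Rt_def split: if_splits)

lemma Rt_pos: "0 < l ==> 0 < t ==> 0 < Rt l t" by (simp add: Rt_def)

lemma Rt_comparable: "comparable (%t. ln (Rt l t)) (%t. ln t)"
proof -
 have "\<exists>T>0. \<forall>t\<ge>T. 0 < ln (Rt l t) \<and> 0 < ln t \<and> 1 / cR <= ln t / ln (Rt l t) \<and> ln t / ln (Rt l t) <= 1 / cR"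
 proof (rule exI[of _ "max tR 2"], intro conjI allI impI)
  fix t assume t: "max tR 2 <= t"
  then have l: "ln (Rt l t) = cR * ln t" "0 < ln t" by (simp_all add: Rt_def ln_powr)
  show "0 < ln (Rt l t)" "0 < ln t" using l cR_pos by simp_all
  show "1 / cR <= ln t / ln (Rt l t)" "ln t / ln (Rt l t) <= 1 / cR" using l cR_pos by simp_all
 qed simp
 moreover have "0 < 1 / cR" using cR_pos by simp
 ultimately show ?thesis unfolding comparable_def by blast
qed

lemma ball_subset_support:
 assumes w: "AE x in lborel. ub x t <= w x" and l: "0 < l" "R0 = rhat l" and t: "0 < t"
 shows "ball 0 (Rt l t) \<subseteq> ess_support w"
proof
 fix x :: 'a assume x: "x \<in> ball 0 (Rt l t)"
 show "x \<in> ess_support w" unfolding ess_support_def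
 proof (intro CollectI allI impI notI)
  fix e :: real assume e: "0 < e" and z: "AE y in lborel. y \<in> ball x e --> w y = 0"
  define A where "A = ball x e \<inter> ball 0 (Rt l t)"
  have "AE y in lborel. y \<notin> A"
   using w z
  proof eventually_elim
   fix y assume y: "ub y t <= w y" "y \<in> ball x e --> w y = 0"
   show "y \<notin> A"
   proof
    assume yA: "y \<in> A"
    then have "0 < ub y t" using U_pos_ball[OF l t, of y] A_def u_tilde_U[of t y] t by simp
    then show False using y yA by (auto simp: A_def)
   qed
  qed
  moreover have Ao: "open A" "x \<in> A" using e x by (auto simp: A_def)
  ultimately have "A \<in> null_sets lborel" using AE_iff_null[of lborel "%y. y \<notin> A"] by simp
  then have "negligible A" by (simp add: negligible_iff_null_sets null_sets_completionI)
  then show False using open_not_negligible[OF Ao(1)] Ao(2) by auto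
 qed
qed

end

theorem theorem1p7:
 fixes p m \<alpha>1 \<alpha>2 \<epsilon> l :: real
  and g rhat :: "real \<Rightarrow> real"
  and u0 :: "'a::euclidean_space \<Rightarrow> real"
 assumes "1 < p" and "p < real DIM('a)" and "p + m - 3 > 0"
  and "continuous_on {0..} g" and "g C1_differentiable_on {0<..}"
  and "g 0 = 0" and "\<forall>s>0. g s > 0"
  and "0 < \<alpha>1" and "\<alpha>1 \<le> \<alpha>2" and "\<alpha>2 < p"
  and "\<forall>s>0. \<alpha>1 * (g s / s) \<le> deriv g s \<and> deriv g s \<le> \<alpha>2 * (g s / s)"
  and "radial_change DIM('a) p g rhat"
  and "compact (ess_support u0)"
  and "\<exists>M. AE x in lborel. \<bar>u0 x\<bar> \<le> M"
  and "\<epsilon> > 0" and "l > 0"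
  and "AE x in lborel. norm x \<le> l \<longrightarrow> u0 x \<ge> \<epsilon>"
 shows "\<exists>t0 Cs r0 \<Gamma> :: real. \<exists>R :: real \<Rightarrow> real.
   t0 > 1 \<and> Cs > 0 \<and> r0 > 0 \<and> \<Gamma> > 0 \<and>
   (\<forall>t>t0. R t > 0) \<and> comparable (\<lambda>t. ln (R t)) (\<lambda>t. ln t) \<and>
   weak_subsolution (rho p rhat) p m
    (\<lambda>(x::'a) t. u_tilde p m g Cs t0 r0 \<Gamma> (rhat (norm x)) t) \<and>
   (\<forall>v :: 'a \<Rightarrow> real \<Rightarrow> real.
    strong_solution (rho p rhat) p m v \<and> (AE x in lborel. v x 0 = u0 x) \<longrightarrow>
    (\<forall>t>0. AE x in lborel. v x t \<ge> u_tilde p m g Cs t0 r0 \<Gamma> (rhat (norm x)) t) \<and>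
    (\<forall>t>t0. ball 0 (R t) \<subseteq> ess_support (\<lambda>x. v x t)))"
proof -
 interpret rd: radial p m \<alpha>1 \<alpha>2 g rhat "DIM('a)" by unfold_locales (use assms in auto)
 \<comment> \<open>The initial front lies at \<open>|x| = l\<close>, so the barrier is initially
   supported where the data are at least \<open>\<epsilon>\<close>.\<close>
 define R0 where "R0 = rhat l"
 have R0: "0 < R0" unfolding R0_def by (rule rd.rhat_pos[OF \<open>l > 0\<close>])
 obtain r0 where r0: "0 < r0" "r0 < R0" "J p g r0 powr (1 / (p - 1)) <= J p g R0 powr (1 / (p - 1)) / 2"
  using rd.J_root_small[OF R0] by metis
 interpret ba: barrier p m \<alpha>1 \<alpha>2 g rhat "DIM('a)" r0 by unfold_locales (rule r0(1))
 obtain L0 where L0: "L0 > 0" "!!r. 0 < r ==> r ~= r0 ==> \<bar>ba.LL r\<bar> <= L0" using ba.LL_bounded by metis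
 define k where "k = 1 / (p + m - 3)"
 define q where "q = (p - 1) / (p + m - 3)"
 \<comment> \<open>\<open>cond_C\<close>, after division by \<open>Cs\<close>, says exactly that
   \<open>Cs^(p+m-3)\<close> is at most \<open>c1\<close>.\<close>
 define c1 where "c1 = k / (2 * q powr (p - 1) * L0)"
 define c where "c = p / ((p - 1) * \<alpha>1)"
 define jR where "jR = ba.jf R0"
 have pm: "p + m - 3 > 0" by fact
 have k: "0 < k" using pm by (simp add: k_def)
 have q: "0 < q" using pm \<open>1 < p\<close> by (simp add: q_def)
 have c1: "0 < c1" using k q L0 by (simp add: c1_def)
 have c: "0 < c" using \<open>1 < p\<close> \<open>0 < \<alpha>1\<close> by (simp add: c_def)
 have jR: "0 < jR" unfolding jR_def using ba.jf_pos[of R0] R0 by simp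
 \<comment> \<open>The first entry gives \<open>cond_C\<close>; the second keeps the barrier at time
   0 below \<open>\<epsilon>\<close>, because its maximal height is at most
   \<open>Cs * jR^q\<close>.\<close>
 define Cs where "Cs = min (c1 powr k) (\<epsilon> / jR powr q)"
 have Cs: "0 < Cs" using c1 jR \<open>\<epsilon> > 0\<close> by (simp add: Cs_def)
 have Cs_eps: "Cs * jR powr q <= \<epsilon>"
 proof -
  have "Cs <= \<epsilon> / jR powr q" by (simp add: Cs_def)
  then show ?thesis using jR by (simp add: le_divide_eq)
 qed
 have cond_C: "Cs powr (p + m - 2) * q powr (p - 1) * L0 <= Cs * k / 2"
 proof -
  have "Cs powr (p + m - 3) <= (c1 powr k) powr (p + m - 3)" using Cs pm by (intro powr_mono2) (auto simp: Cs_def)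
  also have "... = c1" using c1 pm by (simp add: powr_powr k_def)
  finally have "Cs powr (p + m - 3) * (q powr (p - 1) * L0) <= c1 * (q powr (p - 1) * L0)" using L0 by (intro mult_right_mono) auto
  also have "... = k / 2" using q L0 by (simp add: c1_def)
  finally have "Cs * (Cs powr (p + m - 3) * (q powr (p - 1) * L0)) <= Cs * (k / 2)" using Cs by (intro mult_left_mono) auto
  moreover have "Cs * Cs powr (p + m - 3) = Cs powr (p + m - 2)" using powr_mult_base[of Cs "p + m - 3"] Cs by (simp add: add.commute)
  ultimately show ?thesis by (simp add: mult.assoc[symmetric])
 qed
 define D where "D = Cs powr (p + m - 2) * q powr (p - 1) * ((p - \<alpha>2) / (2 * (p - 1))) powr p"
 have D: "0 < D" using Cs q \<open>1 < p\<close> \<open>\<alpha>2 < p\<close> by (simp add: D_def)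
 have GR: "0 < G g R0" by (rule rd.G_pos[OF R0])
 \<comment> \<open>\<open>a1\<close> and \<open>a2\<close> are the values that \<open>ln t0\<close>
   must reach for \<open>cond_1\<close> and \<open>cond_2\<close>; in the latter,
   \<open>\<Gamma>\<close> is already written as \<open>G(R0) / ln t0\<close>.\<close>
 define a1 where "a1 = max q 2 * c * 4 / k"
 define a2 where "a2 = Cs * G g R0 * c / D"
 have a: "0 < a1" "0 < a2" using q c k Cs GR D by (auto simp: a1_def a2_def)
 define t0 where "t0 = exp (1 + a1 + a2)"
 have lnt: "ln t0 = 1 + a1 + a2" "0 < ln t0" using a by (simp_all add: t0_def)
 \<comment> \<open>Forced by the initial front: at \<open>t = 0\<close> the value
   \<open>\<Gamma> ln t0\<close> has to equal \<open>G(R0)\<close>.\<close>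
 define \<Gamma> where "\<Gamma> = G g R0 / ln t0"
 have cond_1: "max q 2 * c / ln t0 <= k / 4"
 proof -
  have "max q 2 * c / ln t0 <= max q 2 * c / a1" using a c lnt by (intro divide_left_mono) auto
  also have "... = k / 4" using q c k by (simp add: a1_def)
  finally show ?thesis .
 qed
 have cond_2: "Cs * \<Gamma> * c <= D"
 proof -
  have "Cs * \<Gamma> * c = Cs * G g R0 * c / ln t0" by (simp add: \<Gamma>_def)
  also have "... <= Cs * G g R0 * c / a2" using a c lnt Cs GR by (intro divide_left_mono) auto
  also have "... = D" using Cs GR c D by (simp add: a2_def)
  finally show ?thesis .
 qed
 interpret sp: spacetime p m \<alpha>1 \<alpha>2 g rhat "DIM('a)" r0 Cs t0 \<Gamma> R0 L0 "TYPE('a)"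
 proof unfold_locales
  show "0 < Cs" by (rule Cs)
  show "1 < t0" using a by (simp add: t0_def)
  show "0 < \<Gamma>" using GR lnt by (simp add: \<Gamma>_def)
  show "r0 < R0" by (rule r0(2))
  show "\<Gamma> * ln t0 = G g R0" using lnt by (simp add: \<Gamma>_def)
  show "ba.jf r0 <= ba.jf R0 / 2" using r0 by (simp add: ba.jf_def)
  show "\<bar>ba.LL r\<bar> <= L0" if "0 < r" "r ~= r0" for r using L0(2) that by blast
  show "Cs powr (p + m - 2) * ((p - 1) / (p + m - 3)) powr (p - 1) * L0 <= Cs * (1 / (p + m - 3)) / 2"
   using cond_C by (simp only: k_def q_def)
  show "max ((p - 1) / (p + m - 3)) 2 * (p / ((p - 1) * \<alpha>1)) / ln t0 <= 1 / (p + m - 3) / 4"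
   using cond_1 by (simp only: k_def q_def c_def)
  show "Cs * \<Gamma> * (p / ((p - 1) * \<alpha>1)) <= Cs powr (p + m - 2) * ((p - 1) / (p + m - 3)) powr (p - 1) * ((p - \<alpha>2) / (2 * (p - 1))) powr p"
   using cond_2 by (simp only: D_def q_def c_def)
 qed simp
 have cmp: "AE x in lborel. sp.ub x t <= v x t"
  if v: "strong_solution (rho p rhat) p m v" "AE x in lborel. v x 0 = u0 x" and t: "0 < t" for v :: "'a => real => real" and t
 proof (rule sp.comparison_ub[OF v(1) _ t])
  have "AE x in lborel. 0 <= v x 0"
   using v(1) unfolding strong_solution_def weak_solution_def energy_class_def by auto
  then show "AE x in lborel. sp.U (x, 0) <= v x 0"
   using v(2) assms(17)
  proof eventually_elim
   fix x assume x: "0 <= v x 0" "v x 0 = u0 x" "norm x <= l --> \<epsilon> <= u0 x"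
   show "sp.U (x, 0) <= v x 0"
   proof (cases "norm x <= l")
    case True
    have "sp.U (x, 0) <= Cs * jR powr q"
     using sp.U_initial(1)[OF \<open>l > 0\<close> R0_def, of x] by (simp add: jR_def q_def sp.q_def)
    then show ?thesis using Cs_eps x True by linarith
   next
    case False
    then show ?thesis using sp.U_initial(2)[OF \<open>l > 0\<close> R0_def, of x] x by simp
   qed
  qed
 qed
 have t0: "1 < t0" using a by (simp add: t0_def)
 have supp: "ball 0 (sp.Rt l t) \<subseteq> ess_support (%x. v x t)"
  if v: "strong_solution (rho p rhat) p m v" "AE x in lborel. v x 0 = u0 x" and t: "t0 < t" for v :: "'a => real => real" and t
  by (rule sp.ball_subset_support[OF cmp[OF v] \<open>l > 0\<close> R0_def]) (use t t0 in auto)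
 show ?thesis
 proof (rule exI[of _ t0], rule exI[of _ Cs], rule exI[of _ r0], rule exI[of _ \<Gamma>], rule exI[of _ "sp.Rt l"], intro conjI allI impI)
  show "0 < sp.Rt l t" if "t0 < t" for t using sp.Rt_pos[OF \<open>l > 0\<close>, of t] t0 that by simp
  show "comparable (%t. ln (sp.Rt l t)) ln" by (rule sp.Rt_comparable)
  show "weak_subsolution (rho p rhat) p m sp.ub" by (rule sp.weak_subsolution_ub)
  show "AE x in lborel. sp.ub x t <= v x t"
   if "strong_solution (rho p rhat) p m v \<and> (AE x in lborel. v x 0 = u0 x)" "0 < t" for v :: "'a => real => real" and t
   using cmp that by blast
  show "ball 0 (sp.Rt l t) \<subseteq> ess_support (%x. v x t)"
   if "strong_solution (rho p rhat) p m v \<and> (AE x in lborel. v x 0 = u0 x)" "t0 < t" for v :: "'a => real => real" and t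
   using supp that by blast
 qed (use t0 Cs r0 sp.\<Gamma> in auto)
qed

end
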